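(* Let $m>1$ be a composite integer, $E$ an elliptic curve defined over a field $K$ with $\operatorname{char}K\nmid m$, and $P\in E(K)$. Then at least one of the following holds: (i) $\delta_m^P$ is irreducible over $K$; (ii) $\delta_d^P$ is reducible over $K$ for some proper divisor $d>1$ of $m$; (iii) $E$ admits an isogeny of degree $l$ defined over $K$ for some prime $l\mid m$; (iv) the homomorphism $\alpha_m:\mathcal{G}_m\to G_m$ is an isomorphism.
   Context: For $E$ with Weierstrass coordinate functions $x,y$ and $m\in\mathbb{Z}$, $\psi_m$ is the $m$-th division polynomial ($\psi_m^2\in K[x]$), $\theta_m=x\psi_m^2-\psi_{m+1}\psi_{m-1}$, so $x([m]R)=\theta_m(x(R))/\psi_m^2(x(R))$; and $\delta_m^P=\theta_m-x(P)\psi_m^2$ if $P\ne O$, $\delta_m^P=\psi_m^2$ if $P=O$. With $\operatorname{char}K\nmid m$, $E[m]\cong(\mathbb{Z}/m\mathbb{Z})^2$ (fix a basis) and, fixing $R_0$ with $mR_0=P$, the set $[m]^{-1}P=\{R: mR=P\}=R_0+E[m]$ is in bijection with $(\mathbb{Z}/m\mathbb{Z})^2$. The action of $\operatorname{Gal}(\bar K/K)$ on $E[m]$ gives a homomorphism to $\mathrm{GL}_2(\mathbb{Z}/m\mathbb{Z})$ with image $G_m$, and its action on $[m]^{-1}P$ gives a homomorphism to the affine group $\mathrm{AGL}_2(\mathbb{Z}/m\mathbb{Z})$ (elements $(A,b)$ acting by $v\mapsto Av+b$) with image $\mathcal{G}_m$. The map $\alpha_m:\mathcal{G}_m\to G_m$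 is $\alpha_m((A,b))=A$. *)

theory Defs
  imports "HOL-Computational_Algebra.Polynomial_Factorial" "HOL-Library.FuncSet"
begin

datatype 'a wcurve = WC (wa1: 'a) (wa2: 'a) (wa3: 'a) (wa4: 'a) (wa6: 'a)

datatype 'a ecpt = Inf | Pt 'a 'a

definition wb2 :: "'a::field wcurve \<Rightarrow> 'a" where
  "wb2 E = wa1 E ^ 2 + 4 * wa2 E"
definition wb4 :: "'a::field wcurve \<Rightarrow> 'a" where
  "wb4 E = 2 * wa4 E + wa1 E * wa3 E"
definition wb6 :: "'a::field wcurve \<Rightarrow> 'a" where
  "wb6 E = wa3 E ^ 2 + 4 * wa6 E"
definition wb8 :: "'a::field wcurve \<Rightarrow> 'a" where
  "wb8 E = wa1 E ^ 2 * wa6 E + 4 * wa2 E * wa6 E - wa1 E * wa3 E * wa4 E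
           + wa2 E * wa3 E ^ 2 - wa4 E ^ 2"
definition disc :: "'a::field wcurve \<Rightarrow> 'a" where
  "disc E = - (wb2 E ^ 2 * wb8 E) - 8 * wb4 E ^ 3 - 27 * wb6 E ^ 2
            + 9 * wb2 E * wb4 E * wb6 E"

definition elliptic :: "'a::field wcurve \<Rightarrow> bool" where
  "elliptic E \<longleftrightarrow> disc E \<noteq> 0"

fun on_curve :: "'a::field wcurve \<Rightarrow> 'a ecpt \<Rightarrow> bool" where
  "on_curve E Inf = True"
| "on_curve E (Pt x y) \<longleftrightarrow>
     y ^ 2 + wa1 E * x * y + wa3 E * y = x ^ 3 + wa2 E * x ^ 2 + wa4 E * x + wa6 E"

definition points :: "'a::field wcurve \<Rightarrow> 'a ecpt set" where
  "points E = {R. on_curve E R}"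

fun ec_neg :: "'a::field wcurve \<Rightarrow> 'a ecpt \<Rightarrow> 'a ecpt" where
  "ec_neg E Inf = Inf"
| "ec_neg E (Pt x y) = Pt x (- y - wa1 E * x - wa3 E)"

text \<open>Group law (Silverman, Algorithm III.2.3).\<close>
fun ec_add :: "'a::field wcurve \<Rightarrow> 'a ecpt \<Rightarrow> 'a ecpt \<Rightarrow> 'a ecpt" where
  "ec_add E Inf Q = Q"
| "ec_add E (Pt x1 y1) Inf = Pt x1 y1"
| "ec_add E (Pt x1 y1) (Pt x2 y2) =
     (if x1 = x2 \<and> y1 + y2 + wa1 E * x2 + wa3 E = 0 then Inf
      else
        (let l = (if x1 = x2
                  then (3 * x1 ^ 2 + 2 * wa2 E * x1 + wa4 E - wa1 E * y1) / (2 * y1 + wa1 E * x1 + wa3 E)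
                  else (y2 - y1) / (x2 - x1));
             v = (if x1 = x2
                  then (- (x1 ^ 3) + wa4 E * x1 + 2 * wa6 E - wa3 E * y1) / (2 * y1 + wa1 E * x1 + wa3 E)
                  else (y1 * x2 - y2 * x1) / (x2 - x1));
             x3 = l ^ 2 + wa1 E * l - wa2 E - x1 - x2;
             y3 = - (l + wa1 E) * x3 - v - wa3 E
         in Pt x3 y3))"

primrec ec_mul :: "'a::field wcurve \<Rightarrow> nat \<Rightarrow> 'a ecpt \<Rightarrow> 'a ecpt" where
  "ec_mul E 0 R = Inf"
| "ec_mul E (Suc n) R = ec_add E R (ec_mul E n R)"

fun map_pt :: "('a \<Rightarrow> 'b) \<Rightarrow> 'a ecpt \<Rightarrow> 'b ecpt" where
  "map_pt f Inf = Inf"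
| "map_pt f (Pt x y) = Pt (f x) (f y)"

definition map_curve :: "('a \<Rightarrow> 'b) \<Rightarrow> 'a wcurve \<Rightarrow> 'b wcurve" where
  "map_curve f E = WC (f (wa1 E)) (f (wa2 E)) (f (wa3 E)) (f (wa4 E)) (f (wa6 E))"

text \<open>F = (2y + a1 x + a3)^2 = 4x^3 + b2 x^2 + 2 b4 x + b6 = psi_2^2.\<close>
definition divF :: "'a::field wcurve \<Rightarrow> 'a poly" where
  "divF E = [: wb6 E, 2 * wb4 E, wb2 E, 4 :]"

text \<open>divf E n = f_n, where psi_n = f_n for n odd and psi_n = (2y + a1 x + a3) f_n for n even.
  The recursion is the standard one for psi_n translated via psi_2^2 = F.\<close>
function divf :: "'a::field wcurve \<Rightarrow> nat \<Rightarrow> 'a poly" where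
  "divf E n =
    (if n = 0 then 0
     else if n = 1 then 1
     else if n = 2 then 1
     else if n = 3 then [: wb8 E, 3 * wb6 E, 3 * wb4 E, wb2 E, 3 :]
     else if n = 4 then [: wb4 E * wb8 E - wb6 E ^ 2, wb2 E * wb8 E - wb4 E * wb6 E,
                           10 * wb8 E, 10 * wb6 E, 5 * wb4 E, wb2 E, 2 :]
     else if even n then
       divf E (n div 2) * (divf E (n div 2 + 2) * divf E (n div 2 - 1) ^ 2
                           - divf E (n div 2 - 2) * divf E (n div 2 + 1) ^ 2)
     else if even (n div 2) then
       divF E ^ 2 * divf E (n div 2 + 2) * divf E (n div 2) ^ 3
       - divf E (n div 2 - 1) * divf E (n div 2 + 1) ^ 3
     else
       divf E (n div 2 + 2) * divf E (n div 2) ^ 3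
       - divF E ^ 2 * divf E (n div 2 - 1) * divf E (n div 2 + 1) ^ 3)"
  by pat_completeness auto
termination
  by (relation "measure (\<lambda>(E, n). n)") auto

definition psi_sq :: "'a::field wcurve \<Rightarrow> nat \<Rightarrow> 'a poly" where
  "psi_sq E n = (if odd n then divf E n ^ 2 else divF E * divf E n ^ 2)"

text \<open>psi_(n+1) psi_(n-1) in K[x] (n \<ge> 1).\<close>
definition psi_nb :: "'a::field wcurve \<Rightarrow> nat \<Rightarrow> 'a poly" where
  "psi_nb E n = (if odd n then divF E * divf E (n + 1) * divf E (n - 1)
                 else divf E (n + 1) * divf E (n - 1))"

definition theta :: "'a::field wcurve \<Rightarrow> nat \<Rightarrow> 'a poly" where
  "theta E n = [:0, 1:] * psi_sq E n - psi_nb E n"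

definition delta :: "'a::field wcurve \<Rightarrow> nat \<Rightarrow> 'a ecpt \<Rightarrow> 'a poly" where
  "delta E n P = (case P of Inf \<Rightarrow> psi_sq E n | Pt x0 y0 \<Rightarrow> theta E n - [:x0:] * psi_sq E n)"

definition is_alg_closure :: "('k::field \<Rightarrow> 'c::alg_closed_field) \<Rightarrow> bool" where
  "is_alg_closure emb \<longleftrightarrow>
     (\<forall>a b. emb (a + b) = emb a + emb b) \<and> (\<forall>a b. emb (a * b) = emb a * emb b) \<and> emb 1 = 1 \<and>
     (\<forall>z. \<exists>p. p \<noteq> 0 \<and> poly (map_poly emb p) z = 0)"

definition galois :: "('k \<Rightarrow> 'c::field) \<Rightarrow> ('c \<Rightarrow> 'c) set" where
  "galois emb = {\<sigma>. bij \<sigma> \<and> (\<forall>a b. \<sigma> (a + b) = \<sigma> a + \<sigma> b) \<and> (\<forall>a b. \<sigma> (a * b) = \<sigma> a * \<sigma> b)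
                    \<and> (\<forall>k. \<sigma> (emb k) = emb k)}"

definition torsion :: "'c::field wcurve \<Rightarrow> nat \<Rightarrow> 'c ecpt set" where
  "torsion E m = {R \<in> points E. ec_mul E m R = Inf}"

definition preimg :: "'c::field wcurve \<Rightarrow> nat \<Rightarrow> 'c ecpt \<Rightarrow> 'c ecpt set" where
  "preimg E m P = {R \<in> points E. ec_mul E m R = P}"

definition Gm :: "('k::field \<Rightarrow> 'c::field) \<Rightarrow> 'k wcurve \<Rightarrow> nat \<Rightarrow> ('c ecpt \<Rightarrow> 'c ecpt) set" where
  "Gm emb E m = (\<lambda>\<sigma>. restrict (map_pt \<sigma>) (torsion (map_curve emb E) m)) ` galois emb"

definition calGm :: "('k::field \<Rightarrow> 'c::field) \<Rightarrow> 'k wcurve \<Rightarrow> nat \<Rightarrow> 'k ecpt \<Rightarrow> ('c ecpt \<Rightarrow> 'c ecpt) set" where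
  "calGm emb E m P = (\<lambda>\<sigma>. restrict (map_pt \<sigma>) (preimg (map_curve emb E) m (map_pt emb P))) ` galois emb"

text \<open>alpha_m: linear part of an affine map g of R0 + E[m]: T \<mapsto> g(R0+T) - g(R0).\<close>
definition alpha :: "('k::field \<Rightarrow> 'c::field) \<Rightarrow> 'k wcurve \<Rightarrow> nat \<Rightarrow> 'k ecpt
                     \<Rightarrow> ('c ecpt \<Rightarrow> 'c ecpt) \<Rightarrow> ('c ecpt \<Rightarrow> 'c ecpt)" where
  "alpha emb E m P g =
     (let Ec = map_curve emb E; R0 = (SOME R. R \<in> preimg Ec m (map_pt emb P))
      in (\<lambda>T \<in> torsion Ec m. ec_add Ec (g (ec_add Ec R0 T)) (ec_neg Ec (g R0))))"

text \<open>phi is an isogeny E \<rightarrow> E' defined over K of degree l: a homomorphism of the groups of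
  Kbar-points, given by rational functions with coefficients in K:
  x' \<circ> phi = u(x)/v(x) (u, v coprime, so deg phi = [Kbar(x) : Kbar(u/v)] = max(deg u, deg v)),
  y' \<circ> phi = (a(x) + b(x) y)/c(x).\<close>
definition isogeny_over :: "('k::field \<Rightarrow> 'c::field) \<Rightarrow> 'k wcurve \<Rightarrow> 'k wcurve
                            \<Rightarrow> ('c ecpt \<Rightarrow> 'c ecpt) \<Rightarrow> nat \<Rightarrow> bool" where
  "isogeny_over emb E E' \<phi> l \<longleftrightarrow>
     (let Ec = map_curve emb E; Ec' = map_curve emb E' in
      (\<forall>R \<in> points Ec. \<phi> R \<in> points Ec') \<and> \<phi> Inf = Inf \<and>
      (\<forall>R \<in> points Ec. \<forall>S \<in> points Ec. \<phi> (ec_add Ec R S) = ec_add Ec' (\<phi> R) (\<phi> S)) \<and>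
      (\<exists>u v a b c :: 'k poly.
          v \<noteq> 0 \<and> c \<noteq> 0 \<and> coprime u v \<and> max (degree u) (degree v) = l \<and>
          (\<forall>x0 y0. Pt x0 y0 \<in> points Ec \<longrightarrow>
             (poly (map_poly emb v) x0 = 0 \<longrightarrow> \<phi> (Pt x0 y0) = Inf) \<and>
             (poly (map_poly emb v) x0 \<noteq> 0 \<and> poly (map_poly emb c) x0 \<noteq> 0 \<longrightarrow>
                \<phi> (Pt x0 y0) =
                  Pt (poly (map_poly emb u) x0 / poly (map_poly emb v) x0)
                     ((poly (map_poly emb a) x0 + poly (map_poly emb b) x0 * y0)
                        / poly (map_poly emb c) x0)))))"

end

theory Submission imports Defs begin

text \<open>If \<open>\<alpha>\<^sub>m\<close> is not injective, some Galois elements fix \<open>E[m]\<close> pointwise but translate \<open>[m]\<^sup>-\<^sup>1 P\<close>. The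
  translations so obtained form a nonzero Galois-stable subgroup of \<open>E[m]\<close>, which meets \<open>E[l]\<close> for some prime
  \<open>l\<close> dividing \<open>m\<close>. If the intersection has order \<open>l\<close>, it is the kernel of a rational isogeny. If it is all of
  \<open>E[l]\<close> and \<open>\<delta>\<^sub>d\<close> is irreducible for \<open>d = m / l\<close>, then the Galois group is transitive on
  \<open>[d]\<^sup>-\<^sup>1 P\<close>, hence on \<open>[m]\<^sup>-\<^sup>1 P\<close>, and \<open>\<delta>\<^sub>m\<close>, whose roots are the \<open>m\<^sup>2\<close> distinct
  \<open>x\<close>-coordinates of that fibre when \<open>2 P \<noteq> O\<close>, is irreducible.

  Associativity of the group law comes from the injectivity of \<open>P \<mapsto>\<close> (class of the maximal ideal at \<open>P\<close>). The
  quotient by a subgroup \<open>C\<close> has the coordinates \<open>\<Sum>c\<in>C. x(R + c)\<close> and \<open>\<Sum>c\<in>C. y(R + c)\<close>; they are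
  rational over the base field because they are traces over the \<open>x\<close>-coordinates of \<open>C\<close>.\<close>

section \<open>The group law\<close>

text \<open>The obstacle is to do all this from the bare addition formulas. Rational functions are
  functions on points, identified when they agree outside a finite set. Orders are measured only at
  infinity; orders elsewhere are obtained by translating the function. The substitute for
  Riemann-Roch is one parity fact: a(x) and b(x) y have pole orders 2 deg a and 2 deg b + 3, so a
  nonconstant function with poles only at infinity has a pole of order at least 2 there. It
  separates ideal classes in the proof of associativity, and it bounds the invariant functions on
  the quotient. The condition on the characteristic enters in the separability of multiplication by
  n (torsion and fibre counts), in a division of a residue by the order of C, and in the descent:
  over an imperfect field a Galois-stable set need not be the root set of a product of linear
  factors with coefficients in the base field, so the x-coordinates of C must be simple roots of a
  division polynomial. If 2 P = O, then x is not injective on the fibre; there a prime divisor of m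
  already gives a reducible polynomial, and it is proper because m is composite.\<close>

lemma singular_point_disc:
  fixes E :: "'a::field wcurve"
  assumes "on_curve E (Pt x y)" "2 * y + wa1 E * x + wa3 E = 0"
    "3 * x^2 + 2 * wa2 E * x + wa4 E - wa1 E * y = 0"
  shows "disc E = 0"
proof -
  have a3: "wa3 E = - 2 * y - wa1 E * x" using assms(2) by (simp add: algebra_simps eq_neg_iff_add_eq_0)
  have a4: "wa4 E = wa1 E * y - 3 * x^2 - 2 * wa2 E * x" using assms(3) by (simp add: algebra_simps)
  have a6: "wa6 E = y^2 + wa1 E * x * y + wa3 E * y - x^3 - wa2 E * x^2 - wa4 E * x"
    using assms(1) by (simp add: algebra_simps)
  show ?thesis
    unfolding disc_def wb2_def wb4_def wb6_def wb8_def a6 unfolding a4 a3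
    by algebra
qed

text \<open>Vieta's relations for the cubic obtained by substituting y = l x + v in the equation of
  the curve: x1, x2, x3 are the intersections counted with multiplicity. Chords and tangents are
  thereby treated alike, and the condition is symmetric in the three points.\<close>

definition collin :: "'a::field wcurve \<Rightarrow> 'a \<Rightarrow> 'a \<Rightarrow> 'a \<Rightarrow> 'a \<Rightarrow> 'a \<Rightarrow> bool" where
  "collin E l v x1 x2 x3 \<longleftrightarrow> l^2 + wa1 E * l - wa2 E = x1 + x2 + x3
     \<and> 2 * l * v + wa1 E * v + wa3 E * l - wa4 E = - (x1 * x2 + x1 * x3 + x2 * x3)
     \<and> v^2 + wa3 E * v - wa6 E = x1 * x2 * x3"

lemma collin_perm: "collin E l v x1 x2 x3 \<Longrightarrow> collin E l v x2 x1 x3"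
  "collin E l v x1 x2 x3 \<Longrightarrow> collin E l v x3 x2 x1"
  by (auto simp: collin_def algebra_simps)

text \<open>The negation y -> - y - a1 x - a3 of the curve maps the line with coefficients l, v to
  the one with coefficients - l - a1, - v - a3 and keeps the x-coordinates.\<close>

lemma collin_conj: "collin E l v x1 x2 x3 \<Longrightarrow> collin E (- l - wa1 E) (- v - wa3 E) x1 x2 x3"
  unfolding collin_def by (auto simp: algebra_simps power2_eq_square)

lemma collin_cubic:
  assumes "collin E l v x1 x2 x3"
  shows "(l*t+v)^2 + wa1 E * t * (l*t+v) + wa3 E * (l*t+v) - (t^3 + wa2 E * t^2 + wa4 E * t + wa6 E)
    = - ((t - x1) * (t - x2) * (t - x3))"
  using assms unfolding collin_def by algebra

lemma collin_on_curve: "collin E l v x1 x2 x3 \<Longrightarrow> on_curve E (Pt x3 (l*x3+v))"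
  using collin_cubic[of E l v x1 x2 x3 x3] by simp

locale wcv = fixes E :: "'a::field wcurve"
  assumes ell: "elliptic E"
begin

abbreviation "a1 \<equiv> wa1 E"
abbreviation "a2 \<equiv> wa2 E"
abbreviation "a3 \<equiv> wa3 E"
abbreviation "a4 \<equiv> wa4 E"
abbreviation "a6 \<equiv> wa6 E"

abbreviation add (infixl "\<oplus>" 65) where "R \<oplus> S \<equiv> ec_add E R S"
abbreviation neg ("\<ominus> _" [81] 80) where "\<ominus> R \<equiv> ec_neg E R"

lemma smooth: "on_curve E (Pt x y) \<Longrightarrow> 2 * y + a1 * x + a3 = 0 \<Longrightarrow>
    3 * x^2 + 2 * a2 * x + a4 - a1 * y \<noteq> 0"
  using singular_point_disc ell elliptic_def by blast

lemma add_Inf [simp]: "Inf \<oplus> R = R" "R \<oplus> Inf = R"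
  by (cases R; simp)+

lemma neg_neg [simp]: "\<ominus> (\<ominus> R) = R" by (cases R) auto

lemma neg_inj: "\<ominus> R = \<ominus> S \<Longrightarrow> R = S" by (metis neg_neg)

lemma on_curve_neg [simp]: "on_curve E (\<ominus> R) = on_curve E R"
proof (cases R)
  case (Pt x y)
  have "(- y - a1 * x - a3)^2 + a1 * x * (- y - a1 * x - a3) + a3 * (- y - a1 * x - a3)
    = y^2 + a1 * x * y + a3 * y" by algebra
  then show ?thesis using Pt by simp
qed simp

lemma add_neg [simp]: "R \<oplus> \<ominus> R = Inf" "\<ominus> R \<oplus> R = Inf"
  by (cases R; simp)+

lemma neg_Inf_iff [simp]: "\<ominus> R = Inf \<longleftrightarrow> R = Inf" by (cases R) auto

lemma same_x:
  assumes "on_curve E (Pt x y)" "on_curve E (Pt x y')"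
  shows "y' = y \<or> y' = - y - a1 * x - a3"
proof -
  have "(y' - y) * (y' + y + a1 * x + a3) = 0" using assms by simp algebra
  then have "y' - y = 0 \<or> y' + y + a1 * x + a3 = 0" by (simp only: mult_eq_0_iff)
  moreover have "y' = - y - a1 * x - a3" if "y' + y + a1 * x + a3 = 0" using that by algebra
  ultimately show ?thesis by auto
qed

lemma collin_add:
  assumes "collin E l v x1 x2 x3"
  shows "Pt x1 (l*x1+v) \<oplus> Pt x2 (l*x2+v) = \<ominus> (Pt x3 (l*x3+v))"
proof (cases "x1 = x2")
  case False
  then have n: "x2 - x1 \<noteq> 0" by simp
  have l: "(l*x2+v - (l*x1+v)) / (x2 - x1) = l" using n by (simp add: field_simps)
  have v: "((l*x1+v)*x2 - (l*x2+v)*x1) / (x2 - x1) = v" using n by (simp add: field_simps)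
  have x3: "x3 = l^2 + a1 * l - a2 - x1 - x2" using assms by (simp add: collin_def)
  have "Pt x1 (l*x1+v) \<oplus> Pt x2 (l*x2+v) = Pt x3 (- (l + a1) * x3 - v - a3)"
    using False by (simp only: ec_add.simps l v Let_def if_True if_False refl simp_thms x3[symmetric])
  then show ?thesis by (simp add: algebra_simps)
next
  case True
  have c: "on_curve E (Pt x1 (l*x1+v))"
    using collin_on_curve collin_perm assms by blast
  \<comment> \<open>A double root makes the line tangent, so \<open>l\<close> times the y-derivative
    is minus the x-derivative. If the former vanished, both would, and the point would be singular;
    hence the point is not its own negative and the doubling formula applies.\<close>
  have dr: "l * (2 * (l*x1+v) + a1 * x1 + a3) = 3 * x1^2 + 2 * a2 * x1 + a4 - a1 * (l*x1+v)"
    using assms True unfolding collin_def by algebra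
  have n: "2 * (l*x1+v) + a1 * x1 + a3 \<noteq> 0"
    using smooth[OF c] dr by force
  have n': "l*x1+v + (l*x1+v) + a1 * x1 + a3 \<noteq> 0" using n by (simp add: algebra_simps)
  have l: "(3 * x1^2 + 2 * a2 * x1 + a4 - a1 * (l*x1+v)) / (2 * (l*x1+v) + a1 * x1 + a3) = l"
    using n dr by (simp add: nonzero_divide_eq_eq)
  have "- (x1^3) + a4 * x1 + 2 * a6 - a3 * (l*x1+v) = v * (2 * (l*x1+v) + a1 * x1 + a3)"
    using c dr by simp algebra
  then have v: "(- (x1^3) + a4 * x1 + 2 * a6 - a3 * (l*x1+v)) / (2 * (l*x1+v) + a1 * x1 + a3) = v"
    using n by (simp add: nonzero_divide_eq_eq)
  have x3: "x3 = l^2 + a1 * l - a2 - x1 - x1" using assms True by (simp add: collin_def)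
  have "Pt x1 (l*x1+v) \<oplus> Pt x1 (l*x1+v) = Pt x3 (- (l + a1) * x3 - v - a3)"
    using n' by (simp only: ec_add.simps l v Let_def if_True if_False refl simp_thms x3[symmetric])
  then show ?thesis using True by (simp add: algebra_simps)
qed

lemma addE:
  assumes "on_curve E (Pt x1 y1)" "on_curve E (Pt x2 y2)" "Pt x2 y2 \<noteq> \<ominus> (Pt x1 y1)"
  obtains l v x3 where "collin E l v x1 x2 x3" "y1 = l*x1+v" "y2 = l*x2+v"
    "Pt x1 y1 \<oplus> Pt x2 y2 = \<ominus> (Pt x3 (l*x3+v))"
proof (cases "x1 = x2")
  case False
  define l v x3 where d: "l = (y2 - y1) / (x2 - x1)" "v = y1 - l * x1" "x3 = l^2 + a1 * l - a2 - x1 - x2"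
  have l: "l * (x2 - x1) = y2 - y1" using False d by simp
  have y1: "y1 = l * x1 + v" using d by simp
  have y2: "y2 = l * x2 + v" using l y1 by algebra
  \<comment> \<open>The difference of the two curve equations is \<open>x2 - x1\<close> times the
    middle Vieta relation.\<close>
  have t: "(x2 - x1) * (2 * l * v + a1 * v + a3 * l - a4 + (x1 * x2 + x1 * x3 + x2 * x3)) = 0"
    using assms(1,2) unfolding y1 y2 d(3) by simp algebra
  then have t': "2 * l * v + a1 * v + a3 * l - a4 + (x1 * x2 + x1 * x3 + x2 * x3) = 0" using False by simp
  have "collin E l v x1 x2 x3"
    unfolding collin_def
  proof (intro conjI)
    show "l^2 + a1 * l - a2 = x1 + x2 + x3" by (simp add: d)
    show b: "2 * l * v + a1 * v + a3 * l - a4 = - (x1 * x2 + x1 * x3 + x2 * x3)" using t' by algebra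
    show "v\<^sup>2 + a3 * v - a6 = x1 * x2 * x3" using assms(1) b d(3) unfolding y1 by simp algebra
  qed
  then show ?thesis using that[of l v x3] collin_add[of l v x1 x2 x3] y1 y2 by simp
next
  case True
  have y2: "y2 = y1" using same_x[OF assms(1), of y2] assms True by auto
  have n: "2 * y1 + a1 * x1 + a3 \<noteq> 0" using assms(3) True y2 by (simp add: algebra_simps eq_neg_iff_add_eq_0)
  define l v x3 where d: "l = (3 * x1^2 + 2 * a2 * x1 + a4 - a1 * y1) / (2 * y1 + a1 * x1 + a3)"
     "v = y1 - l * x1" "x3 = l^2 + a1 * l - a2 - x1 - x1"
  have l: "l * (2 * y1 + a1 * x1 + a3) = 3 * x1^2 + 2 * a2 * x1 + a4 - a1 * y1" using n d by simp
  have y1: "y1 = l * x1 + v" using d by simp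
  have "collin E l v x1 x1 x3"
    unfolding collin_def
  proof (intro conjI)
    show a: "l^2 + a1 * l - a2 = x1 + x1 + x3" by (simp add: d)
    show b: "2 * l * v + a1 * v + a3 * l - a4 = - (x1 * x1 + x1 * x3 + x1 * x3)"
      using a l unfolding y1 by algebra
    show "v\<^sup>2 + a3 * v - a6 = x1 * x1 * x3" using assms(1) b a unfolding y1 by simp algebra
  qed
  then show ?thesis using that[of l v x3] collin_add[of l v x1 x2 x3] y1 y2 True by simp
qed

lemma add_closed: "on_curve E R \<Longrightarrow> on_curve E S \<Longrightarrow> on_curve E (R \<oplus> S)"
proof (cases R; cases S)
  fix x1 y1 x2 y2 assume R: "R = Pt x1 y1" "S = Pt x2 y2" and c: "on_curve E R" "on_curve E S"
  show ?thesis
  proof (cases "S = \<ominus> R")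
    case True then show ?thesis by (simp only: add_neg on_curve.simps)
  next
    case False
    then obtain l v x3 where "collin E l v x1 x2 x3" "R \<oplus> S = \<ominus> (Pt x3 (l*x3+v))"
      using addE[of x1 y1 x2 y2] c R by metis
    then show ?thesis using collin_on_curve on_curve_neg by metis
  qed
qed auto

lemma add_commute: "on_curve E R \<Longrightarrow> on_curve E S \<Longrightarrow> R \<oplus> S = S \<oplus> R"
proof (cases R; cases S)
  fix x1 y1 x2 y2 assume R: "R = Pt x1 y1" "S = Pt x2 y2" and c: "on_curve E R" "on_curve E S"
  show ?thesis
  proof (cases "S = \<ominus> R")
    case True then show ?thesis by (simp only: add_neg)
  next
    case False
    then obtain l v x3 where "collin E l v x1 x2 x3" "R \<oplus> S = \<ominus> (Pt x3 (l*x3+v))" "y1 = l*x1+v" "y2 = l*x2+v"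
      using addE[of x1 y1 x2 y2] c R by metis
    then show ?thesis using collin_add[of l v x2 x1 x3] collin_perm R by metis
  qed
qed auto

text \<open>The instance of associativity that is visible on a single line: the line through R and S
  meets the curve a third time at -(R + S), so its conjugate passes through -R, -S and R + S, and
  the sum of the last two is R. The proof of general associativity relies on it.\<close>

lemma add_cancel: "on_curve E R \<Longrightarrow> on_curve E S \<Longrightarrow> (R \<oplus> S) \<oplus> \<ominus> S = R"
proof (cases R; cases S)
  fix x1 y1 x2 y2 assume R: "R = Pt x1 y1" "S = Pt x2 y2" and c: "on_curve E R" "on_curve E S"
  show ?thesis
  proof (cases "S = \<ominus> R")
    case True then show ?thesis by (simp only: add_neg add_Inf neg_neg)
  next
    case False
    then obtain l v x3 where *: "collin E l v x1 x2 x3" "R \<oplus> S = \<ominus> (Pt x3 (l*x3+v))" "y1 = l*x1+v" "y2 = l*x2+v"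
      using addE[of x1 y1 x2 y2] c R by metis
    have "collin E (-l-a1) (-v-a3) x3 x2 x1" using collin_conj collin_perm *(1) by blast
    from collin_add[OF this]
    have "\<ominus> (Pt x3 (l*x3+v)) \<oplus> \<ominus> S = R"
      by (simp add: R *(3,4) algebra_simps)
    then show ?thesis using * by simp
  qed
qed auto

end

section \<open>Functions on the curve\<close>

lemma alg_closed_infinite: "infinite (UNIV :: 'a::alg_closed_field set)"
proof
  assume f: "finite (UNIV :: 'a set)"
  define p where "p = (\<Prod>a\<in>(UNIV::'a set). [:-a, 1:]) + 1"
  have "degree (\<Prod>a\<in>(UNIV::'a set). [:-a, 1:]) = card (UNIV :: 'a set)"
    by (subst degree_prod_eq_sum_degree) auto
  moreover have "card (UNIV :: 'a set) > 0" using f by (simp add: card_gt_0_iff)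
  ultimately have "degree p > 0" unfolding p_def by (subst degree_add_eq_left) auto
  then obtain z where "poly p z = 0" using alg_closed_imp_poly_has_root by blast
  moreover have "poly p z = 1" using f by (simp add: p_def poly_prod)
  ultimately show False by simp
qed

text \<open>The value 0 at \<open>Inf\<close> is a dummy, but it is fixed by every field
  homomorphism, so that \<open>px\<close> commutes with the Galois action at all points.\<close>

fun px :: "'a::zero ecpt \<Rightarrow> 'a" where "px Inf = 0" | "px (Pt x y) = x"
fun py :: "'a::zero ecpt \<Rightarrow> 'a" where "py Inf = 0" | "py (Pt x y) = y"

locale ecv = wcv E for E :: "'a::alg_closed_field wcurve"
begin

lemma ex_point: "\<exists>y. on_curve E (Pt x y)"
proof -
  have "degree [:-(x^3 + a2*x^2 + a4*x + a6), a1*x+a3, 1:] > 0" by simp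
  then obtain y where "poly [:-(x^3 + a2*x^2 + a4*x + a6), a1*x+a3, 1:] y = 0"
    using alg_closed_imp_poly_has_root by blast
  then have "on_curve E (Pt x y)" by simp algebra
  then show ?thesis ..
qed

lemma finite_fibre: "finite {R \<in> points E. px R = x}"
proof (cases "\<exists>y. on_curve E (Pt x y)")
  case True
  then obtain y where y: "on_curve E (Pt x y)" ..
  have "{R \<in> points E. px R = x} \<subseteq> {Inf, Pt x y, Pt x (- y - a1 * x - a3)}"
  proof
    fix R assume "R \<in> {R \<in> points E. px R = x}"
    then show "R \<in> {Inf, Pt x y, Pt x (- y - a1 * x - a3)}"
      using same_x[OF y, of "py R"] by (cases R) (auto simp: points_def)
  qed
  then show ?thesis by (rule finite_subset) simp
next
  case False
  then have "{R \<in> points E. px R = x} \<subseteq> {Inf}"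
  proof (intro subsetI)
    fix R assume "R \<in> {R \<in> points E. px R = x}"
    then show "R \<in> {Inf}" using False by (cases R) (auto simp: points_def simp del: on_curve.simps(2))
  qed
  then show ?thesis by (rule finite_subset) simp
qed

text \<open>Along this filter "eventually" means "at all but finitely many points of the curve".
  Equality of rational functions is modelled by equality of arbitrary functions on points along
  \<open>gen\<close>, which makes the values at poles harmless.\<close>

definition gen :: "'a ecpt filter" where "gen = inf cofinite (principal (points E))"

lemma eventually_gen: "eventually P gen \<longleftrightarrow> finite {R \<in> points E. \<not> P R}"
  unfolding gen_def eventually_inf_principal eventually_cofinite
  by (rule arg_cong[of _ _ finite]) auto

lemma infinite_points: "infinite (points E)"
proof
  assume "finite (points E)"
  then have "finite (px ` points E)" by simp
  moreover have "px ` points E = UNIV"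
  proof -
    have "x \<in> px ` points E" for x using ex_point[of x] by (metis imageI mem_Collect_eq points_def px.simps(2))
    then show ?thesis by blast
  qed
  ultimately show False using alg_closed_infinite[where 'a='a] by simp
qed

lemma gen_neq_bot [simp]: "gen \<noteq> bot"
proof
  assume "gen = bot"
  then have "eventually (\<lambda>_. False) gen" by simp
  then show False using infinite_points by (simp add: eventually_gen)
qed

lemma gen_const [simp]: "eventually (\<lambda>_. P) gen \<longleftrightarrow> P"
  by (cases P) (auto simp: eventually_False)

lemma gen_ex: "eventually P gen \<Longrightarrow> \<exists>R \<in> points E. P R"
  using infinite_points unfolding eventually_gen
  by (metis (mono_tags, lifting) finite_subset mem_Collect_eq subsetI)

lemma gen_points: "\<forall>\<^sub>F R in gen. R \<in> points E" by (simp add: eventually_gen)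

lemma gen_neq: "\<forall>\<^sub>F R in gen. R \<noteq> S"
proof -
  have "{R \<in> points E. \<not> R \<noteq> S} \<subseteq> {S}" by auto
  then show ?thesis unfolding eventually_gen by (rule finite_subset) simp
qed

lemma gen_px: "\<forall>\<^sub>F R in gen. px R \<noteq> x"
  unfolding eventually_gen using finite_fibre[of x] by (simp add: conj_commute)

lemma gen_Pt: "\<forall>\<^sub>F R in gen. R = Pt (px R) (py R) \<and> on_curve E (Pt (px R) (py R))"
  using gen_points gen_neq[of Inf]
proof eventually_elim
  case (elim R)
  then show ?case by (cases R) (simp_all add: points_def del: on_curve.simps(2))
qed

lemma gen_curve: "\<forall>\<^sub>F R in gen. on_curve E (Pt (px R) (py R))"
  using gen_Pt by (rule eventually_mono) blast

lemma gen_poly: "p \<noteq> 0 \<Longrightarrow> \<forall>\<^sub>F R in gen. poly p (px R) \<noteq> 0"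
proof -
  assume "p \<noteq> 0"
  then have "finite (\<Union>x\<in>{x. poly p x = 0}. {R \<in> points E. px R = x})"
    using finite_fibre poly_roots_finite by (intro finite_UN_I) auto
  moreover have "{R \<in> points E. \<not> poly p (px R) \<noteq> 0} \<subseteq> (\<Union>x\<in>{x. poly p x = 0}. {R \<in> points E. px R = x})" by auto
  ultimately show ?thesis unfolding eventually_gen using finite_subset by blast
qed

lemma gen_poly_0: "\<forall>\<^sub>F R in gen. poly p (px R) = 0 \<Longrightarrow> p = 0"
proof (rule ccontr)
  assume z: "\<forall>\<^sub>F R in gen. poly p (px R) = 0" and "p \<noteq> 0"
  then have "\<forall>\<^sub>F R in gen. poly p (px R) \<noteq> 0" by (intro gen_poly)
  with z have "\<forall>\<^sub>F R in gen. False" by eventually_elim simp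
  then show False by simp
qed

text \<open>Preimages of finite sets under injections are finite. Negation and, later, translations
  are injective, so genericity may be transported along them.\<close>

lemma gen_inj:
  assumes "eventually P gen" "inj_on f (points E)" "f ` points E \<subseteq> points E"
  shows "\<forall>\<^sub>F R in gen. P (f R)"
proof -
  have "{R \<in> points E. \<not> P (f R)} \<subseteq> f -` {R \<in> points E. \<not> P R} \<inter> points E"
    using assms(3) by auto
  moreover have "finite (f -` {R \<in> points E. \<not> P R} \<inter> points E)"
    using assms(1,2) unfolding eventually_gen by (rule finite_vimage_IntI)
  ultimately show ?thesis unfolding eventually_gen using finite_subset by blast
qed

lemma gen_neg: "eventually P gen \<Longrightarrow> \<forall>\<^sub>F R in gen. P (\<ominus> R)"
  by (rule gen_inj) (auto simp: points_def inj_on_def dest: neg_inj)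

lemma F_eq: "on_curve E (Pt x y) \<Longrightarrow> poly (divF E) x = (2*y + a1*x + a3)^2"
  unfolding divF_def wb2_def wb4_def wb6_def by simp algebra

text \<open>If all coefficients vanish, then \<open>wb2 = wb6 = 0\<close> leaves only the term
  \<open>8 * wb4 ^ 3\<close> of the discriminant, and this one dies because 4 = 0.\<close>

lemma F_nonzero: "divF E \<noteq> 0"
proof
  assume "divF E = 0"
  then have z: "wb6 E = 0" "2 * wb4 E = 0" "wb2 E = 0" "(4::'a) = 0" by (simp_all add: divF_def)
  have e8: "(8::'a) = 2 * 4" by simp
  have 8: "(8::'a) = 0" unfolding e8 z by simp
  show False using ell z 8 by (simp add: elliptic_def disc_def)
qed

lemma gen_psi2: "\<forall>\<^sub>F R in gen. 2 * py R + a1 * px R + a3 \<noteq> 0"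
  using gen_poly[OF F_nonzero] gen_Pt
proof eventually_elim
  case (elim R)
  then show ?case using F_eq[of "px R" "py R"] by force
qed

section \<open>The affine coordinate ring as a free module with basis 1, y over polynomials in
  x\<close>

definition rp :: "('a ecpt \<Rightarrow> 'a) \<Rightarrow> 'a poly \<Rightarrow> 'a poly \<Rightarrow> bool" where
  "rp F a b \<longleftrightarrow> (\<forall>\<^sub>F R in gen. F R = poly a (px R) + poly b (px R) * py R)"

text \<open>Subtracting the value at the negated point leaves b(x) (2 y + a1 x + a3), whose second
  factor is generically nonzero; so b = 0 and then a = 0.\<close>

lemma rp_0:
  assumes "rp (\<lambda>_. 0) a b" shows "a = 0 \<and> b = 0"
proof -
  have *: "\<forall>\<^sub>F R in gen. 0 = poly a (px R) + poly b (px R) * py R" using assms by (simp add: rp_def)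
  have "\<forall>\<^sub>F R in gen. poly b (px R) = 0"
    using * gen_neg[OF *] gen_psi2 gen_Pt
  proof eventually_elim
    case (elim R)
    obtain x y where R: "R = Pt x y" using elim(4) by blast
    have e: "poly a x + poly b x * y = 0" "poly a x + poly b x * (- y - a1*x - a3) = 0"
      using elim(1,2) unfolding R by simp_all
    have "poly b x * (2 * y + a1 * x + a3) = (poly a x + poly b x * y) - (poly a x + poly b x * (- y - a1*x - a3))"
      by (simp add: algebra_simps)
    then have "poly b x * (2 * y + a1 * x + a3) = 0" unfolding e by simp
    then show ?case using elim(3) R by simp
  qed
  then have b: "b = 0" by (rule gen_poly_0)
  have "\<forall>\<^sub>F R in gen. poly a (px R) = 0" using * by (rule eventually_mono) (simp add: b)
  then show ?thesis using b gen_poly_0 by blast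
qed

lemma rp_cong: "rp F a b \<Longrightarrow> \<forall>\<^sub>F R in gen. F R = G R \<Longrightarrow> rp G a b"
  unfolding rp_def by (erule (1) eventually_elim2) simp

lemma rp_diff: "rp F a b \<Longrightarrow> rp G c d \<Longrightarrow> rp (\<lambda>R. F R - G R) (a - c) (b - d)"
  unfolding rp_def by (erule (1) eventually_elim2) (simp add: algebra_simps)

lemma rp_add: "rp F a b \<Longrightarrow> rp G c d \<Longrightarrow> rp (\<lambda>R. F R + G R) (a + c) (b + d)"
  unfolding rp_def by (erule (1) eventually_elim2) (simp add: algebra_simps)

lemma rp_unique: assumes "rp F a b" "rp F c d" shows "a = c \<and> b = d"
  using rp_0[of "a - c" "b - d"] rp_diff[OF assms] by simp

lemma rp_const: "rp (\<lambda>R. c) [:c:] 0" by (simp add: rp_def)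
lemma rp_px: "rp px [:0,1:] 0" by (simp add: rp_def)
lemma rp_py: "rp py 0 1" by (simp add: rp_def)

abbreviation "A1 \<equiv> [:a3, a1:]"
abbreviation "W3 \<equiv> [:a6, a4, a2, 1:]"

lemma rp_mult: assumes "rp F a b" "rp G c d"
  shows "rp (\<lambda>R. F R * G R) (a * c + b * d * W3) (a * d + b * c - b * d * A1)"
  using assms gen_Pt unfolding rp_def
proof eventually_elim
  case (elim R)
  obtain x y where R: "R = Pt x y" using elim(3) by blast
  have "y^2 = x^3 + a2*x^2 + a4*x + a6 - a1*x*y - a3*y" using elim(3) R by (simp add: algebra_simps)
  then show ?case unfolding elim(1,2) unfolding R by simp algebra
qed

text \<open>The norm down to polynomials in x: the product of a + b y with its conjugate a - b (a1 x
  + a3) - b y.\<close>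

definition nrm :: "'a poly \<Rightarrow> 'a poly \<Rightarrow> 'a poly" where
  "nrm a b = a * a - a * b * A1 - b * b * W3"

lemma nrm_mult: "nrm (a * c + b * d * W3) (a * d + b * c - b * d * A1) = nrm a b * nrm c d"
  unfolding nrm_def by algebra

lemma degree_diff_left: "degree q < degree (p :: 'b::ring_1 poly) \<Longrightarrow> degree (p - q) = degree p"
  using degree_add_eq_left[of "- q" p] by simp

lemma degree_diff_right: "degree p < degree (q :: 'b::ring_1 poly) \<Longrightarrow> degree (p - q) = degree q"
  using degree_add_eq_right[of p "- q"] by simp

text \<open>The degrees of a^2 and of b^2 \<open>W3\<close> have different parity, so they cannot
  cancel, and the mixed term has smaller degree than the larger of them.\<close>

lemma nrm_degree:
  assumes "b \<noteq> 0"
  shows "nrm a b \<noteq> 0" "degree (nrm a b) = max (2 * degree a) (2 * degree b + 3)"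
proof -
  have W: "degree (b * b * W3) = 2 * degree b + 3" using assms degree_mult_eq[of "b*b" W3] degree_mult_eq[of b b]
    by (simp del: mult_pCons_right)
  have *: "nrm a b \<noteq> 0 \<and> degree (nrm a b) = max (2 * degree a) (2 * degree b + 3)"
  proof (cases "2 * degree a > 2 * degree b + 3")
    case True
    then have a: "a \<noteq> 0" by auto
    have "degree (a * b * A1) \<le> degree a + degree b + 1"
      using degree_mult_le[of "a*b" A1] degree_mult_le[of a b] by (auto intro: order_trans split: if_splits)
    then have "degree (a * b * A1 + b * b * W3) < degree (a * a)"
      using True a W by (intro degree_add_less) (auto simp: degree_mult_eq)
    from degree_diff_left[OF this] have "degree (a * a - (a * b * A1 + b * b * W3)) = 2 * degree a"
      using a degree_mult_eq[of a a] by simp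
    then have "degree (nrm a b) = 2 * degree a" by (simp only: nrm_def diff_diff_eq)
    then show ?thesis using True by auto
  next
    case False
    then have l: "2 * degree a < 2 * degree b + 3" by presburger
    have 1: "degree (a * a) \<le> 2 * degree a" using degree_mult_le[of a a] by simp
    have "degree (a * b * A1) \<le> degree a + degree b + 1"
      using degree_mult_le[of "a*b" A1] degree_mult_le[of a b] by (auto intro: order_trans split: if_splits)
    then have "degree (a * a - a * b * A1) < degree (b * b * W3)"
      using 1 l unfolding W by (intro le_less_trans[OF degree_diff_le_max]) auto
    from degree_diff_right[OF this] have "degree (a * a - a * b * A1 - b * b * W3) = 2 * degree b + 3"
      using W by simp
    then show ?thesis using l by (auto simp: nrm_def)
  qed
  then show "nrm a b \<noteq> 0" "degree (nrm a b) = max (2 * degree a) (2 * degree b + 3)" by auto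
qed

lemma nrm_b0: "nrm a 0 = a * a" by (simp add: nrm_def)

lemma nrm_eq_0: "nrm a b = 0 \<longleftrightarrow> a = 0 \<and> b = 0"
  using nrm_degree(1)[of b a] by (cases "b = 0") (auto simp: nrm_b0)

text \<open>The degree of the norm counts the affine zeros with multiplicity; equivalently it is the
  pole order at infinity.\<close>

definition hasdeg :: "('a ecpt \<Rightarrow> 'a) \<Rightarrow> nat \<Rightarrow> bool" where
  "hasdeg F n \<longleftrightarrow> (\<exists>a b. rp F a b \<and> nrm a b \<noteq> 0 \<and> degree (nrm a b) = n)"

lemma hasdeg_mult: "hasdeg F m \<Longrightarrow> hasdeg G n \<Longrightarrow> hasdeg (\<lambda>R. F R * G R) (m + n)"
proof -
  assume "hasdeg F m" "hasdeg G n"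
  then obtain a b c d where "rp F a b" "nrm a b \<noteq> 0" "degree (nrm a b) = m"
    "rp G c d" "nrm c d \<noteq> 0" "degree (nrm c d) = n" unfolding hasdeg_def by blast
  then show ?thesis unfolding hasdeg_def
    using rp_mult[of F a b G c d] nrm_mult[of a c b d] degree_mult_eq[of "nrm a b" "nrm c d"]
    by (intro exI[of _ "a * c + b * d * W3"] exI[of _ "a * d + b * c - b * d * A1"]) simp
qed

lemma hasdeg_unique: "hasdeg F m \<Longrightarrow> hasdeg F n \<Longrightarrow> m = n"
  unfolding hasdeg_def using rp_unique by metis

lemma hasdeg_cong: "hasdeg F n \<Longrightarrow> \<forall>\<^sub>F R in gen. F R = G R \<Longrightarrow> hasdeg G n"
  unfolding hasdeg_def using rp_cong by metis

text \<open>The degree is even if b = 0 and at least 3 otherwise. This is the trace of genus one: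
  the maximal ideal of an affine point is not principal.\<close>

lemma hasdeg_neq_1: "\<not> hasdeg F 1"
proof
  assume "hasdeg F 1"
  then obtain a b where *: "nrm a b \<noteq> 0" "degree (nrm a b) = 1" unfolding hasdeg_def by blast
  have "degree (nrm a b) \<noteq> 1" if "b = 0"
    using that *(1) by (simp add: nrm_b0 degree_mult_eq) presburger
  then show False using nrm_degree[of b a] * by (cases "b = 0") auto
qed

lemma hasdeg_2: "hasdeg F 2 \<Longrightarrow> \<exists>p. degree p = 1 \<and> rp F p 0"
proof -
  assume "hasdeg F 2"
  then obtain a b where *: "nrm a b \<noteq> 0" "degree (nrm a b) = 2" "rp F a b" unfolding hasdeg_def by blast
  have "degree a = 1" if "b = 0"
    using that *(1,2) by (simp add: nrm_b0 degree_mult_eq)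
  then show ?thesis using nrm_degree[of b a] * by (cases "b = 0") auto
qed

text \<open>Membership in the maximal ideal of the affine point P. For \<open>Inf\<close> it is the
  unit ideal, so that P -> class of its ideal sends the neutral element to the trivial
  class.\<close>

definition van :: "'a ecpt \<Rightarrow> ('a ecpt \<Rightarrow> 'a) \<Rightarrow> bool" where
  "van P F \<longleftrightarrow> (\<exists>a b. rp F a b \<and> (case P of Inf \<Rightarrow> True | Pt x y \<Rightarrow> poly a x + poly b x * y = 0))"

lemma van_add: "van P F \<Longrightarrow> van P G \<Longrightarrow> van P (\<lambda>R. F R + G R)"
  unfolding van_def
proof (elim exE conjE)
  fix a b c d assume "rp F a b" "rp G c d"
    "case P of Inf \<Rightarrow> True | Pt x y \<Rightarrow> poly a x + poly b x * y = 0"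
    "case P of Inf \<Rightarrow> True | Pt x y \<Rightarrow> poly c x + poly d x * y = 0"
  moreover have "poly (a + c) x + poly (b + d) x * y = (poly a x + poly b x * y) + (poly c x + poly d x * y)" for x y
    by (simp add: algebra_simps)
  ultimately show "\<exists>a b. rp (\<lambda>R. F R + G R) a b \<and> (case P of Inf \<Rightarrow> True | Pt x y \<Rightarrow> poly a x + poly b x * y = 0)"
    by (intro exI[of _ "a+c"] exI[of _ "b+d"] conjI rp_add) (auto split: ecpt.splits simp del: poly_add)
qed

lemma van_mult:
  assumes P: "on_curve E P" and "van P F" "rp G c d" shows "van P (\<lambda>R. F R * G R)"
proof -
  obtain a b where 1: "rp F a b" "case P of Inf \<Rightarrow> True | Pt x y \<Rightarrow> poly a x + poly b x * y = 0"
    using assms by (auto simp: van_def)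
  show ?thesis unfolding van_def
  proof (intro exI conjI)
    show "rp (\<lambda>R. F R * G R) (a * c + b * d * W3) (a * d + b * c - b * d * A1)" using rp_mult 1 assms by blast
    show "case P of Inf \<Rightarrow> True | Pt x y \<Rightarrow>
        poly (a * c + b * d * W3) x + poly (a * d + b * c - b * d * A1) x * y = 0"
    proof (cases P)
      case (Pt x y)
      have "poly a x + poly b x * y = 0" "y^2 = x^3 + a2*x^2 + a4*x + a6 - a1*x*y - a3*y"
        using 1 P Pt by (simp_all add: algebra_simps)
      moreover have "poly (a * c + b * d * W3) x + poly (a * d + b * c - b * d * A1) x * y
        = (poly a x + poly b x * y) * (poly c x + poly d x * y)
          + poly b x * poly d x * (x^3 + a2*x^2 + a4*x + a6 - a1*x*y - a3*y - y^2)"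
        by (simp add: algebra_simps power2_eq_square power3_eq_cube)
      ultimately have "poly (a * c + b * d * W3) x + poly (a * d + b * c - b * d * A1) x * y = 0"
        by simp
      then show ?thesis by (simp add: Pt)
    qed simp
  qed
qed

lemma van_scale: "on_curve E P \<Longrightarrow> van P F \<Longrightarrow> van P (\<lambda>R. c * F R)"
  using van_mult[OF _ _ rp_const[of c], of P F] by (simp add: mult.commute)

lemma van_px: "van (Pt x y) (\<lambda>R. px R - x)"
  unfolding van_def by (intro exI[of _ "[:-x,1:]"] exI[of _ 0]) (auto simp: rp_def)

lemma van_line: "van (Pt x (l*x+v)) (\<lambda>R. py R - l * px R - v)"
  unfolding van_def by (intro exI[of _ "[:-v,-l:]"] exI[of _ 1]) (auto simp: rp_def algebra_simps)

lemma van_py: "van (Pt x y) (\<lambda>R. py R - y)"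
  using van_line[of x 0 y] by simp

text \<open>The ideal of a point is generated by \<open>px - x\<close> and \<open>py - y\<close>.
  Dividing both coordinate polynomials by X - x leaves constant remainders, which is why the
  coefficient of the second generator can be taken constant.\<close>

lemma van_decomp:
  assumes "van (Pt x y) F"
  obtains a b c d where "rp a b c" "\<forall>\<^sub>F R in gen. F R = a R * (px R - x) + d * (py R - y)"
proof -
  obtain a b where 1: "rp F a b" "poly a x + poly b x * y = 0" using assms by (auto simp: van_def)
  define a' b' where "a' = synthetic_div a x" "b' = synthetic_div b x"
  have a: "a = [:-x,1:] * a' + [:poly a x:]" "b = [:-x,1:] * b' + [:poly b x:]"
    using synthetic_div_correct'[of x] by (simp_all add: a'_b'_def)
  have "\<forall>\<^sub>F R in gen. F R = (poly a' (px R) + poly b' (px R) * py R) * (px R - x) + poly b x * (py R - y)"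
    using 1(1) unfolding rp_def
  proof eventually_elim
    case (elim R)
    have "poly a (px R) = (px R - x) * poly a' (px R) + poly a x"
         "poly b (px R) = (px R - x) * poly b' (px R) + poly b x"
      using arg_cong[OF a(1), of "\<lambda>p. poly p (px R)"] arg_cong[OF a(2), of "\<lambda>p. poly p (px R)"]
      unfolding poly_add poly_mult by simp_all
    then have "F R = ((px R - x) * poly a' (px R) + poly a x) + ((px R - x) * poly b' (px R) + poly b x) * py R"
      using elim by simp
    then show ?case using 1(2) by algebra
  qed
  then show ?thesis using that[of "\<lambda>R. poly a' (px R) + poly b' (px R) * py R" a' b' "poly b x"]
    by (simp add: rp_def)
qed

definition reg :: "('a ecpt \<Rightarrow> 'a) \<Rightarrow> bool" where "reg F \<longleftrightarrow> (\<exists>a b. rp F a b)"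

lemma reg_intros [intro!]:
  "reg (\<lambda>R. c)" "reg px" "reg py"
  "reg F \<Longrightarrow> reg G \<Longrightarrow> reg (\<lambda>R. F R + G R)"
  "reg F \<Longrightarrow> reg G \<Longrightarrow> reg (\<lambda>R. F R - G R)"
  "reg F \<Longrightarrow> reg G \<Longrightarrow> reg (\<lambda>R. F R * G R)"
  unfolding reg_def
  by (rule exI, rule exI, rule rp_const rp_px rp_py)+
     (elim exE, rule exI, rule exI, erule (1) rp_add rp_diff rp_mult)+

lemma reg_minus [intro!]: "reg F \<Longrightarrow> reg (\<lambda>R. - F R)"
  using reg_intros(5)[OF reg_intros(1)[of 0], of F] by simp

lemma reg_power [intro!]: "reg F \<Longrightarrow> reg (\<lambda>R. F R ^ n)"
  by (induction n) auto

lemma van_decomp_ex: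
  assumes "van (Pt x y) F"
  shows "\<exists>a d. reg a \<and> (\<forall>\<^sub>F R in gen. F R = a R * (px R - x) + d * (py R - y))"
proof -
  from van_decomp[OF assms] obtain a b c d
    where "rp a b c" "\<forall>\<^sub>F R in gen. F R = a R * (px R - x) + d * (py R - y)" .
  then show ?thesis by (intro exI[of _ a] exI[of _ d]) (auto simp: reg_def)
qed

lemma van_Inf: "van Inf F = reg F" by (simp add: van_def reg_def)

lemma van_reg: "van P F \<Longrightarrow> reg F" unfolding van_def reg_def by blast

lemma van_mult_reg: "on_curve E P \<Longrightarrow> van P F \<Longrightarrow> reg G \<Longrightarrow> van P (\<lambda>R. F R * G R)"
  unfolding reg_def by (elim exE, rule van_mult)

section \<open>Associativity\<close>

text \<open>\<open>ht\<close> is the degree of the ideal attached to P. The vertical line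
  \<open>vf\<close> is the generator of the product of the ideals of P and of its negative, and has
  twice that degree.\<close>

definition ht :: "'a ecpt \<Rightarrow> nat" where "ht P = (if P = Inf then 0 else 1)"
definition vf :: "'a ecpt \<Rightarrow> 'a ecpt \<Rightarrow> 'a" where
  "vf P R = (case P of Inf \<Rightarrow> 1 | Pt x _ \<Rightarrow> px R - x)"

lemma vf_simps [simp]: "vf Inf R = 1" "vf (Pt x y) R = px R - x" "vf (\<ominus> P) R = vf P R"
  by (simp_all add: vf_def) (cases P; simp)

lemma hasdeg_vf: "hasdeg (vf P) (2 * ht P)"
proof (cases P)
  case Inf
  have "vf Inf = (\<lambda>R. 1)" by auto
  then show ?thesis using rp_const[of 1] unfolding hasdeg_def Inf ht_def
    by (intro exI[of _ "[:1:]"] exI[of _ 0]) (auto simp: nrm_b0)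
next
  case (Pt x y)
  have "vf (Pt x y) = (\<lambda>R. px R - x)" by auto
  then show ?thesis unfolding hasdeg_def Pt ht_def
    by (intro exI[of _ "[:-x,1:]"] exI[of _ 0]) (auto simp: nrm_b0 rp_def degree_mult_eq)
qed

lemma gen_vf: "\<forall>\<^sub>F R in gen. vf P R \<noteq> 0"
  by (cases P) (use gen_px in auto)

lemma van_vf: "van P (vf P)"
proof (cases P)
  case Inf
  have "vf Inf = (\<lambda>R. 1)" by auto
  then show ?thesis using Inf van_Inf by auto
next
  case (Pt x y)
  have "vf (Pt x y) = (\<lambda>R. px R - x)" by auto
  then show ?thesis using Pt van_px by simp
qed

text \<open>The difference of the two curve equations, factored. At (x0, y0) the cofactor equals
  minus the partial derivative in x of the curve equation, hence is nonzero at a two-torsion point;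
  it is the local unit used there in several later arguments.\<close>

lemma neg_prod:
  assumes "on_curve E (Pt x0 y0)" "on_curve E (Pt x y)"
  shows "(y - y0) * (y - (- y0 - a1*x0 - a3))
    = (x - x0) * (x^2 + x*x0 + x0^2 + a2*(x + x0) + a4 - a1*y)"
proof -
  have "(y - y0) * (y - (- y0 - a1*x0 - a3))
    = (x - x0) * (x^2 + x*x0 + x0^2 + a2*(x + x0) + a4 - a1*y)
     + ((y^2 + a1*x*y + a3*y - (x^3 + a2*x^2 + a4*x + a6))
     - (y0^2 + a1*x0*y0 + a3*y0 - (x0^3 + a2*x0^2 + a4*x0 + a6)))"
    by (simp add: algebra_simps power2_eq_square power3_eq_cube)
  moreover have "y^2 + a1*x*y + a3*y - (x^3 + a2*x^2 + a4*x + a6) = 0"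
    "y0^2 + a1*x0*y0 + a3*y0 - (x0^3 + a2*x0^2 + a4*x0 + a6) = 0" using assms by simp_all
  ultimately show ?thesis by (simp only: diff_self add_0_right)
qed

text \<open>The divisor of the chord through \<open>P\<close> and \<open>Q\<close>, conjugated, turns the product of the maximal ideals
  of \<open>P\<close> and \<open>Q\<close> into the one of \<open>P \<oplus> Q\<close>.\<close>

lemma chord_fun:
  assumes P: "on_curve E P" and Q: "on_curve E Q"
  shows "\<exists>L. hasdeg L (ht P + ht Q + ht (P \<oplus> Q)) \<and> (\<forall>u w. van P u \<longrightarrow> van Q w \<longrightarrow>
    (\<exists>g. van (P \<oplus> Q) g \<and> (\<forall>\<^sub>F R in gen. L R * u R * w R = vf P R * vf Q R * g R)))"
proof -
  consider "P = Inf" | "Q = Inf" | "P \<noteq> Inf" "Q = \<ominus> P" | "P \<noteq> Inf" "Q \<noteq> Inf" "Q \<noteq> \<ominus> P" by blast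
  then show ?thesis
  proof cases
    case 1
    show ?thesis
    proof (rule exI[of _ "vf Q"], intro conjI allI impI)
      fix u w assume "van P u" "van Q w"
      then show "\<exists>g. van (P \<oplus> Q) g \<and> (\<forall>\<^sub>F R in gen. vf Q R * u R * w R = vf P R * vf Q R * g R)"
        using 1 van_mult_reg[OF Q, of w u] by (intro exI[of _ "\<lambda>R. w R * u R"]) (auto simp: van_Inf)
    qed (use 1 hasdeg_vf[of Q] in \<open>simp add: ht_def numeral_2_eq_2 split: if_splits\<close>)
  next
    case 2
    show ?thesis
    proof (rule exI[of _ "vf P"], intro conjI allI impI)
      fix u w assume "van P u" "van Q w"
      then show "\<exists>g. van (P \<oplus> Q) g \<and> (\<forall>\<^sub>F R in gen. vf P R * u R * w R = vf P R * vf Q R * g R)"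
        using 2 van_mult_reg[OF P, of u w] by (intro exI[of _ "\<lambda>R. u R * w R"]) (auto simp: van_Inf)
    qed (use 2 hasdeg_vf[of P] in \<open>simp add: ht_def numeral_2_eq_2 split: if_splits\<close>)
  next
    case 3
    then obtain x y where P': "P = Pt x y" by (cases P) auto
    have Q': "Q = Pt x (- y - a1*x - a3)" using 3 P' by simp
    have i: "P \<oplus> Q = Inf" unfolding 3(2) by simp
    show ?thesis unfolding i
    proof (rule exI[of _ "vf P"], intro conjI allI impI)
      have "2 * ht P = ht P + ht Q + ht Inf" by (simp add: P' Q' ht_def)
      then show "hasdeg (vf P) (ht P + ht Q + ht Inf)" using hasdeg_vf by metis
    next
      fix u w assume u0: "van P u" and w0: "van Q w"
      obtain a d where u: "reg a" "\<forall>\<^sub>F R in gen. u R = a R * (px R - x) + d * (py R - y)"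
        using van_decomp_ex[OF u0[unfolded P']] by blast
      obtain a' d' where w: "reg a'" "\<forall>\<^sub>F R in gen. w R = a' R * (px R - x) + d' * (py R - (- y - a1*x - a3))"
        using van_decomp_ex[OF w0[unfolded Q']] by blast
      \<comment> \<open>In the expansion of \<open>u * w\<close> three of the four terms visibly
        contain \<open>px - x\<close>; \<open>neg_prod\<close> extracts it from the fourth.\<close>
      define g where "g R = a R * a' R * (px R - x) + a R * d' * (py R - (- y - a1*x - a3)) + a' R * d * (py R - y)
         + d * d' * (px R ^2 + px R * x + x^2 + a2 * (px R + x) + a4 - a1 * py R)" for R
      have "van Inf g" unfolding van_Inf g_def using u w by auto
      moreover have "\<forall>\<^sub>F R in gen. vf P R * u R * w R = vf P R * vf Q R * g R"
        using u(2) w(2) gen_Pt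
      proof eventually_elim
        case (elim R)
        have "on_curve E (Pt x y)" "on_curve E (Pt (px R) (py R))" using P P' elim(3) by blast+
        from neg_prod[OF this]
        have "u R * w R = (px R - x) * g R" unfolding elim(1,2) g_def by algebra
        then show ?case unfolding P' Q' vf_simps by (simp only: mult.assoc)
      qed
      ultimately show "\<exists>g. van Inf g \<and> (\<forall>\<^sub>F R in gen. vf P R * u R * w R = vf P R * vf Q R * g R)"
        by (intro exI[of _ g] conjI)
    qed
  next
    case 4
    then obtain x1 y1 x2 y2 where PQ: "P = Pt x1 y1" "Q = Pt x2 y2" by (cases P; cases Q) auto
    obtain l v x3 where c: "collin E l v x1 x2 x3" "y1 = l*x1+v" "y2 = l*x2+v"
      and S: "P \<oplus> Q = \<ominus> (Pt x3 (l*x3+v))" using addE[of x1 y1 x2 y2] P Q PQ 4 by metis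
    have cS: "on_curve E (P \<oplus> Q)" using add_closed P Q by blast
    define L where "L R = py R - l * px R - v" for R
    define L' where "L' R = - py R - a1 * px R - a3 - l * px R - v" for R
    have LL: "\<forall>\<^sub>F R in gen. L R * L' R = - ((px R - x1) * (px R - x2) * (px R - x3))"
      using gen_curve
    proof eventually_elim
      case (elim R)
      have "L R * L' R = (l*px R+v)^2 + a1 * px R * (l*px R+v) + a3 * (l*px R+v)
        - (py R^2 + a1 * px R * py R + a3 * py R)"
        unfolding L_def L'_def by (simp add: algebra_simps power2_eq_square)
      then show ?case using collin_cubic[OF c(1), of "px R"] elim by simp
    qed
    have vL': "van (P \<oplus> Q) L'" unfolding van_def S
      by (intro exI[of _ "[:-a3-v, -a1-l:]"] exI[of _ "-1"]) (auto simp: rp_def L'_def algebra_simps)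
    have vS: "van (P \<oplus> Q) (\<lambda>R. px R - x3)" unfolding S by (simp add: van_px)
    have rL: "reg L" unfolding L_def by auto
    show ?thesis
    proof (rule exI[of _ L'], intro conjI allI impI)
      have "ht (P \<oplus> Q) = 1" unfolding S by (simp add: ht_def)
      moreover have "ht P = 1" "ht Q = 1" unfolding PQ by (simp_all add: ht_def)
      ultimately have h: "ht P + ht Q + ht (P \<oplus> Q) = 3" by simp
      have "rp L' [:-a3-v, -a1-l:] (-1)" by (auto simp: rp_def L'_def algebra_simps)
      moreover have "nrm [:-a3-v, -a1-l:] (-1) \<noteq> 0" by (rule nrm_degree) simp
      moreover have "degree (nrm [:-a3-v, -a1-l:] (-1)) = 3" by (subst nrm_degree(2)) auto
      ultimately show "hasdeg L' (ht P + ht Q + ht (P \<oplus> Q))" unfolding hasdeg_def h by blast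
    next
      fix u w assume u0: "van P u" and w0: "van Q w"
      obtain a d where u: "reg a" "\<forall>\<^sub>F R in gen. u R = a R * (px R - x1) + d * (py R - y1)"
        using van_decomp_ex[OF u0[unfolded PQ]] by blast
      obtain a' d' where w: "reg a'" "\<forall>\<^sub>F R in gen. w R = a' R * (px R - x2) + d' * (py R - y2)"
        using van_decomp_ex[OF w0[unfolded PQ]] by blast
      \<comment> \<open>Put y - yi = L + l (x - xi) in both decompositions. Every term of
        \<open>L' * u * w\<close> then contains (x - x1) (x - x2) or the product L L', and
        \<open>LL\<close> turns the latter into the three verticals; g is the remaining
        cofactor.\<close>
      define g where "g R = L' R * (a R * a' R + a R * d' * l + d * a' R * l + d * d' * l * l)
        + (px R - x3) * (- a R * d' * (px R - x1) - d * a' R * (px R - x2)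
           - d * d' * (L R + l * (px R - x1 + (px R - x2))))" for R
      have "van (P \<oplus> Q) g" unfolding g_def
        using u(1) w(1) rL by (intro van_add van_mult_reg cS vL' vS) auto
      moreover have "\<forall>\<^sub>F R in gen. L' R * u R * w R = vf P R * vf Q R * g R"
        using u(2) w(2) LL
      proof eventually_elim
        case (elim R)
        have y: "py R - y1 = L R + l * (px R - x1)" "py R - y2 = L R + l * (px R - x2)"
          using c by (auto simp: L_def algebra_simps)
        show ?case unfolding elim(1,2) g_def PQ vf_simps y using elim(3) by algebra
      qed
      ultimately show "\<exists>g. van (P \<oplus> Q) g \<and> (\<forall>\<^sub>F R in gen. L' R * u R * w R = vf P R * vf Q R * g R)"
        by (intro exI[of _ g] conjI)
    qed
  qed
qed

text \<open>Smoothness enters here: \<open>x - x(S)\<close> lies in the product of the maximal ideals of \<open>S\<close> and \<open>\<ominus> S\<close>.\<close>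

lemma ideal_neg_split:
  assumes S: "on_curve E S" and V: "on_curve E V"
    and H: "\<And>u w. van S u \<Longrightarrow> van (\<ominus> S) w \<Longrightarrow> \<exists>g. van V g \<and> (\<forall>\<^sub>F R in gen. H R * u R * w R = q R * g R)"
  shows "\<exists>g. van V g \<and> (\<forall>\<^sub>F R in gen. H R * vf S R = q R * g R)"
proof (cases S)
  case Inf
  have "van Inf (\<lambda>R. 1)" by (auto simp: van_Inf)
  then show ?thesis using H[of "\<lambda>R. 1" "\<lambda>R. 1"] by (simp add: Inf)
next
  case (Pt x0 y0)
  have key: ?thesis if uw: "van S u1" "van (\<ominus> S) w1" "van S u2" "van (\<ominus> S) w2"
    and e: "e \<noteq> 0" "\<forall>\<^sub>F R in gen. e * vf S R = u1 R * w1 R - u2 R * w2 R" for u1 w1 u2 w2 e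
  proof -
    obtain g1 where g1: "van V g1" "\<forall>\<^sub>F R in gen. H R * u1 R * w1 R = q R * g1 R" using H[OF uw(1,2)] by blast
    obtain g2 where g2: "van V g2" "\<forall>\<^sub>F R in gen. H R * u2 R * w2 R = q R * g2 R" using H[OF uw(3,4)] by blast
    note g = g1 g2
    have "van V (\<lambda>R. (1/e) * (g1 R + (-1) * g2 R))"
      by (intro van_scale van_add V g)
    moreover have "\<forall>\<^sub>F R in gen. H R * vf S R = q R * ((1/e) * (g1 R + (-1) * g2 R))"
      using e(2) g(2,4)
    proof eventually_elim
      case (elim R)
      have "e * (H R * vf S R) = q R * (g1 R + (-1) * g2 R)" using elim by algebra
      then show ?case using e(1) by (simp add: field_simps)
    qed
    ultimately show ?thesis by (rule_tac x = "\<lambda>R. (1/e) * (g1 R + (-1) * g2 R)" in exI) auto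
  qed
  have n: "\<ominus> S = Pt x0 (- y0 - a1*x0 - a3)" using Pt by simp
  have x: "van S (\<lambda>R. px R - x0)" "van (\<ominus> S) (\<lambda>R. px R - x0)"
    unfolding n unfolding Pt by (rule van_px)+
  have y: "van S (\<lambda>R. py R - y0)" "van (\<ominus> S) (\<lambda>R. py R - (- y0 - a1*x0 - a3))"
    unfolding n unfolding Pt by (rule van_py)+
  show ?thesis
  proof (cases "2 * y0 + a1 * x0 + a3 = 0")
    case False
    \<comment> \<open>The two conjugate values of y differ by 2 y0 + a1 x0 + a3, so this multiple of
      \<open>px - x0\<close> is the difference of the two mixed products of generators.\<close>
    show ?thesis by (rule key[OF x(1) y(2) y(1) x(2) False]) (simp add: Pt algebra_simps)
  next
    case True
    \<comment> \<open>Here S is its own negative. The cofactor of \<open>neg_prod\<close> is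
      \<open>e0\<close> plus an element of the ideal of S, and its product with
      \<open>px - x0\<close> is a product of generators; so \<open>e0 * (px - x0)\<close> lies in
      the product ideal.\<close>
    define e0 where "e0 = 3 * x0^2 + 2 * a2 * x0 + a4 - a1 * y0"
    have e0: "e0 \<noteq> 0" using smooth True S Pt by (simp add: e0_def)
    define e where "e R = px R ^2 + px R * x0 + x0^2 + a2 * (px R + x0) + a4 - a1 * py R" for R
    have vE: "van S (\<lambda>R. e R - e0)" unfolding Pt van_def
      by (intro exI[of _ "[:x0^2 + a2*x0 + a4 - e0, x0 + a2, 1:]"] exI[of _ "[:-a1:]"])
         (auto simp: rp_def e_def e0_def algebra_simps power2_eq_square)
    show ?thesis
    proof (rule key[OF y vE x(2) e0])
      show "\<forall>\<^sub>F R in gen. e0 * vf S R = (py R - y0) * (py R - (- y0 - a1 * x0 - a3)) - (e R - e0) * (px R - x0)"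
        using gen_Pt
      proof eventually_elim
        case (elim R)
        have "on_curve E (Pt x0 y0)" "on_curve E (Pt (px R) (py R))" using S Pt elim by blast+
        from neg_prod[OF this] show ?case by (simp add: Pt e_def algebra_simps)
      qed
    qed
  qed
qed

text \<open>Multiplication by f / q carries the ideal of U into that of V and raises degrees by
  \<open>ht V - ht U\<close>. If U is \<open>Inf\<close>, the image of 1 has degree
  \<open>ht V\<close>, which cannot be 1. Otherwise the image of \<open>px - x\<close> has degree
  \<open>ht V + 1\<close>; so V is affine and the image is a constant multiple of px - x(V).
  Comparing it with the image of \<open>py - y\<close> identifies both coordinates.\<close>

lemma ideal_class_eq:
  assumes U: "on_curve E U" and V: "on_curve E V"
    and f: "hasdeg f df" and q: "hasdeg q dq" and d: "df + ht U = dq + ht V"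
    and nz: "\<forall>\<^sub>F R in gen. q R \<noteq> 0"
    and H: "\<And>w. van U w \<Longrightarrow> \<exists>g. van V g \<and> (\<forall>\<^sub>F R in gen. f R * w R = q R * g R)"
  shows "U = V"
proof -
  have dg: "hasdeg g (df + dw - dq) \<and> df + dw \<ge> dq"
    if "\<forall>\<^sub>F R in gen. f R * w R = q R * g R" "hasdeg w dw" and rg: "reg g" for w g dw
  proof -
    have 1: "hasdeg (\<lambda>R. q R * g R) (df + dw)" by (rule hasdeg_cong[OF hasdeg_mult[OF f that(2)]]) (rule that(1))
    obtain a b where ab: "rp g a b" using rg by (auto simp: reg_def)
    have "nrm a b \<noteq> 0"
    proof
      assume "nrm a b = 0"
      then have "a = 0" "b = 0" by (simp_all add: nrm_eq_0)
      then have "\<forall>\<^sub>F R in gen. g R = 0" using ab by (simp add: rp_def)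
      then have "\<forall>\<^sub>F R in gen. q R * g R = 0" by (rule eventually_mono) simp
      then have "hasdeg (\<lambda>_. 0) (df + dw)" by (rule hasdeg_cong[OF 1])
      then show False unfolding hasdeg_def using rp_0 nrm_eq_0 by blast
    qed
    then obtain n where n: "hasdeg g n" using ab hasdeg_def by blast
    from hasdeg_unique[OF 1 hasdeg_mult[OF q n]] n show ?thesis by simp
  qed
  show ?thesis
  proof (cases U)
    case Inf
    have "van U (\<lambda>R. 1)" by (auto simp: Inf van_Inf)
    then obtain g where g: "van V g" "\<forall>\<^sub>F R in gen. f R * 1 = q R * g R" using H by blast
    have "hasdeg (\<lambda>R. 1) 0" using hasdeg_vf[of Inf] unfolding ht_def vf_def by simp
    from dg[OF g(2) this van_reg[OF g(1)]] have "hasdeg g (ht V)" using d by (simp add: Inf ht_def)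
    then show ?thesis using hasdeg_neq_1 Inf by (auto simp: ht_def split: if_splits)
  next
    case (Pt x y)
    obtain g where g: "van V g" "\<forall>\<^sub>F R in gen. f R * vf U R = q R * g R" using H van_vf by blast
    have hg: "hasdeg g (ht V + 1)"
      using dg[OF g(2) hasdeg_vf van_reg[OF g(1)]] d by (simp add: Pt ht_def split: if_splits)
    then obtain x' y' where V': "V = Pt x' y'" using hasdeg_neq_1 by (cases V) (auto simp: ht_def)
    then have "hasdeg g 2" using hg by (simp add: ht_def numeral_2_eq_2)
    then obtain p where p: "degree p = 1" "rp g p 0" using hasdeg_2 by blast
    obtain a0 b0 where ab0: "rp g a0 b0" "poly a0 x' + poly b0 x' * y' = 0" using g(1) unfolding van_def V' by auto
    have "poly p x' = 0" using rp_unique[OF ab0(1) p(2)] ab0(2) by simp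
    then obtain r where r: "p = [:-x',1:] * r" unfolding poly_eq_0_iff_dvd by (elim dvdE)
    have r0: "r \<noteq> 0" using r p(1) by auto
    have "degree r = 0" using r0 p(1) degree_mult_eq[of "[:-x',1:]" r] unfolding r by simp
    then obtain c where rc: "r = [:c:]" by (rule degree_eq_zeroE)
    then have c0: "p = [:-x',1:] * [:c:]" "c \<noteq> 0" using r r0 by auto
    then have c: "p = smult c [:-x',1:]" "c \<noteq> 0" by simp_all
    have ge: "\<forall>\<^sub>F R in gen. g R = c * (px R - x')" using p(2) unfolding rp_def c(1)
      by (rule eventually_mono) (simp add: algebra_simps)
    have "van U (\<lambda>R. py R - y)" unfolding Pt by (rule van_py)
    then obtain h where h: "van V h" "\<forall>\<^sub>F R in gen. f R * (py R - y) = q R * h R" using H by blast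
    obtain a b where ab: "rp h a b" "poly a x' + poly b x' * y' = 0" using h(1) V' by (auto simp: van_def)
    have "\<forall>\<^sub>F R in gen. 0 = poly (smult c [:-x',1:] * [:-y:] - [:-x,1:] * a) (px R)
       + poly (smult c [:-x',1:] - [:-x,1:] * b) (px R) * py R"
      using ge g(2) h(2) ab(1) nz unfolding rp_def
    proof eventually_elim
      case (elim R)
      have "q R * (c * (px R - x') * (py R - y) - (px R - x) * h R) = 0"
        using elim(1,2,3) unfolding Pt vf_simps by algebra
      then have "c * (px R - x') * (py R - y) - (px R - x) * h R = 0" using elim by simp
      then show ?case unfolding elim(4) by simp algebra
    qed
    then have z: "rp (\<lambda>_. 0) (smult c [:-x',1:] * [:-y:] - [:-x,1:] * a) (smult c [:-x',1:] - [:-x,1:] * b)"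
      unfolding rp_def .
    have e: "smult c [:-x',1:] * [:-y:] = [:-x,1:] * a" "smult c [:-x',1:] = [:-x,1:] * b"
      using conjunct1[OF rp_0[OF z]] conjunct2[OF rp_0[OF z]] by (simp_all only: right_minus_eq)
    have "poly (smult c [:-x',1:]) x = 0" unfolding e(2) by simp
    then have xx: "x' = x" using c by simp
    have nz1: "[:-x,1:] \<noteq> 0" by simp
    have "[:-x,1:] * b = [:-x,1:] * [:c:]" unfolding e(2)[symmetric] xx by simp
    then have b: "b = [:c:]" using nz1 mult_left_cancel by blast
    have "[:-x,1:] * a = [:-x,1:] * [:-c*y:]" unfolding e(1)[symmetric] xx by simp
    then have a: "a = [:-c*y:]" using nz1 mult_left_cancel by blast
    have "y' = y" using ab(2) c(2) by (simp add: a b)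
    then show ?thesis using Pt V' xx by simp
  qed
qed

text \<open>Four chords lead from the ideal of U to that of V: U and -S give T, T and -Q give P, Q
  and S give X, P and X give V. The ideals of S, -S, Q, -Q spent on the way are replaced by
  verticals with \<open>ideal_neg_split\<close>. In the degree count every point except U and V
  occurs twice on both sides, so the balance required by \<open>ideal_class_eq\<close>
  holds.\<close>

theorem add_assoc:
  assumes P: "on_curve E P" and Q: "on_curve E Q" and S: "on_curve E S"
  shows "(P \<oplus> Q) \<oplus> S = P \<oplus> (Q \<oplus> S)"
proof -
  define T U X V where d: "T = P \<oplus> Q" "U = T \<oplus> S" "X = Q \<oplus> S" "V = P \<oplus> X"
  have oc: "on_curve E T" "on_curve E U" "on_curve E X" "on_curve E V"
    unfolding d by (intro add_closed P Q S)+
  have c: "U \<oplus> \<ominus> S = T" "T \<oplus> \<ominus> Q = P" unfolding d by (intro add_cancel add_closed P Q S)+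
  have hn: "ht (\<ominus> R) = ht R" for R by (simp add: ht_def)
  have S': "on_curve E (\<ominus> S)" and Q': "on_curve E (\<ominus> Q)" using S Q by simp_all
  obtain L1 where L1: "hasdeg L1 (ht U + ht S + ht T)" "\<And>u w. van U u \<Longrightarrow> van (\<ominus> S) w \<Longrightarrow>
    \<exists>g. van T g \<and> (\<forall>\<^sub>F R in gen. L1 R * u R * w R = vf U R * vf S R * g R)"
    using chord_fun[OF oc(2) S'] unfolding c hn vf_simps by blast
  obtain L2 where L2: "hasdeg L2 (ht T + ht Q + ht P)" "\<And>u w. van T u \<Longrightarrow> van (\<ominus> Q) w \<Longrightarrow>
    \<exists>g. van P g \<and> (\<forall>\<^sub>F R in gen. L2 R * u R * w R = vf T R * vf Q R * g R)"
    using chord_fun[OF oc(1) Q'] unfolding c hn vf_simps by blast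
  obtain L3 where L3: "hasdeg L3 (ht Q + ht S + ht X)" "\<And>u w. van Q u \<Longrightarrow> van S w \<Longrightarrow>
    \<exists>g. van X g \<and> (\<forall>\<^sub>F R in gen. L3 R * u R * w R = vf Q R * vf S R * g R)"
    using chord_fun[OF Q S] unfolding d(3)[symmetric] by blast
  obtain L4 where L4: "hasdeg L4 (ht P + ht X + ht V)" "\<And>u w. van P u \<Longrightarrow> van X w \<Longrightarrow>
    \<exists>g. van V g \<and> (\<forall>\<^sub>F R in gen. L4 R * u R * w R = vf P R * vf X R * g R)"
    using chord_fun[OF P oc(3)] unfolding d(4)[symmetric] by blast
  define f where "f R = (L1 R * L2 R) * (L3 R * L4 R)" for R
  define q where "q R = ((vf U R * vf S R) * (vf T R * vf Q R)) * (vf P R * vf X R)" for R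
  have "U = V"
  proof (rule ideal_class_eq)
    show "on_curve E U" "on_curve E V" by fact+
    show "hasdeg f ((ht U + ht S + ht T + (ht T + ht Q + ht P)) + ((ht Q + ht S + ht X) + (ht P + ht X + ht V)))"
      unfolding f_def by (intro hasdeg_mult L1 L2 L3 L4)
    show "hasdeg q (((2 * ht U + 2 * ht S) + (2 * ht T + 2 * ht Q)) + (2 * ht P + 2 * ht X))"
      unfolding q_def by (intro hasdeg_mult hasdeg_vf)
    show "\<forall>\<^sub>F R in gen. q R \<noteq> 0" unfolding q_def
      using gen_vf[of U] gen_vf[of S] gen_vf[of T] gen_vf[of Q] gen_vf[of P] gen_vf[of X]
      by eventually_elim simp
  next
    fix w assume w: "van U w"
    have "\<exists>g. van V g \<and> (\<forall>\<^sub>F R in gen. (f R * w R * vf S R) * vf Q R = (q R * (vf S R * vf Q R)) * g R)"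
    proof (rule ideal_neg_split[OF Q oc(4)])
      fix z z' assume z: "van Q z" "van (\<ominus> Q) z'"
      have "\<exists>g. van V g \<and> (\<forall>\<^sub>F R in gen. (f R * w R * z R * z' R) * vf S R = (q R * (vf S R * vf Q R)) * g R)"
      proof (rule ideal_neg_split[OF S oc(4)])
        fix u u' assume u: "van S u" "van (\<ominus> S) u'"
        obtain g1 where g1: "van T g1" "\<forall>\<^sub>F R in gen. L1 R * w R * u' R = vf U R * vf S R * g1 R" using L1(2)[OF w u(2)] by blast
        obtain g2 where g2: "van P g2" "\<forall>\<^sub>F R in gen. L2 R * g1 R * z' R = vf T R * vf Q R * g2 R" using L2(2)[OF g1(1) z(2)] by blast
        obtain g3 where g3: "van X g3" "\<forall>\<^sub>F R in gen. L3 R * z R * u R = vf Q R * vf S R * g3 R" using L3(2)[OF z(1) u(1)] by blast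
        obtain g4 where g4: "van V g4" "\<forall>\<^sub>F R in gen. L4 R * g2 R * g3 R = vf P R * vf X R * g4 R" using L4(2)[OF g2(1) g3(1)] by blast
        have "\<forall>\<^sub>F R in gen. f R * w R * z R * z' R * u R * u' R = q R * (vf S R * vf Q R) * g4 R"
          using g1(2) g2(2) g3(2) g4(2)
        proof eventually_elim
          case (elim R)
          have "f R * w R * z R * z' R * u R * u' R = (L1 R * w R * u' R) * (L2 R * z' R) * (L3 R * z R * u R) * L4 R"
            by (simp add: f_def)
          also have "\<dots> = vf U R * vf S R * (L2 R * g1 R * z' R) * (vf Q R * vf S R * g3 R) * L4 R"
            unfolding elim(1,3) by simp
          also have "\<dots> = vf U R * vf S R * (vf T R * vf Q R) * (vf Q R * vf S R) * (L4 R * g2 R * g3 R)"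
            unfolding elim(2) by simp
          also have "\<dots> = q R * (vf S R * vf Q R) * g4 R"
            unfolding elim(4) by (simp add: q_def)
          finally show ?case .
        qed
        with g4(1) show "\<exists>g. van V g \<and> (\<forall>\<^sub>F R in gen. f R * w R * z R * z' R * u R * u' R = q R * (vf S R * vf Q R) * g R)"
          by (intro exI[of _ g4] conjI)
      qed
      then show "\<exists>g. van V g \<and> (\<forall>\<^sub>F R in gen. f R * w R * vf S R * z R * z' R = q R * (vf S R * vf Q R) * g R)"
        by (simp add: mult_ac)
    qed
    then obtain g where g: "van V g" "\<forall>\<^sub>F R in gen. (f R * w R * vf S R) * vf Q R = (q R * (vf S R * vf Q R)) * g R" by blast
    have "\<forall>\<^sub>F R in gen. f R * w R = q R * g R" using g(2) gen_vf[of S] gen_vf[of Q]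
      by eventually_elim (simp add: mult_ac)
    with g(1) show "\<exists>g. van V g \<and> (\<forall>\<^sub>F R in gen. f R * w R = q R * g R)" by (intro exI[of _ g] conjI)
  qed auto
  then show ?thesis by (simp add: d)
qed

end

declare divf.simps [simp del]

section \<open>Multiples of points\<close>

context ecv
begin

abbreviation mul where "mul n R \<equiv> ec_mul E n R"

lemma add_left_commute: "on_curve E R \<Longrightarrow> on_curve E S \<Longrightarrow> on_curve E T \<Longrightarrow> R \<oplus> (S \<oplus> T) = S \<oplus> (R \<oplus> T)"
  by (metis add_assoc add_commute)

lemmas add_ac = add_assoc add_commute add_left_commute

lemma add_cancel_left: "on_curve E R \<Longrightarrow> on_curve E S \<Longrightarrow> \<ominus> R \<oplus> (R \<oplus> S) = S"
  using add_assoc[of "\<ominus> R" R S] by simp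

lemma add_cancel_left': "on_curve E R \<Longrightarrow> on_curve E S \<Longrightarrow> R \<oplus> (\<ominus> R \<oplus> S) = S"
  using add_assoc[of R "\<ominus> R" S] by simp

lemma add_left_imp_eq: "R \<oplus> S = R \<oplus> T \<Longrightarrow> on_curve E R \<Longrightarrow> on_curve E S \<Longrightarrow> on_curve E T \<Longrightarrow> S = T"
  by (metis add_cancel_left)

lemma add_eq_Inf: "on_curve E R \<Longrightarrow> on_curve E S \<Longrightarrow> R \<oplus> S = Inf \<longleftrightarrow> S = \<ominus> R"
  by (metis add_cancel_left add_neg(1) add_Inf(2))

lemma neg_add: "on_curve E R \<Longrightarrow> on_curve E S \<Longrightarrow> \<ominus> (R \<oplus> S) = \<ominus> R \<oplus> \<ominus> S"
proof -
  assume c: "on_curve E R" "on_curve E S"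
  have "(R \<oplus> S) \<oplus> (\<ominus> R \<oplus> \<ominus> S) = R \<oplus> (S \<oplus> (\<ominus> S \<oplus> \<ominus> R))"
    using c add_assoc[of R S "\<ominus> R \<oplus> \<ominus> S"] add_commute[of "\<ominus> R" "\<ominus> S"] by (simp add: add_closed)
  also have "\<dots> = Inf" using c by (simp add: add_cancel_left')
  finally show ?thesis using c add_eq_Inf add_closed on_curve_neg by metis
qed

lemma mul_closed [simp]: "on_curve E R \<Longrightarrow> on_curve E (mul n R)"
  by (induction n) (auto simp: add_closed)

lemma mul_add: "on_curve E R \<Longrightarrow> mul (m + n) R = mul m R \<oplus> mul n R"
  by (induction m) (auto simp: add_assoc)

lemma mul_mult: "on_curve E R \<Longrightarrow> mul (m * n) R = mul m (mul n R)"
  by (induction m) (auto simp: mul_add)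

lemma mul_Inf [simp]: "mul n Inf = Inf"
  by (induction n) auto

lemma mul_distrib: "on_curve E R \<Longrightarrow> on_curve E S \<Longrightarrow> mul n (R \<oplus> S) = mul n R \<oplus> mul n S"
  by (induction n) (auto simp: add_ac add_closed)

lemma mul_neg: "on_curve E R \<Longrightarrow> mul n (\<ominus> R) = \<ominus> mul n R"
  by (induction n) (auto simp: neg_add)

lemma mul_diff: "on_curve E R \<Longrightarrow> n \<le> m \<Longrightarrow> mul m R \<oplus> \<ominus> mul n R = mul (m - n) R"
  using mul_add[of R "m - n" n] by (simp add: add_cancel)

lemma gen_add:
  assumes "eventually P gen" "on_curve E S"
  shows "\<forall>\<^sub>F R in gen. P (R \<oplus> S)"
proof (rule gen_inj[OF assms(1)])
  show "inj_on (\<lambda>R. R \<oplus> S) (points E)"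
    using assms(2) by (intro inj_onI) (metis add_cancel mem_Collect_eq points_def)
  show "(\<lambda>R. R \<oplus> S) ` points E \<subseteq> points E"
    using assms(2) by (auto simp: points_def add_closed)
qed

lemma gen_on_curve: "\<forall>\<^sub>F R in gen. on_curve E R"
  using gen_points by (simp add: points_def)

lemma Pt_eq: "R \<noteq> Inf \<Longrightarrow> R = Pt (px R) (py R)" by (cases R) auto

lemma px_eq: "on_curve E R \<Longrightarrow> on_curve E S \<Longrightarrow> R \<noteq> Inf \<Longrightarrow> S \<noteq> Inf \<Longrightarrow> px R = px S \<Longrightarrow> S = R \<or> S = \<ominus> R"
  by (cases R; cases S) (use same_x in \<open>auto simp del: on_curve.simps(2)\<close>)

lemma px_neg [simp]: "px (\<ominus> R) = px R" by (cases R) auto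

section \<open>Sums and products of x-coordinates\<close>

text \<open>If X / Z and x are the x-coordinates of A and B, then \<open>Sf\<close> and
  \<open>Pf\<close> divided by (X - x Z)^2 are the sum and the product of the x-coordinates of A + B
  and A - B. The forms are homogeneous in X, Z so that A may later be the point at infinity, with Z
  = 0.\<close>

definition Sf :: "'a \<Rightarrow> 'a \<Rightarrow> 'a \<Rightarrow> 'a" where
  "Sf X Z x = 2 * x * X * (X + x * Z) + wb2 E * x * X * Z + wb4 E * (X + x * Z) * Z + wb6 E * Z^2"
definition Pf :: "'a \<Rightarrow> 'a \<Rightarrow> 'a \<Rightarrow> 'a" where
  "Pf X Z x = x^2 * X^2 - wb4 E * x * X * Z - wb6 E * (X + x * Z) * Z - wb8 E * Z^2"
lemma Sf_1: "Sf X 1 x = 2 * x * X * (X + x) + wb2 E * x * X + wb4 E * (X + x) + wb6 E"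
  by (simp add: Sf_def)
lemma Pf_1: "Pf X 1 x = x^2 * X^2 - wb4 E * x * X - wb6 E * (X + x) - wb8 E"
  by (simp add: Pf_def)
definition Ff :: "'a \<Rightarrow> 'a" where "Ff x = 4 * x^3 + wb2 E * x^2 + 2 * wb4 E * x + wb6 E"
definition Th :: "'a \<Rightarrow> 'a" where "Th x = x^4 - wb4 E * x^2 - 2 * wb6 E * x - wb8 E"

lemma Ff_poly: "poly (divF E) x = Ff x"
  by (simp add: divF_def Ff_def algebra_simps power2_eq_square power3_eq_cube)

lemma Ff_eq: "on_curve E (Pt x y) \<Longrightarrow> Ff x = (2*y + a1*x + a3)^2"
  using F_eq Ff_poly by simp

lemma add_px:
  assumes "on_curve E (Pt x1 y1)" "on_curve E (Pt x2 y2)" "x1 \<noteq> x2"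
  shows "(x1 - x2)^2 * px (Pt x1 y1 \<oplus> Pt x2 y2)
    = x1*x2*(x1+x2) + 2*a2*x1*x2 + a4*(x1+x2) + 2*a6 - 2*y1*y2 - a1*(x2*y1+x1*y2) - a3*(y1+y2)"
proof -
  define l where "l = (y2 - y1) / (x2 - x1)"
  have l: "l * (x2 - x1) = y2 - y1" using assms(3) by (simp add: l_def)
  have "px (Pt x1 y1 \<oplus> Pt x2 y2) = l^2 + a1*l - a2 - x1 - x2"
    using assms(3) by (simp add: l_def Let_def)
  then have "(x1 - x2)^2 * px (Pt x1 y1 \<oplus> Pt x2 y2)
     = (y2 - y1)^2 + a1 * (y2 - y1) * (x2 - x1) - (a2 + x1 + x2) * (x2 - x1)^2"
    unfolding l[symmetric] by algebra
  moreover have "y1^2 = x1^3 + a2*x1^2 + a4*x1 + a6 - a1*x1*y1 - a3*y1"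
    "y2^2 = x2^3 + a2*x2^2 + a4*x2 + a6 - a1*x2*y2 - a3*y2"
    using assms by (simp_all add: algebra_simps)
  ultimately show ?thesis by algebra
qed

lemma add_neq_Inf: "px A \<noteq> px B \<Longrightarrow> A \<oplus> B \<noteq> Inf \<and> A \<oplus> \<ominus> B \<noteq> Inf"
  by (cases A; cases B) (auto simp: Let_def)

lemma kummer:
  assumes A: "on_curve E A" "A \<noteq> Inf" and B: "on_curve E B" "B \<noteq> Inf" and ne: "px A \<noteq> px B"
  shows "(px A - px B)^2 * (px (A \<oplus> B) + px (A \<oplus> \<ominus> B)) = Sf (px A) 1 (px B)"
    and "(px A - px B)^2 * (px (A \<oplus> B) * px (A \<oplus> \<ominus> B)) = Pf (px A) 1 (px B)"
proof -
  obtain x1 y1 x2 y2 where AB: "A = Pt x1 y1" "B = Pt x2 y2" using A B by (cases A; cases B) auto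
  define y2' where "y2' = - y2 - a1 * x2 - a3"
  have c: "on_curve E (Pt x1 y1)" "on_curve E (Pt x2 y2)" "on_curve E (Pt x2 y2')" "x1 \<noteq> x2"
    using A B ne on_curve_neg[of B] unfolding AB y2'_def by (simp_all del: on_curve.simps(2) on_curve_neg)
  have n: "\<ominus> B = Pt x2 y2'" by (simp add: AB y2'_def)
  note e = add_px[OF c(1,2,4)] add_px[OF c(1,3,4)]
  show "(px A - px B)^2 * (px (A \<oplus> B) + px (A \<oplus> \<ominus> B)) = Sf (px A) 1 (px B)"
    unfolding n unfolding AB px.simps distrib_left e unfolding y2'_def Sf_1 wb4_def wb6_def wb2_def by algebra
  have yy: "y1^2 = x1^3 + a2*x1^2 + a4*x1 + a6 - a1*x1*y1 - a3*y1"
    "y2^2 = x2^3 + a2*x2^2 + a4*x2 + a6 - a1*x2*y2 - a3*y2"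
    using c by (simp_all add: algebra_simps)
  have "(x1 - x2)^2 * ((x1 - x2)^2 * (px (A \<oplus> B) * px (A \<oplus> \<ominus> B)))
    = ((x1 - x2)^2 * px (Pt x1 y1 \<oplus> Pt x2 y2)) * ((x1 - x2)^2 * px (Pt x1 y1 \<oplus> Pt x2 y2'))"
    unfolding n unfolding AB by (simp only: mult_ac)
  also have "\<dots> = (x1 - x2)^2 * Pf x1 1 x2"
    unfolding e unfolding y2'_def Pf_1 wb4_def wb6_def wb8_def using yy by algebra
  finally have f: "(x1 - x2)^2 * ((x1 - x2)^2 * (px (A \<oplus> B) * px (A \<oplus> \<ominus> B))) = (x1 - x2)^2 * Pf x1 1 x2" .
  have "(x1 - x2)^2 \<noteq> 0" using c(4) by simp
  then have "(x1 - x2)^2 * (px (A \<oplus> B) * px (A \<oplus> \<ominus> B)) = Pf x1 1 x2" using f mult_left_cancel by blast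
  then show "(px A - px B)^2 * (px (A \<oplus> B) * px (A \<oplus> \<ominus> B)) = Pf (px A) 1 (px B)"
    by (simp only: AB px.simps)
qed

definition Bq :: "'a \<Rightarrow> 'a \<Rightarrow> 'a \<Rightarrow> 'a" where
  "Bq x1 x2 T = (x1 - x2)^2 * T^2 - T * Sf x1 1 x2 + Pf x1 1 x2"

text \<open>For fixed x1, x2 the roots in T are the x-coordinates of A + B and A - B, so vanishing
  expresses that suitably signed points over the three arguments sum to zero. That condition is
  symmetric, and so is the form.\<close>

lemma Bq_sym: "Bq x1 x2 T = Bq T x2 x1" "Bq x1 x2 T = Bq x1 T x2"
  unfolding Bq_def Sf_1 Pf_1 by algebra+

lemma Bq_degenerate: "Bq x1 x x = Th x - x1 * Ff x"
  unfolding Bq_def Sf_1 Pf_1 Th_def Ff_def by algebra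

lemma kummer_Bq:
  assumes "on_curve E A" "A \<noteq> Inf" "on_curve E B" "B \<noteq> Inf" "px A \<noteq> px B"
  shows "(T - px (A \<oplus> B)) * (T - px (A \<oplus> \<ominus> B)) * (px A - px B)^2 = Bq (px A) (px B) T"
  unfolding Bq_def kummer[OF assms, symmetric] by algebra

lemma double_px:
  assumes "on_curve E (Pt x y)" "2*y + a1*x + a3 \<noteq> 0"
  shows "px (Pt x y \<oplus> Pt x y) * Ff x = Th x" "Pt x y \<oplus> Pt x y \<noteq> Inf"
proof -
  define l where "l = (3*x^2 + 2*a2*x + a4 - a1*y) / (2*y + a1*x + a3)"
  have n: "y + y + a1 * x + a3 \<noteq> 0" using assms(2) by (simp add: algebra_simps)
  have l: "l * (2*y + a1*x + a3) = 3*x^2 + 2*a2*x + a4 - a1*y" using assms(2) by (simp add: l_def)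
  have p: "px (Pt x y \<oplus> Pt x y) = l^2 + a1*l - a2 - 2 * x"
    using n by (simp add: l_def Let_def)
  have a6: "a6 = y^2 + a1*x*y + a3*y - (x^3 + a2*x^2 + a4*x)"
    using assms by (simp add: algebra_simps)
  have "px (Pt x y \<oplus> Pt x y) * (2*y + a1*x + a3)^2
    = (3*x^2+2*a2*x+a4-a1*y)^2 + a1*(3*x^2+2*a2*x+a4-a1*y)*(2*y+a1*x+a3) - (a2+2*x)*(2*y+a1*x+a3)^2"
    unfolding p l[symmetric] by algebra
  also have "\<dots> = Th x" unfolding Th_def wb4_def wb6_def wb8_def using a6 by algebra
  finally show "px (Pt x y \<oplus> Pt x y) * Ff x = Th x" using Ff_eq[OF assms(1)] by simp
  show "Pt x y \<oplus> Pt x y \<noteq> Inf" using n by (simp add: Let_def)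
qed

text \<open>At a two-torsion point \<open>Th\<close> becomes the square of the x-derivative, so this
  is again smoothness: numerator and denominator of the doubling formula have no common
  zero.\<close>

lemma Th_nonzero:
  assumes "on_curve E (Pt x y)" "Ff x = 0" shows "Th x \<noteq> 0"
proof -
  have z: "2*y + a1*x + a3 = 0" using Ff_eq assms by simp
  have a6: "a6 = y^2 + a1*x*y + a3*y - (x^3 + a2*x^2 + a4*x)"
    using assms by (simp add: algebra_simps)
  have "Th x = (3*x^2+2*a2*x+a4-a1*y)^2"
    unfolding Th_def wb4_def wb6_def wb8_def using a6 z by algebra
  then show ?thesis using smooth[OF assms(1) z] by simp
qed

end

section \<open>Values of the division polynomials at a point\<close>

context ecv
begin

text \<open>This is psi_n at the point: for even n it restores the factor psi_2 that
  \<open>divf\<close> leaves out.\<close>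

definition om :: "'a \<Rightarrow> 'a \<Rightarrow> nat \<Rightarrow> 'a" where
  "om x y n = poly (divf E n) x * (if even n then 2*y + a1*x + a3 else 1)"

lemma om_simps [simp]: "om x y 0 = 0" "om x y (Suc 0) = 1" "om x y 2 = 2*y + a1*x + a3"
  by (simp_all add: om_def divf.simps)

lemma om_3: "om x y 3 = 3*x^4 + wb2 E*x^3 + 3*wb4 E*x^2 + 3*wb6 E*x + wb8 E"
  by (simp add: om_def divf.simps) algebra

lemma om_4: "om x y 4 = (2*y + a1*x + a3) *
   (2*x^6 + wb2 E*x^5 + 5*wb4 E*x^4 + 10*wb6 E*x^3 + 10*wb8 E*x^2 + (wb2 E*wb8 E - wb4 E*wb6 E)*x + (wb4 E*wb8 E - wb6 E^2))"
  by (simp add: om_def divf.simps) algebra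

lemma om_even:
  assumes "k \<ge> 3"
  shows "om x y (2*k) * (2*y + a1*x + a3)
    = om x y k * (om x y (k+2) * om x y (k-1)^2 - om x y (k-2) * om x y (k+1)^2)"
proof -
  have e: "divf E (2*k) = divf E k * (divf E (k + 2) * divf E (k - 1) ^ 2 - divf E (k - 2) * divf E (k + 1) ^ 2)"
    using assms by (subst divf.simps) simp
  show ?thesis using assms unfolding om_def e
    by (cases "even k") (simp_all add: algebra_simps power2_eq_square)
qed

lemma om_odd:
  assumes "k \<ge> 2" "on_curve E (Pt x y)"
  shows "om x y (2*k+1) = om x y (k+2) * om x y k^3 - om x y (k-1) * om x y (k+1)^3"
proof -
  define p where "p = 2*y + a1*x + a3"
  have p: "poly (divF E) x = p^2" using F_eq assms(2) by (simp add: p_def)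
  show ?thesis
  proof (cases "even k")
    case True
    have e: "divf E (2*k+1) = divF E ^ 2 * divf E (k + 2) * divf E k ^ 3 - divf E (k - 1) * divf E (k + 1) ^ 3"
      using assms True by (subst divf.simps) auto
    show ?thesis using assms True unfolding om_def e p_def[symmetric]
      by (simp add: p power2_eq_square power3_eq_cube algebra_simps)
  next
    case False
    have e: "divf E (2*k+1) = divf E (k + 2) * divf E k ^ 3 - divF E ^ 2 * divf E (k - 1) * divf E (k + 1) ^ 3"
      using assms False by (subst divf.simps) auto
    show ?thesis using assms False unfolding om_def e p_def[symmetric]
      by (simp add: p power2_eq_square power3_eq_cube algebra_simps)
  qed
qed

lemma psi_sq_om: "on_curve E (Pt x y) \<Longrightarrow> poly (psi_sq E n) x = om x y n ^ 2"
  using F_eq by (auto simp: psi_sq_def om_def power_mult_distrib simp del: on_curve.simps(2))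

lemma psi_nb_om: "on_curve E (Pt x y) \<Longrightarrow> n \<ge> 1 \<Longrightarrow> poly (psi_nb E n) x = om x y (n+1) * om x y (n-1)"
  using F_eq by (auto simp: psi_nb_def om_def power2_eq_square simp del: on_curve.simps(2))

lemma theta_om: "on_curve E (Pt x y) \<Longrightarrow> n \<ge> 1 \<Longrightarrow>
    poly (theta E n) x = x * om x y n^2 - om x y (n+1) * om x y (n-1)"
  by (simp add: theta_def psi_sq_om psi_nb_om del: on_curve.simps(2))

end

section \<open>Division polynomials at a point\<close>

text \<open>The sequence determined by \<open>W(n+1) W(n-1) = d(n) W(n)^2\<close>; for \<open>d(n) = x(R) - x(nR)\<close> it is \<open>\<psi>\<^sub>n(R)\<close>.\<close>

fun Wseq :: "'a::field \<Rightarrow> (nat \<Rightarrow> 'a) \<Rightarrow> nat \<Rightarrow> 'a" where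
  "Wseq p d 0 = 0"
| "Wseq p d (Suc 0) = 1"
| "Wseq p d (Suc (Suc n)) = (if n = 0 then p else d (Suc n) * Wseq p d (Suc n) ^ 2 / Wseq p d n)"

text \<open>Up to N no multiple of the point is infinity, so the terms of \<open>W\<close> are
  nonzero and the recursion divides legally. The comparison with the division polynomials reaches
  one index further, to N + 1, which is how vanishing of the first zero multiple is
  detected.\<close>

locale ecpoint = ecv E for E :: "'a::alg_closed_field wcurve" +
  fixes x y :: 'a and N :: nat
  assumes oc: "on_curve E (Pt x y)"
    and nz: "\<And>j. 1 \<le> j \<Longrightarrow> j \<le> N \<Longrightarrow> ec_mul E j (Pt x y) \<noteq> Inf"
    and N1: "N \<ge> 1"
begin

abbreviation "R \<equiv> Pt x y"
definition xs :: "nat \<Rightarrow> 'a" where "xs j = px (mul j R)"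
definition "ps = 2*y + a1*x + a3"
definition W :: "nat \<Rightarrow> 'a" where "W = Wseq ps (\<lambda>j. x - xs j)"

lemma xs_1: "xs 1 = x" by (simp add: xs_def)

lemma W0 [simp]: "W 0 = 0" and W1 [simp]: "W (Suc 0) = 1" and W2: "W 2 = ps"
  by (simp_all add: W_def numeral_2_eq_2)

lemma xs_neq:
  assumes "1 \<le> n" "n < m" "m + n \<le> N" shows "xs m \<noteq> xs n"
proof
  assume "xs m = xs n"
  then have "mul m R = mul n R \<or> mul m R = \<ominus> mul n R"
    using px_eq[of "mul n R" "mul m R"] oc nz[of m] nz[of n] assms by (auto simp: xs_def simp del: on_curve.simps(2))
  then have "mul m R \<oplus> \<ominus> mul n R = Inf \<or> mul m R \<oplus> mul n R = Inf" by auto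
  then have "mul (m - n) R = Inf \<or> mul (m + n) R = Inf"
    using assms mul_diff[OF oc] mul_add[OF oc] by (metis less_imp_le_nat)
  then show False using nz[of "m - n"] nz[of "m + n"] assms by auto
qed

lemma ps_nz: "2 \<le> N \<Longrightarrow> ps \<noteq> 0"
proof
  assume "2 \<le> N" "ps = 0"
  then have "mul 2 R = Inf" by (simp add: numeral_2_eq_2 ps_def Let_def algebra_simps)
  then show False using nz[of 2] \<open>2 \<le> N\<close> by simp
qed

lemma W_nz: "1 \<le> j \<Longrightarrow> j \<le> N \<Longrightarrow> W j \<noteq> 0"
proof (induction j rule: less_induct)
  case (less j)
  have "j = 1 \<or> j = 2 \<or> (\<exists>n. j = Suc (Suc n) \<and> n \<ge> 1)" using less.prems by presburger
  then consider "j = 1" | "j = 2" | n where "j = Suc (Suc n)" "n \<ge> 1" by blast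
  then show ?case
  proof cases
    case 3
    have "xs (Suc n) \<noteq> xs 1" using xs_neq[of 1 "Suc n"] 3 less.prems by simp
    then have "x - xs (Suc n) \<noteq> 0" unfolding xs_1 by auto
    then show ?thesis using 3 less.prems less.IH[of n] less.IH[of "Suc n"] by (simp add: W_def)
  qed (use ps_nz less.prems W2 in auto)
qed

lemma D: "1 \<le> j \<Longrightarrow> j \<le> N \<Longrightarrow> (x - xs j) * W j ^ 2 = W (j + 1) * W (j - 1)"
proof (cases "j = 1")
  case False
  assume "1 \<le> j" "j \<le> N"
  then obtain n where "j = Suc n" "n \<ge> 1" using False by (cases j) auto
  then show ?thesis using W_nz[of n] \<open>j \<le> N\<close> by (simp add: W_def)
qed (simp add: xs_1[unfolded One_nat_def])

lemma kum:
  assumes "1 \<le> n" "n < m" "m + n \<le> N"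
  shows "(T - xs (m + n)) * (T - xs (m - n)) * (xs m - xs n)^2 = Bq (xs m) (xs n) T"
proof -
  have "(T - px (mul m R \<oplus> mul n R)) * (T - px (mul m R \<oplus> \<ominus> mul n R)) * (px (mul m R) - px (mul n R))^2
    = Bq (px (mul m R)) (px (mul n R)) T"
    using xs_neq[OF assms] assms nz[of m] nz[of n] oc by (intro kummer_Bq) (auto simp: xs_def simp del: on_curve.simps(2))
  then show ?thesis using assms by (simp add: mul_add[OF oc] mul_diff[OF oc] xs_def)
qed

lemma xs_2: "2 \<le> N \<Longrightarrow> xs 2 * ps^2 = Th x" 
  using double_px(1)[OF oc] ps_nz Ff_eq[OF oc] by (simp add: xs_def numeral_2_eq_2 ps_def)

text \<open>The addition formula psi_(m+n) psi_(m-n) = (x_n - x_m) psi_m^2 psi_n^2. The induction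
  passes from k - 1 and k to k + 1: the defining recursion at m + k and m - k expresses the product
  of the instances k + 1 and k - 1 by the instance k, and the symmetry of \<open>Bq\<close>
  exchanges (x - x_(m+k)) (x - x_(m-k)) for (x_m - x_(k+1)) (x_m - x_(k-1)).\<close>

lemma J:
  "1 \<le> n \<Longrightarrow> n < m \<Longrightarrow> m + n \<le> N + 1 \<Longrightarrow> W (m + n) * W (m - n) = (xs n - xs m) * W m ^ 2 * W n ^ 2"
proof (induction n rule: less_induct)
  case (less n)
  have "n = 1 \<or> n = 2 \<or> (\<exists>k. n = Suc k \<and> k \<ge> 2)" using less.prems by presburger
  then consider "n = 1" | "n = 2" | k where "n = Suc k" "k \<ge> 2" by blast
  then show ?case
  proof cases
    case 1
    then show ?thesis using D[of m] less.prems by (simp add: xs_1[unfolded One_nat_def])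
  next
    case 2
    have k: "(x - xs (m + 1)) * (x - xs (m - 1)) * (xs m - x)^2 = ps^2 * (xs 2 - xs m)"
      using kum[of 1 m x] 2 less.prems xs_2 Ff_eq[OF oc]
      unfolding xs_1 Bq_degenerate ps_def[symmetric] by (simp add: algebra_simps)
    have d: "(x - xs (m + 1)) * W (m + 1)^2 = W (m + 2) * W m" "(x - xs (m - 1)) * W (m - 1)^2 = W m * W (m - 2)"
      "(x - xs m) * W m ^ 2 = W (m + 1) * W (m - 1)"
      using D[of "m+1"] D[of "m-1"] D[of m] less.prems 2 by (simp_all add: numeral_2_eq_2)
    have z: "W (m+1) \<noteq> 0" "W (m-1) \<noteq> 0" "W m \<noteq> 0" using W_nz less.prems 2 by auto
    have "(W (m+1)^2 * W (m-1)^2 * W m ^2) * (W (m + 2) * W (m - 2))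
       = (x - xs (m + 1)) * W (m + 1)^2 * ((x - xs (m - 1)) * W (m - 1)^2) * ((x - xs m) * W m ^ 2)^2"
      unfolding d by algebra
    also have "\<dots> = (W (m+1)^2 * W (m-1)^2 * W m ^2) * (W m ^ 2 * ((x - xs (m + 1)) * (x - xs (m - 1)) * (xs m - x)^2))"
      by algebra
    finally have "W (m + 2) * W (m - 2) = W m ^ 2 * ((x - xs (m + 1)) * (x - xs (m - 1)) * (xs m - x)^2)"
      using z by simp
    then show ?thesis unfolding k 2 W2 by (simp add: algebra_simps)
  next
    case (3 k)
    have ih: "W (m + k) * W (m - k) = (xs k - xs m) * W m ^ 2 * W k ^ 2"
      "W (m + (k-1)) * W (m - (k-1)) = (xs (k-1) - xs m) * W m ^ 2 * W (k-1) ^ 2"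
      using less.IH[of k] less.IH[of "k-1"] 3 less.prems by auto
    have i: "m + (k - 1) = m + k - 1" "m - (k - 1) = m - k + 1" "m + n = m + k + 1" "m - n = m - k - 1"
      using 3 less.prems by auto
    have d: "(x - xs (m + k)) * W (m + k)^2 = W (m + k + 1) * W (m + k - 1)"
      "(x - xs (m - k)) * W (m - k)^2 = W (m - k + 1) * W (m - k - 1)"
      "(x - xs k) * W k ^ 2 = W (k + 1) * W (k - 1)"
      using D[of "m+k"] D[of "m-k"] D[of k] less.prems 3 by auto
    have z: "W (m+k) \<noteq> 0" "W (m-k) \<noteq> 0" "W (m+k-1) \<noteq> 0" "W (m - k + 1) \<noteq> 0"
      using W_nz less.prems 3 by auto
    have sym: "(x - xs (m + k)) * (x - xs (m - k)) * (xs m - xs k)^2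
      = (xs m - xs (k+1)) * (xs m - xs (k - 1)) * (xs k - x)^2"
    proof -
      have "(x - xs (m + k)) * (x - xs (m - k)) * (xs m - xs k)^2 = Bq (xs m) (xs k) x"
        using kum[of k m x] 3 less.prems by simp
      also have "\<dots> = Bq (xs k) x (xs m)" using Bq_sym(2)[of "xs m" "xs k" x] Bq_sym(1)[of "xs m" x "xs k"] by (rule trans)
      also have "\<dots> = (xs m - xs (k+1)) * (xs m - xs (k - 1)) * (xs k - x)^2"
        using kum[of 1 k "xs m"] 3 less.prems unfolding xs_1 by simp
      finally show ?thesis .
    qed
    have e1: "xs k - xs m \<noteq> 0" using ih(1) z by auto
    have e2: "(xs (k-1) - xs m) * W m ^ 2 * W (k-1) ^ 2 \<noteq> 0" using ih(2) z unfolding i by auto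
    have "(W (m + k + 1) * W (m - k - 1) * (W (m + k - 1) * W (m - k + 1))) * (xs m - xs k)^2
      = ((x - xs (m + k)) * W (m + k)^2) * ((x - xs (m - k)) * W (m - k)^2) * (xs m - xs k)^2"
      unfolding d by algebra
    also have "\<dots> = ((x - xs (m + k)) * (x - xs (m - k)) * (xs m - xs k)^2) * (W (m + k) * W (m - k))^2"
      by algebra
    also have "\<dots> = (xs m - xs (k+1)) * (xs m - xs (k - 1)) * (xs m - xs k)^2 * (W m ^ 2)^2 * ((x - xs k) * W k ^ 2)^2"
      unfolding sym ih by algebra
    also have "\<dots> = ((xs m - xs (k+1)) * (xs m - xs (k - 1)) * (W m ^ 2)^2 * (W (k + 1) * W (k - 1))^2) * (xs m - xs k)^2"
      unfolding d by algebra
    finally have "W (m + k + 1) * W (m - k - 1) * (W (m + k - 1) * W (m - k + 1))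
      = (xs m - xs (k+1)) * (xs m - xs (k - 1)) * (W m ^ 2)^2 * (W (k + 1) * W (k - 1))^2"
      using e1 by simp
    then have "((xs (k-1) - xs m) * W m ^ 2 * W (k-1) ^ 2) * (W (m + k + 1) * W (m - k - 1))
      = ((xs (k-1) - xs m) * W m ^ 2 * W (k-1) ^ 2) * ((xs (k+1) - xs m) * W m ^ 2 * W (k+1) ^ 2)"
      unfolding ih(2)[unfolded i] by algebra
    then have "W (m + k + 1) * W (m - k - 1) = (xs (k+1) - xs m) * W m ^ 2 * W (k+1) ^ 2"
      using e2 mult_left_cancel by blast
    then show ?thesis unfolding i using 3 by simp
  qed
qed

lemma kum_sum:
  "2 + 1 \<le> N \<Longrightarrow> (xs 2 - x)^2 * (xs 3 + x) = Sf (xs 2) 1 x"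
proof -
  assume N: "2 + 1 \<le> N"
  have "xs 2 \<noteq> xs 1" using xs_neq[of 1 2] N by simp
  then have "(px (mul 2 R) - px R)^2 * (px (mul 2 R \<oplus> R) + px (mul 2 R \<oplus> \<ominus> R)) = Sf (px (mul 2 R)) 1 (px R)"
    using nz[of 2] oc N by (intro kummer) (auto simp: xs_def simp del: on_curve.simps(2))
  moreover have "mul 2 R \<oplus> R = mul 3 R" "mul 2 R \<oplus> \<ominus> R = R"
    using mul_add[OF oc, of 2 1] mul_diff[OF oc, of 1 2] by (simp_all add: numeral_3_eq_3)
  ultimately show ?thesis by (simp add: xs_def)
qed

lemma W_3: "2 \<le> N \<Longrightarrow> W 3 = (x - xs 2) * ps^2"
  by (simp add: W_def numeral_3_eq_3 numeral_2_eq_2)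

text \<open>The even and odd recursions are \<open>J\<close> for the pairs (k + 1, k - 1) and (k +
  1, k), with each difference of x-coordinates split as (x - x_j) - (x - x_i) and the defining
  relation of \<open>W\<close> applied. The initial values 3 and 4 come from the doubling formula
  and from \<open>Sf\<close> for 2 R and R.\<close>

lemma om_eq_W: "j \<le> N + 1 \<Longrightarrow> om x y j = W j"
proof (induction j rule: less_induct)
  case (less j)
  note c = xs_2 Ff_eq[OF oc, folded ps_def]
  have "j = 0 \<or> j = 1 \<or> j = 2 \<or> j = 3 \<or> j = 4 \<or> (\<exists>k. j = 2 * k \<and> k \<ge> 3) \<or> (\<exists>k. j = 2 * k + 1 \<and> k \<ge> 2)"
    by presburger
  then consider "j = 0" | "j = 1" | "j = 2" | "j = 3" | "j = 4" | k where "j = 2 * k" "k \<ge> 3" | k where "j = 2 * k + 1" "k \<ge> 2"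
    by blast
  then show ?case
  proof cases
    case 4
    then have "xs 2 * Ff x = Th x" using c less.prems by simp
    then show ?thesis using W_3 4 less.prems unfolding c(2)[symmetric] 4 om_3
      by (simp add: Ff_def Th_def) algebra
  next
    case 5
    define f4 where "f4 = 2*x^6 + wb2 E*x^5 + 5*wb4 E*x^4 + 10*wb6 E*x^3 + 10*wb8 E*x^2 + (wb2 E*wb8 E - wb4 E*wb6 E)*x + (wb4 E*wb8 E - wb6 E^2)"
    have F: "xs 2 * Ff x = Th x" "Ff x = ps^2" using c less.prems 5 by simp_all
    have id: "2*x*(x * Ff x - Th x)^2 - Sf (Th x) (Ff x) x = Ff x * f4"
      unfolding Sf_def Th_def Ff_def f4_def wb2_def wb4_def wb6_def wb8_def by algebra
    have s: "Sf (Th x) (Ff x) x = Sf (xs 2) 1 x * Ff x ^ 2" unfolding F(1)[symmetric] Sf_1 unfolding Sf_def by algebra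
    have p: "ps \<noteq> 0" using ps_nz less.prems 5 by simp
    have N3: "2 + 1 \<le> N" using less.prems 5 by simp
    have w3: "W 3 = (x - xs 2) * ps^2" using W_3 N3 by simp
    have "W 4 * ps = (x - xs 3) * W 3 ^ 2"
      using D[of 3] less.prems 5 W2 by simp
    also have "\<dots> = (2 * x * (x - xs 2)^2 - (xs 2 - x)^2 * (xs 3 + x)) * Ff x ^ 2"
      unfolding w3 F(2) by algebra
    also have "\<dots> = 2*x*(x * Ff x - Th x)^2 - Sf (Th x) (Ff x) x"
      unfolding s unfolding F(1)[symmetric] kum_sum[OF N3, symmetric] by algebra
    also have "\<dots> = ps * f4 * ps" unfolding id unfolding F(2) by algebra
    finally show ?thesis using p unfolding 5 om_4 f4_def ps_def by simp
  next
    case 6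
    have ih: "om x y k = W k" "om x y (k+2) = W (k+2)" "om x y (k-1) = W (k-1)" "om x y (k-2) = W (k-2)" "om x y (k+1) = W (k+1)"
      using less 6 by auto
    have p: "ps \<noteq> 0" using ps_nz less.prems 6 by simp
    have d: "(x - xs (k - 1)) * W (k - 1)^2 = W k * W (k - 2)" "(x - xs (k+1)) * W (k+1)^2 = W (k+2) * W k"
      using D[of "k-1"] D[of "k+1"] 6 less.prems by (simp_all add: numeral_2_eq_2)
    have e: "k + 1 + (k - 1) = 2 * k" "k + 1 - (k - 1) = 2" using 6 by auto
    have a: "1 \<le> k - 1" "k - 1 < k + 1" "k + 1 + (k - 1) \<le> N + 1" using 6 less.prems by auto
    have "W (2*k) * ps = (xs (k-1) - xs (k+1)) * W (k+1)^2 * W (k-1)^2"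
      using J[OF a] unfolding e W2 .
    also have "\<dots> = ((x - xs (k+1)) * W (k+1)^2) * W (k-1)^2 - ((x - xs (k - 1)) * W (k - 1)^2) * W (k+1)^2" by algebra
    also have "\<dots> = om x y (2*k) * ps" unfolding d ps_def om_even[OF 6(2)] ih by algebra
    finally show ?thesis using p 6 by simp
  next
    case 7
    have ih: "om x y k = W k" "om x y (k+2) = W (k+2)" "om x y (k-1) = W (k-1)" "om x y (k+1) = W (k+1)"
      using less 7 by auto
    have d: "(x - xs k) * W k^2 = W (k+1) * W (k - 1)" "(x - xs (k+1)) * W (k+1)^2 = W (k+2) * W k"
      using D[of k] D[of "k+1"] 7 less.prems by simp_all
    have i: "k + 1 + k = 2 * k + 1" "k + 1 - k = 1" by auto
    have "W (2*k+1) = (xs k - xs (k+1)) * W (k+1)^2 * W k^2"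
      using J[of k "k+1"] 7 less.prems unfolding i by simp
    also have "\<dots> = ((x - xs (k+1)) * W (k+1)^2) * W k^2 - ((x - xs k) * W k^2) * W (k+1)^2" by algebra
    also have "\<dots> = om x y (2*k+1)" unfolding d om_odd[OF 7(2) oc] ih by algebra
    finally show ?thesis using 7 by simp
  qed (simp_all add: W2 ps_def)
qed

lemma om_formula:
  assumes "1 \<le> j" "j \<le> N"
  shows "poly (psi_sq E j) x \<noteq> 0" "px (mul j R) * poly (psi_sq E j) x = poly (theta E j) x"
proof -
  have e: "om x y j = W j" "om x y (j+1) = W (j+1)" "om x y (j-1) = W (j-1)" using assms by (auto simp: om_eq_W)
  show "poly (psi_sq E j) x \<noteq> 0" using W_nz[OF assms] by (simp add: psi_sq_om[OF oc] e)
  show "px (mul j R) * poly (psi_sq E j) x = poly (theta E j) x"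
    using D[OF assms] unfolding psi_sq_om[OF oc] theta_om[OF oc assms(1)] e xs_def by algebra
qed

text \<open>If (N + 1) R is infinity, then N R = -R has the x-coordinate x, so the factor x - x_N of
  the recursion vanishes.\<close>

lemma om_Inf:
  assumes "mul (N + 1) R = Inf" shows "om x y (N + 1) = 0"
proof (cases "N = 1")
  case True
  then have "R \<oplus> R = Inf" using assms by simp
  then have "ps = 0" by (simp add: ps_def Let_def algebra_simps split: if_splits)
  then show ?thesis using True om_simps(3) by (simp add: ps_def numeral_2_eq_2)
next
  case False
  have "mul N R = \<ominus> R" using assms add_eq_Inf[of R "mul N R"] oc by (simp del: on_curve.simps(2))
  then have "xs N = x" by (simp add: xs_def)
  then have "W (N + 1) * W (N - 1) = 0" using D[of N] N1 by simp
  moreover have "W (N - 1) \<noteq> 0" using W_nz[of "N-1"] False N1 by simp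
  ultimately show ?thesis by (simp add: om_eq_W)
qed

end

section \<open>Degrees of division polynomials\<close>

text \<open>The coefficient c is allowed to be zero. Leading coefficients such as
  \<open>of_nat n\<close> vanish in some characteristics, and only this weak form is stable under
  products and differences there.\<close>

definition lc :: "'a::field poly \<Rightarrow> nat \<Rightarrow> 'a \<Rightarrow> bool" where
  "lc p d c \<longleftrightarrow> degree p \<le> d \<and> coeff p d = c"

lemma lc_mult: assumes "lc p d c" "lc q e c'" shows "lc (p * q) (d + e) (c * c')"
proof -
  have d: "degree (p * q) \<le> d + e" using assms degree_mult_le[of p q] by (auto simp: lc_def)
  have "coeff (p * q) (d + e) = coeff p d * coeff q e"
  proof (cases "degree p = d \<and> degree q = e")
    case True then show ?thesis using coeff_mult_degree_sum by blast
  next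
    case False
    then have "degree p < d \<or> degree q < e" using assms by (auto simp: lc_def)
    then have "coeff p d * coeff q e = 0" by (auto simp: coeff_eq_0)
    moreover have "degree (p * q) < d + e"
      using False assms degree_mult_le[of p q] by (auto simp: lc_def)
    ultimately show ?thesis by (simp add: coeff_eq_0)
  qed
  then show ?thesis using d assms by (simp add: lc_def)
qed

lemma lc_power: "lc p d c \<Longrightarrow> lc (p ^ n) (n * d) (c ^ n)"
proof (induction n)
  case (Suc n)
  then show ?case using lc_mult[of p d c "p^n" "n*d" "c^n"] by simp
qed (simp add: lc_def)

lemma lc_diff: "lc p d c \<Longrightarrow> lc q d c' \<Longrightarrow> lc (p - q) d (c - c')"
  by (auto simp: lc_def intro: degree_diff_le)

lemma lc_cong: "lc p d c \<Longrightarrow> d = d' \<Longrightarrow> c = c' \<Longrightarrow> lc p d' c'" by simp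

lemma lc_eq: "lc q d c \<Longrightarrow> p = q \<Longrightarrow> d = d' \<Longrightarrow> c = c' \<Longrightarrow> lc p d' c'" by simp

lemma lc_divf_eq: "lc (divf E k) d c \<Longrightarrow> n = k \<Longrightarrow> d = d' \<Longrightarrow> c = c' \<Longrightarrow> lc (divf E n) d' c'" by simp

lemma lc_divF: "lc (divF E) 3 4" by (simp add: lc_def divF_def numeral_3_eq_3)

text \<open>The parametrisation by i avoids division: for n = 2 i + 2 the degree is (n^2 - 4) / 2
  and the coefficient n / 2, for n = 2 i + 1 they are (n^2 - 1) / 2 and n.\<close>

lemma divf_lc:
  fixes E :: "'a::field wcurve"
  shows "lc (divf E (2*i+2)) (2*i*(i+2)) (of_nat (i+1))" "lc (divf E (2*i+1)) (2*i*(i+1)) (of_nat (2*i+1))"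
proof -
  have "(\<forall>i. n = 2*i+2 \<longrightarrow> lc (divf E n) (2*i*(i+2)) (of_nat (i+1))) \<and>
     (\<forall>i. n = 2*i+1 \<longrightarrow> lc (divf E n) (2*i*(i+1)) (of_nat (2*i+1)))" for n
  proof (induction n rule: less_induct)
    case (less n)
    have ev: "lc (divf E (2*i+2)) (2*i*(i+2)) (of_nat (i+1))" if "2*i+2 < n" for i using less that by blast
    have od: "lc (divf E (2*i+1)) (2*i*(i+1)) (of_nat (2*i+1))" if "2*i+1 < n" for i using less that by blast
    show ?case
    proof (intro conjI allI impI)
      fix i assume n: "n = 2*i+2"
      consider "i = 0" | "i = 1" | j where "i = 2*j+3" | j where "i = 2*j+2"
      proof -
        have "i = 0 \<or> i = 1 \<or> (\<exists>j. i = 2*j+3) \<or> (\<exists>j. i = 2*j+2)" by presburger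
        then show ?thesis using that by blast
      qed
      then show "lc (divf E n) (2*i*(i+2)) (of_nat (i+1))"
      proof cases
        case 1 then show ?thesis by (simp add: n lc_def divf.simps)
      next
        case 2
        have "divf E 4 = [: wb4 E * wb8 E - wb6 E ^ 2, wb2 E * wb8 E - wb4 E * wb6 E,
                           10 * wb8 E, 10 * wb6 E, 5 * wb4 E, wb2 E, 2 :]" by (simp add: divf.simps)
        then show ?thesis using 2 by (simp add: n lc_def eval_nat_numeral)
      next
        case 3
        have r: "divf E (2*(2*(j+1)+2)) = divf E (2*(j+1)+2) * (divf E (2*(j+2)+2) * divf E (2*(j+1)+1) ^ 2
            - divf E (2*j+2) * divf E (2*(j+2)+1) ^ 2)"
          by (subst divf.simps) (simp add: algebra_simps)
        have "lc (divf E (2*(2*(j+1)+2))) (2*(j+1)*(j+1+2) + (2*(j+2)*(j+2+2) + 2*(2*(j+1)*(j+1+1))))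
          (of_nat (j+1+1) * (of_nat (j+2+1) * of_nat (2*(j+1)+1)^2 - of_nat (j+1) * of_nat (2*(j+2)+1)^2))"
          unfolding r
          by (intro lc_mult lc_diff lc_power ev od lc_cong[OF lc_mult[OF ev[of j] lc_power[OF od[of "j+2"], of 2]]])
             (auto simp: n 3 algebra_simps)
        then show ?thesis by (rule lc_divf_eq)
             (auto simp: n 3 algebra_simps power2_eq_square)
      next
        case 4
        have r: "divf E (2*(2*(j+1)+1)) = divf E (2*(j+1)+1) * (divf E (2*(j+2)+1) * divf E (2*j+2) ^ 2
            - divf E (2*j+1) * divf E (2*(j+1)+2) ^ 2)"
          by (subst divf.simps) (simp add: algebra_simps)
        have "lc (divf E (2*(2*(j+1)+1))) (2*(j+1)*(j+1+1) + (2*(j+2)*(j+2+1) + 2*(2*j*(j+2))))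
          (of_nat (2*(j+1)+1) * (of_nat (2*(j+2)+1) * of_nat (j+1)^2 - of_nat (2*j+1) * of_nat (j+1+1)^2))"
          unfolding r
          by (intro lc_mult lc_diff lc_power ev od lc_cong[OF lc_mult[OF od[of j] lc_power[OF ev[of "j+1"], of 2]]])
             (auto simp: n 4 algebra_simps)
        then show ?thesis by (rule lc_divf_eq)
             (auto simp: n 4 algebra_simps power2_eq_square)
      qed
    next
      fix i assume n: "n = 2*i+1"
      consider "i = 0" | "i = 1" | j where "i = 2*j+2" | j where "i = 2*j+3"
      proof -
        have "i = 0 \<or> i = 1 \<or> (\<exists>j. i = 2*j+3) \<or> (\<exists>j. i = 2*j+2)" by presburger
        then show ?thesis using that by blast
      qed
      then show "lc (divf E n) (2*i*(i+1)) (of_nat (2*i+1))"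
      proof cases
        case 1 then show ?thesis by (simp add: n lc_def divf.simps)
      next
        case 2 
        have "divf E 3 = [: wb8 E, 3 * wb6 E, 3 * wb4 E, wb2 E, 3 :]" by (simp add: divf.simps)
        then show ?thesis using 2 by (simp add: n lc_def eval_nat_numeral)
      next
        case 3
        have r: "divf E (2*(2*j+2)+1) = divF E ^ 2 * divf E (2*(j+1)+2) * divf E (2*j+2) ^ 3
            - divf E (2*j+1) * divf E (2*(j+1)+1) ^ 3"
          by (subst divf.simps) (simp add: algebra_simps)
        have "lc (divf E (2*(2*j+2)+1)) (2*3 + 2*(j+1)*(j+1+2) + 3*(2*j*(j+2)))
          (4^2 * of_nat (j+1+1) * of_nat (j+1)^3 - of_nat (2*j+1) * of_nat (2*(j+1)+1)^3)"
          unfolding r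
          by (intro lc_mult lc_diff lc_power ev od lc_divF lc_cong[OF lc_mult[OF od[of j] lc_power[OF od[of "j+1"], of 3]]])
             (auto simp: n 3 algebra_simps)
        then show ?thesis by (rule lc_divf_eq)
             (auto simp: n 3 algebra_simps power2_eq_square power3_eq_cube)
      next
        case 4
        have r: "divf E (2*(2*(j+1)+1)+1) = divf E (2*(j+2)+1) * divf E (2*(j+1)+1) ^ 3
            - divF E ^ 2 * divf E (2*j+2) * divf E (2*(j+1)+2) ^ 3"
          by (subst divf.simps) (simp add: algebra_simps)
        have "lc (divf E (2*(2*(j+1)+1)+1)) (2*(j+2)*(j+2+1) + 3*(2*(j+1)*(j+1+1)))
          (of_nat (2*(j+2)+1) * of_nat (2*(j+1)+1)^3 - 4^2 * of_nat (j+1) * of_nat (j+1+1)^3)"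
          unfolding r
          by (intro lc_mult lc_diff lc_power ev od lc_cong[OF lc_mult[OF lc_mult[OF lc_power[OF lc_divF[of E], of 2] ev[of j]] lc_power[OF ev[of "j+1"], of 3]]])
             (auto simp: n 4 algebra_simps)
        then show ?thesis by (rule lc_divf_eq)
             (auto simp: n 4 algebra_simps power2_eq_square power3_eq_cube)
      qed
    qed
  qed
  from this[of "2*i+2"] this[of "2*i+1"]
  show "lc (divf E (2*i+2)) (2*i*(i+2)) (of_nat (i+1))" "lc (divf E (2*i+1)) (2*i*(i+1)) (of_nat (2*i+1))"
    by (simp_all only: simp_thms)
qed

lemma psi_sq_lc: "n \<ge> 1 \<Longrightarrow> lc (psi_sq E n) (n^2 - 1) (of_nat n ^ 2)"
proof -
  assume "n \<ge> 1"
  then consider i where "n = 2*i+1" | i where "n = 2*i+2"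
  proof -
    have "(\<exists>i. n = 2*i+1) \<or> (\<exists>i. n = 2*i+2)" using \<open>n \<ge> 1\<close> by presburger
    then show ?thesis using that by blast
  qed
  then show ?thesis
  proof cases
    case 1
    have "lc (divf E (2*i+1) ^ 2) (2 * (2*i*(i+1))) (of_nat (2*i+1)^2)" by (intro lc_power divf_lc)
    then show ?thesis by (rule lc_eq)
        (auto simp: 1 psi_sq_def algebra_simps power2_eq_square)
  next
    case 2
    have "lc (divF E * divf E (2*i+2) ^ 2) (3 + 2 * (2*i*(i+2))) (4 * of_nat (i+1)^2)" by (intro lc_power divf_lc lc_mult lc_divF)
    then show ?thesis by (rule lc_eq)
        (auto simp: 2 psi_sq_def algebra_simps power2_eq_square)
  qed
qed

lemma psi_nb_lc: "n \<ge> 1 \<Longrightarrow> lc (psi_nb E n) (n^2) (of_nat n ^ 2 - 1)"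
proof -
  assume "n \<ge> 1"
  then consider "n = 1" | i where "n = 2*i+3" | i where "n = 2*i+2"
  proof -
    have "n = 1 \<or> (\<exists>i. n = 2*i+3) \<or> (\<exists>i. n = 2*i+2)" using \<open>n \<ge> 1\<close> by presburger
    then show ?thesis using that by blast
  qed
  then show ?thesis
  proof cases
    case 1
    then show ?thesis by (simp add: lc_def psi_nb_def divf.simps[of E 0])
  next
    case 2
    have "lc (divF E * divf E (2*(i+1)+2) * divf E (2*i+2)) (3 + 2*(i+1)*(i+1+2) + 2*i*(i+2)) (4 * of_nat (i+1+1) * of_nat (i+1))"
      by (intro divf_lc lc_mult lc_divF)
    moreover have "psi_nb E n = divF E * divf E (2*(i+1)+2) * divf E (2*i+2)"
    proof -
      have "n + 1 = 2*(i+1)+2" "n - 1 = 2*i+2" "odd n" using 2 by auto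
      then show ?thesis unfolding psi_nb_def by (simp only: if_True if_False simp_thms)
    qed
    ultimately show ?thesis by (rule lc_eq)
        (auto simp: 2 algebra_simps power2_eq_square)
  next
    case 3
    have "lc (divf E (2*(i+1)+1) * divf E (2*i+1)) (2*(i+1)*(i+1+1) + 2*i*(i+1)) (of_nat (2*(i+1)+1) * of_nat (2*i+1))"
      by (intro divf_lc lc_mult)
    moreover have "psi_nb E n = divf E (2*(i+1)+1) * divf E (2*i+1)"
    proof -
      have "n + 1 = 2*(i+1)+1" "n - 1 = 2*i+1" "\<not> odd n" using 3 by auto
      then show ?thesis unfolding psi_nb_def by (simp only: if_True if_False simp_thms)
    qed
    ultimately show ?thesis by (rule lc_eq)
        (auto simp: 3 algebra_simps power2_eq_square)
  qed
qed

text \<open>The coefficients n^2 and n^2 - 1 of x psi_n^2 and psi_(n+1) psi_(n-1) differ by one,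
  which makes \<open>theta\<close> monic in every characteristic.\<close>

lemma theta_lc:
  assumes "n \<ge> 1" shows "lc (theta E n) (n^2) 1"
proof -
  have x: "lc [:0, 1::'a:] 1 1" by (simp add: lc_def)
  have "n^2 = 1 + (n^2 - 1)" using assms by simp
  then have "lc ([:0, 1:] * psi_sq E n) (n^2) (of_nat n ^ 2)"
    using lc_mult[OF x psi_sq_lc[OF assms], of E] by simp
  from lc_diff[OF this psi_nb_lc[OF assms]] show ?thesis by (simp add: theta_def)
qed

lemma theta_degree: "n \<ge> 1 \<Longrightarrow> degree (theta E n - smult c (psi_sq E n)) = n^2 \<and> lead_coeff (theta E n - smult c (psi_sq E n)) = 1"
proof -
  assume n: "n \<ge> 1"
  have "degree (psi_sq E n) \<le> n^2 - 1" using psi_sq_lc[OF n, of E] by (simp add: lc_def)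
  then have d: "degree (smult c (psi_sq E n)) \<le> n^2 - 1" using degree_smult_le le_trans by blast
  then have "degree (smult c (psi_sq E n)) < n^2" using n by (simp add: le_less_trans)
  then have "lc (smult c (psi_sq E n)) (n^2) 0" unfolding lc_def using coeff_eq_0 less_imp_le by blast
  from lc_diff[OF theta_lc[OF n] this] have l: "lc (theta E n - smult c (psi_sq E n)) (n^2) 1" by simp
  then have "degree (theta E n - smult c (psi_sq E n)) = n^2"
    using le_degree[of "theta E n - smult c (psi_sq E n)" "n^2"] by (simp add: lc_def)
  then show ?thesis using l by (simp add: lc_def)
qed

section \<open>Roots of division polynomials\<close>

lemma card_simple_roots:
  fixes p :: "'a::alg_closed_field poly"
  assumes "p \<noteq> 0" "\<And>x. poly p x = 0 \<Longrightarrow> poly (pderiv p) x \<noteq> 0"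
  shows "card {x. poly p x = 0} = degree p"
  using assms
proof (induction "degree p" arbitrary: p)
  case 0
  then obtain c where "p = [:c:]" by (metis degree_eq_zeroE)
  then show ?case using 0 by auto
next
  case (Suc n)
  then obtain x where x: "poly p x = 0" using alg_closed_imp_poly_has_root[of p] by auto
  then obtain q where q: "p = [:-x,1:] * q" unfolding poly_eq_0_iff_dvd by (elim dvdE)
  have q0: "q \<noteq> 0" using q Suc by auto
  have d: "degree p = Suc (degree q)" unfolding q using q0 degree_mult_eq[of "[:-x,1:]" q] by simp
  have pd: "poly (pderiv p) z = poly q z + (z - x) * poly (pderiv q) z" for z
    by (simp only: q pderiv_mult) (simp add: pderiv_pCons algebra_simps)
  have qx: "poly q x \<noteq> 0" using Suc.prems(2)[OF x] pd by simp
  have "card {x. poly q x = 0} = degree q"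
  proof (rule Suc.hyps(1))
    fix z assume z: "poly q z = 0"
    then have "poly p z = 0" by (simp add: q)
    then show "poly (pderiv q) z \<noteq> 0" using Suc.prems(2)[of z] pd z by auto
  qed (use d Suc q0 in auto)
  moreover have "{z. poly p z = 0} = insert x {z. poly q z = 0}" by (auto simp: q)
  moreover have "finite {z. poly q z = 0}" using q0 poly_roots_finite by blast
  ultimately show ?case using qx d by simp
qed

context ecv
begin

lemma point_formula:
  assumes "on_curve E (Pt x y)" "\<And>j. 1 \<le> j \<Longrightarrow> j \<le> n \<Longrightarrow> mul j (Pt x y) \<noteq> Inf" "1 \<le> n"
  shows "poly (psi_sq E n) x \<noteq> 0" "px (mul n (Pt x y)) * poly (psi_sq E n) x = poly (theta E n) x"
    and "mul (n + 1) (Pt x y) = Inf \<Longrightarrow> om x y (n + 1) = 0"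
proof -
  interpret ecpoint E x y n by unfold_locales (fact assms)+
  show "poly (psi_sq E n) x \<noteq> 0" "px (mul n (Pt x y)) * poly (psi_sq E n) x = poly (theta E n) x"
    using om_formula[of n] assms(3) by auto
  show "mul (n + 1) (Pt x y) = Inf \<Longrightarrow> om x y (n + 1) = 0" by (rule om_Inf)
qed

lemma two_torsion_poly: "on_curve E (Pt x y) \<Longrightarrow> Ff x = 0 \<Longrightarrow> Pt x y \<oplus> Pt x y = Inf"
proof -
  assume a: "on_curve E (Pt x y)" "Ff x = 0"
  then have "y + y + a1 * x + a3 = 0" using Ff_eq[OF a(1)] by (simp add: algebra_simps)
  then show ?thesis by simp
qed

text \<open>A point killed by n but by no smaller multiple is a root of psi_n, so only
  \<open>divf E n = 0\<close> could do harm. Then n would kill every point. If n = 2 b, doubling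
  would map almost all points into the finite b-torsion, and some theta_2 - c psi_2^2 of degree 4
  would be zero. If n is odd, the leading coefficient n vanishes in the field, so the characteristic
  is not 2; then there is a point of order two, and n does not kill it.\<close>

lemma order_gen: "n \<ge> 1 \<Longrightarrow> \<forall>\<^sub>F R in gen. \<forall>j. 1 \<le> j \<longrightarrow> j \<le> n \<longrightarrow> mul j R \<noteq> Inf"
proof (induction n rule: less_induct)
  case (less n)
  show ?case
  proof (cases "n = 1")
    case True
    show ?thesis using gen_neq[of Inf]
    proof eventually_elim
      case (elim R)
      show ?case
      proof (intro allI impI)
        fix j assume "1 \<le> j" "j \<le> n"
        then have "j = 1" using True by simp
        then show "mul j R \<noteq> Inf" using elim by simp
      qed
    qed
  next
    case False
    then have n: "n \<ge> 2" using less.prems by simp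
    have G: "\<forall>\<^sub>F R in gen. \<forall>j. 1 \<le> j \<longrightarrow> j \<le> n - 1 \<longrightarrow> mul j R \<noteq> Inf"
      using less.IH[of "n - 1"] n by simp
    have key: "\<forall>\<^sub>F R in gen. mul n R \<noteq> Inf"
    proof (cases "divf E n = 0")
      case False
      show ?thesis using G gen_poly[OF False] gen_psi2 gen_Pt
      proof eventually_elim
        case (elim R)
        obtain x y where R: "R = Pt x y" "on_curve E (Pt x y)" using elim(4) by metis
        show ?case
        proof
          assume "mul n R = Inf"
          then have "om x y n = 0" using point_formula(3)[OF R(2), of "n - 1"] elim(1) n R(1) by simp
          then show False using elim(2,3) R by (simp add: om_def split: if_splits)
        qed
      qed
    next
      case True
      have "\<forall>\<^sub>F R in gen. mul n R = Inf" using G gen_Pt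
      proof eventually_elim
        case (elim R)
        obtain x y where R: "R = Pt x y" "on_curve E (Pt x y)" using elim(2) by metis
        show ?case
        proof (rule ccontr)
          assume a: "mul n R \<noteq> Inf"
          have "mul j (Pt x y) \<noteq> Inf" if "1 \<le> j" "j \<le> n" for j
            using a elim(1) that R by (cases "j = n") auto
          then have "poly (psi_sq E n) x \<noteq> 0" using point_formula(1)[OF R(2)] n by simp
          moreover have "psi_sq E n = 0" using True by (simp add: psi_sq_def)
          ultimately show False by simp
        qed
      qed
      note ev = this
      \<comment> \<open>Every point is a difference of two generic points, so the generic identity
        holds without exception.\<close>
      have all: "mul n R = Inf" if R: "on_curve E R" for R
      proof -
        have "\<forall>\<^sub>F S in gen. mul n S = Inf \<and> mul n (S \<oplus> R) = Inf \<and> on_curve E S"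
          using ev gen_add[OF ev R] gen_on_curve by eventually_elim simp
        then obtain S where S: "mul n S = Inf" "mul n (S \<oplus> R) = Inf" "on_curve E S" using gen_ex by blast
        then show ?thesis using mul_distrib[of S R n] R by simp
      qed
      show ?thesis
      proof (cases "even n")
        case True
        then obtain b where b: "n = 2 * b" by auto
        show ?thesis
        proof (cases "b = 1")
          case True
          then have "divf E n = 1" using b by (simp add: divf.simps)
          then show ?thesis using \<open>divf E n = 0\<close> by simp
        next
          case False
          then have b2: "b \<ge> 2" using b n by auto
          have "\<forall>\<^sub>F R in gen. mul b R \<noteq> Inf" using less.IH[of b] b b2
            by (auto elim!: eventually_mono)
          then have fin: "finite {R \<in> points E. mul b R = Inf}" by (simp add: eventually_gen)
          define p where "p = (\<Prod>Q\<in>{R \<in> points E. mul b R = Inf}. (theta E 2 - smult (px Q) (psi_sq E 2)))"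
          have "\<forall>\<^sub>F R in gen. \<forall>j. 1 \<le> j \<longrightarrow> j \<le> 2 \<longrightarrow> mul j R \<noteq> Inf" using less.IH[of 2] b b2 by simp
          then have "\<forall>\<^sub>F R in gen. poly p (px R) = 0" using gen_Pt
          proof eventually_elim
            case (elim R)
            obtain x y where R: "R = Pt x y" "on_curve E (Pt x y)" using elim(2) by metis
            have "mul n R = Inf" using all R by metis
            then have "mul b (mul 2 R) = Inf" using mul_mult[of R b 2] R b by (simp add: mult.commute)
            then have m: "mul 2 R \<in> {R \<in> points E. mul b R = Inf}" using R mul_closed[of R 2] by (simp add: points_def)
            have "px (mul 2 R) * poly (psi_sq E 2) x = poly (theta E 2) x"
              using point_formula(2)[OF R(2), of 2] elim(1) R(1) by simp
            then have "poly (theta E 2 - smult (px (mul 2 R)) (psi_sq E 2)) x = 0" by simp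
            then show ?case unfolding p_def poly_prod using m fin R(1) by (auto intro!: prod_zero)
          qed
          then have "p = 0" by (rule gen_poly_0)
          then obtain Q where Q: "theta E 2 - smult (px Q) (psi_sq E 2) = 0" using fin by (auto simp: p_def)
          have "degree (theta E 2 - smult (px Q) (psi_sq E 2)) = 2^2" using theta_degree[of 2 E "px Q"] by simp
          then show ?thesis unfolding Q by simp
        qed
      next
        case False
        then obtain k where k: "n = 2 * k + 1" by (elim oddE)
        have "lc (divf E n) (2*k*(k+1)) (of_nat n)" unfolding k by (rule divf_lc)
        then have n0: "(of_nat n :: 'a) = 0" using True by (simp add: lc_def)
        have two: "(2::'a) \<noteq> 0"
        proof
          assume "(2::'a) = 0"
          then have "(of_nat n :: 'a) = 1" by (simp add: k)
          then show False using n0 by simp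
        qed
        have "(2::'a) * 2 \<noteq> 0" unfolding mult_eq_0_iff using two by simp
        then have four: "(4::'a) \<noteq> 0" by simp
        have "degree (divF E) = 3" using four unfolding divF_def by simp
        then obtain x where x: "Ff x = 0" using alg_closed_imp_poly_has_root[of "divF E"] Ff_poly by force
        obtain y where y: "on_curve E (Pt x y)" using ex_point by blast
        have "mul 2 (Pt x y) = Inf" using two_torsion_poly[OF y x] by (simp add: numeral_2_eq_2)
        then have "mul (2 * k) (Pt x y) = Inf" using mul_mult[OF y, of k 2] by (simp add: mult.commute)
        then have "mul n (Pt x y) = Pt x y" unfolding k by simp
        then show ?thesis using all[OF y] by simp
      qed
    qed
    show ?thesis using G key
    proof eventually_elim
      case (elim R)
      show ?case
      proof (intro allI impI)
        fix j assume "1 \<le> j" "j \<le> n"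
        then show "mul j R \<noteq> Inf" using elim by (cases "j = n") auto
      qed
    qed
  qed
qed

lemma mul_gen: "n \<ge> 1 \<Longrightarrow> \<forall>\<^sub>F R in gen. mul n R \<noteq> Inf"
  using order_gen[of n] by (rule eventually_mono) auto

lemma finite_torsion: "n \<ge> 1 \<Longrightarrow> finite {R \<in> points E. mul n R = Inf}"
  using mul_gen by (simp add: eventually_gen)

lemma finite_mul_fibre:
  assumes "n \<ge> 1" shows "finite {R \<in> points E. mul n R = Q}"
proof (cases "\<exists>S. on_curve E S \<and> mul n S = Q")
  case True
  then obtain S where S: "on_curve E S" "mul n S = Q" by blast
  have "{R \<in> points E. mul n R = Q} \<subseteq> (\<lambda>T. T \<oplus> S) ` {R \<in> points E. mul n R = Inf}"
  proof
    fix R assume "R \<in> {R \<in> points E. mul n R = Q}"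
    then have R: "on_curve E R" "mul n R = Q" by (auto simp: points_def)
    have "mul n (R \<oplus> \<ominus> S) = Inf" using R S by (simp add: mul_distrib mul_neg)
    moreover have "R = (R \<oplus> \<ominus> S) \<oplus> S" using R S add_cancel[of R "\<ominus> S"] by simp
    moreover have "on_curve E (R \<oplus> \<ominus> S)" using R S by (simp add: add_closed)
    ultimately show "R \<in> (\<lambda>T. T \<oplus> S) ` {R \<in> points E. mul n R = Inf}" by (auto simp: points_def)
  qed
  then show ?thesis using finite_torsion[OF assms] finite_subset by blast
next
  case False
  then have "{R \<in> points E. mul n R = Q} = {}" by (auto simp: points_def)
  then show ?thesis by (simp only: finite.emptyI)
qed

section \<open>Multiples of arbitrary points, torsion included\<close>

lemma psi_sq_rec: "n \<ge> 1 \<Longrightarrow> poly (psi_sq E (n+1)) x * poly (psi_sq E (n-1)) x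
   = (x * poly (psi_sq E n) x - poly (theta E n) x)^2"
proof -
  assume n: "n \<ge> 1"
  obtain y where y: "on_curve E (Pt x y)" using ex_point by blast
  show ?thesis unfolding psi_sq_om[OF y] theta_om[OF y n] by algebra
qed

definition SfP :: "'a poly \<Rightarrow> 'a poly \<Rightarrow> 'a poly" where
  "SfP X Z = [:0,2:] * X * (X + [:0,1:] * Z) + [:0,wb2 E:] * X * Z + [:wb4 E:] * (X + [:0,1:] * Z) * Z + [:wb6 E:] * Z * Z"
definition PfP :: "'a poly \<Rightarrow> 'a poly \<Rightarrow> 'a poly" where
  "PfP X Z = [:0,0,1:] * X * X - [:0, wb4 E:] * X * Z - [:wb6 E:] * (X + [:0,1:] * Z) * Z - [:wb8 E:] * Z * Z"

lemma poly_SfP: "poly (SfP X Z) x = Sf (poly X x) (poly Z x) x"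
  unfolding SfP_def Sf_def by (simp add: algebra_simps power2_eq_square)
lemma poly_PfP: "poly (PfP X Z) x = Pf (poly X x) (poly Z x) x"
  unfolding PfP_def Pf_def by (simp add: algebra_simps power2_eq_square)

text \<open>At generic points the multiples involved are affine and these are the Kummer formulas
  multiplied by psi_(n+1)^2 psi_(n-1)^2. As polynomial identities in x they then hold at torsion
  points as well, where the formulas themselves make no sense.\<close>

lemma theta_rec:
  assumes n: "n \<ge> 2"
  shows "poly (theta E (n+1)) x * poly (psi_sq E (n-1)) x + poly (theta E (n-1)) x * poly (psi_sq E (n+1)) x
      = Sf (poly (theta E n) x) (poly (psi_sq E n) x) x"
    and "poly (theta E (n+1)) x * poly (theta E (n-1)) x = Pf (poly (theta E n) x) (poly (psi_sq E n) x) x"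
proof -
  define X Z where "X = theta E" "Z = psi_sq E"
  have G: "\<forall>\<^sub>F R in gen. \<forall>j. 1 \<le> j \<longrightarrow> j \<le> n + 1 \<longrightarrow> mul j R \<noteq> Inf" using order_gen[of "n+1"] by simp
  have ev: "\<forall>\<^sub>F R in gen. poly (X (n+1) * Z (n-1) + X (n-1) * Z (n+1) - SfP (X n) (Z n)) (px R) = 0
     \<and> poly (X (n+1) * X (n-1) - PfP (X n) (Z n)) (px R) = 0"
    using G gen_Pt
  proof eventually_elim
    case (elim R)
    obtain x y where R: "R = Pt x y" "on_curve E (Pt x y)" using elim(2) by metis
    have oR: "on_curve E R" using R by metis
    define u v w where d: "u = px (mul (n+1) R)" "v = px (mul (n-1) R)" "w = px (mul n R)"
    have e: "poly (X (n+1)) x = u * poly (Z (n+1)) x" "poly (X (n-1)) x = v * poly (Z (n-1)) x" "poly (X n) x = w * poly (Z n) x"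
      using point_formula(2)[OF R(2), of "n+1"] point_formula(2)[OF R(2), of "n-1"] point_formula(2)[OF R(2), of n] elim(1) R(1) n
      by (simp_all add: d X_Z_def)
    have nR: "mul n R \<noteq> Inf" "R \<noteq> Inf" using elim(1) n R(1) by auto
    have wx: "w \<noteq> px R"
    proof
      assume "w = px R"
      then have "mul n R = R \<or> mul n R = \<ominus> R" using px_eq[of R "mul n R"] oR nR by (simp add: d)
      then have "mul n R \<oplus> \<ominus> R = Inf \<or> mul n R \<oplus> R = Inf" by auto
      moreover have "mul n R \<oplus> \<ominus> R = mul (n - 1) R" "mul n R \<oplus> R = mul (n + 1) R"
        using mul_diff[OF oR, of 1 n] mul_add[OF oR, of n 1] n by simp_all
      ultimately show False using elim(1) n by auto
    qed
    have ad: "mul n R \<oplus> \<ominus> R = mul (n - 1) R" "mul n R \<oplus> R = mul (n + 1) R"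
        using mul_diff[OF oR, of 1 n] mul_add[OF oR, of n 1] n by simp_all
    have k: "(w - x)^2 * (u + v) = Sf w 1 x" "(w - x)^2 * (u * v) = Pf w 1 x"
      using kummer[of "mul n R" R] oR nR wx R(1) unfolding ad d by simp_all
    have z: "poly (Z (n+1)) x * poly (Z (n-1)) x = poly (Z n) x ^2 * (w - x)^2"
    proof -
      have "poly (Z (n+1)) x * poly (Z (n-1)) x = (x * poly (Z n) x - poly (X n) x)^2"
        unfolding X_Z_def using psi_sq_rec[of n x] n by simp
      then show ?thesis unfolding e(3) by algebra
    qed
    have "poly (X (n+1)) x * poly (Z (n-1)) x + poly (X (n-1)) x * poly (Z (n+1)) x
      = (u + v) * (poly (Z (n+1)) x * poly (Z (n-1)) x)" unfolding e by algebra
    also have "\<dots> = Sf w 1 x * poly (Z n) x ^2" unfolding z k(1)[symmetric] by algebra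
    also have "\<dots> = Sf (w * poly (Z n) x) (poly (Z n) x) x" unfolding Sf_1 unfolding Sf_def by algebra
    finally have 1: "poly (X (n+1)) x * poly (Z (n-1)) x + poly (X (n-1)) x * poly (Z (n+1)) x = Sf (poly (X n) x) (poly (Z n) x) x"
      unfolding e(3) .
    have "poly (X (n+1)) x * poly (X (n-1)) x = (u * v) * (poly (Z (n+1)) x * poly (Z (n-1)) x)" unfolding e by algebra
    also have "\<dots> = Pf w 1 x * poly (Z n) x ^2" unfolding z k(2)[symmetric] by algebra
    also have "\<dots> = Pf (w * poly (Z n) x) (poly (Z n) x) x" unfolding Pf_1 unfolding Pf_def by algebra
    finally have 2: "poly (X (n+1)) x * poly (X (n-1)) x = Pf (poly (X n) x) (poly (Z n) x) x" unfolding e(3) .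
    show ?case using 1 2 R(1) by (simp add: poly_SfP poly_PfP)
  qed
  have "X (n+1) * Z (n-1) + X (n-1) * Z (n+1) - SfP (X n) (Z n) = 0"
    by (rule gen_poly_0) (use ev in \<open>auto elim: eventually_mono\<close>)
  then have "poly (X (n+1) * Z (n-1) + X (n-1) * Z (n+1) - SfP (X n) (Z n)) x = 0" by simp
  then show "poly (theta E (n+1)) x * poly (psi_sq E (n-1)) x + poly (theta E (n-1)) x * poly (psi_sq E (n+1)) x
      = Sf (poly (theta E n) x) (poly (psi_sq E n) x) x" by (simp add: poly_SfP X_Z_def)
  have "X (n+1) * X (n-1) - PfP (X n) (Z n) = 0"
    by (rule gen_poly_0) (use ev in \<open>auto elim: eventually_mono\<close>)
  then have "poly (X (n+1) * X (n-1) - PfP (X n) (Z n)) x = 0" by simp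
  then show "poly (theta E (n+1)) x * poly (theta E (n-1)) x = Pf (poly (theta E n) x) (poly (psi_sq E n) x) x"
    by (simp add: poly_PfP X_Z_def)
qed

lemma Sf_diag: "Sf (x * Z) Z x = Z^2 * Ff x" "Pf (x * Z) Z x = Z^2 * Th x"
  unfolding Sf_def Pf_def Ff_def Th_def by algebra+

lemma Sf_0: "Sf X 0 x = 2 * x * X^2"
  by (simp add: Sf_def power2_eq_square)

text \<open>X : Z are homogeneous coordinates of the image of A on the projective line, with
  infinity at Z = 0. In particular X and Z do not both vanish, which says that theta_n and psi_n^2
  have no common root.\<close>

definition repr :: "'a ecpt \<Rightarrow> 'a \<Rightarrow> 'a \<Rightarrow> bool" where
  "repr A X Z \<longleftrightarrow> (if A = Inf then Z = 0 \<and> X \<noteq> 0 else Z \<noteq> 0 \<and> X = px A * Z)"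

text \<open>If A, A + R and A - R are affine, sum and product of the x-coordinates determine the new
  pair. The content lies in the degenerate cases A = Inf, A = R, A = -R. There the danger is the
  pair 0 : 0; it is excluded by \<open>Th_nonzero\<close> if R has order two, and by the sum
  relation otherwise.\<close>

lemma repr_step:
  assumes A: "on_curve E A" and R: "R = Pt x y" "on_curve E R"
    and r: "repr A X Z" "repr (A \<oplus> \<ominus> R) X' Z'"
    and e: "Z'' * Z' = (x * Z - X)^2" "X'' * Z' + X' * Z'' = Sf X Z x" "X'' * X' = Pf X Z x"
  shows "repr (A \<oplus> R) X'' Z''"
proof (cases "A = Inf")
  case True
  then have Z: "Z = 0" "X \<noteq> 0" using r(1) by (auto simp: repr_def)
  have p: "X' = x * Z'" "Z' \<noteq> 0" using r(2) R True by (auto simp: repr_def)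
  have "Z'' * Z' = X^2" using e(1) Z by simp
  then have "Z'' \<noteq> 0" using Z by auto
  moreover have "X'' * Z' = x * Z'' * Z'" using e(1,2) unfolding Z Sf_0 p by algebra
  ultimately show ?thesis using R True p by (simp add: repr_def)
next
  case False
  then have Z: "Z \<noteq> 0" "X = px A * Z" using r(1) by (auto simp: repr_def)
  show ?thesis
  proof (cases "px A = x")
    case True
    then have X: "X = x * Z" using Z by simp
    have zz: "Z'' * Z' = 0" using e(1) X by simp
    have e': "X'' * Z' + X' * Z'' = Z^2 * Ff x" "X'' * X' = Z^2 * Th x" using e(2,3) unfolding X Sf_diag by simp_all
    have "A = R \<or> A = \<ominus> R" using px_eq[of R A] A R False True by (simp del: on_curve.simps(2))
    then show ?thesis
    proof
      assume AR: "A = R"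
      then have m: "Z' = 0" "X' \<noteq> 0" using r(2) by (auto simp: repr_def)
      have c: "on_curve E (Pt x y)" using R by simp
      show ?thesis
      proof (cases "Ff x = 0")
        case f: True
        have "A \<oplus> R = Inf" unfolding AR R using two_torsion_poly[OF c f] .
        moreover have "Z'' = 0" using e'(1) m f by simp
        moreover have "X'' \<noteq> 0" using e'(2) Th_nonzero[OF c f] Z by auto
        ultimately show ?thesis by (simp add: repr_def)
      next
        case f: False
        have n: "2*y + a1*x + a3 \<noteq> 0" using f Ff_eq[OF c] by auto
        have d: "px (A \<oplus> R) * Ff x = Th x" "A \<oplus> R \<noteq> Inf" unfolding AR R using double_px[OF c n] by auto
        have "X' * Z'' = Z^2 * Ff x" using e'(1) m by simp
        then have 1: "Z'' \<noteq> 0" using f Z by auto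
        have "X' * X'' = X' * (px (A \<oplus> R) * Z'')" using e' d(1) m by (simp add: mult_ac) algebra
        then have "X'' = px (A \<oplus> R) * Z''" using m(2) by simp
        then show ?thesis using 1 d(2) by (simp add: repr_def)
      qed
    next
      assume AR: "A = \<ominus> R"
      have i: "A \<oplus> R = Inf" by (simp add: AR)
      have c: "on_curve E (Pt x y)" using R by simp
      show ?thesis
      proof (cases "Ff x = 0")
        case f: True
        have "R \<oplus> R = Inf" unfolding R using two_torsion_poly[OF c f] .
        then have "\<ominus> R = R" using add_eq_Inf[of R R] R by simp
        then have "A \<oplus> \<ominus> R = Inf" unfolding AR by (metis add_neg(1))
        then have m: "Z' = 0" "X' \<noteq> 0" using r(2) by (auto simp: repr_def)
        have "Z'' = 0" using e'(1) m f by simp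
        moreover have "X'' \<noteq> 0" using e'(2) Th_nonzero[OF c f] Z by auto
        ultimately show ?thesis using i by (simp add: repr_def)
      next
        case f: False
        have n: "2*y + a1*x + a3 \<noteq> 0" using f Ff_eq[OF c] by auto
        have "\<ominus> (R \<oplus> R) \<noteq> Inf" using double_px(2)[OF c n] R by (simp del: ec_add.simps)
        then have "A \<oplus> \<ominus> R \<noteq> Inf" unfolding AR neg_add[OF R(2) R(2)] .
        then have "Z' \<noteq> 0" using r(2) by (simp add: repr_def)
        then have z: "Z'' = 0" using zz by simp
        then have "X'' \<noteq> 0" using e'(1) f Z by auto
        then show ?thesis using i z by (simp add: repr_def)
      qed
    qed
  next
    case F: False
    have nI: "A \<oplus> R \<noteq> Inf" "A \<oplus> \<ominus> R \<noteq> Inf" using add_neq_Inf[of A R] F R by (auto simp del: ec_add.simps)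
    have m: "Z' \<noteq> 0" "X' = px (A \<oplus> \<ominus> R) * Z'" using r(2) nI by (simp_all add: repr_def)
    have k: "(px A - x)^2 * (px (A \<oplus> R) + px (A \<oplus> \<ominus> R)) = Sf (px A) 1 x"
      using kummer(1)[of A R] A R False F by (simp del: ec_add.simps on_curve.simps(2))
    have z: "Z'' * Z' = Z^2 * (px A - x)^2" using e(1) unfolding Z(2) by algebra
    then have z0: "Z'' \<noteq> 0" using F Z by auto
    have "Sf X Z x = Sf (px A) 1 x * Z^2" unfolding Z(2) Sf_1 unfolding Sf_def by algebra
    also have "\<dots> = (px (A \<oplus> R) + px (A \<oplus> \<ominus> R)) * (Z'' * Z')" unfolding k[symmetric] z by algebra
    finally have "X'' * Z' = (px (A \<oplus> R) * Z'') * Z'" using e(2) unfolding m(2) by algebra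
    then have "X'' = px (A \<oplus> R) * Z''" using m(1) by simp
    then show ?thesis using z0 nI by (simp add: repr_def)
  qed
qed

lemma repr_mul:
  assumes c: "on_curve E (Pt x y)" and n: "n \<ge> 1"
  shows "repr (mul n (Pt x y)) (poly (theta E n) x) (poly (psi_sq E n) x)"
proof -
  define R where "R = Pt x y"
  have R: "on_curve E R" "R = Pt x y" using c by (simp_all add: R_def del: on_curve.simps(2))
  have 1: "repr (mul 1 R) (poly (theta E 1) x) (poly (psi_sq E 1) x)"
    using psi_sq_om[OF c, of 1] theta_om[OF c, of 1] by (simp add: repr_def R)
  have "poly (psi_sq E 2) x = Ff x" using psi_sq_om[OF c, of 2] Ff_eq[OF c] by simp
  moreover have "poly (theta E 2) x = Th x"
    using theta_om[OF c, of 2] om_3[of x y] Ff_eq[OF c] by (simp add: Ff_def Th_def) algebra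
  moreover have "mul 2 R = R \<oplus> R" by (simp add: numeral_2_eq_2)
  ultimately have 2: "repr (mul 2 R) (poly (theta E 2) x) (poly (psi_sq E 2) x)"
    using two_torsion_poly[OF c] Th_nonzero[OF c] double_px[OF c] Ff_eq[OF c] unfolding R(2)
    by (cases "Ff x = 0") (auto simp: repr_def simp del: ec_add.simps)
  have "repr (mul n R) (poly (theta E n) x) (poly (psi_sq E n) x)" using n
  proof (induction n rule: less_induct)
    case (less n)
    consider "n = 1" | "n = 2" | "n \<ge> 3" using less.prems by linarith
    then show ?case
    proof cases
      case 3
      define k where "k = n - 1"
      have k: "n = k + 1" "k \<ge> 2" using 3 by (auto simp: k_def)
      have "repr (mul k R \<oplus> R) (poly (theta E (k+1)) x) (poly (psi_sq E (k+1)) x)"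
      proof (rule repr_step)
        show "repr (mul k R) (poly (theta E k) x) (poly (psi_sq E k) x)" using less.IH[of k] k by simp
        have "mul k R \<oplus> \<ominus> R = mul (k - 1) R" using mul_diff[OF R(1), of 1 k] k by simp
        then show "repr (mul k R \<oplus> \<ominus> R) (poly (theta E (k-1)) x) (poly (psi_sq E (k-1)) x)" using less.IH[of "k-1"] k by simp
      qed (use R k psi_sq_rec[of k x] theta_rec[of k x] in auto)
      moreover have "mul k R \<oplus> R = mul (k+1) R" using mul_add[OF R(1), of k 1] by simp
      ultimately show ?thesis using k by simp
    qed (use 1 2 in auto)
  qed
  then show ?thesis by (simp add: R_def)
qed

lemma psi_sq_root: "on_curve E (Pt x y) \<Longrightarrow> n \<ge> 1 \<Longrightarrow> poly (psi_sq E n) x = 0 \<longleftrightarrow> mul n (Pt x y) = Inf"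
  using repr_mul[of x y n] by (auto simp: repr_def split: if_splits)

lemma delta_root:
  assumes "on_curve E (Pt x y)" "n \<ge> 1" "on_curve E (Pt x0 y0)"
  shows "poly (theta E n - smult x0 (psi_sq E n)) x = 0
    \<longleftrightarrow> mul n (Pt x y) = Pt x0 y0 \<or> mul n (Pt x y) = \<ominus> (Pt x0 y0)"
proof (cases "mul n (Pt x y) = Inf")
  case True
  then show ?thesis using repr_mul[OF assms(1,2)] by (auto simp: repr_def)
next
  case False
  then have r: "poly (psi_sq E n) x \<noteq> 0" "poly (theta E n) x = px (mul n (Pt x y)) * poly (psi_sq E n) x"
    using repr_mul[OF assms(1,2)] by (auto simp: repr_def)
  then have "poly (theta E n - smult x0 (psi_sq E n)) x = 0 \<longleftrightarrow> px (mul n (Pt x y)) = x0" by auto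
  also have "\<dots> \<longleftrightarrow> mul n (Pt x y) = Pt x0 y0 \<or> mul n (Pt x y) = \<ominus> (Pt x0 y0)"
    using px_eq[of "Pt x0 y0" "mul n (Pt x y)"] assms False mul_closed[OF assms(1), of n]
    by (auto simp del: on_curve.simps(2))
  finally show ?thesis .
qed

lemma mul_surj:
  assumes "on_curve E P" "n \<ge> 1" shows "\<exists>R. on_curve E R \<and> mul n R = P"
proof (cases P)
  case Inf then show ?thesis by (intro exI[of _ Inf]) simp
next
  case (Pt x0 y0)
  have "degree (theta E n - smult x0 (psi_sq E n)) > 0" using theta_degree[OF assms(2), of E x0] assms(2) by simp
  then obtain x where x: "poly (theta E n - smult x0 (psi_sq E n)) x = 0" using alg_closed_imp_poly_has_root by blast
  obtain y where y: "on_curve E (Pt x y)" using ex_point by blast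
  have "mul n (Pt x y) = P \<or> mul n (Pt x y) = \<ominus> P" using delta_root[OF y assms(2)] x assms(1) Pt by blast
  then show ?thesis using y mul_neg[OF y, of n] on_curve_neg[of "Pt x y"] neg_neg by metis
qed

section \<open>Separability of multiplication by n and the size of its fibres\<close>

lemma lc_pderiv: "lc p d (c::'b::field) \<Longrightarrow> lc (pderiv p) (d - 1) (of_nat d * c)"
proof -
  assume a: "lc p d c"
  have "degree (pderiv p) \<le> d - 1"
    using a by (intro degree_le allI impI) (auto simp: lc_def coeff_pderiv intro!: coeff_eq_0)
  moreover have "coeff (pderiv p) (d - 1) = of_nat d * c"
    using a by (cases d) (auto simp: lc_def coeff_pderiv elim: degree_eq_zeroE)
  ultimately show ?thesis by (simp add: lc_def)
qed

definition Wr :: "nat \<Rightarrow> 'a poly" where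
  "Wr n = pderiv (theta E n) * psi_sq E n - theta E n * pderiv (psi_sq E n)"

text \<open>The coefficient in degree 2 (n^2 - 1) is n^2 (n^2 - (n^2 - 1)) = n^2; this is where it
  matters that the characteristic does not divide n.\<close>

lemma Wr_nonzero:
  assumes "n \<ge> 2" "(of_nat n :: 'a) \<noteq> 0" shows "Wr n \<noteq> 0"
proof -
  have n1: "n \<ge> 1" and n2: "n^2 \<ge> 2" using assms self_le_power[of n 2] by auto
  note t = theta_lc[OF n1, of E] and p = psi_sq_lc[OF n1, of E]
  have 1: "lc (pderiv (theta E n) * psi_sq E n) ((n^2 - 1) + (n^2 - 1)) (of_nat (n^2) * 1 * of_nat n ^ 2)"
    by (intro lc_mult lc_pderiv t p)
  have "lc (theta E n * pderiv (psi_sq E n)) (n^2 + (n^2 - 1 - 1)) (1 * (of_nat (n^2 - 1) * of_nat n ^ 2))"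
    by (intro lc_mult lc_pderiv t p)
  moreover have "n^2 + (n^2 - 1 - 1) = (n^2 - 1) + (n^2 - 1)" using n2 by simp
  ultimately have "lc (theta E n * pderiv (psi_sq E n)) ((n^2 - 1) + (n^2 - 1)) (1 * (of_nat (n^2 - 1) * of_nat n ^ 2))" by metis
  from lc_diff[OF 1 this] have "coeff (Wr n) ((n^2 - 1) + (n^2 - 1)) = of_nat (n^2) * of_nat n ^ 2 - of_nat (n^2 - 1) * of_nat n ^ 2"
    by (simp add: lc_def Wr_def)
  also have "\<dots> = of_nat n ^ 2" using n2 by (simp add: of_nat_diff algebra_simps)
  finally show ?thesis using assms by auto
qed

text \<open>All fibres of \<open>[n]\<close> have the same cardinality, and the generic one has \<open>n\<^sup>2\<close> elements because the
  Wronskian of \<open>\<theta>\<^sub>n\<close> and \<open>\<psi>\<^sub>n\<^sup>2\<close> does not vanish identically.\<close>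

lemma card_fibre_translate:
  assumes "on_curve E R0" "mul n R0 = P"
  shows "bij_betw (\<lambda>T. R0 \<oplus> T) {R \<in> points E. mul n R = Inf} {R \<in> points E. mul n R = P}"
proof (rule bij_betwI[where g = "\<lambda>R. \<ominus> R0 \<oplus> R"])
  show "(\<lambda>T. R0 \<oplus> T) \<in> {R \<in> points E. mul n R = Inf} \<rightarrow> {R \<in> points E. mul n R = P}"
    using assms by (auto simp: points_def add_closed mul_distrib)
  show "(\<lambda>R. \<ominus> R0 \<oplus> R) \<in> {R \<in> points E. mul n R = P} \<rightarrow> {R \<in> points E. mul n R = Inf}"
    using assms by (auto simp: points_def add_closed mul_distrib mul_neg)
qed (use assms add_cancel_left add_cancel_left' in \<open>auto simp: points_def\<close>)

text \<open>As P differs from -P, the points R and -R cannot both lie over P, whence injectivity of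
  x. Conversely a point over a root is mapped to P or -P, and changing its sign does not change its
  x-coordinate.\<close>

lemma fibre_px:
  assumes n: "n \<ge> 1" and P: "on_curve E (Pt x0 y0)" and P2: "Pt x0 y0 \<oplus> Pt x0 y0 \<noteq> Inf"
  shows "bij_betw px {R \<in> points E. mul n R = Pt x0 y0} {x. poly (theta E n - smult x0 (psi_sq E n)) x = 0}"
  unfolding bij_betw_def
proof
  have nP: "Pt x0 y0 \<noteq> \<ominus> (Pt x0 y0)" using P2 add_neg(1) by metis
  show "inj_on px {R \<in> points E. mul n R = Pt x0 y0}"
  proof (rule inj_onI)
    fix R S assume a: "R \<in> {R \<in> points E. mul n R = Pt x0 y0}" "S \<in> {R \<in> points E. mul n R = Pt x0 y0}" "px R = px S"
    then have c: "on_curve E R" "on_curve E S" "mul n R = Pt x0 y0" "mul n S = Pt x0 y0" by (auto simp: points_def)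
    then have "R \<noteq> Inf" "S \<noteq> Inf" by auto
    then have "S = R \<or> S = \<ominus> R" using px_eq c a(3) by blast
    moreover have "S \<noteq> \<ominus> R" using c mul_neg nP by metis
    ultimately show "R = S" by simp
  qed
  show "px ` {R \<in> points E. mul n R = Pt x0 y0} = {x. poly (theta E n - smult x0 (psi_sq E n)) x = 0}"
  proof (intro equalityI subsetI)
    fix x assume "x \<in> px ` {R \<in> points E. mul n R = Pt x0 y0}"
    then obtain R where R: "on_curve E R" "mul n R = Pt x0 y0" "x = px R" by (auto simp: points_def)
    then have "R = Pt x (py R)" using Pt_eq[of R] by fastforce
    then show "x \<in> {x. poly (theta E n - smult x0 (psi_sq E n)) x = 0}"
      using delta_root[of x "py R" n x0 y0] R n P by (metis mem_Collect_eq)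
  next
    fix x assume x: "x \<in> {x. poly (theta E n - smult x0 (psi_sq E n)) x = 0}"
    obtain y where y: "on_curve E (Pt x y)" using ex_point by blast
    then have "mul n (Pt x y) = Pt x0 y0 \<or> mul n (Pt x y) = \<ominus> (Pt x0 y0)" using delta_root[OF y n P] x by blast
    then have "mul n (Pt x y) = Pt x0 y0 \<or> mul n (\<ominus> (Pt x y)) = Pt x0 y0" using mul_neg[OF y] neg_neg by metis
    moreover have "px (Pt x y) = x" "px (\<ominus> (Pt x y)) = x" by simp_all
    moreover have "on_curve E (\<ominus> (Pt x y))" using y on_curve_neg by blast
    ultimately obtain R where "px R = x" "on_curve E R" "mul n R = Pt x0 y0" using y by blast
    then show "x \<in> px ` {R \<in> points E. mul n R = Pt x0 y0}" by (auto simp: points_def)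
  qed
qed

lemma card_torsion:
  assumes n: "n \<ge> 2" and n0: "(of_nat n :: 'a) \<noteq> 0"
  shows "card {R \<in> points E. mul n R = Inf} = n^2"
proof -
  \<comment> \<open>The branch values. A double root of theta_n - x0 psi_n^2 satisfies theta_n = x0
    psi_n^2 and the derived equation, hence is a zero of the Wronskian; so a P outside B has a fibre
    polynomial with simple roots only.\<close>
  define B where "B = mul n ` (\<Union>x\<in>{x. poly (Wr n) x = 0}. {R \<in> points E. px R = x})"
  have "finite B" unfolding B_def using Wr_nonzero[OF n n0] finite_fibre poly_roots_finite
    by (intro finite_imageI finite_UN_I) auto
  then have "\<forall>\<^sub>F P in gen. P \<notin> B" unfolding eventually_gen by (rule rev_finite_subset) auto
  then have "\<forall>\<^sub>F P in gen. P \<notin> B \<and> mul 2 P \<noteq> Inf \<and> P \<noteq> Inf" using mul_gen[of 2, OF one_le_numeral] gen_neq[of Inf]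
    by eventually_elim simp
  then obtain P where P: "on_curve E P" "P \<notin> B" "mul 2 P \<noteq> Inf" "P \<noteq> Inf" using gen_ex by (auto simp: points_def)
  obtain x0 y0 where xy: "P = Pt x0 y0" using P(4) by (cases P) auto
  have P2: "Pt x0 y0 \<oplus> Pt x0 y0 \<noteq> Inf" using P(3) unfolding xy by (simp add: numeral_2_eq_2 del: ec_add.simps)
  have n1: "n \<ge> 1" using n by simp
  define d where "d = theta E n - smult x0 (psi_sq E n)"
  have dd: "degree d = n^2" "lead_coeff d = 1" using theta_degree[OF n1, of E x0] unfolding d_def by blast+
  have "card {x. poly d x = 0} = degree d"
  proof (rule card_simple_roots)
    show "d \<noteq> 0" using dd(2) by auto
    fix x assume x: "poly d x = 0"
    show "poly (pderiv d) x \<noteq> 0"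
    proof
      assume x': "poly (pderiv d) x = 0"
      have "poly (theta E n) x = x0 * poly (psi_sq E n) x" "poly (pderiv (theta E n)) x = x0 * poly (pderiv (psi_sq E n)) x"
        using x x' by (simp_all add: d_def pderiv_diff pderiv_smult)
      then have w: "poly (Wr n) x = 0" by (simp add: Wr_def)
      obtain y where y: "on_curve E (Pt x y)" using ex_point by blast
      then have "mul n (Pt x y) = P \<or> mul n (Pt x y) = \<ominus> P" using delta_root[OF y n1] x P(1) unfolding xy d_def by blast
      then have "mul n (Pt x y) = P \<or> mul n (\<ominus> (Pt x y)) = P" using mul_neg[OF y] neg_neg by metis
      moreover have "Pt x y \<in> (\<Union>x\<in>{x. poly (Wr n) x = 0}. {R \<in> points E. px R = x})"
        "\<ominus> (Pt x y) \<in> (\<Union>x\<in>{x. poly (Wr n) x = 0}. {R \<in> points E. px R = x})"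
        using w y on_curve_neg[of "Pt x y"] by (auto simp: points_def simp del: on_curve.simps(2) on_curve_neg)
      ultimately obtain R where "R \<in> (\<Union>x\<in>{x. poly (Wr n) x = 0}. {R \<in> points E. px R = x})" "mul n R = P" by blast
      then have "P \<in> B" unfolding B_def by (intro image_eqI[of P "mul n" R]) (rule sym)
      then show False using P by simp
    qed
  qed
  moreover have "card {R \<in> points E. mul n R = P} = card {x. poly d x = 0}"
    unfolding d_def xy by (rule bij_betw_same_card[OF fibre_px[OF n1 P(1)[unfolded xy] P2]])
  ultimately have "card {R \<in> points E. mul n R = P} = n^2" using dd(1) by simp
  moreover obtain R0 where "on_curve E R0" "mul n R0 = P" using mul_surj[OF P(1) n1] by blast
  ultimately show ?thesis using bij_betw_same_card[OF card_fibre_translate[of R0 n P]] by simp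
qed

lemma card_delta_roots:
  assumes n: "n \<ge> 2" and n0: "(of_nat n :: 'a) \<noteq> 0"
    and P: "on_curve E (Pt x0 y0)" and P2: "Pt x0 y0 \<oplus> Pt x0 y0 \<noteq> Inf"
  shows "card {x. poly (theta E n - smult x0 (psi_sq E n)) x = 0} = n^2"
proof -
  have n1: "n \<ge> 1" using n by simp
  obtain R0 where "on_curve E R0" "mul n R0 = Pt x0 y0" using mul_surj[OF P n1] by blast
  then show ?thesis
    using bij_betw_same_card[OF fibre_px[OF n1 P P2]] bij_betw_same_card[OF card_fibre_translate[of R0 n "Pt x0 y0"]]
      card_torsion[OF n n0] by simp
qed

end

section \<open>Pole orders at infinity\<close>

context ecv
begin

text \<open>\<open>f\<close> has a pole of order at most \<open>n\<close> at infinity: \<open>x\<close> and \<open>y\<close> have orders 2 and 3, so \<open>a(x)\<close> and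
  \<open>b(x) y\<close> have orders of different parity and cannot cancel.\<close>

definition ordle :: "('a ecpt \<Rightarrow> 'a) \<Rightarrow> int \<Rightarrow> bool" where
  "ordle f n \<longleftrightarrow> (\<exists>a b q. q \<noteq> 0 \<and> 2 * int (degree a) \<le> 2 * int (degree q) + n
     \<and> 2 * int (degree b) + 3 \<le> 2 * int (degree q) + n
     \<and> (\<forall>\<^sub>F R in gen. f R * poly q (px R) = poly a (px R) + poly b (px R) * py R))"

lemma ordleI:
  assumes "q \<noteq> 0" "2 * int (degree a) \<le> 2 * int (degree q) + n"
     "2 * int (degree b) + 3 \<le> 2 * int (degree q) + n"
     "\<forall>\<^sub>F R in gen. f R * poly q (px R) = poly a (px R) + poly b (px R) * py R"
  shows "ordle f n"
  unfolding ordle_def using assms by (intro exI[of _ a] exI[of _ b] exI[of _ q]) simp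

lemma ordleE:
  assumes "ordle f n"
  obtains a b q where "q \<noteq> 0" "2 * int (degree a) \<le> 2 * int (degree q) + n"
     "2 * int (degree b) + 3 \<le> 2 * int (degree q) + n"
     "\<forall>\<^sub>F R in gen. f R * poly q (px R) = poly a (px R) + poly b (px R) * py R"
  using assms unfolding ordle_def by (elim exE conjE) (rule that)

lemma ordle_cong:
  assumes "ordle f n" "\<forall>\<^sub>F R in gen. f R = g R" shows "ordle g n"
proof -
  from assms(1) obtain a b q where q: "q \<noteq> 0" "2 * int (degree a) \<le> 2 * int (degree q) + n"
     "2 * int (degree b) + 3 \<le> 2 * int (degree q) + n"
     "\<forall>\<^sub>F R in gen. f R * poly q (px R) = poly a (px R) + poly b (px R) * py R" by (rule ordleE)
  show ?thesis
  proof (rule ordleI[OF q(1-3)])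
    show "\<forall>\<^sub>F R in gen. g R * poly q (px R) = poly a (px R) + poly b (px R) * py R"
      using q(4) assms(2) by eventually_elim simp
  qed
qed

lemma ordle_mono: "ordle f m \<Longrightarrow> m \<le> n \<Longrightarrow> ordle f n"
  by (erule ordleE) (rule ordleI, auto)

lemma ordle_add:
  assumes "ordle f n" "ordle g n" shows "ordle (\<lambda>R. f R + g R) n"
proof -
  from assms(1) obtain a b q where q: "q \<noteq> 0" "2 * int (degree a) \<le> 2 * int (degree q) + n"
     "2 * int (degree b) + 3 \<le> 2 * int (degree q) + n"
     "\<forall>\<^sub>F R in gen. f R * poly q (px R) = poly a (px R) + poly b (px R) * py R" by (rule ordleE)
  from assms(2) obtain c d p where p: "p \<noteq> 0" "2 * int (degree c) \<le> 2 * int (degree p) + n"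
     "2 * int (degree d) + 3 \<le> 2 * int (degree p) + n"
     "\<forall>\<^sub>F R in gen. g R * poly p (px R) = poly c (px R) + poly d (px R) * py R" by (rule ordleE)
  have dq: "degree (q * p) = degree q + degree p" using q p by (simp add: degree_mult_eq)
  have 1: "degree (a * p + c * q) \<le> max (degree a + degree p) (degree c + degree q)"
    by (intro degree_add_le_max[THEN order_trans] max.mono degree_mult_le)
  have 2: "degree (b * p + d * q) \<le> max (degree b + degree p) (degree d + degree q)"
    by (intro degree_add_le_max[THEN order_trans] max.mono degree_mult_le)
  show ?thesis
  proof (rule ordleI[of "q * p" "a * p + c * q" _ "b * p + d * q"])
    show "\<forall>\<^sub>F R in gen. (f R + g R) * poly (q * p) (px R) = poly (a * p + c * q) (px R) + poly (b * p + d * q) (px R) * py R"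
      using q(4) p(4)
    proof eventually_elim
      case (elim R)
      have "(f R + g R) * poly (q * p) (px R) = (f R * poly q (px R)) * poly p (px R) + (g R * poly p (px R)) * poly q (px R)"
        by (simp add: algebra_simps)
      then show ?case unfolding elim by (simp add: algebra_simps)
    qed
  qed (use q p dq 1 2 in auto)
qed

lemma ordle_mult:
  assumes "ordle f m" "ordle g n" shows "ordle (\<lambda>R. f R * g R) (m + n)"
proof -
  from assms(1) obtain a b q where q: "q \<noteq> 0" "2 * int (degree a) \<le> 2 * int (degree q) + m"
     "2 * int (degree b) + 3 \<le> 2 * int (degree q) + m"
     "\<forall>\<^sub>F R in gen. f R * poly q (px R) = poly a (px R) + poly b (px R) * py R" by (rule ordleE)
  from assms(2) obtain c d p where p: "p \<noteq> 0" "2 * int (degree c) \<le> 2 * int (degree p) + n"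
     "2 * int (degree d) + 3 \<le> 2 * int (degree p) + n"
     "\<forall>\<^sub>F R in gen. g R * poly p (px R) = poly c (px R) + poly d (px R) * py R" by (rule ordleE)
  have dq: "degree (q * p) = degree q + degree p" using q p by (simp add: degree_mult_eq)
  have "degree (b * d * W3) \<le> degree b + degree d + 3"
    using degree_mult_le[of "b*d" W3] degree_mult_le[of b d] by (auto intro: order_trans)
  then have 1: "degree (a * c + b * d * W3) \<le> max (degree a + degree c) (degree b + degree d + 3)"
    using degree_mult_le[of a c] degree_add_le_max[of "a*c" "b*d*W3"] by linarith
  have "degree (b * d * A1) \<le> degree b + degree d + 1"
    using degree_mult_le[of "b*d" A1] degree_mult_le[of b d] by (auto intro: order_trans split: if_splits)
  then have 2: "degree (a * d + b * c - b * d * A1) \<le> max (max (degree a + degree d) (degree b + degree c)) (degree b + degree d + 1)"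
    using degree_mult_le[of a d] degree_mult_le[of b c] degree_add_le_max[of "a*d" "b*c"] degree_diff_le_max[of "a*d+b*c" "b*d*A1"]
    by linarith
  show ?thesis
  proof (rule ordleI[of "q * p" "a * c + b * d * W3" _ "a * d + b * c - b * d * A1"])
    have "rp (\<lambda>R. (poly a (px R) + poly b (px R) * py R) * (poly c (px R) + poly d (px R) * py R))
       (a * c + b * d * W3) (a * d + b * c - b * d * A1)"
      by (rule rp_mult) (simp_all add: rp_def)
    then show "\<forall>\<^sub>F R in gen. f R * g R * poly (q * p) (px R) = poly (a * c + b * d * W3) (px R) + poly (a * d + b * c - b * d * A1) (px R) * py R"
      using q(4) p(4) unfolding rp_def
    proof eventually_elim
      case (elim R)
      have "f R * g R * poly (q * p) (px R) = (f R * poly q (px R)) * (g R * poly p (px R))"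
        by (simp add: algebra_simps)
      then show ?case unfolding elim(2,3) elim(1) .
    qed
  qed (use q p dq 1 2 in auto)
qed

lemma ordle_zero: "ordle (\<lambda>_. 0) n"
proof (rule ordleI[of "[:0,1:] ^ nat (3 - n)" 0 _ 0])
  have "degree ([:0,1::'a:] ^ nat (3 - n)) = nat (3 - n)" by (simp add: degree_power_eq)
  then show "2 * int (degree (0::'a poly)) \<le> 2 * int (degree ([:0, 1::'a:] ^ nat (3 - n))) + n"
    "2 * int (degree (0::'a poly)) + 3 \<le> 2 * int (degree ([:0, 1::'a:] ^ nat (3 - n))) + n" by simp_all
qed auto

text \<open>The padding by x^2 is due to the convention that the zero polynomial has degree 0: the
  bound on b then asks for a denominator of degree at least 2 even when b = 0.\<close>

lemma ordle_const: "ordle (\<lambda>_. c) 0"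
  by (rule ordleI[of "[:0,0,1:]" "[:0,0,c:]" _ 0]) (auto simp: algebra_simps)

lemma ordle_const': "0 \<le> n \<Longrightarrow> ordle (\<lambda>_. c) n"
  using ordle_mono[OF ordle_const] .

lemma ordle_px: "ordle px 2"
  by (rule ordleI[of "[:0,0,1:]" "[:0,0,0,1:]" _ 0]) (auto simp: algebra_simps)

lemma ordle_py: "ordle py 3"
  by (rule ordleI[of 1 0 _ 1]) auto

lemma ordle_scale: "ordle f n \<Longrightarrow> ordle (\<lambda>R. c * f R) n"
  using ordle_mult[OF ordle_const[of c], of f n] by simp

lemma ordle_minus: "ordle f n \<Longrightarrow> ordle (\<lambda>R. - f R) n"
  using ordle_scale[of f n "-1"] by simp

lemma ordle_diff: "ordle f n \<Longrightarrow> ordle g n \<Longrightarrow> ordle (\<lambda>R. f R - g R) n"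
  using ordle_add[of f n "\<lambda>R. - g R"] ordle_minus[of g n] by simp

lemma ordle_sum: "(\<And>i. i \<in> I \<Longrightarrow> ordle (f i) n) \<Longrightarrow> ordle (\<lambda>R. \<Sum>i\<in>I. f i R) n"
  by (induction I rule: infinite_finite_induct) (auto simp: ordle_zero intro: ordle_add)

lemma ordle_inv_px: "ordle (\<lambda>R. 1 / (px R - s)) (-2)"
proof (rule ordleI[of "[:-s,1:]^3" "[:-s,1:]^2" _ 0])
  show "\<forall>\<^sub>F R in gen. 1 / (px R - s) * poly ([:-s,1:]^3) (px R) = poly ([:-s,1:]^2) (px R) + poly 0 (px R) * py R"
    using gen_px[of s]
  proof eventually_elim
    case (elim R)
    define u where "u = px R - s"
    have "u \<noteq> 0" "poly [:-s,1:] (px R) = u" using elim by (simp_all add: u_def)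
    then show ?case unfolding poly_power u_def[symmetric] by (simp add: power2_eq_square power3_eq_cube)
  qed
qed (auto simp: degree_power_eq)

lemma ordle_rp:
  assumes "rp f a b" "ordle f n"
  shows "a = 0 \<or> 2 * int (degree a) \<le> n" "b = 0 \<or> 2 * int (degree b) + 3 \<le> n"
proof -
  from assms(2) obtain c d q where q: "q \<noteq> 0" "2 * int (degree c) \<le> 2 * int (degree q) + n"
     "2 * int (degree d) + 3 \<le> 2 * int (degree q) + n"
     "\<forall>\<^sub>F R in gen. f R * poly q (px R) = poly c (px R) + poly d (px R) * py R" by (rule ordleE)
  have "rp (\<lambda>R. f R * poly q (px R)) (a * q) (b * q)"
    using assms(1) unfolding rp_def by eventually_elim (simp add: algebra_simps)
  moreover have "rp (\<lambda>R. f R * poly q (px R)) c d" using q(4) by (simp add: rp_def)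
  ultimately have e: "c = a * q" "d = b * q" using rp_unique by blast+
  show "a = 0 \<or> 2 * int (degree a) \<le> n"
  proof (cases "a = 0")
    case False
    then have "degree c = degree a + degree q" using q(1) by (simp add: e degree_mult_eq)
    then show ?thesis using q(2) by simp
  qed simp
  show "b = 0 \<or> 2 * int (degree b) + 3 \<le> n"
  proof (cases "b = 0")
    case False
    then have "degree d = degree b + degree q" using q(1) by (simp add: e degree_mult_eq)
    then show ?thesis using q(3) by simp
  qed simp
qed

text \<open>This replaces evaluation at infinity: two constants that approximate the same function
  up to negative order are equal.\<close>

lemma ordle_const_neg: "ordle (\<lambda>_. c) n \<Longrightarrow> n < 0 \<Longrightarrow> c = 0"
  using ordle_rp(1)[OF rp_const[of c], of n] by auto

lemma ordle_poly: "ordle f 0 \<Longrightarrow> ordle (\<lambda>R. poly p (f R)) 0"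
proof (induction p)
  case (pCons a p)
  have "ordle (\<lambda>R. a + f R * poly p (f R)) 0"
    using ordle_add[OF ordle_const[of a] ordle_mult[OF pCons.prems pCons.IH[OF pCons.prems], simplified]] .
  then show ?case by simp
qed (simp add: ordle_zero)

lemma ordle_lim_le: "ordle (\<lambda>R. f R - v) n \<Longrightarrow> n \<le> 0 \<Longrightarrow> ordle f 0"
  using ordle_add[OF ordle_mono[of "\<lambda>R. f R - v" n 0] ordle_const[of v]] by simp

lemma ordle_poly_lim:
  assumes "ordle (\<lambda>R. f R - v) n" "n \<le> 0" shows "ordle (\<lambda>R. poly p (f R) - poly p v) n"
proof -
  have p: "p = [:-v,1:] * synthetic_div p v + [:poly p v:]" by (rule synthetic_div_correct'[symmetric])
  have "ordle (\<lambda>R. (f R - v) * poly (synthetic_div p v) (f R)) (n + 0)"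
    by (intro ordle_mult assms ordle_poly ordle_lim_le[OF assms])
  moreover have "(f R - v) * poly (synthetic_div p v) (f R) = poly p (f R) - poly p v" for R
    using arg_cong[OF p, of "\<lambda>p. poly p (f R)"] by (simp add: algebra_simps)
  ultimately show ?thesis by simp
qed

text \<open>The reciprocal is formed with the conjugate. Because v is nonzero, a has exactly the
  degree of q, so the norm in the denominator has the full degree 2 deg q.\<close>

lemma ordle_inverse:
  assumes l: "ordle (\<lambda>R. f R - v) (-1)" and v: "v \<noteq> 0"
  shows "ordle (\<lambda>R. 1 / f R) 0" "\<forall>\<^sub>F R in gen. f R \<noteq> 0"
proof -
  from l obtain a0 b q where q: "q \<noteq> 0" "2 * int (degree a0) \<le> 2 * int (degree q) + -1"
     "2 * int (degree b) + 3 \<le> 2 * int (degree q) + -1"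
     "\<forall>\<^sub>F R in gen. (f R - v) * poly q (px R) = poly a0 (px R) + poly b (px R) * py R" by (rule ordleE)
  define a where "a = smult v q + a0"
  have da: "degree a = degree q" unfolding a_def using q v by (subst degree_add_eq_left) auto
  have a0: "a \<noteq> 0" using da q by auto
  have dn: "degree (nrm a b) = 2 * degree q" "nrm a b \<noteq> 0"
    using nrm_degree[of b a] q(3) da a0 by (cases "b = 0"; simp add: nrm_b0 degree_mult_eq)+
  have fq: "\<forall>\<^sub>F R in gen. f R * poly q (px R) = poly a (px R) + poly b (px R) * py R"
    using q(4) by eventually_elim (simp add: a_def algebra_simps)
  have nr: "\<forall>\<^sub>F R in gen. (f R * poly q (px R)) * (poly (a - b * A1) (px R) - poly b (px R) * py R) = poly (nrm a b) (px R)"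
    using fq gen_curve
  proof eventually_elim
    case (elim R)
    have "py R^2 = px R^3 + a2*px R^2 + a4*px R + a6 - a1*px R*py R - a3*py R" using elim(2) by (simp add: algebra_simps)
    then show ?case unfolding elim(1) nrm_def by (simp add: algebra_simps power2_eq_square power3_eq_cube) algebra
  qed
  show nzf: "\<forall>\<^sub>F R in gen. f R \<noteq> 0" using nr gen_poly[OF dn(2)] by eventually_elim auto
  show "ordle (\<lambda>R. 1 / f R) 0"
  proof (rule ordleI[of "nrm a b" "q * (a - b * A1)" _ "- (q * b)"])
    show "\<forall>\<^sub>F R in gen. 1 / f R * poly (nrm a b) (px R) = poly (q * (a - b * A1)) (px R) + poly (- (q * b)) (px R) * py R"
      using nr nzf by eventually_elim (simp add: field_simps)
    have "degree (b * A1) \<le> degree b + 1"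
      using degree_mult_le[of b A1] by (auto intro: order_trans split: if_splits)
    then have "degree (a - b * A1) \<le> degree q" using da q(3) by (intro degree_diff_le) auto
    then have "degree (q * (a - b * A1)) \<le> 2 * degree q" using degree_mult_le[of q "a - b * A1"] by linarith
    then show "2 * int (degree (q * (a - b * A1))) \<le> 2 * int (degree (nrm a b)) + 0" using dn by simp
    have "degree (q * b) \<le> degree q + degree b" by (rule degree_mult_le)
    then show "2 * int (degree (- (q * b))) + 3 \<le> 2 * int (degree (nrm a b)) + 0" using dn q(3) by simp
  qed (use dn in auto)
qed

section \<open>Expansion of translations at infinity\<close>

text \<open>Written for the expansion at infinity: as R tends to \<open>Inf\<close>, its translate
  tends to the point (s, t), and dividing by the power of x - s on the left exhibits x' - s as
  small. The second identity is the collinearity of R, (s, t) and the negative of their sum.\<close>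

lemma add_formula:
  assumes "on_curve E (Pt x y)" "on_curve E (Pt s t)" "x \<noteq> s"
  defines "x' \<equiv> px (Pt x y \<oplus> Pt s t)" and "y' \<equiv> py (Pt x y \<oplus> Pt s t)"
  shows "(x' - s) * (x - s)^2 = - (2*t + a1*s + a3) * y + (3*s^2 + 2*a2*s + a4 - a1*t) * x + (a4*s + 2*a6 - a3*t - s^3)"
    and "(y' + t + a1*x' + a3) * (x - s) = - ((y - t) * (x' - s))"
    and "Pt x y \<oplus> Pt s t = Pt x' y'"
proof -
  have "(x - s)^2 * x' = x*s*(x+s) + 2*a2*x*s + a4*(x+s) + 2*a6 - 2*y*t - a1*(s*y+x*t) - a3*(y+t)"
    unfolding x'_def by (rule add_px[OF assms(1-3)])
  then show "(x' - s) * (x - s)^2 = - (2*t + a1*s + a3) * y + (3*s^2 + 2*a2*s + a4 - a1*t) * x + (a4*s + 2*a6 - a3*t - s^3)"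
    by algebra
  define l where "l = (t - y) / (s - x)"
  define v where "v = (y * s - t * x) / (s - x)"
  have l: "l * (s - x) = t - y" "v * (s - x) = y * s - t * x" using assms(3) by (simp_all add: l_def v_def)
  have e: "Pt x y \<oplus> Pt s t = Pt (l^2 + a1*l - a2 - x - s) (- (l + a1) * (l^2 + a1*l - a2 - x - s) - v - a3)"
    using assms(3) by (simp add: l_def v_def Let_def)
  then have y': "y' = - (l + a1) * x' - v - a3" by (simp add: x'_def y'_def)
  show "(y' + t + a1*x' + a3) * (x - s) = - ((y - t) * (x' - s))"
    unfolding y' using l by algebra
  show "Pt x y \<oplus> Pt s t = Pt x' y'" unfolding x'_def y'_def e by simp
qed

lemma gen_add_formula:
  assumes "on_curve E (Pt s t)"
  shows "\<forall>\<^sub>F R in gen. px R \<noteq> s \<and> on_curve E (Pt (px R) (py R))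
    \<and> (px (R \<oplus> Pt s t) - s) * (px R - s)^2 = - (2*t + a1*s + a3) * py R + (3*s^2 + 2*a2*s + a4 - a1*t) * px R + (a4*s + 2*a6 - a3*t - s^3)
    \<and> (py (R \<oplus> Pt s t) + t + a1*px (R \<oplus> Pt s t) + a3) * (px R - s) = - ((py R - t) * (px (R \<oplus> Pt s t) - s))"
  using gen_px[of s] gen_Pt
proof eventually_elim
  case (elim R)
  obtain x y where R: "R = Pt x y" "on_curve E (Pt x y)" using elim(2) by metis
  have "x \<noteq> s" using elim(1) R(1) by simp
  from add_formula[OF R(2) assms this] show ?case unfolding R(1) using \<open>x \<noteq> s\<close> R(2) by (simp only: px.simps py.simps simp_thms)
qed

text \<open>The order of f at an affine point S is, by convention, the order at infinity of the
  translated function R -> f(R + S). Read in this way, \<open>px\<close> minus its value at S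
  vanishes at S.\<close>

lemma tau_px:
  assumes "on_curve E (Pt s t)" shows "ordle (\<lambda>R. px (R \<oplus> Pt s t) - s) (-1)"
proof (rule ordleI[of "[:-s,1:]^2" "[:a4*s + 2*a6 - a3*t - s^3, 3*s^2 + 2*a2*s + a4 - a1*t:]" _ "[:- (2*t + a1*s + a3):]"])
  show "\<forall>\<^sub>F R in gen. (px (R \<oplus> Pt s t) - s) * poly ([:-s,1:]^2) (px R)
    = poly [:a4*s + 2*a6 - a3*t - s^3, 3*s^2 + 2*a2*s + a4 - a1*t:] (px R) + poly [:- (2*t + a1*s + a3):] (px R) * py R"
    using gen_add_formula[OF assms] by eventually_elim (simp add: algebra_simps)
qed (auto simp: degree_power_eq)

text \<open>At a two-torsion point the y-term of the translation formula drops out, and smoothness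
  keeps the coefficient of x nonzero; so x - s vanishes to order exactly two.\<close>

lemma tau_px_2:
  assumes "on_curve E (Pt s t)" "2*t + a1*s + a3 = 0"
  shows "ordle (\<lambda>R. px (R \<oplus> Pt s t) - s) (-2)" "\<not> ordle (\<lambda>R. px (R \<oplus> Pt s t) - s) (-3)"
proof -
  have ev: "\<forall>\<^sub>F R in gen. (px (R \<oplus> Pt s t) - s) * poly ([:-s,1:]^2) (px R)
    = poly [:a4*s + 2*a6 - a3*t - s^3, 3*s^2 + 2*a2*s + a4 - a1*t:] (px R) + poly 0 (px R) * py R"
    using gen_add_formula[OF assms(1)]
  proof eventually_elim
    case (elim R)
    then have "(px (R \<oplus> Pt s t) - s) * (px R - s)^2 = - (2*t + a1*s + a3) * py R + (3*s^2 + 2*a2*s + a4 - a1*t) * px R + (a4*s + 2*a6 - a3*t - s^3)" by blast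
    then show ?case unfolding assms(2) by (simp add: algebra_simps)
  qed
  show "ordle (\<lambda>R. px (R \<oplus> Pt s t) - s) (-2)"
  proof (rule ordleI[of "[:-s,1:]^2 * [:0,1:]" "[:a4*s + 2*a6 - a3*t - s^3, 3*s^2 + 2*a2*s + a4 - a1*t:] * [:0,1:]" _ 0])
    have "degree ([:-s,1:]^2 * [:0,1:]) = 3" by (subst degree_mult_eq) (auto simp: degree_power_eq)
    moreover have "degree ([:a4*s + 2*a6 - a3*t - s^3, 3*s^2 + 2*a2*s + a4 - a1*t:] * [:0,1:]) \<le> 2"
      by (rule order_trans[OF degree_mult_le]) simp
    ultimately show "2 * int (degree ([:a4*s + 2*a6 - a3*t - s^3, 3*s^2 + 2*a2*s + a4 - a1*t:] * [:0,1:])) \<le> 2 * int (degree ([:-s,1:]^2 * [:0,1:])) + -2"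
      "2 * int (degree (0::'a poly)) + 3 \<le> 2 * int (degree ([:-s,1:]^2 * [:0,1:])) + -2" by simp_all
    show "\<forall>\<^sub>F R in gen. (px (R \<oplus> Pt s t) - s) * poly ([:-s,1:]^2 * [:0,1:]) (px R)
      = poly ([:a4*s + 2*a6 - a3*t - s^3, 3*s^2 + 2*a2*s + a4 - a1*t:] * [:0,1:]) (px R) + poly 0 (px R) * py R"
      using ev
    proof eventually_elim
      case (elim R)
      then show ?case unfolding poly_mult mult.assoc[symmetric] by simp
    qed
  qed simp
  show "\<not> ordle (\<lambda>R. px (R \<oplus> Pt s t) - s) (-3)"
  proof
    assume "ordle (\<lambda>R. px (R \<oplus> Pt s t) - s) (-3)"
    moreover have "ordle (\<lambda>R. poly ([:-s,1:]^2) (px R)) 4"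
      by (rule ordleI[of "[:0,1:]" "[:-s,1:]^2 * [:0,1:]" _ 0]) (auto simp: degree_mult_eq degree_power_eq)
    ultimately have "ordle (\<lambda>R. (px (R \<oplus> Pt s t) - s) * poly ([:-s,1:]^2) (px R)) (-3 + 4)"
      by (rule ordle_mult)
    moreover have "rp (\<lambda>R. (px (R \<oplus> Pt s t) - s) * poly ([:-s,1:]^2) (px R)) [:a4*s + 2*a6 - a3*t - s^3, 3*s^2 + 2*a2*s + a4 - a1*t:] 0"
      using ev by (simp add: rp_def)
    ultimately show False using ordle_rp(1)[of _ _ _ "-3+4"] smooth[OF assms] by (force split: if_splits)
  qed
qed

lemma tau_py:
  assumes c: "on_curve E (Pt s t)" shows "ordle (\<lambda>R. py (R \<oplus> Pt s t) - t) (-1)"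
proof -
  define p where "p = 2*t + a1*s + a3"
  define e1 where "e1 = 3*s^2 + 2*a2*s + a4 - a1*t"
  define e0 where "e0 = a4*s + 2*a6 - a3*t - s^3"
  have 1: "ordle (\<lambda>R. - (py (R \<oplus> Pt s t) + t + a1*px (R \<oplus> Pt s t) + a3) + p) (-1)"
  \<comment> \<open>Multiplying the second translation formula by (x - s)^2 and inserting the first
    gives the numerator (y - t) (- p y + e1 x + e0) + p (x - s)^3. After y^2 is replaced by the
    curve equation the terms in x^3 cancel, which gains the required order; the witnesses are the
    remaining coefficients.\<close>
  proof (rule ordleI[of "[:-s,1:]^3"
      "[:- p * a6 - t * e0 - p * s^3, - p * a4 - t * e1 + 3 * p * s^2, - p * a2 - 3 * p * s:]" _ "[:p * a3 + e0 + t * p, p * a1 + e1:]"])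
    show "\<forall>\<^sub>F R in gen. (- (py (R \<oplus> Pt s t) + t + a1*px (R \<oplus> Pt s t) + a3) + p) * poly ([:-s,1:]^3) (px R)
     = poly [:- p * a6 - t * e0 - p * s^3, - p * a4 - t * e1 + 3 * p * s^2, - p * a2 - 3 * p * s:] (px R)
      + poly [:p * a3 + e0 + t * p, p * a1 + e1:] (px R) * py R"
      using gen_add_formula[OF c]
    proof eventually_elim
      case (elim R)
      define x y x' y' where d: "x = px R" "y = py R" "x' = px (R \<oplus> Pt s t)" "y' = py (R \<oplus> Pt s t)"
      have f: "(x' - s) * (x - s)^2 = - p * y + e1 * x + e0" "(y' + t + a1*x' + a3) * (x - s) = - ((y - t) * (x' - s))"
        using elim unfolding d p_def e1_def e0_def by blast+
      have cc: "y^2 = x^3 + a2*x^2 + a4*x + a6 - a1*x*y - a3*y" using elim by (simp add: d algebra_simps)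
      have "(- (y' + t + a1*x' + a3) + p) * (x - s)^3 = - ((y' + t + a1*x' + a3) * (x - s)) * (x - s)^2 + p * (x - s)^3" by algebra
      also have "\<dots> = (y - t) * ((x' - s) * (x - s)^2) + p * (x - s)^3" unfolding f(2) by algebra
      also have "\<dots> = (y - t) * (- p * y + e1 * x + e0) + p * (x - s)^3" unfolding f(1) ..
      also have "\<dots> = (- p * a6 - t * e0 - p * s^3) + (- p * a4 - t * e1 + 3 * p * s^2) * x + (- p * a2 - 3 * p * s) * x^2
          + ((p * a3 + e0 + t * p) + (p * a1 + e1) * x) * y" using cc by algebra
      finally show ?case unfolding d by (simp add: algebra_simps power2_eq_square)
    qed
  qed (auto simp: degree_power_eq)
  have "ordle (\<lambda>R. - (- (py (R \<oplus> Pt s t) + t + a1*px (R \<oplus> Pt s t) + a3) + p) - a1 * (px (R \<oplus> Pt s t) - s)) (-1)"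
    by (intro ordle_diff ordle_minus ordle_scale 1 tau_px c)
  then show ?thesis by (rule ordle_cong) (simp add: p_def algebra_simps)
qed

lemma tau_px_0: "on_curve E S \<Longrightarrow> S \<noteq> Inf \<Longrightarrow> ordle (\<lambda>R. px (R \<oplus> S)) 0"
  "on_curve E S \<Longrightarrow> S \<noteq> Inf \<Longrightarrow> ordle (\<lambda>R. py (R \<oplus> S)) 0"
  using ordle_lim_le[OF tau_px[of "px S" "py S"]] ordle_lim_le[OF tau_py[of "px S" "py S"]] Pt_eq[of S] by simp_all

text \<open>The function y / x has a simple pole at infinity and serves as the unit of residue; g is
  the residue of f in this unit.\<close>

lemma ordle_lead_1:
  assumes "ordle f 1" shows "\<exists>g. ordle (\<lambda>R. f R - g * (py R / px R)) 0"
proof -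
  from assms obtain a b q where q: "q \<noteq> 0" "2 * int (degree a) \<le> 2 * int (degree q) + 1"
     "2 * int (degree b) + 3 \<le> 2 * int (degree q) + 1"
     "\<forall>\<^sub>F R in gen. f R * poly q (px R) = poly a (px R) + poly b (px R) * py R" by (rule ordleE)
  define d where "d = degree q"
  define g where "g = coeff b (d - 1) / lead_coeff q"
  have d1: "d \<ge> 1" "degree a \<le> d" "degree b \<le> d - 1" using q by (auto simp: d_def)
  define b' where "b' = b * [:0,1:] - smult g q"
  have "degree b' < d"
  proof -
    have "coeff b' d = 0" using d1 q(1) by (simp add: b'_def g_def d_def coeff_pCons split: nat.splits)
    moreover have "degree (b * [:0,1:]) \<le> d" using degree_mult_le[of b "[:0,1:]"] d1 by simp
    then have "degree b' \<le> d" unfolding b'_def by (intro degree_diff_le) (auto simp: d_def intro: order_trans[OF degree_smult_le])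
    ultimately show ?thesis using d1 by (metis leading_coeff_0_iff le_neq_implies_less degree_0 less_le_trans zero_less_one)
  qed
  then have "ordle (\<lambda>R. f R - g * (py R / px R)) 0"
  proof (intro ordleI[of "q * [:0,1:]" "a * [:0,1:]" _ b'])
    have dq: "degree (q * [:0,1:]) = d + 1" using q by (subst degree_mult_eq) (auto simp: d_def)
    show "2 * int (degree (a * [:0,1:])) \<le> 2 * int (degree (q * [:0,1:])) + 0"
      using degree_mult_le[of a "[:0,1:]"] d1 unfolding dq by simp
    assume "degree b' < d"
    then show "2 * int (degree b') + 3 \<le> 2 * int (degree (q * [:0,1:])) + 0" unfolding dq by simp
    show "\<forall>\<^sub>F R in gen. (f R - g * (py R / px R)) * poly (q * [:0,1:]) (px R) = poly (a * [:0,1:]) (px R) + poly b' (px R) * py R"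
      using q(4) gen_px[of 0]
    proof eventually_elim
      case (elim R)
      have "(f R - g * (py R / px R)) * poly (q * [:0,1:]) (px R) = (f R * poly q (px R)) * px R - g * py R * poly q (px R)"
        using elim(2) by (simp add: field_simps)
      then show ?case unfolding elim(1) b'_def by (simp add: algebra_simps)
    qed
  qed (use q in auto)
  then show ?thesis ..
qed

lemma not_ordle_yx: "ordle (\<lambda>R. c * (py R / px R)) 0 \<Longrightarrow> c = 0"
proof -
  assume "ordle (\<lambda>R. c * (py R / px R)) 0"
  from ordle_mult[OF this ordle_px] have "ordle (\<lambda>R. c * (py R / px R) * px R) 2" by simp
  moreover have "rp (\<lambda>R. c * (py R / px R) * px R) 0 [:c:]"
    unfolding rp_def using gen_px[of 0] by eventually_elim simp
  ultimately show "c = 0" using ordle_rp(2)[of _ 0 "[:c:]" 2] by simp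
qed

end

section \<open>Functions invariant under a finite subgroup\<close>

context ecv
begin

lemma poly_degree_drop:
  fixes p :: "'b::comm_ring_1 poly"
  shows "degree p \<le> n \<Longrightarrow> coeff p n = 0 \<Longrightarrow> n \<ge> 1 \<Longrightarrow> degree p < n"
  by (metis leading_coeff_0_iff le_neq_implies_less degree_0 less_le_trans zero_less_one)

lemma ordleE':
  assumes "ordle f n"
  obtains a b q where "q \<noteq> 0" "degree q \<ge> 1" "2 * int (degree a) \<le> 2 * int (degree q) + n"
     "2 * int (degree b) + 3 \<le> 2 * int (degree q) + n"
     "\<forall>\<^sub>F R in gen. f R * poly q (px R) = poly a (px R) + poly b (px R) * py R"
proof -
  from assms obtain a b q where q: "q \<noteq> 0" "2 * int (degree a) \<le> 2 * int (degree q) + n"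
     "2 * int (degree b) + 3 \<le> 2 * int (degree q) + n"
     "\<forall>\<^sub>F R in gen. f R * poly q (px R) = poly a (px R) + poly b (px R) * py R" by (rule ordleE)
  have d: "degree (q * [:0,1:]) = degree q + 1" using q by (subst degree_mult_eq) auto
  show ?thesis
  proof (rule that[of "q * [:0,1:]" "a * [:0,1:]" "b * [:0,1:]"])
    show "\<forall>\<^sub>F R in gen. f R * poly (q * [:0,1:]) (px R) = poly (a * [:0,1:]) (px R) + poly (b * [:0,1:]) (px R) * py R"
      using q(4)
    proof eventually_elim
      case (elim R)
      then have "f R * poly q (px R) * px R = (poly a (px R) + poly b (px R) * py R) * px R" by simp
      then show ?case by (simp add: algebra_simps)
    qed
  qed (use q d degree_mult_le[of a "[:0,1:]"] degree_mult_le[of b "[:0,1:]"] in auto)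
qed

lemma ordle_lead_3:
  assumes "ordle f 3" shows "\<exists>g. ordle (\<lambda>R. f R - g * py R) 2"
proof -
  from assms obtain a b q where q: "q \<noteq> 0" "degree q \<ge> 1" "2 * int (degree a) \<le> 2 * int (degree q) + 3"
     "2 * int (degree b) + 3 \<le> 2 * int (degree q) + 3"
     "\<forall>\<^sub>F R in gen. f R * poly q (px R) = poly a (px R) + poly b (px R) * py R" by (rule ordleE')
  define g where "g = coeff b (degree q) / lead_coeff q"
  have "degree (b - smult g q) < degree q"
    using q by (intro poly_degree_drop) (auto simp: g_def intro!: degree_diff_le order_trans[OF degree_smult_le])
  moreover have da: "degree a \<le> degree q + 1" using q(3) by presburger
  ultimately have "ordle (\<lambda>R. f R - g * py R) 2"
  proof (intro ordleI[of q a _ "b - smult g q"])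
    show "\<forall>\<^sub>F R in gen. (f R - g * py R) * poly q (px R) = poly a (px R) + poly (b - smult g q) (px R) * py R"
      using q(5) by eventually_elim (simp add: algebra_simps)
  qed (use q da in auto)
  then show ?thesis ..
qed

lemma ordle_lead_2:
  assumes "ordle f 2" shows "\<exists>g. ordle (\<lambda>R. f R - g * px R) 1"
proof -
  from assms obtain a b q where q: "q \<noteq> 0" "degree q \<ge> 1" "2 * int (degree a) \<le> 2 * int (degree q) + 2"
     "2 * int (degree b) + 3 \<le> 2 * int (degree q) + 2"
     "\<forall>\<^sub>F R in gen. f R * poly q (px R) = poly a (px R) + poly b (px R) * py R" by (rule ordleE')
  define g where "g = coeff a (degree q + 1) / lead_coeff q"
  have d: "degree (pCons 0 q) = degree q + 1" using q by simp
  have "degree (a - smult g (pCons 0 q)) < degree q + 1"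
    using q d by (intro poly_degree_drop degree_diff_le order_trans[OF degree_smult_le]) (auto simp: g_def)
  moreover have db: "degree b + 1 \<le> degree q" using q(4) by presburger
  ultimately have "ordle (\<lambda>R. f R - g * px R) 1"
  proof (intro ordleI[of q "a - smult g (pCons 0 q)" _ b])
    show "\<forall>\<^sub>F R in gen. (f R - g * px R) * poly q (px R) = poly (a - smult g (pCons 0 q)) (px R) + poly b (px R) * py R"
      using q(5) by eventually_elim (simp add: algebra_simps)
  qed (use q db in auto)
  then show ?thesis ..
qed

lemma ordle_ratio:
  assumes "q \<noteq> 0" "degree p \<le> degree q + n" "\<forall>\<^sub>F R in gen. f R * poly q (px R) = poly p (px R)"
  shows "ordle f (2 * int n)"
proof (rule ordleI[of "q * [:0,0,1:]" "p * [:0,0,1:]" _ 0])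
  have d: "degree (q * [:0,0,1:]) = degree q + 2" using assms by (subst degree_mult_eq) auto
  show "2 * int (degree (p * [:0,0,1:])) \<le> 2 * int (degree (q * [:0,0,1:])) + 2 * int n"
    "2 * int (degree (0::'a poly)) + 3 \<le> 2 * int (degree (q * [:0,0,1:])) + 2 * int n"
    using degree_mult_le[of p "[:0,0,1:]"] assms(2) unfolding d by simp_all
  show "\<forall>\<^sub>F R in gen. f R * poly (q * [:0,0,1:]) (px R) = poly (p * [:0,0,1:]) (px R) + poly 0 (px R) * py R"
    using assms(3)
  proof eventually_elim
    case (elim R)
    then have "f R * poly q (px R) * (px R * px R) = poly p (px R) * (px R * px R)" by simp
    then show ?case by (simp add: algebra_simps)
  qed
qed (use assms in auto)

end

definition Kpoly :: "'b::zero set \<Rightarrow> 'b poly \<Rightarrow> bool" where "Kpoly K p \<longleftrightarrow> (\<forall>i. coeff p i \<in> K)"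

text \<open>The condition \<open>cardC\<close> serves to divide by the order of C in the residue
  count of \<open>inv_simple_pole\<close>.\<close>

locale ecsub = ecv E for E :: "'a::alg_closed_field wcurve" +
  fixes C :: "'a ecpt set"
  assumes finC: "finite C" and InfC: "Inf \<in> C" and onC: "\<And>c. c \<in> C \<Longrightarrow> on_curve E c"
    and addC: "\<And>c d. c \<in> C \<Longrightarrow> d \<in> C \<Longrightarrow> c \<oplus> d \<in> C"
    and negC: "\<And>c. c \<in> C \<Longrightarrow> \<ominus> c \<in> C"
    and cardC: "(of_nat (card C) :: 'a) \<noteq> 0"
begin

section \<open>Functions regular outside the subgroup C\<close>

definition "C' = C - {Inf}"
definition vC :: "'a poly" where "vC = (\<Prod>c\<in>C'. [:- px c, 1:])"

lemma C'D: "c \<in> C' \<Longrightarrow> c \<in> C \<and> on_curve E c \<and> c \<noteq> Inf \<and> c = Pt (px c) (py c) \<and> on_curve E (Pt (px c) (py c))"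
  using onC Pt_eq unfolding C'_def by (metis DiffD1 DiffD2 singletonI)

lemma finC': "finite C'" by (simp add: C'_def finC)

lemma C_insert: "C = insert Inf C'" "Inf \<notin> C'" using InfC by (auto simp: C'_def)

lemma card_C: "card C = card C' + 1"
proof -
  have "card C = card (insert Inf C')" by (rule arg_cong[OF C_insert(1)])
  then show ?thesis using C_insert(2) finC' by simp
qed

lemma negC': "c \<in> C' \<Longrightarrow> \<ominus> c \<in> C'" using negC by (auto simp: C'_def)

lemma vC_root: "poly vC s = 0 \<longleftrightarrow> s \<in> px ` C'"
  by (auto simp: vC_def poly_prod finC')

lemma vC_nz: "vC \<noteq> 0" by (simp add: vC_def finC')

text \<open>\<open>f\<close> is regular outside \<open>C\<close>, pointwise and not only generically.\<close>

definition AC :: "('a ecpt \<Rightarrow> 'a) \<Rightarrow> bool" where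
  "AC f \<longleftrightarrow> (\<exists>N a b. \<forall>x y. on_curve E (Pt x y) \<longrightarrow> Pt x y \<notin> C \<longrightarrow>
     f (Pt x y) * poly vC x ^ N = poly a x + poly b x * y)"

lemma ACI: "(\<And>x y. on_curve E (Pt x y) \<Longrightarrow> Pt x y \<notin> C \<Longrightarrow> f (Pt x y) * poly vC x ^ N = poly a x + poly b x * y) \<Longrightarrow> AC f"
  unfolding AC_def by blast

lemma ACE:
  assumes "AC f"
  obtains N a b where "\<And>x y. on_curve E (Pt x y) \<Longrightarrow> Pt x y \<notin> C \<Longrightarrow> f (Pt x y) * poly vC x ^ N = poly a x + poly b x * y"
  using assms unfolding AC_def by blast

lemma AC_cong: "AC f \<Longrightarrow> (\<And>x y. on_curve E (Pt x y) \<Longrightarrow> Pt x y \<notin> C \<Longrightarrow> f (Pt x y) = g (Pt x y)) \<Longrightarrow> AC g"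
  by (erule ACE) (rule ACI, simp del: on_curve.simps)

lemma px_notin_C: "on_curve E (Pt x y) \<Longrightarrow> Pt x y \<notin> C \<Longrightarrow> c \<in> C' \<Longrightarrow> x \<noteq> px c"
  using px_eq[of c "Pt x y"] C'D negC' by (metis ecpt.distinct(1) px.simps(2) C'_def DiffD1)

lemma vC_notin_C: "on_curve E (Pt x y) \<Longrightarrow> Pt x y \<notin> C \<Longrightarrow> poly vC x \<noteq> 0"
  using px_notin_C by (auto simp: vC_root simp del: on_curve.simps)

lemma gen_notin_C: "\<forall>\<^sub>F R in gen. R \<notin> C"
  unfolding eventually_gen by (rule finite_subset[OF _ finC]) auto

lemma reg_AC: assumes "AC f" shows "\<exists>N. reg (\<lambda>R. f R * poly vC (px R) ^ N)"
proof -
  obtain N a b where N: "\<And>x y. on_curve E (Pt x y) \<Longrightarrow> Pt x y \<notin> C \<Longrightarrow> f (Pt x y) * poly vC x ^ N = poly a x + poly b x * y"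
    by (rule ACE[OF assms], rule that, blast)
  have "rp (\<lambda>R. f R * poly vC (px R) ^ N) a b" unfolding rp_def using gen_Pt gen_notin_C
  proof eventually_elim
    case (elim R)
    obtain x y where R: "R = Pt x y" "on_curve E (Pt x y)" using elim(1) by metis
    show ?case using N[OF R(2)] elim(2) unfolding R(1) by simp
  qed
  then show ?thesis by (auto simp: reg_def)
qed

text \<open>The representation by polynomials is unique, and \<open>vC\<close> has no zero at points
  outside C. Thus generic identities between such functions become identities at every point outside
  C, as needed for an honest map of points.\<close>

lemma AC_zero:
  assumes "AC f" "\<forall>\<^sub>F R in gen. f R = 0" "on_curve E R" "R \<notin> C" shows "f R = 0"
proof -
  obtain N a b where N: "\<And>x y. on_curve E (Pt x y) \<Longrightarrow> Pt x y \<notin> C \<Longrightarrow> f (Pt x y) * poly vC x ^ N = poly a x + poly b x * y"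
    by (rule ACE[OF assms(1)], rule that, blast)
  have "rp (\<lambda>R. 0) a b" unfolding rp_def using gen_Pt gen_notin_C assms(2)
  proof eventually_elim
    case (elim R)
    obtain x y where R: "R = Pt x y" "on_curve E (Pt x y)" using elim(1) by metis
    show ?case using N[OF R(2)] elim(2,3) unfolding R(1) by simp
  qed
  then have ab: "a = 0" "b = 0" using rp_0 by blast+
  obtain x y where R: "R = Pt x y" using assms(4) InfC by (cases R) auto
  show ?thesis using N[of x y] vC_notin_C[of x y] assms(3,4) unfolding R ab by simp
qed

lemma AC_mult: assumes "AC f" "AC g" shows "AC (\<lambda>R. f R * g R)"
proof -
  obtain N a b where N: "\<And>x y. on_curve E (Pt x y) \<Longrightarrow> Pt x y \<notin> C \<Longrightarrow> f (Pt x y) * poly vC x ^ N = poly a x + poly b x * y"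
    by (rule ACE[OF assms(1)], rule that, blast)
  obtain M c d where M: "\<And>x y. on_curve E (Pt x y) \<Longrightarrow> Pt x y \<notin> C \<Longrightarrow> g (Pt x y) * poly vC x ^ M = poly c x + poly d x * y"
    by (rule ACE[OF assms(2)], rule that, blast)
  show ?thesis
  proof (rule ACI[of _ "N + M" "a * c + b * d * W3" "a * d + b * c - b * d * A1"])
    fix x y assume c0: "on_curve E (Pt x y)" "Pt x y \<notin> C"
    have z: "x^3 + a2*x^2 + a4*x + a6 - a1*x*y - a3*y - y^2 = 0" using c0(1) by (simp add: algebra_simps)
    have "f (Pt x y) * g (Pt x y) * poly vC x ^ (N + M) = (f (Pt x y) * poly vC x ^ N) * (g (Pt x y) * poly vC x ^ M)"
      by (simp add: power_add)
    also have "\<dots> = (poly a x + poly b x * y) * (poly c x + poly d x * y)" unfolding N[OF c0] M[OF c0] ..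
    also have "\<dots> = poly (a * c + b * d * W3) x + poly (a * d + b * c - b * d * A1) x * y
       - poly b x * poly d x * (x^3 + a2*x^2 + a4*x + a6 - a1*x*y - a3*y - y^2)"
      by (simp add: algebra_simps power2_eq_square power3_eq_cube)
    finally show "f (Pt x y) * g (Pt x y) * poly vC x ^ (N + M) = poly (a * c + b * d * W3) x + poly (a * d + b * c - b * d * A1) x * y"
      unfolding z by simp
  qed
qed

lemma AC_add: assumes "AC f" "AC g" shows "AC (\<lambda>R. f R + g R)"
proof -
  obtain N a b where N: "\<And>x y. on_curve E (Pt x y) \<Longrightarrow> Pt x y \<notin> C \<Longrightarrow> f (Pt x y) * poly vC x ^ N = poly a x + poly b x * y"
    by (rule ACE[OF assms(1)], rule that, blast)
  obtain M c d where M: "\<And>x y. on_curve E (Pt x y) \<Longrightarrow> Pt x y \<notin> C \<Longrightarrow> g (Pt x y) * poly vC x ^ M = poly c x + poly d x * y"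
    by (rule ACE[OF assms(2)], rule that, blast)
  show ?thesis
  proof (rule ACI[of _ "N + M" "a * vC ^ M + c * vC ^ N" "b * vC ^ M + d * vC ^ N"])
    fix x y assume c0: "on_curve E (Pt x y)" "Pt x y \<notin> C"
    have "(f (Pt x y) + g (Pt x y)) * poly vC x ^ (N + M) = (f (Pt x y) * poly vC x ^ N) * poly vC x ^ M + (g (Pt x y) * poly vC x ^ M) * poly vC x ^ N"
      by (simp add: power_add algebra_simps)
    then show "(f (Pt x y) + g (Pt x y)) * poly vC x ^ (N + M) = poly (a * vC ^ M + c * vC ^ N) x + poly (b * vC ^ M + d * vC ^ N) x * y"
      unfolding N[OF c0] M[OF c0] by (simp add: algebra_simps)
  qed
qed

lemma AC_const: "AC (\<lambda>R. c)" by (rule ACI[of _ 0 "[:c:]" 0]) simp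
lemma AC_px: "AC px" by (rule ACI[of _ 0 "[:0,1:]" 0]) simp
lemma AC_py: "AC py" by (rule ACI[of _ 0 0 1]) simp

lemma AC_scale: "AC f \<Longrightarrow> AC (\<lambda>R. c * f R)" by (rule AC_mult[OF AC_const])

lemma AC_diff: "AC f \<Longrightarrow> AC g \<Longrightarrow> AC (\<lambda>R. f R - g R)"
  using AC_add[of f "\<lambda>R. (-1) * g R"] AC_scale[of g "-1"] by simp

lemma AC_sum: "(\<And>i. i \<in> I \<Longrightarrow> AC (f i)) \<Longrightarrow> AC (\<lambda>R. \<Sum>i\<in>I. f i R)"
  by (induction I rule: infinite_finite_induct) (auto simp: AC_const intro: AC_add)

lemma AC_prod: "(\<And>i. i \<in> I \<Longrightarrow> AC (f i)) \<Longrightarrow> AC (\<lambda>R. \<Prod>i\<in>I. f i R)"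
  by (induction I rule: infinite_finite_induct) (auto simp: AC_const intro: AC_mult)

lemma AC_power: "AC f \<Longrightarrow> AC (\<lambda>R. f R ^ n)"
  by (induction n) (auto simp: AC_const intro: AC_mult)

lemma AC_inv: assumes "c \<in> C'" shows "AC (\<lambda>R. 1 / (px R - px c))"
proof -
  have v: "vC = [:- px c, 1:] * (\<Prod>c\<in>C' - {c}. [:- px c, 1:])"
    unfolding vC_def using assms finC' by (rule prod.remove[rotated])
  show ?thesis
  proof (rule ACI[of _ 1 "\<Prod>c\<in>C' - {c}. [:- px c, 1:]" 0])
    fix x y assume "on_curve E (Pt x y)" "Pt x y \<notin> C"
    then have "x \<noteq> px c" using px_notin_C assms by blast
    moreover have "poly vC x = (x - px c) * poly (\<Prod>c\<in>C' - {c}. [:- px c, 1:]) x" unfolding v poly_mult by simp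
    ultimately show "1 / (px (Pt x y) - px c) * poly vC x ^ 1 = poly (\<Prod>c\<in>C' - {c}. [:- px c, 1:]) x + poly 0 x * y" by simp
  qed
qed

lemma AC_tau: assumes "c \<in> C" shows "AC (\<lambda>R. px (R \<oplus> c))" "AC (\<lambda>R. py (R \<oplus> c))"
proof -
  show x: "AC (\<lambda>R. px (R \<oplus> c))"
  proof (cases "c = Inf")
    case False
    then have c: "c \<in> C'" using assms by (simp add: C'_def)
    define s t where "s = px c" "t = py c"
    have cc: "c = Pt s t" "on_curve E (Pt s t)" using C'D[OF c] by (simp_all add: s_t_def)
    have "AC (\<lambda>R. s + (- (2*t + a1*s + a3) * py R + (3*s^2 + 2*a2*s + a4 - a1*t) * px R + (a4*s + 2*a6 - a3*t - s^3))
       * ((1 / (px R - px c)) * (1 / (px R - px c))))"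
      by (intro AC_add AC_mult AC_const AC_inv c AC_px AC_py)
    then show ?thesis
    proof (rule AC_cong)
      fix x y assume xy: "on_curve E (Pt x y)" "Pt x y \<notin> C"
      define R where "R = Pt x y"
      have xs: "x \<noteq> s" using px_notin_C[OF xy c] by (simp add: s_t_def)
      show "s + (- (2*t + a1*s + a3) * py (Pt x y) + (3*s^2 + 2*a2*s + a4 - a1*t) * px (Pt x y) + (a4*s + 2*a6 - a3*t - s^3))
       * ((1 / (px (Pt x y) - px c)) * (1 / (px (Pt x y) - px c))) = px (Pt x y \<oplus> c)"
        unfolding R_def[symmetric]
      proof -
        have e: "(px (R \<oplus> c) - s) * (px R - s)^2 = - (2*t + a1*s + a3) * py R + (3*s^2 + 2*a2*s + a4 - a1*t) * px R + (a4*s + 2*a6 - a3*t - s^3)"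
          using add_formula(1)[OF xy(1) cc(2) xs] unfolding R_def cc(1) px.simps py.simps .
        have n: "px R - s \<noteq> 0" using xs by (simp add: R_def)
        have "s + ((px (R \<oplus> c) - s) * (px R - s)^2) * ((1 / (px R - px c)) * (1 / (px R - px c))) = px (R \<oplus> c)"
          using n by (simp add: s_t_def[symmetric] power2_eq_square)
        then show "s + (- (2*t + a1*s + a3) * py R + (3*s^2 + 2*a2*s + a4 - a1*t) * px R + (a4*s + 2*a6 - a3*t - s^3))
       * ((1 / (px R - px c)) * (1 / (px R - px c))) = px (R \<oplus> c)" unfolding e .
      qed
    qed
  qed (simp add: AC_px)
  show "AC (\<lambda>R. py (R \<oplus> c))"
  proof (cases "c = Inf")
    case False
    then have c: "c \<in> C'" using assms by (simp add: C'_def)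
    define s t where "s = px c" "t = py c"
    have cc: "c = Pt s t" "on_curve E (Pt s t)" using C'D[OF c] by (simp_all add: s_t_def)
    have "AC (\<lambda>R. (-1) * (((py R - t) * (px (R \<oplus> c) - s)) * (1 / (px R - px c))) - (t + a1*px (R \<oplus> c) + a3))"
      by (intro AC_add AC_mult AC_diff AC_const AC_inv c AC_px AC_py x)
    then show ?thesis
    proof (rule AC_cong)
      fix x y assume xy: "on_curve E (Pt x y)" "Pt x y \<notin> C"
      define R where "R = Pt x y"
      have xs: "x \<noteq> s" using px_notin_C[OF xy c] by (simp add: s_t_def)
      show "(-1) * (((py (Pt x y) - t) * (px (Pt x y \<oplus> c) - s)) * (1 / (px (Pt x y) - px c))) - (t + a1*px (Pt x y \<oplus> c) + a3) = py (Pt x y \<oplus> c)"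
        unfolding R_def[symmetric]
      proof -
        have e: "(py (R \<oplus> c) + t + a1*px (R \<oplus> c) + a3) * (px R - s) = - ((py R - t) * (px (R \<oplus> c) - s))"
          using add_formula(2)[OF xy(1) cc(2) xs] unfolding R_def cc(1) px.simps py.simps .
        have n: "px R - s \<noteq> 0" using xs by (simp add: R_def)
        have "(-1) * (((py R - t) * (px (R \<oplus> c) - s)) * (1 / (px R - px c))) = (- ((py R - t) * (px (R \<oplus> c) - s))) / (px R - s)"
          by (simp add: s_t_def)
        also have "\<dots> = py (R \<oplus> c) + t + a1*px (R \<oplus> c) + a3" unfolding e[symmetric] using n by simp
        finally show "(-1) * (((py R - t) * (px (R \<oplus> c) - s)) * (1 / (px R - px c))) - (t + a1*px (R \<oplus> c) + a3) = py (R \<oplus> c)" by simp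
      qed
    qed
  qed (simp add: AC_py)
qed

text \<open>Roots s of the denominator are cancelled one at a time. Regularity of f forces a + b y
  to vanish at the points over s. If there are two of them, with different y, then a and b vanish at
  s; the remaining case of a two-torsion point needs second-order information.\<close>

lemma regular_at_C_aux:
  assumes "q \<noteq> 0" "\<And>s. poly q s = 0 \<Longrightarrow> s \<in> px ` C'"
    and "\<forall>\<^sub>F R in gen. f R * poly q (px R) = poly a (px R) + poly b (px R) * py R"
    and f: "\<And>c. c \<in> C' \<Longrightarrow> ordle (\<lambda>R. f (R \<oplus> c)) 0"
  shows "reg f"
  using assms(1-3)
proof (induction "degree q" arbitrary: q a b)
  case 0
  then obtain k where k: "q = [:k:]" by (metis degree_eq_zeroE)
  have "rp f (smult (1/k) a) (smult (1/k) b)" unfolding rp_def using 0(4)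
  proof eventually_elim
    case (elim R)
    have "k \<noteq> 0" using 0(2) k by auto
    moreover have "f R * k = poly a (px R) + poly b (px R) * py R" using elim k by simp
    ultimately show ?case by (simp add: field_simps)
  qed
  then show ?case by (auto simp: reg_def)
next
  case (Suc n)
  then obtain s where s0: "poly q s = 0" using alg_closed_imp_poly_has_root[of q] by auto
  then obtain c where c: "c \<in> C'" "px c = s" using Suc.prems(2) by force
  obtain q1 where q1: "q = [:-s,1:] * q1" using s0 unfolding poly_eq_0_iff_dvd by (elim dvdE)
  have q10: "q1 \<noteq> 0" using q1 Suc.prems by auto
  have dq: "degree q = Suc (degree q1)" unfolding q1 using q10 degree_mult_eq[of "[:-s,1:]" q1] by simp
  text \<open>Comparing constant terms at a point \<open>d\<close> of \<open>C\<close> over \<open>s\<close>.\<close>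
  have at: "ordle (\<lambda>R. poly a (px (R \<oplus> d)) + poly b (px (R \<oplus> d)) * py (R \<oplus> d)) k"
    if d: "d \<in> C'" "px d = s" and k: "ordle (\<lambda>R. px (R \<oplus> d) - s) k" for d k
  proof -
    have "ordle (\<lambda>R. f (R \<oplus> d) * ((px (R \<oplus> d) - s) * poly q1 (px (R \<oplus> d)))) (0 + (k + 0))"
      using C'D[OF d(1)] by (intro ordle_mult f d k ordle_poly tau_px_0) auto
    then have "ordle (\<lambda>R. f (R \<oplus> d) * ((px (R \<oplus> d) - s) * poly q1 (px (R \<oplus> d)))) k"
      by (simp only: add_0 add_0_right)
    moreover have "\<forall>\<^sub>F R in gen. f (R \<oplus> d) * ((px (R \<oplus> d) - s) * poly q1 (px (R \<oplus> d)))
       = poly a (px (R \<oplus> d)) + poly b (px (R \<oplus> d)) * py (R \<oplus> d)"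
    proof -
      have "\<forall>\<^sub>F R in gen. f (R \<oplus> d) * poly q (px (R \<oplus> d)) = poly a (px (R \<oplus> d)) + poly b (px (R \<oplus> d)) * py (R \<oplus> d)"
        using gen_add[OF Suc.prems(3), of d] C'D[OF d(1)] by blast
      then show ?thesis by eventually_elim (simp add: q1 algebra_simps)
    qed
    ultimately show ?thesis by (rule ordle_cong)
  qed
  have val: "poly a s + poly b s * py d = 0" if d: "d \<in> C'" "px d = s" for d
  proof -
    have dd: "on_curve E (Pt s (py d))" "d = Pt s (py d)" using C'D[OF d(1)] d(2) by simp_all
    have p: "ordle (\<lambda>R. px (R \<oplus> d) - s) (-1)" "ordle (\<lambda>R. py (R \<oplus> d) - py d) (-1)"
      using tau_px[OF dd(1)] tau_py[OF dd(1)] dd(2) by simp_all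
    have "ordle (\<lambda>R. (poly a (px (R \<oplus> d)) + poly b (px (R \<oplus> d)) * py (R \<oplus> d))
      - ((poly a (px (R \<oplus> d)) - poly a s) + ((poly b (px (R \<oplus> d)) - poly b s) * py (R \<oplus> d) + poly b s * (py (R \<oplus> d) - py d)))) (-1)"
    proof (rule ordle_diff[OF at[OF d p(1)]], rule ordle_add)
      show "ordle (\<lambda>R. poly a (px (R \<oplus> d)) - poly a s) (-1)" by (rule ordle_poly_lim[OF p(1)]) simp
      have "ordle (\<lambda>R. (poly b (px (R \<oplus> d)) - poly b s) * py (R \<oplus> d)) (-1 + 0)"
        using C'D[OF d(1)] by (intro ordle_mult ordle_poly_lim[OF p(1)] tau_px_0) auto
      then have "ordle (\<lambda>R. (poly b (px (R \<oplus> d)) - poly b s) * py (R \<oplus> d)) (-1)" by (simp only: add_0_right)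
      then show "ordle (\<lambda>R. (poly b (px (R \<oplus> d)) - poly b s) * py (R \<oplus> d) + poly b s * (py (R \<oplus> d) - py d)) (-1)"
        by (rule ordle_add) (rule ordle_scale[OF p(2)])
    qed
    moreover have "(poly a (px (R \<oplus> d)) + poly b (px (R \<oplus> d)) * py (R \<oplus> d))
      - ((poly a (px (R \<oplus> d)) - poly a s) + ((poly b (px (R \<oplus> d)) - poly b s) * py (R \<oplus> d) + poly b s * (py (R \<oplus> d) - py d)))
      = poly a s + poly b s * py d" for R by (simp add: algebra_simps)
    ultimately have "ordle (\<lambda>R. poly a s + poly b s * py d) (-1)" by simp
    then show ?thesis using ordle_const_neg by simp
  qed
  define t where "t = py c"
  have cc: "c = Pt s t" "on_curve E (Pt s t)" using C'D[OF c(1)] c(2) by (simp_all add: t_def)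
  have onc: "on_curve E c" using cc by simp
  have v1: "poly a s + poly b s * t = 0" using val[OF c] by (simp add: t_def)
  have v2: "poly a s + poly b s * (- t - a1*s - a3) = 0"
    using val[of "\<ominus> c"] negC'[OF c(1)] cc(1) by simp
  have bs: "poly b s = 0"
  proof (cases "2*t + a1*s + a3 = 0")
    case False
    have "poly b s * (2*t + a1*s + a3) = 0" using v1 v2 by algebra
    then show ?thesis using False by simp
  next
    \<comment> \<open>Only one linear equation is available here, but x - s vanishes to order two,
      and so does the numerator. If b(s) were nonzero, y - t would vanish to order two as well, and
      (y - t)^2 = (x - s) e with e nonzero at the point would give x - s a zero of order at least
      three, against \<open>tau_px_2\<close>.\<close>
    case True
    show ?thesis
    proof (rule ccontr)
      assume b0: "poly b s \<noteq> 0"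
      note p2 = tau_px_2[OF cc(2) True]
      have l: "ordle (\<lambda>R. px (R \<oplus> c) - s) (-2)" using p2(1) cc(1) by simp
      have "ordle (\<lambda>R. (poly a (px (R \<oplus> c)) + poly b (px (R \<oplus> c)) * py (R \<oplus> c))
        - ((poly a (px (R \<oplus> c)) - poly a s) + (poly b (px (R \<oplus> c)) - poly b s) * py (R \<oplus> c))) (-2)"
      proof (rule ordle_diff[OF at[OF c l]], rule ordle_add)
        show "ordle (\<lambda>R. poly a (px (R \<oplus> c)) - poly a s) (-2)" by (rule ordle_poly_lim[OF l]) simp
        have "ordle (\<lambda>R. (poly b (px (R \<oplus> c)) - poly b s) * py (R \<oplus> c)) (-2 + 0)"
          using C'D[OF c(1)] by (intro ordle_mult ordle_poly_lim[OF l] tau_px_0) auto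
        then show "ordle (\<lambda>R. (poly b (px (R \<oplus> c)) - poly b s) * py (R \<oplus> c)) (-2)" by (simp only: add_0_right)
      qed
      moreover have "(poly a (px (R \<oplus> c)) + poly b (px (R \<oplus> c)) * py (R \<oplus> c))
        - ((poly a (px (R \<oplus> c)) - poly a s) + (poly b (px (R \<oplus> c)) - poly b s) * py (R \<oplus> c))
        = poly b s * (py (R \<oplus> c) - t)" for R using v1 by (simp add: algebra_simps)
      ultimately have "ordle (\<lambda>R. poly b s * (py (R \<oplus> c) - t)) (-2)" by simp
      from ordle_scale[OF this, of "1 / poly b s"]
      have yt: "ordle (\<lambda>R. py (R \<oplus> c) - t) (-2)" using b0 by simp
      define e where "e R = px R ^2 + px R * s + s^2 + a2 * (px R + s) + a4 - a1 * py R" for R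
      define e0 where "e0 = 3*s^2 + 2*a2*s + a4 - a1*t"
      have e0: "e0 \<noteq> 0" using smooth[OF cc(2) True] by (simp add: e0_def)
      have x0: "ordle (\<lambda>R. px (R \<oplus> c)) 0" using tau_px_0(1) C'D[OF c(1)] by simp
      have "ordle (\<lambda>R. (px (R \<oplus> c) - s) * ((px (R \<oplus> c) + 2 * s) + a2)) (-1 + 0)"
        by (intro ordle_mult ordle_add x0 ordle_const ordle_mono[OF l]) simp
      moreover have "ordle (\<lambda>R. a1 * (py (R \<oplus> c) - t)) (-1)" by (intro ordle_scale ordle_mono[OF yt]) simp
      ultimately have "ordle (\<lambda>R. (px (R \<oplus> c) - s) * ((px (R \<oplus> c) + 2 * s) + a2) - a1 * (py (R \<oplus> c) - t)) (-1)"
        by (intro ordle_diff) simp_all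
      moreover have "(px (R \<oplus> c) - s) * ((px (R \<oplus> c) + 2 * s) + a2) - a1 * (py (R \<oplus> c) - t) = e (R \<oplus> c) - e0" for R
        by (simp add: e_def e0_def algebra_simps power2_eq_square)
      ultimately have el: "ordle (\<lambda>R. e (R \<oplus> c) - e0) (-1)" by simp
      have rel: "\<forall>\<^sub>F R in gen. (py (R \<oplus> c) - t) * (py (R \<oplus> c) - t) = (px (R \<oplus> c) - s) * e (R \<oplus> c)"
        using gen_add[OF gen_curve onc]
      proof eventually_elim
        case (elim R)
        have tt: "- t - a1 * s - a3 = t" using True by algebra
        from neg_prod[OF cc(2) elim(1)] show ?case unfolding tt e_def .
      qed
      have "ordle (\<lambda>R. (px (R \<oplus> c) - s) * e (R \<oplus> c)) (-2 + -2)"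
        by (rule ordle_cong[OF ordle_mult[OF yt yt] rel])
      then have "ordle (\<lambda>R. (px (R \<oplus> c) - s) * e (R \<oplus> c)) (-3)" by (rule ordle_mono) simp
      moreover have "ordle (\<lambda>R. (px (R \<oplus> c) - s) * (e (R \<oplus> c) - e0)) (-3)" using ordle_mult[OF l el] by simp
      ultimately have "ordle (\<lambda>R. (1/e0) * ((px (R \<oplus> c) - s) * e (R \<oplus> c) - (px (R \<oplus> c) - s) * (e (R \<oplus> c) - e0))) (-3)"
        by (intro ordle_scale ordle_diff)
      moreover have "(1/e0) * ((px (R \<oplus> c) - s) * e (R \<oplus> c) - (px (R \<oplus> c) - s) * (e (R \<oplus> c) - e0)) = px (R \<oplus> Pt s t) - s" for R
        using e0 cc(1) by (simp add: field_simps)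
      ultimately show False using p2(2) by simp
    qed
  qed
  then have as: "poly a s = 0" using v1 by simp
  obtain a' b' where ab: "a = [:-s,1:] * a'" "b = [:-s,1:] * b'" using as bs unfolding poly_eq_0_iff_dvd by (elim dvdE)
  show ?case
  proof (rule Suc.hyps(1))
    show "n = degree q1" using dq Suc.hyps(2) by simp
    show "\<forall>\<^sub>F R in gen. f R * poly q1 (px R) = poly a' (px R) + poly b' (px R) * py R"
      using Suc.prems(3) gen_px[of s]
    proof eventually_elim
      case (elim R)
      have "(px R - s) * (f R * poly q1 (px R)) = (px R - s) * (poly a' (px R) + poly b' (px R) * py R)"
        using elim(1) unfolding q1 ab poly_mult by (simp add: algebra_simps)
      then show ?case using elim(2) by simp
    qed
    fix z assume "poly q1 z = 0"
    then show "z \<in> px ` C'" using Suc.prems(2)[of z] q1 by simp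
  qed (use q10 in auto)
qed

lemma regular_at_C:
  assumes "AC f" "\<And>c. c \<in> C' \<Longrightarrow> ordle (\<lambda>R. f (R \<oplus> c)) 0"
  shows "reg f"
proof -
  obtain N a b where N: "rp (\<lambda>R. f R * poly vC (px R) ^ N) a b" using reg_AC[OF assms(1)] by (auto simp: reg_def)
  show ?thesis
  proof (rule regular_at_C_aux[OF _ _ _ assms(2)])
    show "vC ^ N \<noteq> 0" using vC_nz by simp
    show "\<forall>\<^sub>F R in gen. f R * poly (vC ^ N) (px R) = poly a (px R) + poly b (px R) * py R"
      using N by (simp add: rp_def poly_power)
    fix s assume "poly (vC ^ N) s = 0"
    then show "s \<in> px ` C'" by (simp add: poly_power vC_root split: if_splits)
  qed
qed

section \<open>Invariant functions with few poles\<close>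

definition inv :: "('a ecpt \<Rightarrow> 'a) \<Rightarrow> bool" where
  "inv f \<longleftrightarrow> (\<forall>c\<in>C. \<forall>\<^sub>F R in gen. f (R \<oplus> c) = f R)"

lemma invD: "inv f \<Longrightarrow> c \<in> C \<Longrightarrow> \<forall>\<^sub>F R in gen. f R = f (R \<oplus> c)"
  unfolding inv_def by (auto elim!: eventually_mono ballE[of _ _ c])

lemma inv_diff: "inv f \<Longrightarrow> inv g \<Longrightarrow> inv (\<lambda>R. f R - g R)"
  unfolding inv_def
proof (intro ballI)
  fix c assume "\<forall>c\<in>C. \<forall>\<^sub>F R in gen. f (R \<oplus> c) = f R" "\<forall>c\<in>C. \<forall>\<^sub>F R in gen. g (R \<oplus> c) = g R" "c \<in> C"
  then have "\<forall>\<^sub>F R in gen. f (R \<oplus> c) = f R" "\<forall>\<^sub>F R in gen. g (R \<oplus> c) = g R" by blast+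
  then show "\<forall>\<^sub>F R in gen. f (R \<oplus> c) - g (R \<oplus> c) = f R - g R" by eventually_elim simp
qed

lemma inv_map: "inv f \<Longrightarrow> inv (\<lambda>R. h (f R))"
  unfolding inv_def by (intro ballI) (auto elim!: eventually_mono ballE)

lemma regular_const:
  assumes "reg f" "ordle f 1" shows "\<exists>v. \<forall>\<^sub>F R in gen. f R = v"
proof -
  obtain a b where ab: "rp f a b" using assms by (auto simp: reg_def)
  have "b = 0" "degree a = 0" using ordle_rp[OF ab assms(2)] by auto
  then obtain v where "a = [:v:]" by (metis degree_eq_zeroE)
  then show ?thesis using ab \<open>b = 0\<close> by (intro exI[of _ v]) (simp add: rp_def)
qed

text \<open>Liouville's theorem: invariance transports regularity at infinity to every point of C,
  so nothing is left but a regular function without pole at infinity.\<close>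

lemma inv_const:
  assumes "AC f" "inv f" "ordle f 0" shows "\<exists>v. \<forall>\<^sub>F R in gen. f R = v"
proof (rule regular_const[OF regular_at_C])
  fix c assume "c \<in> C'"
  then show "ordle (\<lambda>R. f (R \<oplus> c)) 0" using ordle_cong[OF assms(3) invD[OF assms(2)]] C'D by blast
qed (use assms ordle_mono in auto)

text \<open>The slope \<open>mu c\<close> has simple poles exactly at \<open>Inf\<close> and \<open>c\<close>, with opposite residues. Adding all of them to
  an invariant function with at most simple poles on \<open>C\<close> leaves a single simple pole, of residue \<open>card C\<close>
  times the original one.\<close>

definition mu :: "'a ecpt \<Rightarrow> 'a ecpt \<Rightarrow> 'a" where
  "mu c R = (py R - py (\<ominus> c)) / (px R - px c)"

lemma AC_mu: "c \<in> C' \<Longrightarrow> AC (mu c)"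
proof -
  assume c: "c \<in> C'"
  have "AC (\<lambda>R. (py R - py (\<ominus> c)) * (1 / (px R - px c)))"
    by (intro AC_mult AC_diff AC_py AC_const AC_inv c)
  then show ?thesis by (simp add: mu_def[abs_def])
qed

lemma mu_Inf: "ordle (\<lambda>R. mu c R - py R / px R) 0"
proof -
  have "ordle (\<lambda>R. (px c * py R - py (\<ominus> c) * px R) * ((1 / (px R - px c)) * (1 / (px R - 0)))) (3 + (-2 + -2))"
    by (intro ordle_mult ordle_diff ordle_scale ordle_inv_px ordle_py ordle_mono[OF ordle_px]) auto
  then have "ordle (\<lambda>R. (px c * py R - py (\<ominus> c) * px R) * ((1 / (px R - px c)) * (1 / (px R - 0)))) 0"
    by (rule ordle_mono) simp
  then show ?thesis
  proof (rule ordle_cong)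
    show "\<forall>\<^sub>F R in gen. (px c * py R - py (\<ominus> c) * px R) * ((1 / (px R - px c)) * (1 / (px R - 0))) = mu c R - py R / px R"
      using gen_px[of "px c"] gen_px[of 0] by eventually_elim (simp add: mu_def field_simps)
  qed
qed

lemma mu_self: assumes c: "c \<in> C'" shows "ordle (\<lambda>R. mu c (R \<oplus> c) + py R / px R) 0"
proof -
  define s t where "s = px c" "t = py c"
  have cc: "c = Pt s t" "on_curve E (Pt s t)" using C'D[OF c] by (simp_all add: s_t_def)
  have "ordle (\<lambda>R. ((t * px R - s * py R)) * ((1 / (px R - s)) * (1 / (px R - 0)))) (3 + (-2 + -2))"
    by (intro ordle_mult ordle_diff ordle_scale ordle_inv_px ordle_py ordle_mono[OF ordle_px]) auto
  then have "ordle (\<lambda>R. ((t * px R - s * py R)) * ((1 / (px R - s)) * (1 / (px R - 0)))) 0" by (rule ordle_mono) simp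
  then have "ordle (\<lambda>R. ((t * px R - s * py R)) * ((1 / (px R - s)) * (1 / (px R - 0))) - a1) 0"
    by (rule ordle_diff[OF _ ordle_const])
  then show ?thesis
  proof (rule ordle_cong)
    have "\<forall>\<^sub>F R in gen. px (R \<oplus> c) \<noteq> s" using gen_add[OF gen_px[of s]] C'D[OF c] by blast
    then show "\<forall>\<^sub>F R in gen. ((t * px R - s * py R)) * ((1 / (px R - s)) * (1 / (px R - 0))) - a1 = mu c (R \<oplus> c) + py R / px R"
      using gen_add_formula[OF cc(2)] gen_px[of 0]
    proof eventually_elim
      case (elim R)
      define x y x' y' where d: "x = px R" "y = py R" "x' = px (R \<oplus> c)" "y' = py (R \<oplus> c)"
      have f: "(y' + t + a1*x' + a3) * (x - s) = - ((y - t) * (x' - s))" and n: "x - s \<noteq> 0" "x' - s \<noteq> 0" "x \<noteq> 0"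
        using elim unfolding d cc(1) by auto
      have "(y' - (- t - a1*s - a3)) * (x - s) = (- (y - t) - a1 * (x - s)) * (x' - s)" using f by algebra
      then have "(y' - (- t - a1*s - a3)) / (x' - s) = (- (y - t) - a1 * (x - s)) / (x - s)"
        using n by (simp add: frac_eq_eq mult.commute)
      moreover have "py (\<ominus> c) = - t - a1*s - a3" by (simp add: cc(1))
      then have "mu c (R \<oplus> c) = (y' - (- t - a1*s - a3)) / (x' - s)"
        unfolding mu_def d(3,4)[symmetric] s_t_def(1)[symmetric] by simp
      moreover have "(- (y - t) - a1 * (x - s)) / (x - s) = - (y - t) / (x - s) - a1"
        using n by (simp add: diff_divide_distrib)
      ultimately have "mu c (R \<oplus> c) = - (y - t) / (x - s) - a1" by simp
      moreover have "- (y - t) / (x - s) + y / x = ((t * x - s * y)) * ((1 / (x - s)) * (1 / (x - 0)))"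
        using n by (simp add: field_simps)
      ultimately show ?case unfolding d[symmetric] by simp
    qed
  qed
qed

text \<open>The delicate case is d = -c, where numerator and denominator of the slope both vanish.
  By \<open>neg_prod\<close> the slope is also e / (y - y(c)), and this denominator is nonzero at d
  because c and d differ.\<close>

lemma mu_other:
  assumes c: "c \<in> C'" and d: "d \<in> C'" and ne: "c \<noteq> d" shows "ordle (\<lambda>R. mu c (R \<oplus> d)) 0"
proof -
  define s t where "s = px d" "t = py d"
  have dd: "d = Pt s t" "on_curve E (Pt s t)" "on_curve E d" using C'D[OF d] by (simp_all add: s_t_def)
  have px0: "ordle (\<lambda>R. px (R \<oplus> d)) 0" and py0: "ordle (\<lambda>R. py (R \<oplus> d)) 0" using tau_px_0 C'D[OF d] by blast+
  have lx: "ordle (\<lambda>R. px (R \<oplus> d) - s) (-1)" and ly: "ordle (\<lambda>R. py (R \<oplus> d) - t) (-1)"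
    using tau_px[OF dd(2)] tau_py[OF dd(2)] dd(1) by simp_all
  show ?thesis
  proof (cases "px c = s")
    case False
    have "ordle (\<lambda>R. (px (R \<oplus> d) - px c) - (s - px c)) (-1)" using lx by simp
    from ordle_inverse(1)[OF this] False have "ordle (\<lambda>R. 1 / (px (R \<oplus> d) - px c)) 0" by simp
    then have "ordle (\<lambda>R. (py (R \<oplus> d) - py (\<ominus> c)) * (1 / (px (R \<oplus> d) - px c))) (0 + 0)"
      by (intro ordle_mult ordle_diff py0 ordle_const)
    then show ?thesis by (simp add: mu_def)
  next
    case True
    then have cd: "c = \<ominus> d" using px_eq[of d c] C'D[OF c] C'D[OF d] ne s_t_def by metis
    define t' where "t' = - t - a1*s - a3"
    have cp: "c = Pt s t'" using cd dd(1) by (simp add: t'_def)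
    have tt: "t - t' \<noteq> 0" using ne cp dd(1) by auto
    define e where "e R = px R ^2 + px R * s + s^2 + a2 * (px R + s) + a4 - a1 * py R" for R
    have "ordle (\<lambda>R. (py (R \<oplus> d) - t') - (t - t')) (-1)" using ly by simp
    note iv = ordle_inverse[OF this tt]
    have "ordle (\<lambda>R. (px (R \<oplus> d) * px (R \<oplus> d) + s * px (R \<oplus> d) + s^2 + a2 * (px (R \<oplus> d) + s) + a4 - a1 * py (R \<oplus> d))) 0"
      by (intro ordle_diff ordle_add ordle_scale px0 py0 ordle_const ordle_mult[OF px0 px0, simplified])
    then have "ordle (\<lambda>R. e (R \<oplus> d)) 0" by (simp add: e_def power2_eq_square mult.commute)
    from ordle_mult[OF this iv(1)] have "ordle (\<lambda>R. e (R \<oplus> d) * (1 / (py (R \<oplus> d) - t'))) 0" by simp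
    then show ?thesis
    proof (rule ordle_cong)
      have "\<forall>\<^sub>F R in gen. px (R \<oplus> d) \<noteq> s" using gen_add[OF gen_px[of s] dd(3)] .
      moreover have "\<forall>\<^sub>F R in gen. on_curve E (Pt (px (R \<oplus> d)) (py (R \<oplus> d)))" using gen_add[OF gen_curve dd(3)] .
      ultimately show "\<forall>\<^sub>F R in gen. e (R \<oplus> d) * (1 / (py (R \<oplus> d) - t')) = mu c (R \<oplus> d)"
        using iv(2)
      proof eventually_elim
        case (elim R)
        have n: "(py (R \<oplus> d) - t) * (py (R \<oplus> d) - t') = (px (R \<oplus> d) - s) * e (R \<oplus> d)"
          using neg_prod[OF dd(2) elim(2)] unfolding e_def t'_def .
        have nc: "py (\<ominus> c) = t" using cd dd(1) by simp
        have "mu c (R \<oplus> d) = (py (R \<oplus> d) - t) / (px (R \<oplus> d) - s)" unfolding mu_def nc True ..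
        also have "\<dots> = e (R \<oplus> d) / (py (R \<oplus> d) - t')"
          using n elim(1,3) by (simp add: frac_eq_eq mult.commute)
        finally show ?case by simp
      qed
    qed
  qed
qed

lemma inv_simple_pole:
  assumes f: "AC f" "inv f" "ordle f 1" shows "\<exists>v. \<forall>\<^sub>F R in gen. f R = v"
proof -
  obtain g where g: "ordle (\<lambda>R. f R - g * (py R / px R)) 0" using ordle_lead_1[OF f(3)] by blast
  define F where "F R = f R + (\<Sum>c\<in>C'. g * mu c R)" for R
  have "reg F"
  proof (rule regular_at_C)
    show "AC F" unfolding F_def by (intro AC_add AC_sum AC_scale AC_mu f)
    fix d assume d: "d \<in> C'"
    have fd: "\<forall>\<^sub>F R in gen. f R = f (R \<oplus> d)" using invD[OF f(2)] C'D[OF d] by blast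
    have 1: "ordle (\<lambda>R. f (R \<oplus> d) - g * (py R / px R)) 0"
      by (rule ordle_cong[OF g]) (use fd in \<open>auto elim: eventually_mono\<close>)
    have "ordle (\<lambda>R. (f (R \<oplus> d) - g * (py R / px R)) + g * (mu d (R \<oplus> d) + py R / px R) + (\<Sum>c\<in>C'-{d}. g * mu c (R \<oplus> d))) 0"
      using d by (intro ordle_add ordle_sum ordle_scale mu_self mu_other 1) auto
    moreover have "(f (R \<oplus> d) - g * (py R / px R)) + g * (mu d (R \<oplus> d) + py R / px R) + (\<Sum>c\<in>C'-{d}. g * mu c (R \<oplus> d)) = F (R \<oplus> d)" for R
      unfolding F_def using sum.remove[OF finC' d, of "\<lambda>c. g * mu c (R \<oplus> d)"] by (simp add: algebra_simps)
    ultimately show "ordle (\<lambda>R. F (R \<oplus> d)) 0" by simp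
  qed
  have l0: "ordle (\<lambda>R. (f R - g * (py R / px R)) + (\<Sum>c\<in>C'. g * (mu c R - py R / px R))) 0"
    by (intro ordle_add ordle_sum ordle_scale mu_Inf g)
  have yx: "ordle (\<lambda>R. py R / px R) 1"
  proof -
    have "ordle (\<lambda>R. py R * (1 / (px R - 0))) (3 + -2)" by (intro ordle_mult ordle_py ordle_inv_px)
    then show ?thesis by simp
  qed
  have eq: "(f R - g * (py R / px R)) + (\<Sum>c\<in>C'. g * (mu c R - py R / px R)) = F R - (g * of_nat (card C)) * (py R / px R)" for R
    unfolding F_def card_C by (simp add: sum_subtractf right_diff_distrib algebra_simps)
  have "ordle (\<lambda>R. ((f R - g * (py R / px R)) + (\<Sum>c\<in>C'. g * (mu c R - py R / px R))) + (g * of_nat (card C)) * (py R / px R)) 1"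
    by (intro ordle_add ordle_mono[OF l0] ordle_scale yx) simp
  then have "ordle F 1" unfolding eq by simp
  \<comment> \<open>A regular function with at most a simple pole at infinity is constant, so the
    residue \<open>g * of_nat (card C)\<close> is zero.\<close>
  then obtain v where v: "\<forall>\<^sub>F R in gen. F R = v" using regular_const[OF \<open>reg F\<close>] by blast
  have "ordle (\<lambda>R. v - ((f R - g * (py R / px R)) + (\<Sum>c\<in>C'. g * (mu c R - py R / px R)))) 0"
    by (intro ordle_diff l0 ordle_const)
  then have "ordle (\<lambda>R. (g * of_nat (card C)) * (py R / px R)) 0"
  proof (rule ordle_cong)
    show "\<forall>\<^sub>F R in gen. v - ((f R - g * (py R / px R)) + (\<Sum>c\<in>C'. g * (mu c R - py R / px R)))
      = (g * of_nat (card C)) * (py R / px R)"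
      unfolding eq using v by eventually_elim simp
  qed
  then have "g * of_nat (card C) = 0" by (rule not_ordle_yx)
  then have "g = 0" using cardC by simp
  then have "ordle f 0" using g by simp
  then show ?thesis using inv_const f by blast
qed

section \<open>The coordinates of the quotient\<close>

definition XX :: "'a ecpt \<Rightarrow> 'a" where "XX R = (\<Sum>c\<in>C. px (R \<oplus> c))"
definition YY :: "'a ecpt \<Rightarrow> 'a" where "YY R = (\<Sum>c\<in>C. py (R \<oplus> c))"

lemma C_translate: "c \<in> C \<Longrightarrow> bij_betw (\<lambda>d. c \<oplus> d) C C"
  by (rule bij_betwI[where g = "\<lambda>d. \<ominus> c \<oplus> d"])
     (auto simp: addC negC onC add_cancel_left add_cancel_left')

lemma sum_translate: "c \<in> C \<Longrightarrow> on_curve E R \<Longrightarrow> (\<Sum>d\<in>C. h ((R \<oplus> c) \<oplus> d)) = (\<Sum>d\<in>C. h (R \<oplus> d))"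
  using sum.reindex_bij_betw[OF C_translate, of c "\<lambda>d. h (R \<oplus> d)"] by (simp add: add_assoc onC)

lemma prod_translate: "c \<in> C \<Longrightarrow> on_curve E R \<Longrightarrow> (\<Prod>d\<in>C. h ((R \<oplus> c) \<oplus> d)) = (\<Prod>d\<in>C. h (R \<oplus> d))"
  using prod.reindex_bij_betw[OF C_translate, of c "\<lambda>d. h (R \<oplus> d)"] by (simp add: add_assoc onC)

lemma XX_add: "c \<in> C \<Longrightarrow> on_curve E R \<Longrightarrow> XX (R \<oplus> c) = XX R"
  and YY_add: "c \<in> C \<Longrightarrow> on_curve E R \<Longrightarrow> YY (R \<oplus> c) = YY R"
  by (simp_all add: XX_def YY_def sum_translate)

lemma invI: "(\<And>R c. on_curve E R \<Longrightarrow> c \<in> C \<Longrightarrow> f (R \<oplus> c) = f R) \<Longrightarrow> inv f"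
  unfolding inv_def using gen_on_curve by (intro ballI) (auto elim!: eventually_mono)

lemma inv_XX: "inv XX" and inv_YY: "inv YY"
  by (rule invI, simp add: XX_add YY_add)+

lemma AC_XX: "AC XX"
  unfolding XX_def[abs_def] by (intro AC_sum AC_tau)
lemma AC_YY: "AC YY"
  unfolding YY_def[abs_def] by (intro AC_sum AC_tau)

lemma sum_C: "(\<Sum>c\<in>C. h c) = h Inf + (\<Sum>c\<in>C'. h c)"
  using C_insert finC' by (metis sum.insert)

lemma XX_lead: "ordle (\<lambda>R. XX R - px R) 0"
proof -
  have "ordle (\<lambda>R. \<Sum>c\<in>C'. px (R \<oplus> c)) 0" by (intro ordle_sum tau_px_0) (auto dest: C'D)
  then show ?thesis unfolding XX_def sum_C by simp
qed

lemma YY_lead: "ordle (\<lambda>R. YY R - py R) 0"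
proof -
  have "ordle (\<lambda>R. \<Sum>c\<in>C'. py (R \<oplus> c)) 0" by (intro ordle_sum tau_px_0) (auto dest: C'D)
  then show ?thesis unfolding YY_def sum_C by simp
qed

text \<open>\<open>YY\<close> and \<open>XX\<close> behave like \<open>py\<close> and
  \<open>px\<close> at infinity, so suitable multiples lower a pole of order three to one of order
  at most one, which \<open>inv_simple_pole\<close> turns into a constant. In terms of Riemann-Roch
  on the quotient: 1, \<open>XX\<close>, \<open>YY\<close> span the functions with at most a triple
  pole.\<close>

lemma inv_cubic:
  assumes f: "AC f" "inv f" "ordle f 3"
  shows "\<exists>a b c. \<forall>\<^sub>F R in gen. f R = a + b * XX R + c * YY R"
proof -
  obtain c where c: "ordle (\<lambda>R. f R - c * py R) 2" using ordle_lead_3[OF f(3)] by blast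
  have "ordle (\<lambda>R. (f R - c * py R) - c * (YY R - py R)) 2"
    by (intro ordle_diff c ordle_scale ordle_mono[OF YY_lead]) simp
  then have c': "ordle (\<lambda>R. f R - c * YY R) 2" by (simp add: algebra_simps)
  then obtain b where b: "ordle (\<lambda>R. (f R - c * YY R) - b * px R) 1" using ordle_lead_2 by blast
  have "ordle (\<lambda>R. ((f R - c * YY R) - b * px R) - b * (XX R - px R)) 1"
    by (intro ordle_diff b ordle_scale ordle_mono[OF XX_lead]) simp
  then have b': "ordle (\<lambda>R. f R - c * YY R - b * XX R) 1" by (simp add: algebra_simps)
  have "\<exists>v. \<forall>\<^sub>F R in gen. f R - c * YY R - b * XX R = v"
    by (rule inv_simple_pole[OF _ _ b'])
       (intro AC_diff AC_scale f AC_XX AC_YY inv_diff inv_map[OF inv_YY] inv_map[OF inv_XX])+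
  then obtain v where "\<forall>\<^sub>F R in gen. f R - c * YY R - b * XX R = v" by blast
  then have "\<forall>\<^sub>F R in gen. f R = v + b * XX R + c * YY R" by (rule eventually_mono) (simp add: algebra_simps)
  then show ?thesis by blast
qed


text \<open>An invariant rational function of \<open>x\<close> without poles outside \<open>C\<close> is a polynomial in \<open>XX\<close>; the
  division algorithm does not leave the field of coefficients.\<close>

lemma inv_even:
  assumes K: "\<And>a b. a \<in> K \<Longrightarrow> b \<in> K \<Longrightarrow> a + b \<in> K" "\<And>a b. a \<in> K \<Longrightarrow> b \<in> K \<Longrightarrow> a - b \<in> K"
      "\<And>a b. a \<in> K \<Longrightarrow> b \<in> K \<Longrightarrow> a * b \<in> K" "\<And>a b. a \<in> K \<Longrightarrow> b \<in> K \<Longrightarrow> a / b \<in> K" "0 \<in> K" "1 \<in> K"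
    and uv: "Kpoly K u" "Kpoly K v" "lc v d 1" "lc u (d + 1) 1" "degree v = d" "v \<noteq> 0"
      "\<forall>\<^sub>F R in gen. XX R * poly v (px R) = poly u (px R)"
    and pq: "Kpoly K p" "Kpoly K q" "q \<noteq> 0" "degree p \<le> degree q + n" "AC r" "inv r"
      "\<forall>\<^sub>F R in gen. r R * poly q (px R) = poly p (px R)"
  shows "\<exists>w. degree w \<le> n \<and> coeff w n = coeff p (degree q + n) / lead_coeff q \<and> Kpoly K w
    \<and> (\<forall>\<^sub>F R in gen. r R = poly w (XX R))"
  using pq
proof (induction n arbitrary: p q r)
  case (0 p q r)
  have "ordle r 0" using ordle_ratio[OF 0(3) 0(4) 0(7)] by simp
  then obtain k where k: "\<forall>\<^sub>F R in gen. r R = k" using inv_const 0 by blast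
  have "\<forall>\<^sub>F R in gen. poly (smult k q - p) (px R) = 0"
    using k 0(7) by eventually_elim simp
  then have p: "p = smult k q" using gen_poly_0 by fastforce
  have kk: "k = coeff p (degree q + 0) / lead_coeff q" using 0(3) by (simp add: p)
  then have "k \<in> K" using 0(1,2) K(4) by (auto simp: Kpoly_def)
  then show ?case using k kk K(5) by (intro exI[of _ "[:k:]"]) (auto simp: Kpoly_def coeff_pCons split: nat.splits)
next
  case (Suc n p q r)
  have Kmult: "Kpoly K (f * g)" if "Kpoly K f" "Kpoly K g" for f g
  proof -
    have "(\<Sum>i\<in>I. coeff f i * coeff g (m - i)) \<in> K" if "finite I" for I :: "nat set" and m
      using that by (induction I rule: finite_induct) (use K \<open>Kpoly K f\<close> \<open>Kpoly K g\<close> in \<open>auto simp: Kpoly_def\<close>)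
    then show ?thesis by (simp add: Kpoly_def coeff_mult)
  qed
  have Kpow: "Kpoly K (f ^ m)" if "Kpoly K f" for f m
    using that by (induction m) (auto simp: Kmult, auto simp: Kpoly_def K coeff_1)
  define g where "g = coeff p (degree q + Suc n) / lead_coeff q"
  have gK: "g \<in> K" using Suc.prems K(4) by (auto simp: g_def Kpoly_def)
  \<comment> \<open>One division step over the common denominator q v^(n+1). As u and v are monic
    with deg u = deg v + 1, the leading terms cancel and the excess of the numerator degree over the
    denominator degree drops.\<close>
  define q' p' r' where "q' = q * v ^ Suc n" "p' = p * v ^ Suc n - smult g (q * u ^ Suc n)" "r' = (\<lambda>R. r R - g * XX R ^ Suc n)"
  note d = q'_p'_r'_def
  have dq: "degree q' = degree q + Suc n * d" unfolding d using Suc.prems(3) uv by (simp add: degree_mult_eq degree_power_eq del: power_Suc)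
  have "lc (p * v ^ Suc n) ((degree q + Suc n) + Suc n * d) (coeff p (degree q + Suc n) * 1 ^ Suc n)"
    by (intro lc_mult lc_power uv) (use Suc.prems in \<open>simp add: lc_def\<close>)
  then have 1: "lc (p * v ^ Suc n) (degree q' + Suc n) (coeff p (degree q + Suc n))"
    by (rule lc_cong) (simp_all add: dq)
  have "lc ([:g:] * (q * u ^ Suc n)) (0 + (degree q + Suc n * (d + 1))) (g * (lead_coeff q * 1 ^ Suc n))"
    by (intro lc_mult lc_power uv) (simp_all add: lc_def)
  then have 2: "lc (smult g (q * u ^ Suc n)) (degree q' + Suc n) (coeff p (degree q + Suc n))"
    by (rule lc_eq) (use Suc.prems(3) in \<open>simp_all add: dq g_def algebra_simps\<close>)
  have "lc p' (degree q' + Suc n) 0" unfolding d(2) using lc_diff[OF 1 2] by simp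
  then have dp: "degree p' \<le> degree q' + n" using poly_degree_drop[of p' "degree q' + Suc n"] by (simp add: lc_def)
  have "\<exists>w. degree w \<le> n \<and> coeff w n = coeff p' (degree q' + n) / lead_coeff q' \<and> Kpoly K w \<and> (\<forall>\<^sub>F R in gen. r' R = poly w (XX R))"
  proof (rule Suc.IH)
    show "Kpoly K q'" unfolding d by (intro Kmult Kpow uv Suc.prems)
    have "Kpoly K (p * v ^ Suc n)" "Kpoly K (q * u ^ Suc n)" by (intro Kmult Kpow uv Suc.prems)+
    then show "Kpoly K p'" unfolding d using gK K by (simp add: Kpoly_def)
    show "q' \<noteq> 0" unfolding d using Suc.prems(3) uv(6) by simp
    show "AC r'" unfolding d by (intro AC_diff AC_scale AC_power AC_XX Suc.prems)
    show "inv r'" unfolding d by (intro inv_diff inv_map[OF inv_XX] Suc.prems)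
    show "\<forall>\<^sub>F R in gen. r' R * poly q' (px R) = poly p' (px R)" using Suc.prems(7) uv(7)
    proof eventually_elim
      case (elim R)
      have "r' R * poly q' (px R) = (r R * poly q (px R)) * poly v (px R) ^ Suc n - g * poly q (px R) * (XX R * poly v (px R)) ^ Suc n"
        unfolding d poly_mult poly_power power_mult_distrib by (simp add: algebra_simps)
      then show ?case unfolding elim d by (simp add: poly_power)
    qed
  qed (rule dp)
  then obtain w where w: "degree w \<le> n" "Kpoly K w" "\<forall>\<^sub>F R in gen. r' R = poly w (XX R)" by blast
  show ?case
  proof (intro exI[of _ "w + monom g (Suc n)"] conjI)
    show "degree (w + monom g (Suc n)) \<le> Suc n" using w(1) by (intro degree_add_le degree_monom_le) simp
    show "coeff (w + monom g (Suc n)) (Suc n) = coeff p (degree q + Suc n) / lead_coeff q"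
      using w(1) by (simp add: g_def coeff_eq_0)
    show "Kpoly K (w + monom g (Suc n))" using w(2) gK K by (auto simp: Kpoly_def)
    show "\<forall>\<^sub>F R in gen. r R = poly (w + monom g (Suc n)) (XX R)"
      using w(3) by eventually_elim (simp add: d poly_monom algebra_simps)
  qed
qed

end

section \<open>The quotient curve\<close>

text \<open>If 2 is invertible, the discriminant is 16 times the product of the squared differences
  of the roots of \<open>divF\<close> E, and a double root gives the singular point. In
  characteristic 2, if a1 = 0 then the discriminant forces a3 = 0, and x is a square root of a4. If
  a1 is nonzero, vanishing of the derivatives determines x = a3 / a1 and y, and the discriminant is
  a1^6 times the curve equation at this point.\<close>

lemma disc_zero_singular:
  fixes E :: "'a::alg_closed_field wcurve"
  assumes d: "disc E = 0"
  shows "\<exists>x y. on_curve E (Pt x y) \<and> 2 * y + wa1 E * x + wa3 E = 0 \<and> 3 * x^2 + 2 * wa2 E * x + wa4 E - wa1 E * y = 0"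
proof (cases "(2::'a) = 0")
  case False
  have "(2::'a) * 2 \<noteq> 0" unfolding mult_eq_0_iff using False by simp
  then have four: "(4::'a) \<noteq> 0" by simp
  have dF: "degree (divF E) = 3" "lead_coeff (divF E) = 4" using four by (simp_all add: divF_def numeral_3_eq_3)
  then have "divF E \<noteq> 0" by auto
  from alg_closed_imp_factorization[OF this] obtain A where A: "size A = 3" "divF E = smult 4 (\<Prod>x\<in>#A. [:-x, 1:])"
    using dF by auto
  have "size A = Suc (Suc (Suc 0))" using A(1) by simp
  then obtain r1 N where 1: "A = add_mset r1 N" using size_eq_Suc_imp_eq_union by blast
  then have "size N = Suc (Suc 0)" using A(1) by simp
  then obtain r2 M where 2: "N = add_mset r2 M" using size_eq_Suc_imp_eq_union by blast
  then have "size M = 1" using 1 A(1) by simp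
  then obtain r3 where 3: "M = {#r3#}" using size_1_singleton_mset by blast
  have "A = {#r1, r2, r3#}" using 1 2 3 by simp
  then have F: "divF E = smult 4 ([:-r1,1:] * ([:-r2,1:] * [:-r3,1:]))" using A(2) by simp
  have c: "wb6 E = - 4 * (r1 * r2 * r3)" "2 * wb4 E = 4 * (r1*r2 + r1*r3 + r2*r3)" "wb2 E = - 4 * (r1 + r2 + r3)"
    using F by (auto simp: divF_def algebra_simps)
  have "2 * wb4 E = 2 * (2 * (r1*r2 + r1*r3 + r2*r3))" using c(2) by simp
  then have c4: "wb4 E = 2 * (r1*r2 + r1*r3 + r2*r3)" unfolding mult_cancel_left using False by blast
  have b8: "4 * wb8 E = wb2 E * wb6 E - wb4 E ^ 2" unfolding wb2_def wb4_def wb6_def wb8_def by algebra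
  have "4 * disc E = - (wb2 E ^ 2 * (4 * wb8 E)) - 32 * wb4 E ^ 3 - 108 * wb6 E ^ 2 + 36 * wb2 E * wb4 E * wb6 E"
    unfolding disc_def by algebra
  also have "\<dots> = 4 * 4 * 4 * ((r1 - r2)^2 * (r1 - r3)^2 * (r2 - r3)^2)" unfolding b8 c(1,3) c4 by algebra
  finally have "4 * 4 * 4 * ((r1 - r2)^2 * (r1 - r3)^2 * (r2 - r3)^2) = 0" using d by simp
  then have "r1 = r2 \<or> r1 = r3 \<or> r2 = r3" unfolding mult_eq_0_iff using four by auto
  then obtain x z where F2: "divF E = smult 4 ([:-x,1:] * ([:-x,1:] * [:-z,1:]))" using F
    by (metis mult.left_commute mult.commute)
  have e: "poly (divF E) x = 0" "poly (pderiv (divF E)) x = 0"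
    unfolding F2 by (simp_all only: pderiv_smult pderiv_mult poly_smult poly_mult poly_add) simp_all
  define y where "y = - (wa1 E * x + wa3 E) / 2"
  have half: "2 * (s / 2) = s" for s :: 'a using False by simp
  have "2 * y = - (wa1 E * x + wa3 E)" using False half by (simp only: y_def)
  then have y: "2 * y + wa1 E * x + wa3 E = 0" by algebra
  have "4 * (y ^ 2 + wa1 E * x * y + wa3 E * y - (x ^ 3 + wa2 E * x ^ 2 + wa4 E * x + wa6 E))
    = (2 * y + wa1 E * x + wa3 E)^2 - poly (divF E) x"
    unfolding divF_def wb2_def wb4_def wb6_def by simp algebra
  then have "4 * (y ^ 2 + wa1 E * x * y + wa3 E * y - (x ^ 3 + wa2 E * x ^ 2 + wa4 E * x + wa6 E)) = 0" unfolding y e by simp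
  then have "y ^ 2 + wa1 E * x * y + wa3 E * y - (x ^ 3 + wa2 E * x ^ 2 + wa4 E * x + wa6 E) = 0" unfolding mult_eq_0_iff using four by blast
  then have 1: "on_curve E (Pt x y)" by simp
  have "4 * (3 * x^2 + 2 * wa2 E * x + wa4 E - wa1 E * y) = poly (pderiv (divF E)) x - 2 * wa1 E * (2 * y + wa1 E * x + wa3 E)"
    unfolding divF_def wb2_def wb4_def wb6_def by (simp add: pderiv_pCons) algebra
  then have "4 * (3 * x^2 + 2 * wa2 E * x + wa4 E - wa1 E * y) = 0" unfolding y e by simp
  then have "3 * x^2 + 2 * wa2 E * x + wa4 E - wa1 E * y = 0" unfolding mult_eq_0_iff using four by blast
  then show ?thesis using 1 y by blast
next
  case two: True
  show ?thesis
  proof (cases "wa1 E = 0")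
    case True
    have b2: "wb2 E = 4 * wa2 E" and b4: "wb4 E = 2 * wa4 E" by (simp_all add: wb2_def wb4_def True)
    have "disc E = - (wa3 E ^ 4) + 2 * (- 4 * wb4 E ^ 3 - 13 * wa3 E ^ 4 - 108 * wa6 E * wa3 E ^ 2 - 216 * wa6 E ^ 2 + 36 * wa2 E * wa4 E * (wa3 E ^ 2 + 4 * wa6 E)
       - 8 * wa2 E ^ 2 * wb8 E)"
      unfolding disc_def b2 b4 wb6_def by algebra
    then have a3: "wa3 E = 0" using d two by simp
    obtain x where x: "x ^ 2 = wa4 E" using nth_root_exists[of 2 "wa4 E"] by auto
    obtain y where y: "y ^ 2 = x^3 + wa2 E * x^2 + wa4 E * x + wa6 E" using nth_root_exists[of 2 "x^3 + wa2 E * x^2 + wa4 E * x + wa6 E"] by auto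
    have "on_curve E (Pt x y)" using y True a3 by simp
    moreover have "2 * y + wa1 E * x + wa3 E = 0" using two True a3 by simp
    moreover have "3 * x^2 + 2 * wa2 E * x + wa4 E - wa1 E * y = 2 * (2 * x^2 + wa2 E * x)"
      unfolding True x[symmetric] by algebra
    then have "3 * x^2 + 2 * wa2 E * x + wa4 E - wa1 E * y = 0" using two by simp
    ultimately show ?thesis by blast
  next
    case False
    define x where "x = wa3 E / wa1 E"
    define y where "y = (3 * x^2 + 2 * wa2 E * x + wa4 E) / wa1 E"
    have x: "wa3 E = wa1 E * x" using False by (simp add: x_def)
    have y: "3 * x^2 + 2 * wa2 E * x + wa4 E - wa1 E * y = 0" using False by (simp add: y_def)
    have t: "2 * s = 0" for s :: 'a using two by simp
    have n: "- s = s" for s :: 'a using t[of s] unfolding mult_2 by (rule minus_unique)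
    have m: "r - s = r + s" for r s :: 'a by (simp only: diff_conv_add_uminus n)
    have c: "(4::'a) = 0" "(8::'a) = 0" "(27::'a) = 1" "(9::'a) = 1" "(3::'a) = 1"
    proof -
      have "(4::'a) = 2 * 2" "(8::'a) = 2 * 4" "(27::'a) = 2 * 13 + 1" "(9::'a) = 2 * 4 + 1" "(3::'a) = 2 * 1 + 1" by simp_all
      then show "(4::'a) = 0" "(8::'a) = 0" "(27::'a) = 1" "(9::'a) = 1" "(3::'a) = 1" unfolding t by simp_all
    qed
    have "wa4 E = wa1 E * y - 3 * x^2 - 2 * wa2 E * x" using y by algebra
    also have "\<dots> = wa1 E * y + x^2" by (simp only: m c t) simp
    finally have a4: "wa4 E = wa1 E * y + x^2" .
    have "2 * y + wa1 E * x + wa3 E = 2 * (y + wa3 E)" unfolding x by algebra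
    then have p: "2 * y + wa1 E * x + wa3 E = 0" using two by simp
    have b: "wb2 E = wa1 E ^ 2" "wb4 E = wa1 E * wa3 E" "wb6 E = wa3 E ^ 2"
      using two c by (simp_all add: wb2_def wb4_def wb6_def)
    have b8: "wb8 E = wa1 E ^ 2 * wa6 E + wa1 E * wa3 E * wa4 E + wa2 E * wa3 E ^ 2 + wa4 E ^ 2"
      unfolding wb8_def by (simp only: m c) simp
    have "disc E = wb2 E ^ 2 * wb8 E + wb6 E ^ 2 + wb2 E * wb4 E * wb6 E"
      unfolding disc_def by (simp only: m n c) simp
    also have "\<dots> = wa1 E ^ 6 * (y ^ 2 + wa2 E * x^2 + wa4 E * x + wa6 E + x^3) + 2 * (wa1 E ^ 4 * x^4 + wa1 E ^ 4 * (wa1 E * x^2 * y))"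
      unfolding b b8 unfolding x unfolding a4 by algebra
    finally have "y ^ 2 + wa2 E * x^2 + wa4 E * x + wa6 E + x^3 = 0" using d two False by simp
    moreover have "y ^ 2 + wa1 E * x * y + wa3 E * y - (x ^ 3 + wa2 E * x ^ 2 + wa4 E * x + wa6 E)
      = (y ^ 2 + wa2 E * x^2 + wa4 E * x + wa6 E + x^3) + 2 * (wa1 E * x * y - (x ^ 3 + wa2 E * x ^ 2 + wa4 E * x + wa6 E))"
      unfolding x by algebra
    ultimately have "y ^ 2 + wa1 E * x * y + wa3 E * y - (x ^ 3 + wa2 E * x ^ 2 + wa4 E * x + wa6 E) = 0" using t by simp
    then have "on_curve E (Pt x y)" by simp
    then show ?thesis using p y by blast
  qed
qed

context ecv
begin

lemma reg_nonzero:
  assumes "rp F a b" "a \<noteq> 0 \<or> b \<noteq> 0" shows "\<forall>\<^sub>F R in gen. F R \<noteq> 0"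
proof -
  have n: "nrm a b \<noteq> 0" using assms(2) by (simp add: nrm_eq_0)
  have F: "\<forall>\<^sub>F R in gen. F R = poly a (px R) + poly b (px R) * py R" using assms(1) by (simp add: rp_def)
  show ?thesis using F gen_poly[OF n] gen_curve
  proof eventually_elim
    case (elim R)
    have z: "py R^2 = px R^3 + a2*px R^2 + a4*px R + a6 - a1*px R*py R - a3*py R" using elim(3) by (simp add: algebra_simps)
    have "(poly a (px R) + poly b (px R) * py R) * (poly a (px R) - poly b (px R) * (a3 + a1 * px R) - poly b (px R) * py R) = poly (nrm a b) (px R)"
      unfolding nrm_def using z by simp algebra
    then show ?case using elim(1,2) by auto
  qed
qed

lemma ordle_prod_0: "(\<And>i. i \<in> I \<Longrightarrow> ordle (f i) 0) \<Longrightarrow> ordle (\<lambda>R. \<Prod>i\<in>I. f i R) 0"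
proof (induction I rule: infinite_finite_induct)
  case (insert i I)
  then have "ordle (\<lambda>R. f i R * (\<Prod>i\<in>I. f i R)) (0 + 0)" by (intro ordle_mult) auto
  then show ?case using insert by simp
qed (auto simp: ordle_const)

end

text \<open>The base field as a subset of the big field: the quotient is built over the closure, and
  rationality is a statement about coefficients that is followed along the construction.\<close>

locale subfd = fixes K :: "'a::field set"
  assumes K: "\<And>a b. a \<in> K \<Longrightarrow> b \<in> K \<Longrightarrow> a + b \<in> K" "\<And>a b. a \<in> K \<Longrightarrow> b \<in> K \<Longrightarrow> a - b \<in> K"
      "\<And>a b. a \<in> K \<Longrightarrow> b \<in> K \<Longrightarrow> a * b \<in> K" "\<And>a b. a \<in> K \<Longrightarrow> b \<in> K \<Longrightarrow> a / b \<in> K" "0 \<in> K" "1 \<in> K"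
begin

abbreviation "KP \<equiv> Kpoly K"

lemma Kofnat: "of_nat n \<in> K" by (induction n) (auto simp: K)
lemma Knumeral: "numeral n \<in> K" using Kofnat[of "numeral n"] by simp
lemma Kminus: "a \<in> K \<Longrightarrow> - a \<in> K" using K(2)[OF K(5)] by force
lemma Kpower: "a \<in> K \<Longrightarrow> a ^ n \<in> K" by (induction n) (auto simp: K)
lemma Ksum: "(\<And>i. i \<in> I \<Longrightarrow> f i \<in> K) \<Longrightarrow> sum f I \<in> K"
  by (induction I rule: infinite_finite_induct) (auto simp: K)

lemma KP_add: "KP p \<Longrightarrow> KP q \<Longrightarrow> KP (p + q)" and KP_diff: "KP p \<Longrightarrow> KP q \<Longrightarrow> KP (p - q)"
  by (auto simp: Kpoly_def K)
lemma KP_mult: "KP p \<Longrightarrow> KP q \<Longrightarrow> KP (p * q)"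
  unfolding Kpoly_def coeff_mult by (auto intro!: Ksum K)
lemma KP_0: "KP 0" and KP_1: "KP 1" by (auto simp: Kpoly_def K)
lemma KP_pCons: "a \<in> K \<Longrightarrow> KP p \<Longrightarrow> KP (pCons a p)"
  by (auto simp: Kpoly_def coeff_pCons split: nat.splits)
lemma KP_const: "a \<in> K \<Longrightarrow> KP [:a:]" by (intro KP_pCons KP_0)
lemma KP_X: "KP [:0, 1:]" by (intro KP_pCons KP_0 K)
lemma KP_power: "KP p \<Longrightarrow> KP (p ^ n)" by (induction n) (auto intro: KP_1 KP_mult)
lemma KP_pderiv: "KP p \<Longrightarrow> KP (pderiv p)"
  by (auto simp: Kpoly_def coeff_pderiv simp del: of_nat_Suc intro!: K(3) Kofnat)
end

text \<open>The interface between explicit formulas and geometry: \<open>XX\<close> = u / v and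
  \<open>YY\<close> = (A + B y) / w with rational coefficients. It is supplied separately for order
  two and for subgroups without two-torsion, while everything about the quotient curve is derived
  from it once.\<close>

locale ecrat = ecsub E C + subfd K for E :: "'a::alg_closed_field wcurve" and C and K :: "'a set" +
  fixes u v w A B :: "'a poly"
  assumes KE: "a1 \<in> K" "a2 \<in> K" "a3 \<in> K" "a4 \<in> K" "a6 \<in> K"
    and Kp: "Kpoly K u" "Kpoly K v" "Kpoly K w" "Kpoly K A" "Kpoly K B"
    and uv: "lc v (card C - 1) 1" "lc u (card C) 1" "degree v = card C - 1" "\<And>s. poly u s = 0 \<Longrightarrow> poly v s \<noteq> 0"
    and vr: "\<And>s. poly v s = 0 \<longleftrightarrow> s \<in> px ` C'"
    and wr: "\<And>s. poly w s = 0 \<Longrightarrow> s \<in> px ` C'"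
    and XXr: "\<And>R. on_curve E R \<Longrightarrow> R \<notin> C \<Longrightarrow> XX R * poly v (px R) = poly u (px R)"
    and YYr: "\<And>R. on_curve E R \<Longrightarrow> R \<notin> C \<Longrightarrow> YY R * poly w (px R) = poly A (px R) + poly B (px R) * py R"
begin

lemma v_nz: "v \<noteq> 0" using uv(1) by (auto simp: lc_def)
lemma w_nz: "w \<noteq> 0"
proof
  assume "w = 0"
  then have "UNIV \<subseteq> px ` C'" using wr by auto
  then show False using finC' alg_closed_infinite[where 'a='a] finite_surj[of C' UNIV px] by simp
qed

lemma gen_XXr: "\<forall>\<^sub>F R in gen. XX R * poly v (px R) = poly u (px R)"
  using gen_on_curve gen_notin_C by eventually_elim (rule XXr)

lemma gen_YYr: "\<forall>\<^sub>F R in gen. YY R * poly w (px R) = poly A (px R) + poly B (px R) * py R"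
  using gen_on_curve gen_notin_C by eventually_elim (rule YYr)

text \<open>The coefficient a3 of the quotient: summing the negation formula - y - a1 x - a3 over C
  yields \<open>card C\<close> copies of a3 but just one a1 \<open>XX\<close>.\<close>

definition "l3 = of_nat (card C) * a3"

lemma neg_notC: "on_curve E R \<Longrightarrow> R \<notin> C \<Longrightarrow> \<ominus> R \<notin> C"
  using negC[of "\<ominus> R"] by auto

lemma add_notC: "on_curve E R \<Longrightarrow> R \<notin> C \<Longrightarrow> c \<in> C \<Longrightarrow> R \<oplus> c \<notin> C"
  using addC[of "R \<oplus> c" "\<ominus> c"] negC[of c] add_cancel[of R c] onC by auto

lemma neg_bij: "bij_betw (\<lambda>c. \<ominus> c) C C"
  by (rule bij_betwI[where g = "\<lambda>c. \<ominus> c"]) (auto simp: negC)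

lemma XX_neg: "on_curve E R \<Longrightarrow> XX (\<ominus> R) = XX R"
proof -
  assume R: "on_curve E R"
  have "XX (\<ominus> R) = (\<Sum>c\<in>C. px (\<ominus> R \<oplus> \<ominus> c))"
    unfolding XX_def using sum.reindex_bij_betw[OF neg_bij, of "\<lambda>c. px (\<ominus> R \<oplus> c)"] by simp
  also have "\<dots> = (\<Sum>c\<in>C. px (\<ominus> (R \<oplus> c)))" using R onC by (intro sum.cong) (auto simp: neg_add)
  finally show ?thesis by (simp add: XX_def)
qed

lemma YY_neg: "on_curve E R \<Longrightarrow> R \<notin> C \<Longrightarrow> YY (\<ominus> R) = - YY R - a1 * XX R - l3"
proof -
  assume R: "on_curve E R" "R \<notin> C"
  have "YY (\<ominus> R) = (\<Sum>c\<in>C. py (\<ominus> R \<oplus> \<ominus> c))"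
    unfolding YY_def using sum.reindex_bij_betw[OF neg_bij, of "\<lambda>c. py (\<ominus> R \<oplus> c)"] by simp
  also have "\<dots> = (\<Sum>c\<in>C. py (\<ominus> (R \<oplus> c)))" using R onC by (intro sum.cong) (auto simp: neg_add)
  also have "\<dots> = (\<Sum>c\<in>C. - py (R \<oplus> c) - a1 * px (R \<oplus> c) - a3)"
  proof (rule sum.cong)
    fix c assume "c \<in> C"
    then have "R \<oplus> c \<noteq> Inf" using add_notC[OF R] InfC by metis
    then show "py (\<ominus> (R \<oplus> c)) = - py (R \<oplus> c) - a1 * px (R \<oplus> c) - a3" by (cases "R \<oplus> c") auto
  qed simp
  also have "\<dots> = - YY R - a1 * XX R - l3"
    by (simp add: sum_subtractf sum_negf sum_distrib_left YY_def XX_def l3_def)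
  finally show ?thesis .
qed

text \<open>\<open>YY - py\<close> has no pole at infinity, so A + (B - w) y has pole order at most
  2 deg w; the two summands obey this bound separately.\<close>

lemma B_lead: "degree B = degree w" "lead_coeff B = lead_coeff w" "A = 0 \<or> degree A \<le> degree w"
proof -
  have "ordle (\<lambda>R. poly w (px R)) (2 * int (degree w))"
    by (rule ordle_ratio[of 1 w]) auto
  from ordle_mult[OF YY_lead this] have o: "ordle (\<lambda>R. (YY R - py R) * poly w (px R)) (2 * int (degree w))" by simp
  have r: "rp (\<lambda>R. (YY R - py R) * poly w (px R)) A (B - w)"
    unfolding rp_def using gen_YYr by eventually_elim (simp add: algebra_simps)
  show "A = 0 \<or> degree A \<le> degree w" using ordle_rp(1)[OF r o] by auto
  have "B - w = 0 \<or> degree (B - w) < degree w" using ordle_rp(2)[OF r o] by auto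
  then have "degree B = degree w \<and> lead_coeff B = lead_coeff w"
  proof
    assume l: "degree (B - w) < degree w"
    then have "degree (w + (B - w)) = degree w" by (intro degree_add_eq_left)
    moreover have "coeff B (degree w) = lead_coeff w" using coeff_eq_0[OF l] by simp
    ultimately show ?thesis by simp
  qed simp
  then show "degree B = degree w" "lead_coeff B = lead_coeff w" by auto
qed

text \<open>The left side is minus the product of \<open>YY\<close> at R and at -R, that is, minus
  the norm of A + B y over w^2. It is thus an invariant rational function of x, with degree excess 3
  and leading coefficient 1, and \<open>inv_even\<close> rewrites it as a cubic in \<open>XX\<close>
  over K.\<close>

lemma cubic_ex: "\<exists>W. degree W \<le> 3 \<and> coeff W 3 = 1 \<and> Kpoly K W \<and>
   (\<forall>R. on_curve E R \<longrightarrow> R \<notin> C \<longrightarrow> YY R ^ 2 + a1 * XX R * YY R + l3 * YY R = poly W (XX R))"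
proof -
  define r where "r R = YY R ^ 2 + a1 * XX R * YY R + l3 * YY R" for R
  define p where "p = 0 - nrm A B"
  have Kpp: "Kpoly K p" unfolding p_def nrm_def by (intro KP_diff KP_mult KP_pCons KP_0 Kp KE K(6))
  have Kq: "Kpoly K (w * w)" by (intro KP_mult Kp)
  have rp: "\<forall>\<^sub>F R in gen. r R * poly (w * w) (px R) = poly p (px R)"
    using gen_Pt gen_notin_C gen_YYr
  proof eventually_elim
    case (elim R)
    obtain x y where R: "R = Pt x y" "on_curve E (Pt x y)" using elim(1) by metis
    have oR: "on_curve E R" using R by metis
    have n: "\<ominus> R = Pt x (- y - a1 * x - a3)" using R(1) by simp
    have "YY (\<ominus> R) * poly w (px (\<ominus> R)) = poly A (px (\<ominus> R)) + poly B (px (\<ominus> R)) * py (\<ominus> R)"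
      by (rule YYr) (use oR neg_notC elim(2) in auto)
    then have 1: "YY (\<ominus> R) * poly w x = poly A x + poly B x * (- y - a1 * x - a3)" unfolding n by simp
    have 2: "YY R * poly w x = poly A x + poly B x * y" using elim(3) R(1) by simp
    have "r R = - (YY R * YY (\<ominus> R))" unfolding YY_neg[OF oR elim(2)] r_def by algebra
    then have "r R * poly (w * w) x = - ((YY R * poly w x) * (YY (\<ominus> R) * poly w x))" by (simp add: mult_ac)
    also have "\<dots> = poly p x" unfolding 1 2 p_def nrm_def using R(2) by simp algebra
    finally show ?case using R(1) by simp
  qed
  have lA: "lc A (degree w) (coeff A (degree w))" using B_lead(3) by (auto simp: lc_def)
  have lB: "lc B (degree w) (lead_coeff w)" using B_lead(1,2) by (auto simp: lc_def)
  have "lc (B * B * W3) (degree w + degree w + 3) (lead_coeff w * lead_coeff w * 1)"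
    by (intro lc_mult lB) (simp add: lc_def numeral_3_eq_3)
  moreover have "lc (A * A - A * B * A1) (degree w + degree w + 3) 0"
  proof -
    have "degree (A * A) \<le> degree w + degree w" using lc_mult[OF lA lA] by (simp add: lc_def)
    moreover have "degree (A * B * A1) \<le> degree w + degree w + 1"
    proof -
      have "lc A1 1 a1" by (simp add: lc_def)
      from lc_mult[OF lc_mult[OF lA lB] this] show ?thesis by (simp add: lc_def)
    qed
    ultimately have "degree (A * A - A * B * A1) < degree w + degree w + 3"
      by (intro le_less_trans[OF degree_diff_le_max]) auto
    then show ?thesis by (simp only: lc_def less_imp_le coeff_eq_0 simp_thms)
  qed
  ultimately have "lc (A * A - A * B * A1 - B * B * W3) (degree w + degree w + 3) (0 - lead_coeff w * lead_coeff w * 1)"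
    by (intro lc_diff)
  moreover have "lc (0::'a poly) (degree w + degree w + 3) 0" by (simp add: lc_def)
  ultimately have "lc (0 - (A * A - A * B * A1 - B * B * W3)) (degree w + degree w + 3) (0 - (0 - lead_coeff w * lead_coeff w * 1))"
    using lc_diff by blast
  moreover have "p = 0 - (A * A - A * B * A1 - B * B * W3)" unfolding p_def nrm_def ..
  ultimately have lcp: "lc p (degree w + degree w + 3) (lead_coeff w * lead_coeff w)" by simp
  have dw: "degree (w * w) = degree w + degree w" using w_nz by (simp add: degree_mult_eq)
  have cw: "lead_coeff (w * w) = lead_coeff w * lead_coeff w" by (rule lead_coeff_mult)
  have lp: "degree p \<le> degree (w * w) + 3" "coeff p (degree (w * w) + 3) = lead_coeff (w * w)"
    using lcp unfolding cw unfolding dw lc_def by blast+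
  have c1: "card C = card C - 1 + 1" using card_C by simp
  have ACr: "AC r" unfolding r_def[abs_def] by (intro AC_add AC_mult AC_power AC_scale AC_XX AC_YY AC_const)
  have "\<exists>W. degree W \<le> 3 \<and> coeff W 3 = coeff p (degree (w * w) + 3) / lead_coeff (w * w) \<and> Kpoly K W \<and> (\<forall>\<^sub>F R in gen. r R = poly W (XX R))"
  proof (rule inv_even[OF K _ _ _ _ _ v_nz gen_XXr Kpp Kq _ lp(1) ACr _ rp])
    show "Kpoly K u" "Kpoly K v" by (rule Kp)+
    show "lc v (card C - 1) 1" "lc u (card C - 1 + 1) 1" "degree v = card C - 1" using uv(1-3) c1 by simp_all
    show "w * w \<noteq> 0" using w_nz by simp
    show "inv r" unfolding r_def[abs_def] by (rule invI) (simp add: XX_add YY_add)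
  qed
  then obtain W where W: "degree W \<le> 3" "coeff W 3 = 1" "Kpoly K W" "\<forall>\<^sub>F R in gen. r R = poly W (XX R)"
    using lp(2) w_nz by auto
  have Wp: "AC (\<lambda>R. poly W (XX R))"
    unfolding poly_altdef by (intro AC_sum AC_scale AC_power AC_XX)
  have "r R = poly W (XX R)" if R: "on_curve E R" "R \<notin> C" for R
  proof -
    have "r R - poly W (XX R) = 0"
      by (rule AC_zero[of "\<lambda>R. r R - poly W (XX R)", OF AC_diff[OF ACr Wp] _ R]) (use W(4) in \<open>auto elim: eventually_mono\<close>)
    then show ?thesis by simp
  qed
  then show ?thesis using W unfolding r_def by blast
qed

section \<open>The quotient map: fibres, collinearity, additivity\<close>

lemma XX_gen: "\<forall>\<^sub>F R in gen. XX R \<noteq> X0"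
proof -
  have "lc (smult X0 v) (card C) 0"
    using uv(1) card_C by (auto simp: lc_def intro!: coeff_eq_0 le_less_trans[OF degree_smult_le])
  from lc_diff[OF uv(2) this] have "u - smult X0 v \<noteq> 0" by (auto simp: lc_def)
  from gen_poly[OF this] gen_XXr show ?thesis by eventually_elim auto
qed

lemma XX_surj: assumes "card C \<ge> 1" shows "\<exists>R. on_curve E R \<and> R \<notin> C \<and> XX R = X0"
proof -
  have "lc (smult X0 v) (card C) 0"
    using uv(1) card_C by (auto simp: lc_def intro!: coeff_eq_0 le_less_trans[OF degree_smult_le])
  from lc_diff[OF uv(2) this] have "degree (u - smult X0 v) \<ge> card C" by (auto simp: lc_def intro!: le_degree)
  then have "degree (u - smult X0 v) > 0" using assms by simp
  then obtain x where x: "poly (u - smult X0 v) x = 0" using alg_closed_imp_poly_has_root by blast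
  then have "poly v x \<noteq> 0" using uv(4)[of x] by auto
  then have nC: "x \<notin> px ` C'" using vr by blast
  obtain y where y: "on_curve E (Pt x y)" using ex_point by blast
  have "Pt x y \<notin> C" using nC unfolding C'_def image_iff by (metis DiffI ecpt.distinct(1) px.simps(2) singletonD)
  then show ?thesis using XXr[OF y] x \<open>poly v x \<noteq> 0\<close> y by (intro exI[of _ "Pt x y"]) auto
qed

text \<open>The polynomial u - \<open>XX R\<close> v has degree at most \<open>card C\<close>, and
  the x-coordinates of the points R + c are already that many roots: they are distinct, since R + c
  = -(R + d) would put 2 R into C. So the point S lies over one of them.\<close>

lemma XX_fibre:
  assumes R: "on_curve E R" "R \<notin> C" "R \<oplus> R \<notin> C" and S: "on_curve E S" "S \<notin> C" and eq: "XX S = XX R"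
  shows "\<exists>c\<in>C. S = R \<oplus> c \<or> S = \<ominus> (R \<oplus> c)"
proof -
  define g where "g = u - smult (XX R) v"
  have "lc (smult (XX R) v) (card C) 0"
    using uv(1) card_C by (auto simp: lc_def intro!: coeff_eq_0 le_less_trans[OF degree_smult_le])
  from lc_diff[OF uv(2) this] have g: "degree g \<le> card C" "g \<noteq> 0" by (auto simp: lc_def g_def)
  have rt: "poly g (px T) = 0" if "on_curve E T" "T \<notin> C" "XX T = XX R" for T
    using XXr[OF that(1,2)] that(3) by (simp add: g_def)
  have inj: "inj_on (\<lambda>c. px (R \<oplus> c)) C"
  proof (rule inj_onI)
    fix c d assume cd: "c \<in> C" "d \<in> C" "px (R \<oplus> c) = px (R \<oplus> d)"
    have "R \<oplus> c \<noteq> Inf" "R \<oplus> d \<noteq> Inf" using add_notC[OF R(1,2)] cd InfC by metis+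
    then have "R \<oplus> d = R \<oplus> c \<or> R \<oplus> d = \<ominus> (R \<oplus> c)" using px_eq[of "R \<oplus> c" "R \<oplus> d"] cd R onC add_closed by blast
    then show "c = d"
    proof
      assume "R \<oplus> d = R \<oplus> c" then show ?thesis using add_left_imp_eq[of R d c] R cd onC by simp
    next
      assume n: "R \<oplus> d = \<ominus> (R \<oplus> c)"
      have "(R \<oplus> R) \<oplus> (c \<oplus> d) = (R \<oplus> c) \<oplus> (R \<oplus> d)"
        using R cd onC by (simp add: add_ac add_closed)
      also have "\<dots> = Inf" unfolding n by simp
      finally have s0: "(R \<oplus> R) \<oplus> (c \<oplus> d) = Inf" .
      have on: "on_curve E (R \<oplus> R)" "on_curve E (c \<oplus> d)" using R(1) onC[OF cd(1)] onC[OF cd(2)] by (auto intro: add_closed)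
      have "c \<oplus> d = \<ominus> (R \<oplus> R)" using add_eq_Inf[OF on] s0 by (rule iffD1)
      then have "R \<oplus> R = \<ominus> (c \<oplus> d)" by simp
      then show ?thesis using R(3) addC negC cd by metis
    qed
  qed
  have sub: "(\<lambda>c. px (R \<oplus> c)) ` C \<subseteq> {x. poly g x = 0}"
    using rt add_notC[OF R(1,2)] XX_add R(1) onC add_closed by auto
  have fin: "finite {x. poly g x = 0}" using g poly_roots_finite by blast
  have "card {x. poly g x = 0} \<le> card C" using g card_poly_roots_bound[of g] by linarith
  then have "(\<lambda>c. px (R \<oplus> c)) ` C = {x. poly g x = 0}"
    using card_image[OF inj] sub fin by (intro card_seteq) auto
  moreover have "px S \<in> {x. poly g x = 0}" using rt S eq by simp
  ultimately have "px S \<in> (\<lambda>c. px (R \<oplus> c)) ` C" by simp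
  then obtain c where c: "c \<in> C" "px (R \<oplus> c) = px S" by auto
  have "R \<oplus> c \<noteq> Inf" "S \<noteq> Inf" using add_notC[OF R(1,2)] c S InfC by metis+
  then have "S = R \<oplus> c \<or> S = \<ominus> (R \<oplus> c)"
    using px_eq[of "R \<oplus> c" S] add_closed[OF R(1) onC[OF c(1)]] S(1) c(2) by blast
  then show ?thesis using c(1) by blast
qed

text \<open>General position: U, S and U + S have images with three different x-coordinates, so the
  addition on the image curve can be read off a chord, without tangents or vertical lines.\<close>

definition good :: "'a ecpt \<Rightarrow> 'a ecpt \<Rightarrow> bool" where
  "good U S \<longleftrightarrow> on_curve E S \<and> S \<notin> C \<and> U \<oplus> S \<notin> C \<and> XX S \<noteq> XX U \<and> XX (U \<oplus> S) \<noteq> XX U \<and> XX S \<noteq> XX (U \<oplus> S)"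

lemma gen_good:
  assumes U: "on_curve E U" "U \<notin> C" shows "\<forall>\<^sub>F S in gen. good U S"
proof -
  \<comment> \<open>The exceptional S: those with 2 S in C, to which \<open>XX_fibre\<close> does
    not apply, and those for which U + S would be the negative of some S + c.\<close>
  have fin: "finite (\<Union>c\<in>C. {R \<in> points E. mul 2 R = \<ominus> (U \<oplus> c)} \<union> {R \<in> points E. mul 2 R = c})"
    using finC finite_mul_fibre[of 2] by auto
  have d: "\<forall>\<^sub>F S in gen. \<forall>c\<in>C. S \<oplus> S \<noteq> \<ominus> (U \<oplus> c) \<and> S \<oplus> S \<noteq> c"
    unfolding eventually_gen by (rule finite_subset[OF _ fin]) (auto simp: numeral_2_eq_2)
  have 1: "\<forall>\<^sub>F S in gen. U \<oplus> S \<notin> C"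
    using gen_add[OF gen_notin_C U(1)] gen_on_curve by eventually_elim (simp add: add_commute U)
  have 2: "\<forall>\<^sub>F S in gen. XX (U \<oplus> S) \<noteq> XX U"
    using gen_add[OF XX_gen[of "XX U"] U(1)] gen_on_curve by eventually_elim (simp add: add_commute U)
  show ?thesis using d 1 2 XX_gen[of "XX U"] gen_on_curve gen_notin_C
  proof eventually_elim
    case (elim S)
    have "XX (U \<oplus> S) \<noteq> XX S"
    proof
      assume a: "XX (U \<oplus> S) = XX S"
      have "S \<oplus> S \<notin> C" using elim(1) by blast
      then obtain c where c: "c \<in> C" "U \<oplus> S = S \<oplus> c \<or> U \<oplus> S = \<ominus> (S \<oplus> c)"
        using XX_fibre[of S "U \<oplus> S"] elim a add_closed U by blast
      from c(2) show False
      proof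
        assume "U \<oplus> S = S \<oplus> c"
        then have "S \<oplus> U = S \<oplus> c" using add_commute U elim by metis
        then have "U = c" using add_left_imp_eq elim(5) U(1) onC c(1) by blast
        then show False using U c by simp
      next
        assume "U \<oplus> S = \<ominus> (S \<oplus> c)"
        then have "(U \<oplus> S) \<oplus> (S \<oplus> c) = Inf" by simp
        then have "(U \<oplus> c) \<oplus> (S \<oplus> S) = Inf" using U elim(5) onC[OF c(1)] by (simp add: add_ac add_closed)
        then have "S \<oplus> S = \<ominus> (U \<oplus> c)" using add_eq_Inf add_closed U elim(5) onC[OF c(1)] by blast
        then show False using elim(1) c by blast
      qed
    qed
    then show ?case using elim by (simp add: good_def)
  qed
qed

text \<open>The norm over \<open>C\<close> of a line through \<open>P\<close>, \<open>Q\<close> is an affine function of \<open>XX\<close>, \<open>YY\<close>, so the images of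
  \<open>P\<close>, \<open>Q\<close> and \<open>P \<oplus> Q\<close> under \<open>\<ominus>\<close> are collinear.\<close>

lemma line_image:
  assumes P: "on_curve E P" "P \<notin> C" and g: "good P Q"
  shows "\<exists>l m. YY P = l * XX P + m \<and> YY Q = l * XX Q + m \<and> YY (\<ominus> (P \<oplus> Q)) = l * XX (P \<oplus> Q) + m"
proof -
  have Q: "on_curve E Q" "Q \<notin> C" "P \<oplus> Q \<notin> C" using g by (auto simp: good_def)
  obtain x1 y1 x2 y2 where xy: "P = Pt x1 y1" "Q = Pt x2 y2" using P Q InfC by (cases P; cases Q) auto
  have nQ: "Q \<noteq> \<ominus> P" using Q(3) InfC by auto
  obtain l m x3 where lm: "y1 = l*x1+m" "y2 = l*x2+m" "P \<oplus> Q = \<ominus> (Pt x3 (l*x3+m))"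
    using addE[of x1 y1 x2 y2] P Q xy nQ by metis
  define L where "L R = py R - l * px R - m" for R
  define M where "M R = (\<Prod>c\<in>C. L (R \<oplus> c))" for R
  have Mpr: "M R = L R * (\<Prod>c\<in>C'. L (R \<oplus> c))" for R
    unfolding M_def using C_insert finC' by (metis (no_types) prod.insert add_Inf(2))
  have L3: "ordle L 3" unfolding L_def[abs_def]
    by (intro ordle_diff ordle_py ordle_scale ordle_mono[OF ordle_px] ordle_const') auto
  have L0: "ordle (\<lambda>R. L (R \<oplus> c)) 0" if "c \<in> C'" for c
    unfolding L_def using C'D[OF that] by (intro ordle_diff ordle_scale ordle_const tau_px_0) auto
  have "ordle (\<lambda>R. L R * (\<Prod>c\<in>C'. L (R \<oplus> c))) (3 + 0)" by (intro ordle_mult ordle_prod_0 L3 L0)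
  then have M3: "ordle M 3" unfolding Mpr[symmetric] by (simp add: eta_contract_eq)
  have ACM: "AC M" unfolding M_def[abs_def] L_def by (intro AC_prod AC_diff AC_scale AC_const AC_tau)
  have invM: "inv M" by (rule invI) (simp add: M_def prod_translate)
  obtain a b c where abc: "\<forall>\<^sub>F R in gen. M R = a + b * XX R + c * YY R" using inv_cubic[OF ACM invM M3] by blast
  have ACd: "AC (\<lambda>R. M R - (a + b * XX R + c * YY R))" by (intro AC_diff AC_add AC_scale ACM AC_XX AC_YY AC_const)
  have ex: "M R = a + b * XX R + c * YY R" if "on_curve E R" "R \<notin> C" for R
  proof -
    have "M R - (a + b * XX R + c * YY R) = 0"
      by (rule AC_zero[OF ACd _ that]) (use abc in \<open>auto elim: eventually_mono\<close>)
    then show ?thesis by simp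
  qed
  define T where "T = \<ominus> (P \<oplus> Q)"
  have T: "on_curve E T" "T \<notin> C" "XX T = XX (P \<oplus> Q)"
    unfolding T_def using Q P add_closed neg_notC XX_neg by auto
  have Tx: "T = Pt x3 (l*x3+m)" unfolding T_def lm(3) by simp
  have z: "M P = 0" "M Q = 0" "M T = 0" unfolding Mpr unfolding xy Tx L_def using lm(1,2) by simp_all
  \<comment> \<open>If c were 0, then a + b \<open>XX\<close> would vanish at two values of
    \<open>XX\<close>, so a = b = 0 and the norm of the line would vanish identically.\<close>
  have c0: "c \<noteq> 0"
  proof
    assume c: "c = 0"
    have "a + b * XX P = 0" "a + b * XX Q = 0" using ex[OF P] ex[OF Q(1,2)] z c by simp_all
    then have "b * (XX Q - XX P) = 0" by algebra
    then have b: "b = 0" using g by (simp add: good_def)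
    then have "a = 0" using ex[OF P] z c by simp
    then have M0: "\<forall>\<^sub>F R in gen. M R = 0" using abc b c by simp
    have "rp L [:-m, -l:] 1" unfolding rp_def L_def by (simp add: algebra_simps)
    then have Lnz: "\<forall>\<^sub>F R in gen. L R \<noteq> 0" by (rule reg_nonzero) simp
    have "\<forall>\<^sub>F R in gen. \<forall>c\<in>C. L (R \<oplus> c) \<noteq> 0"
      by (rule eventually_ball_finite[OF finC]) (use gen_add[OF Lnz] onC in blast)
    with M0 have "\<forall>\<^sub>F R in gen. False"
    proof eventually_elim
      case (elim R)
      then show ?case using finC by (simp add: M_def)
    qed
    then show False by simp
  qed
  have Y: "YY R = (- b / c) * XX R + (- a / c)" if "on_curve E R" "R \<notin> C" "M R = 0" for R
  proof -
    have "a + b * XX R + c * YY R = 0" using ex[OF that(1,2)] that(3) by simp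
    then have "c * YY R = - b * XX R - a" by algebra
    then have "YY R = (- b * XX R - a) / c" using c0 by (metis nonzero_mult_div_cancel_left)
    then show ?thesis by (simp add: diff_divide_distrib)
  qed
  show ?thesis using Y[OF P z(1)] Y[OF Q(1,2) z(2)] Y[OF T(1,2) z(3)] unfolding T(3) unfolding T_def by (intro exI[of _ "- b / c"] exI[of _ "- a / c"] conjI)
qed


definition WX :: "'a poly" where
  "WX = (SOME W. degree W \<le> 3 \<and> coeff W 3 = 1 \<and> Kpoly K W \<and>
     (\<forall>R. on_curve E R \<longrightarrow> R \<notin> C \<longrightarrow> YY R ^ 2 + a1 * XX R * YY R + l3 * YY R = poly W (XX R)))"

lemma WX: "degree WX \<le> 3" "coeff WX 3 = 1" "Kpoly K WX"
  "on_curve E R \<Longrightarrow> R \<notin> C \<Longrightarrow> YY R ^ 2 + a1 * XX R * YY R + l3 * YY R = poly WX (XX R)"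
  using someI_ex[OF cubic_ex] unfolding WX_def by auto

definition Eq :: "'a wcurve" where "Eq = WC a1 (coeff WX 2) l3 (coeff WX 1) (coeff WX 0)"

lemma Eq_K: "wa1 Eq \<in> K" "wa2 Eq \<in> K" "wa3 Eq \<in> K" "wa4 Eq \<in> K" "wa6 Eq \<in> K"
  using WX(3) KE K(3) Kofnat by (auto simp: Eq_def l3_def Kpoly_def)

lemma poly_WX: "poly WX x = x^3 + wa2 Eq * x^2 + wa4 Eq * x + wa6 Eq"
proof -
  have "WX = [:coeff WX 0, coeff WX 1, coeff WX 2, 1:]"
  proof (rule poly_eqI)
    fix n :: nat
    consider "n = 0" | "n = 1" | "n = 2" | "n = 3" | "n > 3" by linarith
    then show "coeff WX n = coeff [:coeff WX 0, coeff WX 1, coeff WX 2, 1:] n"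
    proof cases
      case 5
      then have "coeff WX n = 0" using WX(1) by (intro coeff_eq_0) simp
      moreover have "degree [:coeff WX 0, coeff WX 1, coeff WX 2, 1:] < n" using 5 by simp
      then have "coeff [:coeff WX 0, coeff WX 1, coeff WX 2, 1:] n = 0" by (rule coeff_eq_0)
      ultimately show ?thesis by simp
    qed (use WX(2) in \<open>auto simp: numeral_2_eq_2 numeral_3_eq_3\<close>)
  qed
  then have "poly WX x = poly [:coeff WX 0, coeff WX 1, coeff WX 2, 1:] x" by (rule arg_cong)
  then show ?thesis unfolding Eq_def by (simp add: algebra_simps power2_eq_square power3_eq_cube)
qed

definition phi :: "'a ecpt \<Rightarrow> 'a ecpt" where "phi R = (if R \<in> C then Inf else Pt (XX R) (YY R))"

lemma Eq_sel: "wa1 Eq = a1" "wa3 Eq = l3" by (simp_all add: Eq_def)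

lemma phi_closed: assumes "on_curve E R" shows "on_curve Eq (phi R)"
proof (cases "R \<in> C")
  case False
  have "YY R ^ 2 + wa1 Eq * XX R * YY R + wa3 Eq * YY R = XX R^3 + wa2 Eq * XX R^2 + wa4 Eq * XX R + wa6 Eq"
    unfolding poly_WX[symmetric] Eq_sel by (rule WX(4)[OF assms False])
  then show ?thesis using False by (simp add: phi_def)
qed (simp add: phi_def)

lemma phi_neg: assumes "on_curve E R" shows "phi (\<ominus> R) = ec_neg Eq (phi R)"
proof (cases "R \<in> C")
  case False
  then show ?thesis using neg_notC[OF assms False] XX_neg[OF assms] YY_neg[OF assms False] by (simp add: phi_def Eq_sel)
qed (use negC in \<open>simp add: phi_def\<close>)

lemma three_on_line:
  fixes F :: "'b::field wcurve"
  assumes c: "on_curve F (Pt x1 (l*x1+m))" "on_curve F (Pt x2 (l*x2+m))" "on_curve F (Pt x3 (l*x3+m))"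
    and d: "x1 \<noteq> x2" "x1 \<noteq> x3" "x2 \<noteq> x3"
  shows "collin F l m x1 x2 x3"
proof -
  define e1 e2 e3 where "e1 = l^2 + wa1 F * l - wa2 F" and "e2 = wa4 F - (2*l*m + wa1 F * m + wa3 F * l)" and "e3 = m^2 + wa3 F * m - wa6 F"
  have z: "x^3 - e1 * x^2 + e2 * x - e3 = 0" if "on_curve F (Pt x (l*x+m))" for x
    using that unfolding on_curve.simps e1_def e2_def e3_def by algebra
  note z1 = z[OF c(1)] and z2 = z[OF c(2)] and z3 = z[OF c(3)]
  have "(x1 - x2) * (x1^2 + x1*x2 + x2^2 - e1 * (x1 + x2) + e2) = 0" using z1 z2 by algebra
  then have q2: "x1^2 + x1*x2 + x2^2 - e1 * (x1 + x2) + e2 = 0" using d by simp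
  have "(x1 - x3) * (x1^2 + x1*x3 + x3^2 - e1 * (x1 + x3) + e2) = 0" using z1 z3 by algebra
  then have q3: "x1^2 + x1*x3 + x3^2 - e1 * (x1 + x3) + e2 = 0" using d by simp
  have "(x2 - x3) * (x1 + x2 + x3 - e1) = 0" using q2 q3 by algebra
  then have r1: "e1 = x1 + x2 + x3" using d by simp
  have r2: "e2 = x1*x2 + x1*x3 + x2*x3" using q2 r1 by algebra
  have r3: "e3 = x1*x2*x3" using z1 r1 r2 by algebra
  have "2*l*m + wa1 F * m + wa3 F * l - wa4 F = - e2" unfolding e2_def by algebra
  then show ?thesis using r1 r2 r3 unfolding collin_def e1_def e3_def by simp
qed

lemma generic_collin:
  assumes P: "on_curve E P" "P \<notin> C" and g: "good P Q"
  obtains l m where "YY P = l * XX P + m" "YY Q = l * XX Q + m" "YY (\<ominus> (P \<oplus> Q)) = l * XX (P \<oplus> Q) + m"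
    "collin Eq l m (XX P) (XX Q) (XX (P \<oplus> Q))"
proof -
  have Q: "on_curve E Q" "Q \<notin> C" "P \<oplus> Q \<notin> C" "XX Q \<noteq> XX P" "XX (P \<oplus> Q) \<noteq> XX P" "XX Q \<noteq> XX (P \<oplus> Q)"
    using g by (simp_all add: good_def)
  obtain l m where lm: "YY P = l * XX P + m" "YY Q = l * XX Q + m" "YY (\<ominus> (P \<oplus> Q)) = l * XX (P \<oplus> Q) + m"
    using line_image[OF P g] by blast
  have PQ: "on_curve E (P \<oplus> Q)" using P Q add_closed by blast
  note nPQ = neg_notC[OF PQ Q(3)]
  have "on_curve Eq (Pt (XX P) (l * XX P + m))"
    using phi_closed[OF P(1)] P(2) lm(1) unfolding phi_def by (simp only: if_False)
  moreover have "on_curve Eq (Pt (XX Q) (l * XX Q + m))"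
    using phi_closed[OF Q(1)] Q(2) lm(2) unfolding phi_def by (simp only: if_False)
  moreover have "on_curve Eq (Pt (XX (P \<oplus> Q)) (l * XX (P \<oplus> Q) + m))"
    using phi_closed[of "\<ominus> (P \<oplus> Q)"] PQ nPQ lm(3) XX_neg[OF PQ] unfolding phi_def by (simp only: if_False on_curve_neg)
  ultimately have "collin Eq l m (XX P) (XX Q) (XX (P \<oplus> Q))"
    using Q(4-6) by (intro three_on_line) auto
  then show ?thesis using that lm by blast
qed

text \<open>Suppose there is a singular point, lift it to R and take S in general position. The line
  through the images of R and S has a double intersection at the singular point, so one of the other
  two intersections has the same x-coordinate, which general position forbids.\<close>

lemma Eq_elliptic: "elliptic Eq"
proof (rule ccontr)
  assume "\<not> elliptic Eq"
  then obtain x0 y0 where s: "on_curve Eq (Pt x0 y0)" "2 * y0 + a1 * x0 + l3 = 0"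
     "3 * x0^2 + 2 * wa2 Eq * x0 + wa4 Eq - a1 * y0 = 0"
    using disc_zero_singular[of Eq] unfolding elliptic_def Eq_sel by blast
  obtain R where R: "on_curve E R" "R \<notin> C" "XX R = x0" using XX_surj[of x0] card_C by auto
  have c: "on_curve Eq (Pt x0 (YY R))" using phi_closed[OF R(1)] R(2,3) by (simp add: phi_def)
  have "(YY R - y0)^2 = 0" using s(1,2) c unfolding on_curve.simps Eq_sel by algebra
  then have y: "YY R = y0" by simp
  obtain S where S: "good R S" using gen_ex[OF gen_good[OF R(1,2)]] by blast
  obtain l m where lm: "YY R = l * XX R + m" "collin Eq l m (XX R) (XX S) (XX (R \<oplus> S))"
    by (rule generic_collin[OF R(1,2) S]) 
  have "(x0 - XX S) * (x0 - XX (R \<oplus> S)) = 0"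
    using lm s(2,3) y R(3) unfolding collin_def Eq_sel by algebra
  then show False using S R(3) by (auto simp: good_def)
qed

lemma phi_good: assumes P: "on_curve E P" "P \<notin> C" and g: "good P Q" shows "phi (P \<oplus> Q) = ec_add Eq (phi P) (phi Q)"
proof -
  interpret Q: wcv Eq using Eq_elliptic by unfold_locales
  have Q: "on_curve E Q" "Q \<notin> C" "P \<oplus> Q \<notin> C" using g by (simp_all add: good_def)
  have PQ: "on_curve E (P \<oplus> Q)" using P Q add_closed by blast
  obtain l m where lm: "YY P = l * XX P + m" "YY Q = l * XX Q + m" "YY (\<ominus> (P \<oplus> Q)) = l * XX (P \<oplus> Q) + m"
    "collin Eq l m (XX P) (XX Q) (XX (P \<oplus> Q))" by (rule generic_collin[OF P g])
  have "ec_add Eq (phi P) (phi Q) = ec_neg Eq (Pt (XX (P \<oplus> Q)) (l * XX (P \<oplus> Q) + m))"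
    using Q.collin_add[OF lm(4)] P Q lm(1,2) unfolding phi_def by (simp only: if_False)
  also have "Pt (XX (P \<oplus> Q)) (l * XX (P \<oplus> Q) + m) = phi (\<ominus> (P \<oplus> Q))"
    using neg_notC[OF PQ Q(3)] lm(3) XX_neg[OF PQ] unfolding phi_def by (simp only: if_False)
  also have "\<dots> = ec_neg Eq (phi (P \<oplus> Q))" by (rule phi_neg[OF PQ])
  finally show ?thesis by (simp only: Q.neg_neg)
qed

lemma phi_trans: assumes "on_curve E R" "c \<in> C" shows "phi (R \<oplus> c) = phi R"
proof (cases "R \<in> C")
  case True then show ?thesis using addC assms by (simp add: phi_def)
next
  case False
  then show ?thesis using add_notC[OF assms(1) False assms(2)] XX_add[OF assms(2,1)] YY_add[OF assms(2,1)] by (simp add: phi_def)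
qed

text \<open>Additivity in general position is extended by a generic S: the image of P + Q + S is
  computed in two ways, and the image of S is cancelled with the group law of \<open>Eq\<close>,
  already known to be elliptic and hence associative.\<close>

lemma phi_hom: assumes P: "on_curve E P" and Q: "on_curve E Q" shows "phi (P \<oplus> Q) = ec_add Eq (phi P) (phi Q)"
proof -
  interpret Q: ecv Eq using Eq_elliptic by unfold_locales
  consider "P \<in> C" | "Q \<in> C" | "P \<notin> C" "Q \<notin> C" by blast
  then show ?thesis
  proof cases
    case 1
    have "phi (P \<oplus> Q) = phi Q" using phi_trans[OF Q 1] add_commute P Q by metis
    then show ?thesis using 1 by (simp add: phi_def)
  next
    case 2
    have "phi (P \<oplus> Q) = phi P" using phi_trans[OF P 2] .
    then show ?thesis using 2 by (simp add: phi_def)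
  next
    case 3
    have PQ: "on_curve E (P \<oplus> Q)" using P Q add_closed by blast
    have g1: "\<forall>\<^sub>F S in gen. good P (S \<oplus> Q)" by (rule gen_add[OF gen_good[OF P 3(1)] Q])
    have g2: "\<forall>\<^sub>F S in gen. phi ((P \<oplus> Q) \<oplus> S) = ec_add Eq (phi (P \<oplus> Q)) (phi S)"
    proof (cases "P \<oplus> Q \<in> C")
      case True
      show ?thesis using gen_on_curve
      proof eventually_elim
        case (elim S)
        have "phi ((P \<oplus> Q) \<oplus> S) = phi S" using phi_trans[OF elim True] add_commute[OF PQ elim] by simp
        then show ?case using True by (simp add: phi_def)
      qed
    next
      case False
      show ?thesis using gen_good[OF PQ False] by eventually_elim (rule phi_good[OF PQ False])
    qed
    obtain S where S: "on_curve E S" "good P (S \<oplus> Q)" "good Q S" "phi ((P \<oplus> Q) \<oplus> S) = ec_add Eq (phi (P \<oplus> Q)) (phi S)"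
      using gen_ex[OF eventually_conj[OF gen_on_curve eventually_conj[OF g1 eventually_conj[OF gen_good[OF Q 3(2)] g2]]]] by blast
    have "phi ((P \<oplus> Q) \<oplus> S) = phi (P \<oplus> (S \<oplus> Q))" using P Q S(1) by (simp add: add_assoc add_commute)
    also have "\<dots> = ec_add Eq (phi P) (phi (S \<oplus> Q))" by (rule phi_good[OF P 3(1) S(2)])
    also have "phi (S \<oplus> Q) = ec_add Eq (phi Q) (phi S)" using phi_good[OF Q 3(2) S(3)] add_commute[OF Q S(1)] by simp
    finally have "ec_add Eq (phi (P \<oplus> Q)) (phi S) = ec_add Eq (ec_add Eq (phi P) (phi Q)) (phi S)"
      using S(4) phi_closed P Q S(1) by (simp add: Q.add_assoc)
    moreover have "on_curve Eq (phi (P \<oplus> Q))" "on_curve Eq (ec_add Eq (phi P) (phi Q))" "on_curve Eq (phi S)"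
      using phi_closed P Q PQ S(1) Q.add_closed by blast+
    ultimately show ?thesis using Q.add_cancel by metis
  qed
qed

end

section \<open>Rationality of the quotient\<close>

context subfd
begin

text \<open>Polynomials in x whose coefficients are polynomials over K in the parameter s, as
  functions of s. The inductive form lets a trace over s be reduced, generator by generator, to
  traces of powers of s.\<close>

inductive fam :: "('a \<Rightarrow> 'a poly) \<Rightarrow> bool" where
  fam_const: "KP p \<Longrightarrow> fam (\<lambda>s. p)"
| fam_var: "fam (\<lambda>s. [:s:])"
| fam_add: "fam f \<Longrightarrow> fam g \<Longrightarrow> fam (\<lambda>s. f s + g s)"
| fam_mult: "fam f \<Longrightarrow> fam g \<Longrightarrow> fam (\<lambda>s. f s * g s)"

lemma fam_diff: "fam f \<Longrightarrow> fam g \<Longrightarrow> fam (\<lambda>s. f s - g s)"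
  using fam_add[of f "\<lambda>s. [:-1:] * g s"] fam_mult[OF fam_const[OF KP_const[of "-1"]], of g] Kminus[OF K(6)] by simp

lemma fam_power: "fam f \<Longrightarrow> fam (\<lambda>s. f s ^ n)"
  by (induction n) (auto intro: fam_const KP_1 fam_mult)

lemma fam_poly: "KP p \<Longrightarrow> fam (\<lambda>s. [:poly p s:])"
proof (induction p)
  case (pCons a p)
  have "a \<in> K" "KP p" using pCons.prems unfolding Kpoly_def
    by (metis coeff_pCons_0, metis coeff_pCons_Suc)
  then have "fam (\<lambda>s. [:a:] + [:s:] * [:poly p s:])" by (intro fam_add fam_mult fam_var fam_const KP_const pCons.IH)
  then show ?case by (simp add: mult.commute)
qed (simp add: fam_const KP_0)

lemma fam_synthetic_div: "KP p \<Longrightarrow> fam (\<lambda>s. synthetic_div p s)"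
proof (induction p)
  case (pCons a p)
  have p: "KP p" using pCons.prems unfolding Kpoly_def by (metis coeff_pCons_Suc)
  then have "fam (\<lambda>s. [:poly p s:] + [:0,1:] * synthetic_div p s)"
    by (intro fam_add fam_mult fam_const KP_X fam_poly pCons.IH)
  then show ?case by simp
next
  case 0
  have "synthetic_div 0 = (\<lambda>s::'a. 0)" by (rule ext) simp
  then show ?case using fam_const[OF KP_0] by simp
qed

text \<open>The weights \<open>A\<close> are arbitrary and all powers of s are carried along: a
  factor s only shifts the exponent, and a product is handled by taking the second factor into the
  weights.\<close>

lemma fam_sum_aux:
  assumes "fam f" "\<forall>k. KP (\<Sum>s\<in>S. [:s:] ^ k * A s)" shows "\<forall>k. KP (\<Sum>s\<in>S. [:s:] ^ k * (f s * A s))"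
  using assms
proof (induction f arbitrary: A rule: fam.induct)
  case (fam_const p)
  have "(\<Sum>s\<in>S. [:s:] ^ k * (p * A s)) = p * (\<Sum>s\<in>S. [:s:] ^ k * A s)" for k
    unfolding sum_distrib_left by (intro sum.cong refl) (simp only: mult_ac)
  then show ?case using fam_const by (simp add: KP_mult)
next
  case fam_var
  have "[:s:] ^ k * ([:s:] * A s) = [:s:] ^ Suc k * A s" for k and s :: 'a by (simp only: power_Suc mult_ac)
  then show ?case using fam_var by (simp only:) blast
next
  case (fam_add f g)
  then show ?case by (simp only: distrib_right distrib_left sum.distrib) (blast intro: KP_add)
next
  case (fam_mult f g)
  have "\<forall>k. KP (\<Sum>s\<in>S. [:s:] ^ k * (f s * (g s * A s)))" by (rule fam_mult.IH(1)[OF fam_mult.IH(2)[OF fam_mult.prems]])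
  then show ?case by (simp only: mult.assoc simp_thms)
qed

definition rootpoly :: "'a set \<Rightarrow> 'a poly" where "rootpoly S = (\<Prod>s\<in>S. [:-s, 1:])"

lemma rootpoly_lc: "finite S \<Longrightarrow> lc (rootpoly S) (card S) 1"
proof (induction S rule: finite_induct)
  case (insert s S)
  have "lc ([:-s,1:] * rootpoly S) (1 + card S) (1 * 1)" by (intro lc_mult insert) (simp add: lc_def)
  then show ?case using insert by (simp add: rootpoly_def)
qed (simp add: rootpoly_def lc_def)

lemma rootpoly_root: "finite S \<Longrightarrow> poly (rootpoly S) x = 0 \<longleftrightarrow> x \<in> S"
  by (auto simp: rootpoly_def poly_prod)

lemma rootpoly_remove: "finite S \<Longrightarrow> s \<in> S \<Longrightarrow> rootpoly S = [:-s,1:] * rootpoly (S - {s})"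
  unfolding rootpoly_def by (rule prod.remove)

lemma rootpoly_synthetic: "finite S \<Longrightarrow> s \<in> S \<Longrightarrow> rootpoly (S - {s}) = synthetic_div (rootpoly S) s"
  using synthetic_div_correct'[of s "rootpoly S"] rootpoly_root[of S s] rootpoly_remove[of S s]
  by (metis add.right_neutral mult_cancel_left pCons_0_0 pCons_eq_0_iff zero_neq_one)

text \<open>The power sums of \<open>S\<close> are the subleading coefficients of the sums themselves, so the recursion stays in \<open>K\<close>.\<close>

lemma KP_power_sum:
  assumes S: "finite S" and h: "KP (rootpoly S)" shows "KP (\<Sum>s\<in>S. [:s:] ^ k * rootpoly (S - {s}))"
proof (induction k)
  case 0
  have "pderiv (rootpoly S) = (\<Sum>s\<in>S. rootpoly (S - {s}))"
    unfolding rootpoly_def pderiv_prod by (simp add: pderiv_pCons)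
  then show ?case using KP_pderiv[OF h] by simp
next
  case (Suc k)
  define T where "T = (\<Sum>s\<in>S. [:s:] ^ k * rootpoly (S - {s}))"
  have e: "[:s:] ^ Suc k * rootpoly (S - {s}) = [:0,1:] * ([:s:] ^ k * rootpoly (S - {s})) - rootpoly S * [:s ^ k:]" if "s \<in> S" for s
  proof -
    have X: "[:-s,1:] = [:0,1:] - [:s:]" by simp
    have p: "[:s:] ^ k = [:s ^ k:]" by (induction k) (simp_all add: pCons_one)
    show ?thesis unfolding rootpoly_remove[OF S that] X p[symmetric] by (simp only: power_Suc) algebra
  qed
  have "(\<Sum>s\<in>S. [:s:] ^ Suc k * rootpoly (S - {s})) = [:0,1:] * T - rootpoly S * (\<Sum>s\<in>S. [:s ^ k:])"
    unfolding T_def sum_distrib_left sum_subtractf[symmetric] using e by (intro sum.cong) auto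
  also have "(\<Sum>s\<in>S. [:s ^ k:]) = [:coeff T (card S - 1):]"
  proof -
    have "coeff (rootpoly (S - {s})) (card S - 1) = 1" if "s \<in> S" for s
      using rootpoly_lc[of "S - {s}"] S that by (simp add: lc_def)
    moreover have "[:s:] ^ k * p = smult (s ^ k) p" for s :: 'a and p by (induction k) (simp_all add: mult.assoc)
    ultimately have "coeff T (card S - 1) = (\<Sum>s\<in>S. s ^ k)" unfolding T_def coeff_sum by simp
    moreover have "(\<Sum>s\<in>S. [:g s:]) = [:\<Sum>s\<in>S. g s:]" for g :: "'a \<Rightarrow> 'a"
      using S by (induction S rule: finite_induct) auto
    ultimately show ?thesis by simp
  qed
  finally show ?case using Suc h unfolding T_def[symmetric]
    by (simp only:) (intro KP_diff KP_mult KP_X KP_const; simp add: Kpoly_def)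
qed

text \<open>The quotient of \<open>rootpoly S\<close> by X - s depends polynomially on s, so all but
  one of its powers are absorbed in the family; the remaining one is the weight for which the power
  sums are known.\<close>

lemma KP_fam_sum:
  assumes S: "finite S" and h: "KP (rootpoly S)" and f: "fam f" shows "KP (\<Sum>s\<in>S. f s * rootpoly (S - {s}) ^ Suc n)"
proof -
  have "\<forall>k. KP (\<Sum>s\<in>S. [:s:] ^ k * ((f s * synthetic_div (rootpoly S) s ^ n) * rootpoly (S - {s})))"
    by (intro fam_sum_aux fam_mult fam_power f fam_synthetic_div h allI KP_power_sum S)
  from spec[OF this, of 0] have "KP (\<Sum>s\<in>S. f s * synthetic_div (rootpoly S) s ^ n * rootpoly (S - {s}))" by simp
  also have "(\<Sum>s\<in>S. f s * synthetic_div (rootpoly S) s ^ n * rootpoly (S - {s})) = (\<Sum>s\<in>S. f s * rootpoly (S - {s}) ^ Suc n)"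
    by (intro sum.cong refl) (simp only: rootpoly_synthetic[OF S] power_Suc mult_ac)
  finally show ?thesis .
qed

end

section \<open>Explicit quotients in the style of Velu\<close>

locale ecK = ecsub E C + subfd K for E :: "'a::alg_closed_field wcurve" and C and K :: "'a set" +
  assumes KE: "a1 \<in> K" "a2 \<in> K" "a3 \<in> K" "a4 \<in> K" "a6 \<in> K"
begin

text \<open>The point of order two has 2 t = - (a1 s + a3), so t is rational along with s because 2
  is invertible.\<close>

lemma quotient_2:
  assumes C: "C = {Inf, Pt s t}" and s: "s \<in> K" and two: "(2::'a) \<noteq> 0"
  shows "\<exists>u v w A B. ecrat E C K u v w A B"
proof -
  have T: "on_curve E (Pt s t)" using onC C by blast
  have cC: "card C = 2" unfolding C by simp
  have "C' = C - {Inf}" by (rule C'_def)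
  also have "\<dots> = {Pt s t}" by (subst C) auto
  finally have C': "C' = {Pt s t}" .
  have "\<ominus> (Pt s t) = Pt s t" using negC[of "Pt s t"] C by auto
  then have t': "- t - a1 * s - a3 = t" by simp
  have "2*t + a1*s + a3 = t - (- t - a1 * s - a3)" by algebra
  then have t: "2*t + a1*s + a3 = 0" unfolding t' by simp
  have half: "2 * (z / 2) = z" for z :: 'a using two by simp
  have "2 * t = 2 * ((0 - (a1*s + a3)) / 2)" unfolding half using t by algebra
  then have "t = (0 - (a1*s + a3)) / 2" unfolding mult_cancel_left using two by blast
  moreover have "(0 - (a1*s + a3)) / 2 \<in> K" by (intro K KE s Knumeral)
  ultimately have tK: "t \<in> K" by (simp only:)
  \<comment> \<open>The x-derivative at the two-torsion point. Translation by this point reads (X -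
    s) (x - s) = g, so \<open>XX\<close> = x + s + g / (x - s); hence the denominator
    \<open>D\<close>, and its square for \<open>YY\<close>.\<close>
  define g where "g = 3*s^2 + 2*a2*s + a4 - a1*t"
  have g0: "g \<noteq> 0" unfolding g_def by (rule smooth[OF T t])
  have gK: "g \<in> K" unfolding g_def by (intro K KE s tK Knumeral Kpower)
  define D where "D = [:-s, 1:]"
  define u where "u = [:g - s*s, 0, 1:]"
  define A where "A = [:t*g:] - [:t + a3 + a1 * s:] * D^2 - [:a1*g:] * D"
  define B where "B = D^2 - [:g:]"
  have KD: "KP D" unfolding D_def by (intro KP_pCons KP_0 K Kminus s)
  have f: "XX R * poly D (px R) = poly u (px R) \<and> YY R * poly (D^2) (px R) = poly A (px R) + poly B (px R) * py R"
    if R: "on_curve E R" "R \<notin> C" for R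
  proof -
    obtain x y where xy: "R = Pt x y" using R C by (cases R) auto
    have oxy: "on_curve E (Pt x y)" "Pt x y \<notin> C" using R unfolding xy .
    have xs: "x \<noteq> s" using px_notin_C[OF oxy, of "Pt s t"] C' by simp
    define X Y where "X = px (Pt x y \<oplus> Pt s t)" and "Y = py (Pt x y \<oplus> Pt s t)"
    have e: "(X - s) * (x - s)^2 = - (2*t + a1*s + a3) * y + (3*s^2 + 2*a2*s + a4 - a1*t) * x + (a4*s + 2*a6 - a3*t - s^3)"
      "(Y + t + a1*X + a3) * (x - s) = - ((y - t) * (X - s))"
      unfolding X_def Y_def by (rule add_formula[OF oxy(1) T xs])+
    have cs: "t^2 + a1*s*t + a3*t = s^3 + a2*s^2 + a4*s + a6" using T by simp
    have "(x - s) * ((X - s) * (x - s) - g) = 0" using e(1) cs t unfolding g_def by algebra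
    then have eg: "(X - s) * (x - s) = g" using xs by simp
    have XXe: "XX R = x + X" "YY R = y + Y" unfolding XX_def YY_def sum_C C' xy X_def Y_def by (simp_all del: ec_add.simps)
    have "(x + X) * (x - s) = g - s*s + x*x" unfolding eg[symmetric] by algebra
    moreover have "(y + Y) * (x - s)^2 = t*g - (t + a3 + a1*s) * (x - s)^2 - a1*g*(x - s) + ((x - s)^2 - g) * y"
      unfolding eg[symmetric] using e(2) by algebra
    moreover have pD: "poly D x = x - s" by (simp add: D_def)
    moreover have "poly u x = g - s*s + x*x" by (simp add: u_def)
    moreover have "poly A x = t*g - (t + a3 + a1*s) * (x - s)^2 - a1*g*(x - s)" "poly B x = (x - s)^2 - g"
      unfolding A_def B_def poly_diff poly_mult poly_power pD by simp_all
    ultimately show ?thesis unfolding xy XXe[unfolded xy] by (simp only: px.simps py.simps poly_power simp_thms)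
  qed
  have "ecrat E C K u D (D^2) A B"
  proof (unfold_locales)
    show "Kpoly K u" unfolding u_def by (intro KP_pCons KP_0 K gK s)
    show "Kpoly K D" "Kpoly K (D^2)" by (intro KD KP_power)+
    show "Kpoly K A" "Kpoly K B" unfolding A_def B_def by (intro KP_diff KP_mult KP_const KP_power KD K gK tK s KE)+
    show "lc D (card C - 1) 1" "lc u (card C) 1" "degree D = card C - 1" unfolding D_def u_def cC by (simp_all add: lc_def numeral_2_eq_2)
    show "poly D z \<noteq> 0" if "poly u z = 0" for z using that g0 by (auto simp: u_def D_def)
    show "poly D z = 0 \<longleftrightarrow> z \<in> px ` C'" for z by (auto simp: D_def C')
    show "z \<in> px ` C'" if "poly (D^2) z = 0" for z using that by (simp add: D_def C')
    show "XX R * poly D (px R) = poly u (px R)" if "on_curve E R" "R \<notin> C" for R using f[OF that] by blast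
    show "YY R * poly (D^2) (px R) = poly A (px R) + poly B (px R) * py R" if "on_curve E R" "R \<notin> C" for R
      using f[OF that] by blast
  qed (use K KE in auto)
  then show ?thesis by blast
qed

definition "S = px ` C'"
definition "H s = rootpoly (S - {s})"
definition "X1 = ([:0,1:] :: 'a poly)"
text \<open>Numerators of the joint contribution of c and -c with x-coordinate s: \<open>fx\<close>
  over (x - s)^2 for \<open>XX\<close>, and \<open>fa + fb * y\<close> over (x - s)^3 for
  \<open>YY\<close>. Pairing eliminates the y-coordinate of c, so that only the rational set of
  x-coordinates matters. \<open>SE\<close> is the sum of the two numerators in the translation
  formula.\<close>

definition SE :: "'a \<Rightarrow> 'a poly" where
  "SE s = [:2:] * ([:a4:] * [:s:] + [:2*a6:] - [:s:]^3) + [:a3:] * ([:a1:] * [:s:] + [:a3:])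
    + ([:2:] * ([:3:] * [:s:]^2 + [:2*a2:] * [:s:] + [:a4:]) + [:a1:] * ([:a1:] * [:s:] + [:a3:])) * X1"
definition fx :: "'a \<Rightarrow> 'a poly" where "fx s = [:2:] * [:s:] * (X1 - [:s:])^2 + SE s"
definition fb :: "'a \<Rightarrow> 'a poly" where
  "fb s = 0 - SE s - ([:4:] * [:s:]^3 + [:wb2 E:] * [:s:]^2 + [:2 * wb4 E:] * [:s:] + [:wb6 E:])"
definition fa :: "'a \<Rightarrow> 'a poly" where
  "fa s = 0 - ([:a1:] * [:s:] + [:a3:]) * (([:3:] * [:s:]^2 + [:2*a2:] * [:s:] + [:a4:]) * X1 + ([:a4:] * [:s:] + [:2*a6:] - [:s:]^3))
    - ([:a1:] * X1 + [:a3:]) * (([:a1:] * [:s:] + [:a3:])^2 + [:2:] * ([:s:]^3 + [:a2:] * [:s:]^2 + [:a4:] * [:s:] + [:a6:]))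
    - ([:a1:] * [:s:] + [:a3:]) * (X1 - [:s:])^3 - [:a1:] * (X1 - [:s:]) * SE s"

lemma wbK: "wb2 E \<in> K" "wb4 E \<in> K" "wb6 E \<in> K"
  unfolding wb2_def wb4_def wb6_def by (intro K KE Knumeral Kpower)+

lemma famS: "fam SE" "fam fx" "fam fb" "fam fa"
proof -
  have X: "KP X1" unfolding X1_def by (rule KP_X)
  show S: "fam SE" unfolding SE_def[abs_def]
    by (intro fam_add fam_mult fam_diff fam_power fam_var fam_const[OF KP_const] fam_const[OF X] K KE Knumeral)
  have S': "fam (\<lambda>s. SE s)" using S by simp
  show "fam fx" unfolding fx_def[abs_def]
    by (intro fam_add fam_mult fam_diff fam_power fam_var fam_const[OF KP_const] fam_const[OF X] K KE Knumeral S')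
  show "fam fb" unfolding fb_def[abs_def]
    by (intro fam_add fam_mult fam_diff fam_power fam_var fam_const[OF KP_const] fam_const[OF KP_0] K KE Knumeral S' wbK)
  show "fam fa" unfolding fa_def[abs_def]
    by (intro fam_add fam_mult fam_diff fam_power fam_var fam_const[OF KP_const] fam_const[OF KP_0] fam_const[OF X] K KE Knumeral S')
qed

lemma finS: "finite S" by (simp add: S_def finC')

lemma pair_formula:
  assumes R: "on_curve E (Pt x y)" and c: "on_curve E (Pt s t)" and xs: "x \<noteq> s"
  shows "(px (Pt x y \<oplus> Pt s t) + px (Pt x y \<oplus> \<ominus> (Pt s t))) * (x - s)^2 = poly (fx s) x"
    and "(py (Pt x y \<oplus> Pt s t) + py (Pt x y \<oplus> \<ominus> (Pt s t))) * (x - s)^3 = poly (fa s) x + poly (fb s) x * y"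
proof -
  define X Y where "X = px (Pt x y \<oplus> Pt s t)" and "Y = py (Pt x y \<oplus> Pt s t)"
  define X' Y' where "X' = px (Pt x y \<oplus> \<ominus> (Pt s t))" and "Y' = py (Pt x y \<oplus> \<ominus> (Pt s t))"
  define t' where "t' = - t - a1 * s - a3"
  have n: "\<ominus> (Pt s t) = Pt s t'" by (simp add: t'_def)
  have c': "on_curve E (Pt s t')" using c on_curve_neg[of "Pt s t"] unfolding n by simp
  define L L' where "L = - (2*t + a1*s + a3) * y + (3*s^2 + 2*a2*s + a4 - a1*t) * x + (a4*s + 2*a6 - a3*t - s^3)"
    and "L' = - (2*t' + a1*s + a3) * y + (3*s^2 + 2*a2*s + a4 - a1*t') * x + (a4*s + 2*a6 - a3*t' - s^3)"
  have e: "(X - s) * (x - s)^2 = L" "(Y + t + a1*X + a3) * (x - s) = - ((y - t) * (X - s))"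
    unfolding X_def Y_def L_def by (rule add_formula[OF R c xs])+
  have e': "(X' - s) * (x - s)^2 = L'" "(Y' + t' + a1*X' + a3) * (x - s) = - ((y - t') * (X' - s))"
    unfolding X'_def Y'_def L'_def n by (rule add_formula[OF R c' xs])+
  have cs: "t^2 + a1*s*t + a3*t = s^3 + a2*s^2 + a4*s + a6" using c by simp
  define Z where "Z = 2 * (a4*s + 2*a6 - s^3) + a3 * (a1*s + a3) + (2 * (3*s^2 + 2*a2*s + a4) + a1 * (a1*s + a3)) * x"
  have Z: "poly (SE s) x = Z" unfolding SE_def Z_def X1_def by (simp add: algebra_simps)
  have LL: "L + L' = Z" unfolding L_def L'_def Z_def t'_def by algebra
  have "(X + X') * (x - s)^2 = 2 * s * (x - s)^2 + Z" unfolding LL[symmetric] e(1)[symmetric] e'(1)[symmetric] by algebra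
  then show "(px (Pt x y \<oplus> Pt s t) + px (Pt x y \<oplus> \<ominus> (Pt s t))) * (x - s)^2 = poly (fx s) x"
    unfolding fx_def X_def[symmetric] X'_def[symmetric] poly_add Z by (simp add: X1_def)
  have "(Y + Y') * (x - s)^3 = (t*L + t'*L') - y*(L + L') - (t + t' + 2*a3) * (x - s)^3 - a1 * ((x - s) * (L + L') + 2*s*(x - s)^3)"
    unfolding e(1)[symmetric] e'(1)[symmetric] using e(2) e'(2) by algebra
  \<comment> \<open>The symmetric functions of the two conjugate y-values are polynomials in s:
    their sum is - (a1 s + a3), their product - (s^3 + a2 s^2 + a4 s + a6).\<close>
  also have "t*L + t'*L' = - (4*s^3 + wb2 E * s^2 + 2 * wb4 E * s + wb6 E) * y - (a1*s + a3) * ((3*s^2 + 2*a2*s + a4)*x + (a4*s + 2*a6 - s^3))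
     - (a1*x + a3) * ((a1*s + a3)^2 + 2 * (s^3 + a2*s^2 + a4*s + a6))"
    unfolding L_def L'_def t'_def wb2_def wb4_def wb6_def using cs by algebra
  finally have f: "(Y + Y') * (x - s)^3 = - (4*s^3 + wb2 E * s^2 + 2 * wb4 E * s + wb6 E) * y - (a1*s + a3) * ((3*s^2 + 2*a2*s + a4)*x + (a4*s + 2*a6 - s^3))
     - (a1*x + a3) * ((a1*s + a3)^2 + 2 * (s^3 + a2*s^2 + a4*s + a6)) - y*Z - (t + t' + 2*a3) * (x - s)^3 - a1 * ((x - s) * Z + 2*s*(x - s)^3)"
    unfolding LL .
  have pa: "poly (fa s) x = 0 - (a1*s + a3) * ((3*s^2 + 2*a2*s + a4)*x + (a4*s + 2*a6 - s^3))
     - (a1*x + a3) * ((a1*s + a3)^2 + 2 * (s^3 + a2*s^2 + a4*s + a6)) - (a1*s + a3) * (x - s)^3 - a1 * (x - s) * Z"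
    unfolding fa_def X1_def poly_diff poly_add poly_mult poly_power Z poly_pCons poly_0 mult_zero_right add_0_right add_0_left mult_1_right ..
  have pb: "poly (fb s) x = 0 - Z - (4*s^3 + wb2 E * s^2 + 2 * wb4 E * s + wb6 E)"
    unfolding fb_def X1_def poly_diff poly_add poly_mult poly_power Z poly_pCons poly_0 mult_zero_right add_0_right add_0_left mult_1_right ..
  show "(py (Pt x y \<oplus> Pt s t) + py (Pt x y \<oplus> \<ominus> (Pt s t))) * (x - s)^3 = poly (fa s) x + poly (fb s) x * y"
    unfolding Y_def[symmetric] Y'_def[symmetric] pa pb f unfolding t'_def by algebra
qed

context
  assumes odd: "\<And>c. c \<in> C' \<Longrightarrow> \<ominus> c \<noteq> c" and h: "KP (rootpoly S)"
begin

lemma sum_pairs: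
  assumes "\<And>c. c \<in> C' \<Longrightarrow> g c + g (\<ominus> c) = G (px c)" shows "(\<Sum>c\<in>C'. g c) = (\<Sum>s\<in>S. G s)"
proof -
  have "(\<Sum>c\<in>C'. g c) = (\<Sum>s\<in>S. \<Sum>c\<in>{c\<in>C'. px c = s}. g c)"
    unfolding S_def by (rule sum.image_gen[OF finC'])
  also have "\<dots> = (\<Sum>s\<in>S. G s)"
  proof (rule sum.cong)
    fix s assume "s \<in> S"
    then obtain c where c: "c \<in> C'" "px c = s" by (auto simp: S_def)
    have "{c\<in>C'. px c = s} = {c, \<ominus> c}"
    proof (intro equalityI subsetI)
      fix d assume "d \<in> {c\<in>C'. px c = s}"
      then have "d \<in> C'" "px c = px d" using c by auto
      then show "d \<in> {c, \<ominus> c}" using px_eq[of c d] C'D[of c] C'D[of d] c by auto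
    qed (use c negC' in auto)
    then show "(\<Sum>c\<in>{c\<in>C'. px c = s}. g c) = G s" using odd[OF c(1)] assms[OF c(1)] c(2) by auto
  qed simp
  finally show ?thesis .
qed

lemma card_S: "card C' = 2 * card S"
  using sum_pairs[of "\<lambda>_. 1 :: nat" "\<lambda>_. 2"] by simp

lemma quotient_odd: "\<exists>u v w A B. ecrat E C K u v w A B"
proof -
  define hh where "hh = rootpoly S"
  define u where "u = X1 * hh^2 + (\<Sum>s\<in>S. fx s * H s ^ 2)"
  define A where "A = (\<Sum>s\<in>S. fa s * H s ^ 3)"
  define B where "B = hh^3 + (\<Sum>s\<in>S. fb s * H s ^ 3)"
  have Kh: "KP hh" using h by (simp add: hh_def)
  have Kf: "KP (\<Sum>s\<in>S. f s * H s ^ Suc n)" if "fam f" for f n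
    unfolding H_def by (rule KP_fam_sum[OF finS h that])
  have hr: "poly hh z = 0 \<longleftrightarrow> z \<in> S" for z unfolding hh_def by (rule rootpoly_root[OF finS])
  have hs: "poly hh x = (x - s) * poly (H s) x" if "s \<in> S" for s x
    unfolding hh_def H_def rootpoly_remove[OF finS that] by (simp add: algebra_simps)
  have f: "XX R * poly (hh^2) (px R) = poly u (px R) \<and> YY R * poly (hh^3) (px R) = poly A (px R) + poly B (px R) * py R"
    if R: "on_curve E R" "R \<notin> C" for R
  proof -
    obtain x y where xy: "R = Pt x y" using R InfC by (cases R) auto
    have oxy: "on_curve E (Pt x y)" "Pt x y \<notin> C" using R unfolding xy .
    have xs: "x \<noteq> px c" if "c \<in> C'" for c using px_notin_C[OF oxy that] .
    have p: "(px (Pt x y \<oplus> c) + px (Pt x y \<oplus> \<ominus> c)) * poly hh x ^ 2 = poly (fx (px c)) x * poly (H (px c)) x ^ 2 \<and>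
       (py (Pt x y \<oplus> c) + py (Pt x y \<oplus> \<ominus> c)) * poly hh x ^ 3 = (poly (fa (px c)) x + poly (fb (px c)) x * y) * poly (H (px c)) x ^ 3"
      if c: "c \<in> C'" for c
    proof -
      obtain s t where st: "c = Pt s t" "on_curve E (Pt s t)" using C'D[OF c] by metis
      have sS: "s \<in> S" using c st unfolding S_def by force
      have "x \<noteq> s" using xs[OF c] st by simp
      note pf = pair_formula[OF oxy(1) st(2) this]
      show ?thesis unfolding hs[OF sS] st(1) px.simps pf[symmetric] by (simp only: power_mult_distrib mult_ac)
    qed
    have "(\<Sum>c\<in>C'. px (Pt x y \<oplus> c) * poly hh x ^ 2) = (\<Sum>s\<in>S. poly (fx s) x * poly (H s) x ^ 2)"
      by (rule sum_pairs) (use p in \<open>simp only: distrib_right[symmetric]\<close>)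
    moreover have "(\<Sum>c\<in>C'. py (Pt x y \<oplus> c) * poly hh x ^ 3) = (\<Sum>s\<in>S. (poly (fa s) x + poly (fb s) x * y) * poly (H s) x ^ 3)"
      by (rule sum_pairs) (use p in \<open>simp only: distrib_right[symmetric]\<close>)
    moreover have "XX R * poly hh x ^ 2 = x * poly hh x ^ 2 + (\<Sum>c\<in>C'. px (Pt x y \<oplus> c) * poly hh x ^ 2)"
      "YY R * poly hh x ^ 3 = y * poly hh x ^ 3 + (\<Sum>c\<in>C'. py (Pt x y \<oplus> c) * poly hh x ^ 3)"
      unfolding XX_def YY_def sum_C xy by (simp_all only: add_Inf px.simps py.simps distrib_right sum_distrib_right)
    ultimately show ?thesis unfolding u_def A_def B_def xy
      by (simp add: poly_sum X1_def algebra_simps sum.distrib sum_distrib_left)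
  qed
  have lh: "lc hh (card S) 1" unfolding hh_def by (rule rootpoly_lc[OF finS])
  have cC: "card C = 2 * card S + 1" using card_C card_S by simp
  have lv: "lc (hh^2) (2 * card S) 1" using lc_power[OF lh, of 2] by simp
  have lX: "lc X1 1 1" unfolding X1_def by (simp add: lc_def)
  have "lc u (2 * card S + 1) 1"
  proof -
    have 1: "lc (X1 * hh^2) (1 + 2 * card S) (1 * 1)" by (rule lc_mult[OF lX lv])
    have dfx: "degree (fx s) \<le> 2" for s
    proof -
      have "fx s = [: 2*s*s*s + (2 * (a4*s + 2*a6 - s^3) + a3 * (a1*s + a3)),
         (2 * (3*s^2 + 2*a2*s + a4) + a1 * (a1*s + a3)) - 4*s*s, 2*s :]"
        unfolding fx_def SE_def X1_def by (simp add: algebra_simps power2_eq_square power3_eq_cube)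
      moreover have "degree [:a, b, c:] \<le> 2" for a b c :: 'a by (simp add: degree_pCons_eq_if)
      ultimately show ?thesis by (simp only:)
    qed
    have "degree (fx s * H s ^ 2) \<le> 2 * card S" if "s \<in> S" for s
    proof -
      have "lc (H s) (card S - 1) 1" unfolding H_def using rootpoly_lc[of "S - {s}"] finS that by simp
      from lc_power[OF this, of 2] have "degree (H s ^ 2) \<le> 2 * (card S - 1)" by (simp add: lc_def)
      moreover have "card S \<ge> 1" using that finS by (metis card_gt_0_iff empty_iff Suc_leI One_nat_def)
      ultimately show ?thesis using degree_mult_le[of "fx s" "H s ^ 2"] dfx[of s] by linarith
    qed
    then have "degree (\<Sum>s\<in>S. fx s * H s ^ 2) \<le> 2 * card S" using finS by (intro degree_sum_le) auto
    then have 2: "lc (0 - (\<Sum>s\<in>S. fx s * H s ^ 2)) (1 + 2 * card S) 0"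
      by (auto simp: lc_def intro!: coeff_eq_0)
    from lc_diff[OF 1 2] show ?thesis unfolding u_def by simp
  qed
  \<comment> \<open>At a root z of \<open>hh\<close> only the summand of z survives, and there
    \<open>fx z\<close> takes the value \<open>Ff z\<close>, which is nonzero because no nonzero
    element of C is its own negative.\<close>
  moreover have "poly (hh^2) z \<noteq> 0" if z: "poly u z = 0" for z
  proof
    assume "poly (hh^2) z = 0"
    then have zS: "z \<in> S" "poly hh z = 0" using hr by auto
    then obtain c where c: "c \<in> C'" "z = px c" by (auto simp: S_def)
    have Hz: "poly (H s) z = 0" if "s \<in> S - {z}" for s
      using that zS finS unfolding H_def by (auto simp: rootpoly_root)
    have "poly (H z) z \<noteq> 0" using finS unfolding H_def by (simp add: rootpoly_root)
    moreover have "poly u z = poly (fx z) z * poly (H z) z ^ 2"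
      unfolding u_def using zS sum.remove[OF finS zS(1), of "\<lambda>s. poly (fx s) z * poly (H s) z ^ 2"] Hz
      by (simp add: poly_sum)
    moreover have "poly (fx z) z = Ff z" unfolding fx_def SE_def Ff_def X1_def wb2_def wb4_def wb6_def
      by simp algebra
    ultimately have "Ff z = 0" using z by simp
    then have "c \<oplus> c = Inf" using two_torsion_poly[of z "py c"] C'D[OF c(1)] c(2) by metis
    then have "c = \<ominus> c" using add_eq_Inf C'D[OF c(1)] by blast
    then show False using odd[OF c(1)] by simp
  qed
  moreover have "degree (hh^2) = 2 * card S"
    using lv unfolding lc_def by (metis le_antisym le_degree one_neq_zero)
  ultimately have "ecrat E C K u (hh^2) (hh^3) A B"
  proof unfold_locales
    show "Kpoly K u" unfolding u_def X1_def numeral_2_eq_2 by (intro KP_add KP_mult KP_X KP_power Kh Kf famS)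
    show "Kpoly K (hh^2)" "Kpoly K (hh^3)" by (intro KP_power Kh)+
    show "Kpoly K A" "Kpoly K B" unfolding A_def B_def numeral_3_eq_3 by (intro KP_add KP_power Kh Kf famS)+
    show "lc (hh^2) (card C - 1) 1" using lv cC by simp
    show "poly (hh^2) z = 0 \<longleftrightarrow> z \<in> px ` C'" for z using hr S_def by auto
    show "z \<in> px ` C'" if "poly (hh^3) z = 0" for z using that hr S_def by auto
    show "XX R * poly (hh^2) (px R) = poly u (px R)" if "on_curve E R" "R \<notin> C" for R using f[OF that] by blast
    show "YY R * poly (hh^3) (px R) = poly A (px R) + poly B (px R) * py R" if "on_curve E R" "R \<notin> C" for R
      using f[OF that] by blast
  qed (use K KE cC in auto)
  then show ?thesis by blast
qed

end
end

section \<open>Field homomorphisms and Galois conjugation\<close>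

locale fhom = fixes f :: "'a::field \<Rightarrow> 'b::field"
  assumes f_add: "f (a + b) = f a + f b" and f_mult: "f (a * b) = f a * f b" and f_1: "f 1 = 1"
begin

lemma f_0: "f 0 = 0"
proof -
  have "f 0 + f 0 = f 0 + 0" using f_add[of 0 0, symmetric] by (simp only: add_0_right)
  then show ?thesis by (simp only: add_left_cancel)
qed
lemma f_minus: "f (- a) = - f a" using f_add[of a "- a"] f_0 by (simp add: eq_neg_iff_add_eq_0 add.commute)
lemma f_diff: "f (a - b) = f a - f b" using f_add[of a "- b"] f_minus by simp
lemma f_power: "f (a ^ n) = f a ^ n" by (induction n) (simp_all add: f_1 f_mult)
lemma f_of_nat: "f (of_nat n) = of_nat n" by (induction n) (simp_all add: f_0 f_1 f_add)
lemma f_numeral: "f (numeral n) = numeral n" using f_of_nat[of "numeral n"] by simp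
lemma f_eq_0: "f a = 0 \<longleftrightarrow> a = 0"
proof
  assume a: "f a = 0"
  show "a = 0"
  proof (rule ccontr)
    assume "a \<noteq> 0"
    then have "f a * f (inverse a) = 1" unfolding f_mult[symmetric] by (simp add: f_1)
    then show False using a by simp
  qed
qed (simp add: f_0)
lemma f_eq: "f a = f b \<longleftrightarrow> a = b" using f_eq_0[of "a - b"] by (simp add: f_diff)
lemma f_divide: "f (a / b) = f a / f b"
proof (cases "b = 0")
  case False
  then have "f (a / b) * f b = f a" unfolding f_mult[symmetric] by simp
  then show ?thesis using False by (simp add: f_eq_0 nonzero_eq_divide_eq)
qed (simp add: f_0)
lemma f_sum: "f (sum g A) = (\<Sum>i\<in>A. f (g i))"
  by (induction A rule: infinite_finite_induct) (simp_all add: f_0 f_add)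

lemmas f_hom = f_0 f_1 f_add f_mult f_minus f_diff f_power f_numeral f_divide

abbreviation "mp \<equiv> map_poly f"

lemma mp_coeff: "coeff (mp p) i = f (coeff p i)" by (simp add: coeff_map_poly f_0)
lemma mp_0: "mp 0 = 0" and mp_1: "mp 1 = 1" by (simp_all add: f_1)
lemma mp_pCons: "mp (pCons a p) = pCons (f a) (mp p)" by (intro poly_eqI) (simp add: mp_coeff coeff_pCons split: nat.splits)
lemma mp_add: "mp (p + q) = mp p + mp q" and mp_diff: "mp (p - q) = mp p - mp q"
  by (intro poly_eqI; simp add: mp_coeff f_add f_diff)+
lemma mp_mult: "mp (p * q) = mp p * mp q"
  by (intro poly_eqI) (simp add: mp_coeff coeff_mult f_sum f_mult)
lemma mp_smult: "mp (smult a p) = smult (f a) (mp p)"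
  by (intro poly_eqI) (simp add: mp_coeff f_mult)
lemma mp_power: "mp (p ^ n) = mp p ^ n" by (induction n) (simp_all add: mp_1 mp_mult)
lemma mp_eq: "mp p = mp q \<longleftrightarrow> p = q" by (auto simp: poly_eq_iff mp_coeff f_eq)
lemma mp_eq_0: "mp p = 0 \<longleftrightarrow> p = 0" using mp_eq[of p 0] by (simp add: mp_0)
lemma mp_degree: "degree (mp p) = degree p" by (rule degree_map_poly) (simp add: f_eq_0)
lemma mp_poly: "poly (mp p) (f x) = f (poly p x)"
  by (induction p) (simp_all add: mp_pCons f_0 f_add f_mult)

lemmas mp_hom = mp_0 mp_1 mp_pCons mp_add mp_diff mp_mult mp_power

abbreviation "fE E \<equiv> map_curve f E"

lemma fE_sel [simp]: "wa1 (fE E) = f (wa1 E)" "wa2 (fE E) = f (wa2 E)" "wa3 (fE E) = f (wa3 E)"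
   "wa4 (fE E) = f (wa4 E)" "wa6 (fE E) = f (wa6 E)"
  by (simp_all add: map_curve_def)

lemma wb_f: "wb2 (fE E) = f (wb2 E)" "wb4 (fE E) = f (wb4 E)" "wb6 (fE E) = f (wb6 E)" "wb8 (fE E) = f (wb8 E)"
  by (simp_all add: wb2_def wb4_def wb6_def wb8_def f_hom)

lemma elliptic_f: "elliptic (fE E) \<longleftrightarrow> elliptic E"
proof -
  have "disc (fE E) = f (disc E)" unfolding disc_def wb_f by (simp add: f_hom)
  then show ?thesis by (simp add: elliptic_def f_eq_0)
qed

lemma divF_f: "mp (divF E) = divF (fE E)" by (simp add: divF_def wb_f mp_pCons f_hom mp_0)

lemma divf_f: "mp (divf E n) = divf (fE E) n"
proof (induction n rule: less_induct)
  case (less n)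
  show ?case
  proof (cases "n \<le> 4")
    case True
    then consider "n = 0" | "n = 1" | "n = 2" | "n = 3" | "n = 4" by linarith
    then show ?thesis by cases (simp only:, subst divf.simps[of E], subst divf.simps[of "fE E"], simp add: mp_pCons f_hom mp_0 mp_1 wb_f)+
  next
    case False
    have i: "mp (divf E (n div 2 + 2)) = divf (fE E) (n div 2 + 2)" "mp (divf E (n div 2 + 1)) = divf (fE E) (n div 2 + 1)"
       "mp (divf E (n div 2)) = divf (fE E) (n div 2)" "mp (divf E (n div 2 - 1)) = divf (fE E) (n div 2 - 1)"
       "mp (divf E (n div 2 - 2)) = divf (fE E) (n div 2 - 2)"
      using False by (auto intro!: less)
    have n: "n \<noteq> 0" "n \<noteq> 1" "n \<noteq> 2" "n \<noteq> 3" "n \<noteq> 4" using False by auto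
    show ?thesis
      unfolding divf.simps[of E n] divf.simps[of "fE E" n] using n
      by (simp only: if_False if_distrib[of mp] mp_mult mp_diff mp_power i divF_f)
  qed
qed

lemma psi_sq_f: "mp (psi_sq E n) = psi_sq (fE E) n"
  by (simp add: psi_sq_def mp_mult mp_power divf_f divF_f)

lemma theta_f: "mp (theta E n) = theta (fE E) n"
  by (simp add: theta_def psi_nb_def mp_hom f_0 f_1 divf_f divF_f psi_sq_f)

lemma delta_f: "mp (delta E n P) = delta (fE E) n (map_pt f P)"
  by (cases P) (simp_all add: delta_def theta_f psi_sq_f mp_diff mp_smult)

lemma on_curve_f: "on_curve (fE E) (map_pt f R) \<longleftrightarrow> on_curve E R"
proof (cases R)
  case (Pt x y)
  show ?thesis unfolding Pt by (simp add: f_hom[symmetric] f_eq)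
qed simp

lemma add_f: "map_pt f (ec_add E R S) = ec_add (fE E) (map_pt f R) (map_pt f S)"
proof (cases R; cases S)
  fix x1 y1 x2 y2 assume R: "R = Pt x1 y1" "S = Pt x2 y2"
  have c: "f y1 + f y2 + f (wa1 E) * f x2 + f (wa3 E) = 0 \<longleftrightarrow> y1 + y2 + wa1 E * x2 + wa3 E = 0"
    using f_eq_0[of "y1 + y2 + wa1 E * x2 + wa3 E"] by (simp add: f_hom)
  show ?thesis
    unfolding R map_pt.simps ec_add.simps fE_sel f_eq c Let_def if_distrib[of "map_pt f"]
    by (simp add: f_hom cong: if_cong)
qed auto

lemma mul_f: "map_pt f (ec_mul E n R) = ec_mul (fE E) n (map_pt f R)"
  by (induction n) (simp_all add: add_f)

end

section \<open>Automorphisms of the algebraic closure\<close>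

locale alg_closure = fixes emb :: "'k::field \<Rightarrow> 'c::alg_closed_field"
  assumes alg_closure: "is_alg_closure emb"
begin

sublocale fhom emb using alg_closure by unfold_locales (auto simp: is_alg_closure_def)

lemma algebraic: "\<exists>p. p \<noteq> 0 \<and> poly (mp p) z = 0" using alg_closure by (auto simp: is_alg_closure_def)

definition "KK = range emb"

sublocale subfd KK
  by unfold_locales (auto simp: KK_def f_add[symmetric] f_diff[symmetric] f_mult[symmetric] f_divide[symmetric]
      intro: range_eqI[of _ _ 0] range_eqI[of _ _ 1] simp: f_0 f_1)

lemma KP_mp: "Kpoly KK (mp p)" by (simp add: Kpoly_def mp_coeff KK_def)

lemma KP_ex: assumes "Kpoly KK q" obtains p where "q = mp p"
proof -
  have "\<forall>i. \<exists>a. coeff q i = emb a" using assms by (auto simp: Kpoly_def KK_def)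
  then obtain g where g: "\<And>i. coeff q i = emb (g i)" by metis
  have "\<forall>\<^sub>\<infinity> i. g i = 0"
    using MOST_coeff_eq_0[of q] by (rule MOST_mono) (simp add: g f_eq_0)
  then have "q = mp (Abs_poly g)" by (intro poly_eqI) (simp add: mp_coeff Abs_poly_inverse g)
  then show ?thesis using that by blast
qed

lemma gal: "\<sigma> \<in> galois emb \<Longrightarrow> fhom \<sigma>"
  unfolding galois_def using f_1 by unfold_locales (auto, metis f_1)

lemma gal_emb: "\<sigma> \<in> galois emb \<Longrightarrow> \<sigma> (emb k) = emb k" by (simp add: galois_def)

lemma gal_root:
  assumes "\<sigma> \<in> galois emb" shows "poly (mp p) (\<sigma> x) = 0 \<longleftrightarrow> poly (mp p) x = 0"
proof -
  interpret s: fhom \<sigma> by (rule gal[OF assms])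
  have "map_poly \<sigma> (mp p) = mp p" by (intro poly_eqI) (simp add: s.mp_coeff mp_coeff gal_emb[OF assms])
  then show ?thesis using s.mp_poly[of "mp p" x] by (simp add: s.f_eq_0)
qed

lemma gal_comp: "\<sigma> \<in> galois emb \<Longrightarrow> \<tau> \<in> galois emb \<Longrightarrow> \<sigma> \<circ> \<tau> \<in> galois emb"
  by (auto simp: galois_def intro: bij_comp)

lemma gal_inv: assumes "\<sigma> \<in> galois emb" shows "inv_into UNIV \<sigma> \<in> galois emb"
proof -
  have b: "bij \<sigma>" using assms by (simp add: galois_def)
  have i: "inv_into UNIV \<sigma> y = x \<longleftrightarrow> y = \<sigma> x" for x y using b by (metis bij_inv_eq_iff)
  have s: "\<sigma> (inv_into UNIV \<sigma> y) = y" for y using b by (meson bij_is_surj surj_f_inv_f)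
  show ?thesis unfolding galois_def
    using assms bij_imp_bij_inv[OF b] by (auto simp: i s galois_def)
qed

subsection \<open>Extension of partial homomorphisms\<close>

text \<open>A partial homomorphism is a subalgebra of the product that is the graph of a function.\<close>

definition ghom :: "('c \<times> 'c) set \<Rightarrow> bool" where
  "ghom G \<longleftrightarrow> (\<forall>k. (emb k, emb k) \<in> G) \<and> (\<forall>a b c d. (a, b) \<in> G \<longrightarrow> (c, d) \<in> G \<longrightarrow> (a + c, b + d) \<in> G \<and> (a * c, b * d) \<in> G)
     \<and> (\<forall>b. (0, b) \<in> G \<longrightarrow> b = 0)"

lemma ghomD:
  assumes "ghom G"
  shows "(emb k, emb k) \<in> G" "(a, b) \<in> G \<Longrightarrow> (c, d) \<in> G \<Longrightarrow> (a + c, b + d) \<in> G"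
    "(a, b) \<in> G \<Longrightarrow> (c, d) \<in> G \<Longrightarrow> (a * c, b * d) \<in> G" "(0, b) \<in> G \<Longrightarrow> b = 0"
  using assms unfolding ghom_def by blast+

lemma ghom_diff: assumes G: "ghom G" and "(a, b) \<in> G" "(c, d) \<in> G" shows "(a - c, b - d) \<in> G"
proof -
  have "(emb (-1) * c, emb (-1) * d) \<in> G" by (intro ghomD[OF G] assms)
  then have "(a + emb (-1) * c, b + emb (-1) * d) \<in> G" by (intro ghomD[OF G] assms)
  then show ?thesis by (simp add: f_minus f_1)
qed

lemma ghom_fun: assumes G: "ghom G" and "(a, b) \<in> G" "(a, d) \<in> G" shows "b = d"
proof -
  have "(0, b - d) \<in> G" using ghom_diff[OF assms] by simp
  then show ?thesis using ghomD(4)[OF G] by fastforce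
qed

lemma ghom_0: "ghom G \<Longrightarrow> (0, 0) \<in> G" and ghom_1: "ghom G \<Longrightarrow> (1, 1) \<in> G"
  using ghomD(1)[of G 0] ghomD(1)[of G 1] by (simp_all add: f_0 f_1)

lemma ghom_poly:
  assumes G: "ghom G" and "(x, y) \<in> G" shows "(poly (mp p) x, poly (mp p) y) \<in> G"
  by (induction p) (auto simp: mp_pCons ghom_0[OF G] intro!: ghomD[OF G] assms)

lemma ghom_inverse:
  assumes G: "ghom G" and xy: "(x, y) \<in> G" and x: "x \<noteq> 0"
  shows "(1 / x, 1 / y) \<in> G \<and> y \<noteq> 0"
proof -
  text \<open>Writing an annihilating polynomial as \<open>X ^ n * (c + X * q)\<close> gives \<open>1 / x = - q(x) / c\<close>.\<close>
  obtain p where p: "p \<noteq> 0" "poly (mp p) x = 0" using algebraic by blast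
  have "\<exists>c q. c \<noteq> 0 \<and> emb c + x * poly (mp q) x = 0" using p
  proof (induction p)
    case (pCons a p)
    show ?case
    proof (cases "a = 0")
      case True
      then show ?thesis using pCons x by (auto simp: mp_pCons f_0)
    next
      case False
      then show ?thesis using pCons.prems by (intro exI[of _ a] exI[of _ p]) (simp add: mp_pCons)
    qed
  qed simp
  then obtain c q where c: "c \<noteq> 0" "emb c + x * poly (mp q) x = 0" by blast
  define z where "z = emb (- (1 / c)) * poly (mp q) x"
  define w where "w = emb (- (1 / c)) * poly (mp q) y"
  have zw: "(z, w) \<in> G" unfolding z_def w_def by (intro ghomD[OF G] ghom_poly[OF G] xy)
  have "x * poly (mp q) x = - emb c" using c(2) by (simp add: eq_neg_iff_add_eq_0 add.commute)
  then have "x * z = 1" unfolding z_def using c(1)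
    by (simp add: f_minus f_divide f_1 f_eq_0 mult.left_commute[of x])
  moreover have "(x * z, y * w) \<in> G" by (intro ghomD[OF G] xy zw)
  ultimately have "(1, y * w) \<in> G" by simp
  then have "y * w = 1" using ghom_fun[OF G] ghom_1[OF G] by blast
  then have "y \<noteq> 0" "w = 1 / y" by (auto simp: eq_divide_eq mult.commute)
  moreover have "z = 1 / x" using \<open>x * z = 1\<close> x by (simp add: eq_divide_eq mult.commute)
  ultimately show ?thesis using zw by simp
qed

definition gp :: "('c \<times> 'c) set \<Rightarrow> 'c poly \<Rightarrow> 'c poly \<Rightarrow> bool" where
  "gp G r s \<longleftrightarrow> (\<forall>i. (coeff r i, coeff s i) \<in> G)"

lemma gp_mult: assumes G: "ghom G" and "gp G r s" "gp G r' s'" shows "gp G (r * r') (s * s')"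
proof -
  have "(\<Sum>i\<in>I. coeff r i * coeff r' (n - i), \<Sum>i\<in>I. coeff s i * coeff s' (n - i)) \<in> G" if "finite I" for I n
    using that assms(2,3)
    by (induction I rule: finite_induct) (auto simp: gp_def ghom_0[OF G] intro!: ghomD[OF G])
  then show ?thesis unfolding gp_def coeff_mult by simp
qed

text \<open>Take a polynomial p of least degree over the domain of G with root a, transport its
  coefficients along G to q, and let b be any root of q. A relation r(a) = 0 reduces to one of lower
  degree by subtracting multiples of p, and the transported relation follows suit. Dividing by the
  leading coefficient is possible because, by algebraicity, the domain contains inverses.\<close>

lemma ghom_step:
  assumes G: "ghom G" shows "\<exists>b G'. ghom G' \<and> G \<subseteq> G' \<and> (a, b) \<in> G'"
proof -
  define N where "N n \<longleftrightarrow> (\<exists>p q. p \<noteq> 0 \<and> poly p a = 0 \<and> gp G p q \<and> degree p = n)" for n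
  obtain p0 where p0: "p0 \<noteq> 0" "poly (mp p0) a = 0" using algebraic by blast
  have "N (degree (mp p0))" unfolding N_def
    by (intro exI[of _ "mp p0"]) (use p0 in \<open>auto simp: mp_eq_0 gp_def mp_coeff intro!: ghomD[OF G]\<close>)
  then have "N (LEAST n. N n)" by (rule LeastI)
  then obtain p q where pq: "p \<noteq> 0" "poly p a = 0" "gp G p q" "degree p = (LEAST n. N n)" unfolding N_def by blast
  have least: "degree p \<le> degree r" if "r \<noteq> 0" "poly r a = 0" "gp G r s" for r s
    unfolding pq(4) by (rule Least_le) (use that in \<open>auto simp: N_def\<close>)
  have lq: "(1 / lead_coeff p, 1 / coeff q (degree p)) \<in> G" "coeff q (degree p) \<noteq> 0"
    using ghom_inverse[OF G, of "lead_coeff p" "coeff q (degree p)"] pq(1,3) unfolding gp_def leading_coeff_0_iff by blast+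
  have "degree p \<noteq> 0"
  proof
    assume "degree p = 0"
    then obtain c where "p = [:c:]" by (metis degree_eq_zeroE)
    then show False using pq by simp
  qed
  then have "degree q > 0" using le_degree[OF lq(2)] by simp
  then obtain b where b: "poly q b = 0" using alg_closed_imp_poly_has_root by blast
  have key: "poly s b = 0" if "gp G r s" "poly r a = 0" for r s
    using that
  proof (induction "degree r" arbitrary: r s rule: less_induct)
    case less
    show ?case
    proof (cases "r = 0")
      case True
      then have "s = 0" using less.prems(1) ghomD(4)[OF G] by (intro poly_eqI) (auto simp: gp_def)
      then show ?thesis by simp
    next
      case False
      have le: "degree p \<le> degree r" by (rule least[OF False less.prems(2,1)])
      define c d where "c = lead_coeff r * (1 / lead_coeff p)" and "d = coeff s (degree r) * (1 / coeff q (degree p))"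
      have cd: "(c, d) \<in> G" unfolding c_def d_def using less.prems(1) by (intro ghomD[OF G] lq) (simp add: gp_def)
      define k where "k = degree r - degree p"
      have m: "gp G (monom c k) (monom d k)" using cd ghom_0[OF G] by (auto simp: gp_def)
      define r' s' where "r' = r - monom c k * p" and "s' = s - monom d k * q"
      have g': "gp G r' s'" unfolding r'_def s'_def using gp_mult[OF G m pq(3)] less.prems(1)
        by (auto simp: gp_def intro!: ghom_diff[OF G])
      have r'a: "poly r' a = 0" using less.prems(2) pq(2) by (simp add: r'_def)
      have "poly s' b = 0"
      proof (cases "degree r = 0")
        case True
        then have False using False less.prems(2) by (metis degree_eq_zeroE poly_pCons poly_0 mult_zero_right add_0_right pCons_0_0)
        then show ?thesis ..
      next
        case dr: False
        have "lc r (degree r) (lead_coeff r)" "lc p (degree p) (lead_coeff p)" "lc (monom c k) k c"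
          by (auto simp: lc_def degree_monom_le)
        then have "lc r' (degree r) (lead_coeff r - c * lead_coeff p)" unfolding r'_def
          using le by (intro lc_diff lc_cong[OF lc_mult]) (auto simp: k_def)
        then have "degree r' \<le> degree r" "coeff r' (degree r) = 0" using pq(1) by (auto simp: lc_def c_def)
        then have "degree r' < degree r" using dr by (metis leading_coeff_0_iff le_neq_implies_less degree_0)
        then show ?thesis using less.hyps[OF _ g' r'a] by blast
      qed
      then show ?thesis using b by (simp add: s'_def)
    qed
  qed
  define G' where "G' = {(poly r a, poly s b) |r s. gp G r s}"
  have "ghom G'" unfolding ghom_def
  proof (intro conjI allI impI)
    show "(emb k, emb k) \<in> G'" for k unfolding G'_def
      by (intro CollectI exI[of _ "[:emb k:]"]) (auto simp: gp_def coeff_pCons ghom_0[OF G] intro!: ghomD[OF G] split: nat.splits)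
    fix x y z w assume "(x, y) \<in> G'" "(z, w) \<in> G'"
    then obtain r s r' s' where r: "x = poly r a" "y = poly s b" "gp G r s" "z = poly r' a" "w = poly s' b" "gp G r' s'"
      by (auto simp: G'_def)
    show "(x + z, y + w) \<in> G'" unfolding G'_def
      by (intro CollectI exI[of _ "r + r'"] exI[of _ "s + s'"]) (use r in \<open>auto simp: gp_def intro!: ghomD[OF G]\<close>)
    show "(x * z, y * w) \<in> G'" unfolding G'_def
      by (intro CollectI exI[of _ "r * r'"] exI[of _ "s * s'"]) (use r gp_mult[OF G] in auto)
  next
    fix y assume "(0, y) \<in> G'"
    then show "y = 0" unfolding G'_def using key by auto
  qed
  moreover have "G \<subseteq> G'"
  proof
    fix z assume z: "z \<in> G"
    show "z \<in> G'" unfolding G'_def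
      by (intro CollectI exI[of _ "[:fst z:]"] exI[of _ "[:snd z:]"])
         (use z ghom_0[OF G] in \<open>auto simp: gp_def coeff_pCons split: nat.splits\<close>)
  qed
  moreover have "(a, b) \<in> G'" unfolding G'_def
    by (intro CollectI exI[of _ "[:0,1:]"])
       (auto simp: gp_def coeff_pCons ghom_0[OF G] ghom_1[OF G] split: nat.splits)
  ultimately show ?thesis by blast
qed

text \<open>A maximal extension exists by Zorn's lemma and is total by \<open>ghom_step\<close>.
  Surjectivity comes from finiteness: an injective map over the base field permutes the roots of
  each polynomial with coefficients there.\<close>

lemma ghom_extend:
  assumes G: "ghom G" shows "\<exists>\<sigma>\<in>galois emb. \<forall>(a, b)\<in>G. \<sigma> a = b"
proof -
  define A where "A = {G'. ghom G' \<and> G \<subseteq> G'}"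
  have "\<exists>M\<in>A. \<forall>X\<in>A. M \<subseteq> X \<longrightarrow> X = M"
  proof (rule subset_Zorn)
    fix \<C> assume ch: "subset.chain A \<C>"
    show "\<exists>U\<in>A. \<forall>X\<in>\<C>. X \<subseteq> U"
    proof (cases "\<C> = {}")
      case True then show ?thesis using G by (auto simp: A_def)
    next
      case False
      have sub: "\<And>X. X \<in> \<C> \<Longrightarrow> ghom X \<and> G \<subseteq> X" using ch by (auto simp: subset.chain_def A_def)
      have tot: "X \<subseteq> Y \<or> Y \<subseteq> X" if "X \<in> \<C>" "Y \<in> \<C>" for X Y
        using ch that by (auto simp: subset_chain_def)
      have "ghom (\<Union>\<C>)" unfolding ghom_def
      proof (intro conjI allI impI)
        obtain X where X: "X \<in> \<C>" using False by blast
        then show "(emb k, emb k) \<in> \<Union>\<C>" for k using ghomD(1) sub by blast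
        fix a b c d assume "(a, b) \<in> \<Union>\<C>" "(c, d) \<in> \<Union>\<C>"
        then obtain X Y where XY: "X \<in> \<C>" "Y \<in> \<C>" "(a, b) \<in> X" "(c, d) \<in> Y" by blast
        then obtain Z where Z: "Z \<in> \<C>" "(a, b) \<in> Z" "(c, d) \<in> Z" using tot[of X Y] by blast
        then show "(a + c, b + d) \<in> \<Union>\<C>" "(a * c, b * d) \<in> \<Union>\<C>"
          using ghomD(2,3)[of Z a b c d] sub[of Z] by blast+
      next
        fix b assume "(0, b) \<in> \<Union>\<C>"
        then show "b = 0" using ghomD(4) sub by blast
      qed
      moreover have "G \<subseteq> \<Union>\<C>" using False sub by blast
      ultimately show ?thesis by (intro bexI[of _ "\<Union>\<C>"]) (auto simp: A_def)
    qed
  qed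
  then obtain M where M0: "M \<in> A" "\<forall>X\<in>A. M \<subseteq> X \<longrightarrow> X = M" by (elim bexE)
  have M: "ghom M" "G \<subseteq> M" using M0(1) by (simp_all add: A_def)
  have mx: "X = M" if "ghom X" "M \<subseteq> X" for X
    using M0(2) that M(2) unfolding A_def by (metis (mono_tags, lifting) mem_Collect_eq order_trans)
  have ex: "\<exists>b. (a, b) \<in> M" for a
  proof -
    obtain b X where "ghom X" "M \<subseteq> X" "(a, b) \<in> X" using ghom_step[OF M(1), of a] by (elim exE conjE)
    then show ?thesis using mx[of X] by (intro exI[of _ b]) simp
  qed
  define \<sigma> where "\<sigma> a = (THE b. (a, b) \<in> M)" for a
  have s: "(a, b) \<in> M \<longleftrightarrow> \<sigma> a = b" for a b
  proof -
    obtain c where c: "(a, c) \<in> M" using ex by blast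
    have "\<sigma> a = c" unfolding \<sigma>_def
    proof (rule the_equality)
      show "(a, c) \<in> M" by (rule c)
      show "b = c" if "(a, b) \<in> M" for b by (rule ghom_fun[OF M(1) that c])
    qed
    then show ?thesis using c by (auto dest: ghom_fun[OF M(1) c])
  qed
  have sM: "(a, \<sigma> a) \<in> M" for a by (rule s[THEN iffD2]) simp
  have add: "\<sigma> (a + b) = \<sigma> a + \<sigma> b" for a b by (rule s[THEN iffD1], rule ghomD(2)[OF M(1) sM sM])
  have mult: "\<sigma> (a * b) = \<sigma> a * \<sigma> b" for a b by (rule s[THEN iffD1], rule ghomD(3)[OF M(1) sM sM])
  have emb: "\<sigma> (emb k) = emb k" for k by (rule s[THEN iffD1], rule ghomD(1)[OF M(1)])
  interpret s: fhom \<sigma> by unfold_locales (use add mult emb[of 1] in \<open>auto simp: f_1\<close>)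
  have "inj \<sigma>" by (rule injI) (simp add: s.f_eq)
  moreover have "\<exists>x. \<sigma> x = y" for y
  proof -
    obtain p where p: "p \<noteq> 0" "poly (mp p) y = 0" using algebraic by blast
    define Z where "Z = {x. poly (mp p) x = 0}"
    have fin: "finite Z" unfolding Z_def using p by (intro poly_roots_finite) (simp add: mp_eq_0)
    have e: "map_poly \<sigma> (mp p) = mp p" by (intro poly_eqI) (simp add: s.mp_coeff mp_coeff emb)
    have "\<sigma> ` Z \<subseteq> Z" using s.mp_poly[of "mp p"] unfolding Z_def e by (auto simp: s.f_0)
    then have "\<sigma> ` Z = Z" using fin \<open>inj \<sigma>\<close> by (metis endo_inj_surj inj_on_subset subset_UNIV)
    moreover have "y \<in> Z" using p by (simp add: Z_def)
    ultimately have "y \<in> \<sigma> ` Z" by simp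
    then show ?thesis by auto
  qed
  then have "surj \<sigma>" unfolding surj_def by metis
  ultimately have "\<sigma> \<in> galois emb" using add mult emb by (auto simp: galois_def bij_def)
  then show ?thesis using M(2) s by blast
qed

subsection \<open>Conjugate roots\<close>

definition minpoly :: "'c \<Rightarrow> 'k poly \<Rightarrow> bool" where
  "minpoly a p \<longleftrightarrow> lead_coeff p = 1 \<and> poly (mp p) a = 0 \<and> (\<forall>r. poly (mp r) a = 0 \<longrightarrow> p dvd r)"

lemma minpoly_ex: "\<exists>p. minpoly a p"
proof -
  define N where "N n \<longleftrightarrow> (\<exists>p. p \<noteq> 0 \<and> poly (mp p) a = 0 \<and> degree p = n)" for n
  obtain p0 where p0: "p0 \<noteq> 0" "poly (mp p0) a = 0" using algebraic by blast
  have "N (degree p0)" unfolding N_def by (intro exI[of _ p0]) (simp add: p0)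
  then have "N (LEAST n. N n)" by (rule LeastI)
  then obtain p where p: "p \<noteq> 0" "poly (mp p) a = 0" "degree p = (LEAST n. N n)" unfolding N_def by blast
  have d: "p dvd r" if r: "poly (mp r) a = 0" for r
  proof (rule ccontr)
    assume n: "\<not> p dvd r"
    define t where "t = r mod p"
    have t0: "t \<noteq> 0" using n by (simp add: t_def mod_eq_0_iff_dvd)
    have "t = r - (r div p) * p" unfolding t_def by (simp add: minus_div_mult_eq_mod)
    then have "poly (mp t) a = 0" using p r by (simp add: mp_diff mp_mult)
    then have "degree p \<le> degree t" unfolding p(3) using t0 by (intro Least_le) (auto simp: N_def)
    moreover have "degree t < degree p" using degree_mod_less[OF p(1), of r] t0 by (auto simp: t_def)
    ultimately show False by simp
  qed
  define q where "q = smult (inverse (lead_coeff p)) p"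
  have "lead_coeff q = 1" "poly (mp q) a = 0" using p(1,2) by (simp_all add: q_def mp_smult)
  moreover have "q dvd r" if "poly (mp r) a = 0" for r
    unfolding q_def using d[OF that] p(1) by (simp add: smult_dvd_iff)
  ultimately show ?thesis unfolding minpoly_def by blast
qed

text \<open>Evaluation of polynomials at a and at b gives a partial homomorphism; it is
  single-valued since p divides every polynomial that vanishes at a.\<close>

lemma conjugate:
  assumes p: "minpoly a p" and b: "poly (mp p) b = 0" shows "\<exists>\<sigma>\<in>galois emb. \<sigma> a = b"
proof -
  define G where "G = {(poly (mp r) a, poly (mp r) b) |r. True}"
  have "ghom G" unfolding ghom_def
  proof (intro conjI allI impI)
    show "(emb k, emb k) \<in> G" for k unfolding G_def by (intro CollectI exI[of _ "[:k:]"]) (simp add: mp_pCons)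
    fix x y z w assume "(x, y) \<in> G" "(z, w) \<in> G"
    then obtain r s where r: "x = poly (mp r) a" "y = poly (mp r) b" "z = poly (mp s) a" "w = poly (mp s) b"
      by (auto simp: G_def)
    show "(x + z, y + w) \<in> G" unfolding G_def by (intro CollectI exI[of _ "r + s"]) (simp add: r mp_add)
    show "(x * z, y * w) \<in> G" unfolding G_def by (intro CollectI exI[of _ "r * s"]) (simp add: r mp_mult)
  next
    fix y assume "(0, y) \<in> G"
    then obtain r where r: "poly (mp r) a = 0" "y = poly (mp r) b" by (auto simp: G_def)
    then obtain t where "r = p * t" using p unfolding minpoly_def by (metis dvdE)
    then show "y = 0" using r b by (simp add: mp_mult)
  qed
  moreover have "(a, b) \<in> G" unfolding G_def by (intro CollectI exI[of _ "[:0,1:]"]) (simp add: mp_pCons f_0 f_1)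
  ultimately show ?thesis using ghom_extend by fast
qed

lemma irreducible_transitive:
  assumes q: "irreducible q" and a: "poly (mp q) a = 0" and b: "poly (mp q) b = 0" shows "\<exists>\<sigma>\<in>galois emb. \<sigma> a = b"
proof -
  obtain p where p: "minpoly a p" using minpoly_ex by blast
  then obtain m where m: "q = p * m" using a unfolding minpoly_def by (metis dvdE)
  have "p dvd 1 \<or> m dvd 1" using q m by (simp add: irreducible_def)
  moreover have "\<not> p dvd 1"
  proof
    assume "p dvd 1"
    then obtain r where "1 = p * r" by (elim dvdE)
    then have "mp 1 = mp p * mp r" by (simp add: mp_mult[symmetric])
    then have "poly (mp 1) a = 0" using p by (simp add: minpoly_def)
    then show False by (simp add: mp_1)
  qed
  ultimately have "m dvd 1" by blast
  then obtain r where "1 = m * r" by (elim dvdE)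
  then have "mp 1 = mp m * mp r" by (simp add: mp_mult[symmetric])
  then have "poly (mp m) b * poly (mp r) b = 1" by (metis mp_1 poly_1 poly_mult)
  then have "poly (mp m) b \<noteq> 0" by auto
  then have "poly (mp p) b = 0" using b unfolding m mp_mult by simp
  then show ?thesis by (rule conjugate[OF p])
qed

text \<open>In a factorisation q = p r some root of p is conjugate to a root b of r, so b is a root
  of both factors, and q has fewer distinct roots than its degree.\<close>

lemma transitive_irreducible:
  assumes d: "degree q \<ge> 1" and c: "card {x. poly (mp q) x = 0} = degree q"
    and t: "\<And>a b. poly (mp q) a = 0 \<Longrightarrow> poly (mp q) b = 0 \<Longrightarrow> \<exists>\<sigma>\<in>galois emb. \<sigma> a = b"
  shows "irreducible q"
proof (rule irreducibleI)
  show q0: "q \<noteq> 0" using d by auto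
  show "\<not> q dvd 1" using d q0 by (auto simp: is_unit_iff_degree)
  fix p r assume q: "q = p * r"
  show "p dvd 1 \<or> r dvd 1"
  proof (rule ccontr)
    assume n: "\<not> (p dvd 1 \<or> r dvd 1)"
    have nz: "p \<noteq> 0" "r \<noteq> 0" using q q0 by auto
    have dd: "degree p > 0" "degree r > 0" using n nz by (auto simp: is_unit_iff_degree)
    then obtain a b where ab: "poly (mp p) a = 0" "poly (mp r) b = 0"
      using alg_closed_imp_poly_has_root[of "mp p"] alg_closed_imp_poly_has_root[of "mp r"] by (auto simp: mp_degree)
    have "poly (mp q) a = 0" "poly (mp q) b = 0" using ab by (simp_all add: q mp_mult)
    then obtain \<sigma> where s: "\<sigma> \<in> galois emb" "\<sigma> a = b" using t by blast
    then have pb: "poly (mp p) b = 0" using gal_root[OF s(1), of p a] ab by simp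
    have "{x. poly (mp q) x = 0} = {x. poly (mp p) x = 0} \<union> ({x. poly (mp r) x = 0} - {b})"
      using pb by (auto simp: q mp_mult)
    then have "card {x. poly (mp q) x = 0} \<le> card {x. poly (mp p) x = 0} + card ({x. poly (mp r) x = 0} - {b})"
      by (simp add: card_Un_le)
    also have "card {x. poly (mp p) x = 0} \<le> degree p" using card_poly_roots_bound[of "mp p"] nz by (simp add: mp_eq_0 mp_degree)
    also have "card ({x. poly (mp r) x = 0} - {b}) < card {x. poly (mp r) x = 0}"
      using ab nz by (intro card_Diff1_less poly_roots_finite) (simp_all add: mp_eq_0)
    also have "card {x. poly (mp r) x = 0} \<le> degree r" using card_poly_roots_bound[of "mp r"] nz by (simp add: mp_eq_0 mp_degree)
    finally have "card {x. poly (mp q) x = 0} < degree p + degree r" by simp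
    then show False using c nz by (simp add: q degree_mult_eq)
  qed
qed

text \<open>S is split into conjugacy classes. Each class is the root set of a minimal polynomial,
  which divides f and therefore has simple roots, so it equals the product of the linear factors.
  Simplicity is essential over imperfect fields: a purely inseparable element is fixed by the Galois
  group without being rational.\<close>

lemma KP_rootpoly:
  assumes "finite S" "\<And>\<sigma>. \<sigma> \<in> galois emb \<Longrightarrow> \<sigma> ` S \<subseteq> S"
    "\<And>s. s \<in> S \<Longrightarrow> poly (mp f) s = 0 \<and> poly (pderiv (mp f)) s \<noteq> 0"
  shows "Kpoly KK (rootpoly S)"
  using assms
proof (induction "card S" arbitrary: S rule: less_induct)
  case less
  show ?case
  proof (cases "S = {}")
    case True
    then show ?thesis using KP_1 by (simp add: rootpoly_def)
  next
    case False
    then obtain s where s: "s \<in> S" by blast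
    obtain p where p: "minpoly s p" using minpoly_ex by blast
    have p0: "p \<noteq> 0" using p by (auto simp: minpoly_def)
    define T where "T = {x. poly (mp p) x = 0}"
    have sT: "s \<in> T" using p by (simp add: T_def minpoly_def)
    have TS: "T \<subseteq> S"
    proof
      fix x assume "x \<in> T"
      then obtain \<sigma> where "\<sigma> \<in> galois emb" "\<sigma> s = x" using conjugate[OF p] by (auto simp: T_def)
      then show "x \<in> S" using less.prems(2) s by blast
    qed
    have finT: "finite T" using TS less.prems(1) finite_subset by blast
    obtain m where m: "f = p * m" using p less.prems(3)[OF s] unfolding minpoly_def by (metis dvdE)
    have "poly (pderiv (mp p)) x \<noteq> 0" if "poly (mp p) x = 0" for x
    proof -
      have "x \<in> S" using that TS by (auto simp: T_def)
      then show ?thesis using less.prems(3)[of x] that by (auto simp: m mp_mult pderiv_mult)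
    qed
    then have cT: "card T = degree p" unfolding T_def
      using card_simple_roots[of "mp p"] p0 by (simp add: mp_eq_0 mp_degree)
    have pT: "mp p = rootpoly T"
    proof (rule ccontr)
      assume ne: "mp p \<noteq> rootpoly T"
      have "lc (mp p) (card T) 1" using p by (simp add: lc_def mp_degree mp_coeff cT minpoly_def f_1)
      from lc_diff[OF this rootpoly_lc[OF finT]] have l: "lc (mp p - rootpoly T) (card T) 0" by simp
      have "card T > 0" using sT finT by (auto simp: card_gt_0_iff)
      then have "degree (mp p - rootpoly T) < card T" using l unfolding lc_def
        by (metis leading_coeff_0_iff le_neq_implies_less degree_0)
      moreover have "card {x. poly (mp p - rootpoly T) x = 0} \<le> degree (mp p - rootpoly T)"
        using ne by (intro card_poly_roots_bound) simp
      moreover have "card T \<le> card {x. poly (mp p - rootpoly T) x = 0}"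
        using ne finT by (intro card_mono poly_roots_finite) (auto simp: rootpoly_root T_def)
      ultimately show False by simp
    qed
    have "Kpoly KK (rootpoly (S - T))"
    proof (rule less.hyps)
      show "card (S - T) < card S" using sT s less.prems(1) by (intro psubset_card_mono) auto
      show "finite (S - T)" using less.prems(1) by simp
      show "\<sigma> ` (S - T) \<subseteq> S - T" if "\<sigma> \<in> galois emb" for \<sigma>
        using less.prems(2)[OF that] gal_root[OF that, of p] by (auto simp: T_def)
      show "poly (mp f) x = 0 \<and> poly (pderiv (mp f)) x \<noteq> 0" if "x \<in> S - T" for x using less.prems(3) that by blast
    qed
    moreover have "rootpoly S = rootpoly (S - T) * rootpoly T"
      unfolding rootpoly_def using prod.subset_diff[OF TS less.prems(1)] by blast
    ultimately show ?thesis unfolding pT[symmetric] by (simp add: KP_mult KP_mp)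
  qed
qed

end

section \<open>Galois-stable subgroups give isogenies\<close>

lemma simple_roots:
  fixes p :: "'a::field poly"
  assumes p: "p \<noteq> 0" "degree p \<le> card {x. poly p x = 0}" and s: "poly p s = 0" shows "poly (pderiv p) s \<noteq> 0"
proof
  assume d: "poly (pderiv p) s = 0"
  obtain g where g: "p = [:-s, 1:] * g" using s unfolding poly_eq_0_iff_dvd by (elim dvdE)
  have "pderiv p = g + [:-s, 1:] * pderiv g" unfolding g pderiv_mult by (simp add: pderiv_pCons)
  then have gs: "poly g s = 0" using d by simp
  have g0: "g \<noteq> 0" using g p by auto
  have "{x. poly p x = 0} \<subseteq> {x. poly g x = 0}" using gs unfolding g by auto
  then have "card {x. poly p x = 0} \<le> card {x. poly g x = 0}" using g0 by (intro card_mono poly_roots_finite)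
  also have "\<dots> \<le> degree g" by (rule card_poly_roots_bound[OF g0])
  also have "\<dots> < degree p" unfolding g using g0 degree_mult_eq[of "[:-s,1:]" g] by simp
  finally show False using p(2) by simp
qed

context ecv
begin

lemma torsion_px_roots:
  assumes n: "n \<ge> 1" shows "px ` ({R \<in> points E. mul n R = Inf} - {Inf}) = {x. poly (psi_sq E n) x = 0}"
proof (intro equalityI subsetI)
  fix x assume "x \<in> px ` ({R \<in> points E. mul n R = Inf} - {Inf})"
  then obtain R where R: "on_curve E R" "mul n R = Inf" "R \<noteq> Inf" "x = px R" by (auto simp: points_def)
  have e: "R = Pt x (py R)" using Pt_eq[OF R(3)] R(4) by simp
  have "on_curve E (Pt x (py R))" "mul n (Pt x (py R)) = Inf" using R(1,2) e by metis+
  then show "x \<in> {x. poly (psi_sq E n) x = 0}" using psi_sq_root[OF _ n] by blast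
next
  fix x assume x: "x \<in> {x. poly (psi_sq E n) x = 0}"
  obtain y where y: "on_curve E (Pt x y)" using ex_point by blast
  then have "mul n (Pt x y) = Inf" using psi_sq_root[OF y n] x by blast
  then have "Pt x y \<in> {R \<in> points E. mul n R = Inf} - {Inf}" using y by (simp add: points_def del: on_curve.simps)
  then show "x \<in> px ` ({R \<in> points E. mul n R = Inf} - {Inf})" by (rule rev_image_eqI) simp
qed

lemma two_torsion: "on_curve E R \<Longrightarrow> mul 2 R = Inf \<Longrightarrow> \<ominus> R = R"
  using add_eq_Inf[of R R] by (simp add: numeral_2_eq_2)

text \<open>A count: the n^2 - 1 nonzero torsion points have at least (n^2 - 1) / 2 distinct
  x-coordinates, the degree of psi_n for odd n. For n = 2 each of the three points is its own
  negative, so there are 3 x-coordinates, the degree of \<open>divF\<close>. A polynomial with as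
  many roots as its degree has simple roots.\<close>

lemma torsion_roots_simple:
  assumes n: "n \<ge> 2" "(of_nat n :: 'a) \<noteq> 0" and p: "odd n \<and> p = divf E n \<or> n = 2 \<and> p = divF E"
  shows "poly (psi_sq E n) s = 0 \<Longrightarrow> poly p s = 0 \<and> poly (pderiv p) s \<noteq> 0"
proof -
  define T where "T = {R \<in> points E. mul n R = Inf} - {Inf}"
  have n1: "n \<ge> 1" using n by simp
  have fin: "finite T" unfolding T_def using finite_torsion[OF n1] by simp
  have "card {R \<in> points E. mul n R = Inf} = card (insert Inf T)"
    by (rule arg_cong[where f = card]) (auto simp: T_def points_def)
  moreover have "Inf \<notin> T" by (simp add: T_def)
  then have "card (insert Inf T) = card T + 1" using fin by simp
  ultimately have cT: "n^2 = card T + 1" using card_torsion[OF n] by simp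
  have rt: "px ` T = {x. poly (psi_sq E n) x = 0}" unfolding T_def by (rule torsion_px_roots[OF n1])
  have ps: "poly (psi_sq E n) x = 0 \<longleftrightarrow> poly p x = 0" for x
    using p divf.simps[of E 2] by (auto simp: psi_sq_def)
  have onT: "on_curve E R" "R \<noteq> Inf" "mul n R = Inf" if "R \<in> T" for R using that by (auto simp: T_def points_def)
  have dp: "p \<noteq> 0 \<and> degree p \<le> card (px ` T)"
  proof (cases "odd n \<and> p = divf E n")
    case True
    then obtain i where i: "n = 2 * i + 1" by (metis oddE)
    have l: "lc p (2*i*(i+1)) (of_nat n)" using divf_lc(2)[of E i] True i by simp
    have "card T \<le> 2 * card (px ` T)"
    proof -
      have "card T = (\<Sum>x\<in>px ` T. card {R \<in> T. px R = x})"
        using sum.image_gen[OF fin, of "\<lambda>_. 1::nat" px] by simp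
      also have "\<dots> \<le> (\<Sum>x\<in>px ` T. 2)"
      proof (rule sum_mono)
        fix x assume "x \<in> px ` T"
        then obtain R where R: "R \<in> T" "px R = x" by auto
        have "{S \<in> T. px S = x} \<subseteq> {R, \<ominus> R}"
          using px_eq[OF onT(1)[OF R(1)] onT(1) onT(2)[OF R(1)] onT(2)] R(2) by blast
        then have "card {S \<in> T. px S = x} \<le> card {R, \<ominus> R}" by (intro card_mono) auto
        also have "\<dots> \<le> 2" by (simp add: card_insert_if)
        finally show "card {S \<in> T. px S = x} \<le> 2" .
      qed
      finally show ?thesis by simp
    qed
    moreover have "card T = 2 * (2*i*(i+1))" using cT unfolding i by (simp add: power2_eq_square algebra_simps)
    ultimately have "2*i*(i+1) \<le> card (px ` T)" by linarith
    moreover have "p \<noteq> 0" using l n(2) by (auto simp: lc_def)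
    ultimately show ?thesis using l by (simp add: lc_def)
  next
    case False
    then have n2: "n = 2" "p = divF E" using p by auto
    have "inj_on px T"
    proof (rule inj_onI)
      fix R S assume a: "R \<in> T" "S \<in> T" "px R = px S"
      then have "S = R \<or> S = \<ominus> R" using px_eq onT by blast
      then show "R = S" using two_torsion onT[OF a(1)] n2 by auto
    qed
    then have "card (px ` T) = 3" using cT n2 by (simp add: card_image)
    moreover have "degree p \<le> 3" using lc_divF[of E] n2 by (simp add: lc_def)
    ultimately show ?thesis using F_nonzero n2 by simp
  qed
  show "poly p s = 0 \<and> poly (pderiv p) s \<noteq> 0" if "poly (psi_sq E n) s = 0"
    using simple_roots[of p s] dp that unfolding rt ps by simp
qed

end

section \<open>The Galois action on points and rational isogenies\<close>

locale galcv = alg_closure emb for emb :: "'k::field \<Rightarrow> 'c::alg_closed_field" +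
  fixes E :: "'k wcurve"
  assumes ellE: "elliptic E"
begin

abbreviation "Ec \<equiv> map_curve emb E"

sublocale ecv Ec by unfold_locales (simp add: elliptic_f ellE)

lemma gal_Ec: "\<sigma> \<in> galois emb \<Longrightarrow> map_curve \<sigma> Ec = Ec"
  by (simp add: map_curve_def gal_emb)

lemma act_add: "\<sigma> \<in> galois emb \<Longrightarrow> map_pt \<sigma> (ec_add Ec R S) = ec_add Ec (map_pt \<sigma> R) (map_pt \<sigma> S)"
  using fhom.add_f[OF gal, of \<sigma> Ec R S] gal_Ec[of \<sigma>] by simp

lemma act_mul: "\<sigma> \<in> galois emb \<Longrightarrow> map_pt \<sigma> (mul n R) = mul n (map_pt \<sigma> R)"
  using fhom.mul_f[OF gal, of \<sigma> Ec n R] gal_Ec[of \<sigma>] by simp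

lemma act_on_curve: "\<sigma> \<in> galois emb \<Longrightarrow> on_curve Ec (map_pt \<sigma> R) = on_curve Ec R"
  using fhom.on_curve_f[OF gal, of \<sigma> Ec R] gal_Ec[of \<sigma>] by simp

lemma act_px: "\<sigma> \<in> galois emb \<Longrightarrow> px (map_pt \<sigma> R) = \<sigma> (px R)"
  using fhom.f_0[OF gal, of \<sigma>] by (cases R) simp_all

lemma act_Inf: "map_pt \<sigma> R = Inf \<longleftrightarrow> R = Inf" by (cases R) simp_all

lemma act_emb: "\<sigma> \<in> galois emb \<Longrightarrow> map_pt \<sigma> (map_pt emb P) = map_pt emb P"
  by (cases P) (simp_all add: gal_emb)

lemma act_comp: "map_pt (\<sigma> \<circ> \<tau>) R = map_pt \<sigma> (map_pt \<tau> R)" by (cases R) simp_all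

lemma act_inv:
  assumes "\<sigma> \<in> galois emb"
  shows "map_pt (inv_into UNIV \<sigma>) (map_pt \<sigma> R) = R" "map_pt \<sigma> (map_pt (inv_into UNIV \<sigma>) R) = R"
proof -
  have "bij \<sigma>" using assms by (simp add: galois_def)
  then show "map_pt (inv_into UNIV \<sigma>) (map_pt \<sigma> R) = R" "map_pt \<sigma> (map_pt (inv_into UNIV \<sigma>) R) = R"
    by (cases R; simp add: bij_is_inj inv_f_f bij_is_surj surj_f_inv_f)+
qed

lemma emb_of_nat_0: "(of_nat n :: 'c) = 0 \<longleftrightarrow> (of_nat n :: 'k) = 0"
  using f_eq_0[of "of_nat n"] by (simp add: f_of_nat)

text \<open>The x-coordinates of C form a Galois-stable set of simple roots of a division
  polynomial, so their root polynomial is rational and the quotient data exist over K. The quotient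
  curve and its map then descend; coprimality of the numerator and denominator over K holds because
  a common factor would have a root in the closure.\<close>

lemma isogeny_ex:
  assumes l: "prime l" "(of_nat l :: 'k) \<noteq> 0"
    and C: "Inf \<in> C" "\<And>R. R \<in> C \<Longrightarrow> on_curve Ec R \<and> mul l R = Inf"
      "\<And>R S. R \<in> C \<Longrightarrow> S \<in> C \<Longrightarrow> ec_add Ec R S \<in> C" "\<And>R. R \<in> C \<Longrightarrow> ec_neg Ec R \<in> C"
      "card C = l" "\<And>\<sigma> R. \<sigma> \<in> galois emb \<Longrightarrow> R \<in> C \<Longrightarrow> map_pt \<sigma> R \<in> C"
  shows "\<exists>E' \<phi>. elliptic E' \<and> isogeny_over emb E E' \<phi> l"
proof -
  have l0: "(of_nat l :: 'c) \<noteq> 0" using l(2) by (simp add: emb_of_nat_0)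
  have l2: "l \<ge> 2" using l(1) by (rule prime_ge_2_nat)
  have l1: "l \<ge> 1" using l2 by simp
  have finC: "finite C" using C(5) l2 by (metis card.infinite not_numeral_le_zero)
  interpret c: ecK Ec C KK
  proof unfold_locales
    show "finite C" by (rule finC)
    show "(of_nat (card C) :: 'c) \<noteq> 0" using C(5) l0 by simp
    show "wa1 Ec \<in> KK" "wa2 Ec \<in> KK" "wa3 Ec \<in> KK" "wa4 Ec \<in> KK" "wa6 Ec \<in> KK" by (simp_all add: KK_def)
  qed (use C in auto)
  \<comment> \<open>Not \<open>psi_sq\<close>, which has double roots for odd l: its square root
    then, and psi_2^2 itself if l = 2.\<close>
  define f where "f = (if l = 2 then divF E else divf E l)"
  have odd: "l \<noteq> 2 \<Longrightarrow> odd l" using l(1) prime_odd_nat l2 by (metis le_neq_implies_less)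
  have f: "odd l \<and> mp f = divf Ec l \<or> l = 2 \<and> mp f = divF Ec"
    using odd by (auto simp: f_def divF_f divf_f)
  have pS: "poly (psi_sq Ec l) s = 0" if sS: "s \<in> c.S" for s
  proof -
    obtain d where d: "d \<in> c.C'" "s = px d" using sS by (auto simp: c.S_def)
    then have "d \<in> {R \<in> points Ec. mul l R = Inf} - {Inf}" using c.C'D[OF d(1)] C(2)[of d] by (auto simp: points_def)
    then show ?thesis using torsion_px_roots[OF l1] d(2) by blast
  qed
  have KS: "Kpoly KK (rootpoly c.S)"
  proof (rule KP_rootpoly[OF c.finS])
    show "poly (mp f) s = 0 \<and> poly (pderiv (mp f)) s \<noteq> 0" if "s \<in> c.S" for s
      by (rule torsion_roots_simple[OF l2 l0 f pS[OF that]])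
    show "\<sigma> ` c.S \<subseteq> c.S" if s: "\<sigma> \<in> galois emb" for \<sigma>
    proof
      fix z assume "z \<in> \<sigma> ` c.S"
      then obtain d where d: "d \<in> c.C'" "z = \<sigma> (px d)" by (auto simp: c.S_def)
      then have "map_pt \<sigma> d \<in> c.C'" using C(6)[OF s] c.C'D[OF d(1)] act_Inf[of \<sigma> d] by (auto simp: c.C'_def)
      then show "z \<in> c.S" unfolding d(2) act_px[OF s, symmetric] c.S_def by blast
    qed
  qed
  have "\<exists>u v w A B. ecrat Ec C KK u v w A B"
  proof (cases "l = 2")
    case True
    obtain T where T: "c.C' = {T}" using c.card_C C(5) True card_1_singletonE[of c.C'] by auto
    then have "T \<in> c.C'" by simp
    then obtain s t where st: "T = Pt s t" using c.C'D by blast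
    have "C = insert Inf c.C'" by (rule c.C_insert(1))
    then have Ce: "C = {Inf, Pt s t}" unfolding T st .
    have "c.S = {s}" unfolding c.S_def T st by simp
    then have "rootpoly c.S = [:-s, 1:]" by (simp add: rootpoly_def)
    then have "coeff [:-s, 1:] 0 \<in> KK" using KS unfolding Kpoly_def by metis
    then have "- s \<in> KK" by simp
    then have "s \<in> KK" using Kminus[of "- s"] by simp
    then show ?thesis using c.quotient_2[OF Ce] l0 True by simp
  next
    case False
    show ?thesis
    proof (rule c.quotient_odd[OF _ KS])
      fix d assume d: "d \<in> c.C'"
      have od: "on_curve Ec d" "mul l d = Inf" "d \<noteq> Inf" using c.C'D[OF d] C(2) by blast+
      show "ec_neg Ec d \<noteq> d"
      proof
        assume "ec_neg Ec d = d"
        then have d2: "mul 2 d = Inf" using add_eq_Inf[OF od(1,1)] by (simp add: numeral_2_eq_2)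
        obtain i where i: "l = i * 2 + 1" using odd[OF False] by (metis oddE mult.commute)
        have "mul l d = ec_add Ec (mul (i * 2) d) (mul 1 d)" unfolding i by (rule mul_add[OF od(1)])
        also have "mul (i * 2) d = Inf" unfolding mul_mult[OF od(1)] d2 by simp
        finally show False using od by simp
      qed
    qed
  qed
  then obtain u v w A B where r: "ecrat Ec C KK u v w A B" by blast
  interpret r: ecrat Ec C KK u v w A B by (rule r)
  obtain u' where u': "u = mp u'" by (rule KP_ex[OF r.Kp(1)])
  obtain v' where v': "v = mp v'" by (rule KP_ex[OF r.Kp(2)])
  obtain w' where w': "w = mp w'" by (rule KP_ex[OF r.Kp(3)])
  obtain A' where A': "A = mp A'" by (rule KP_ex[OF r.Kp(4)])
  obtain B' where B': "B = mp B'" by (rule KP_ex[OF r.Kp(5)])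
  obtain b1 b2 b3 b4 b6 where b: "wa1 r.Eq = emb b1" "wa2 r.Eq = emb b2" "wa3 r.Eq = emb b3" "wa4 r.Eq = emb b4" "wa6 r.Eq = emb b6"
    using r.Eq_K unfolding KK_def by (elim rangeE) blast
  define E' where "E' = WC b1 b2 b3 b4 b6"
  have E': "fE E' = r.Eq"
    by (rule wcurve.expand) (simp add: E'_def b)
  have "elliptic E'" using r.Eq_elliptic elliptic_f[of E'] unfolding E' by simp
  moreover have "isogeny_over emb E E' r.phi l"
  proof -
    have v0: "v' \<noteq> 0" "w' \<noteq> 0" using r.v_nz r.w_nz unfolding v' w' by (auto simp: mp_0)
    have cop: "coprime u' v'"
    proof (rule coprimeI)
      fix d assume d: "d dvd u'" "d dvd v'"
      have d0: "d \<noteq> 0" using d(2) v0 by auto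
      show "d dvd 1"
      proof (rule ccontr)
        assume "\<not> d dvd 1"
        then have "degree (mp d) > 0" using d0 by (simp add: is_unit_iff_degree mp_degree)
        then obtain x where x: "poly (mp d) x = 0" using alg_closed_imp_poly_has_root by blast
        obtain g h where "u' = d * g" "v' = d * h" using d by (elim dvdE)
        then have "poly u x = 0" "poly v x = 0" unfolding u' v' using x by (simp_all add: mp_mult)
        then show False using r.uv(4) by blast
      qed
    qed
    have du: "degree u' = l" "degree v' = l - 1"
    proof -
      have "degree u = l" using r.uv(2) C(5) unfolding lc_def by (metis le_antisym le_degree one_neq_zero)
      then show "degree u' = l" unfolding u' mp_degree .
      show "degree v' = l - 1" using r.uv(3) C(5) unfolding v' mp_degree by simp
    qed
    have m: "max (degree u') (degree v') = l" unfolding du by simp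
    have f: "(poly v x0 = 0 \<longrightarrow> r.phi (Pt x0 y0) = Inf) \<and> (poly v x0 \<noteq> 0 \<and> poly w x0 \<noteq> 0 \<longrightarrow>
       r.phi (Pt x0 y0) = Pt (poly u x0 / poly v x0) ((poly A x0 + poly B x0 * y0) / poly w x0))"
      if on: "on_curve Ec (Pt x0 y0)" for x0 y0
    proof (intro conjI impI)
      assume pv: "poly v x0 = 0"
      have "x0 \<in> px ` c.C'" by (rule r.vr[THEN iffD1, OF pv])
      then obtain d where d: "d \<in> c.C'" "px d = x0" by auto
      have dC: "d \<in> C" "on_curve Ec d" "d \<noteq> Inf" using c.C'D[OF d(1)] by simp_all
      have "Pt x0 y0 = d \<or> Pt x0 y0 = ec_neg Ec d"
        by (rule px_eq[OF dC(2) on dC(3)]) (simp_all add: d(2))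
      then have "Pt x0 y0 \<in> C" using dC(1) C(4)[OF dC(1)] by (elim disjE) simp_all
      then show "r.phi (Pt x0 y0) = Inf" by (simp add: r.phi_def)
    next
      assume n: "poly v x0 \<noteq> 0 \<and> poly w x0 \<noteq> 0"
      have nC: "Pt x0 y0 \<notin> C"
      proof
        assume "Pt x0 y0 \<in> C"
        then have "x0 \<in> px ` c.C'" unfolding c.C'_def by (intro rev_image_eqI[of "Pt x0 y0"]) auto
        then have "poly v x0 = 0" by (rule r.vr[THEN iffD2])
        then show False using n by simp
      qed
      have "c.XX (Pt x0 y0) * poly v x0 = poly u x0" "c.YY (Pt x0 y0) * poly w x0 = poly A x0 + poly B x0 * y0"
        using r.XXr[OF on nC] r.YYr[OF on nC] by simp_all
      then have "c.XX (Pt x0 y0) = poly u x0 / poly v x0" "c.YY (Pt x0 y0) = (poly A x0 + poly B x0 * y0) / poly w x0"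
        using n by (simp_all add: nonzero_eq_divide_eq)
      then show "r.phi (Pt x0 y0) = Pt (poly u x0 / poly v x0) ((poly A x0 + poly B x0 * y0) / poly w x0)"
        using nC unfolding r.phi_def by (simp only: if_False)
    qed
    have "\<exists>u v a b c :: 'k poly. v \<noteq> 0 \<and> c \<noteq> 0 \<and> coprime u v \<and> max (degree u) (degree v) = l \<and>
          (\<forall>x0 y0. Pt x0 y0 \<in> points Ec \<longrightarrow>
             (poly (mp v) x0 = 0 \<longrightarrow> r.phi (Pt x0 y0) = Inf) \<and>
             (poly (mp v) x0 \<noteq> 0 \<and> poly (mp c) x0 \<noteq> 0 \<longrightarrow>
                r.phi (Pt x0 y0) = Pt (poly (mp u) x0 / poly (mp v) x0) ((poly (mp a) x0 + poly (mp b) x0 * y0) / poly (mp c) x0)))"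
      unfolding points_def mem_Collect_eq
      by (rule exI[of _ u'], rule exI[of _ v'], rule exI[of _ A'], rule exI[of _ B'], rule exI[of _ w'])
         (use v0 cop m f in \<open>unfold u'[symmetric] v'[symmetric] w'[symmetric] A'[symmetric] B'[symmetric], blast\<close>)
    moreover have "\<forall>R \<in> points Ec. r.phi R \<in> points (fE E')" unfolding E' points_def using r.phi_closed by blast
    moreover have "r.phi Inf = Inf" using C(1) by (simp add: r.phi_def)
    moreover have "\<forall>R \<in> points Ec. \<forall>S \<in> points Ec. r.phi (ec_add Ec R S) = ec_add (fE E') (r.phi R) (r.phi S)"
      unfolding E' points_def using r.phi_hom by blast
    ultimately show ?thesis unfolding isogeny_over_def Let_def by blast
  qed
  ultimately show ?thesis by blast
qed

end

section \<open>The dichotomy for the translations in the affine Galois group\<close>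

context ecv
begin

lemma prime_multiple:
  assumes "on_curve E t" "mul m t = Inf" "t \<noteq> Inf" "m \<ge> 1"
  shows "\<exists>l k. prime l \<and> l dvd m \<and> mul k t \<noteq> Inf \<and> mul l (mul k t) = Inf"
  using assms(2,4)
proof (induction m rule: less_induct)
  case (less m)
  have "m \<noteq> 1" using less.prems(1) assms(1,3) by auto
  then obtain l where l: "prime l" "l dvd m" using prime_factor_nat by blast
  then obtain k where k: "m = l * k" by (elim dvdE)
  have k1: "k \<ge> 1" "k < m" using k less.prems(2) prime_gt_1_nat[OF l(1)] by auto
  show ?case
  proof (cases "mul k t = Inf")
    case True
    obtain l' k' where "prime l' \<and> l' dvd k \<and> mul k' t \<noteq> Inf \<and> mul l' (mul k' t) = Inf" using less.IH[OF k1(2) True k1(1)] by blast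
    then show ?thesis using k by (intro exI[of _ l'] exI[of _ k']) auto
  next
    case False
    have "mul l (mul k t) = Inf" using less.prems(1) unfolding k mul_mult[OF assms(1)] .
    then show ?thesis using l False by blast
  qed
qed

lemma card_subgroup_dvd:
  assumes T: "finite T" "\<And>R. R \<in> T \<Longrightarrow> on_curve E R" "\<And>R S. R \<in> T \<Longrightarrow> S \<in> T \<Longrightarrow> R \<oplus> S \<in> T"
    and N: "N \<subseteq> T" "Inf \<in> N" "\<And>R S. R \<in> N \<Longrightarrow> S \<in> N \<Longrightarrow> R \<oplus> S \<in> N" "\<And>R. R \<in> N \<Longrightarrow> \<ominus> R \<in> N"
  shows "card N dvd card T"
proof -
  define co where "co R = (\<lambda>n. R \<oplus> n) ` N" for R
  have oN: "\<And>n. n \<in> N \<Longrightarrow> on_curve E n" using N(1) T(2) by blast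
  have selfi: "R \<in> co R" for R unfolding co_def using N(2) by (intro rev_image_eqI[of Inf]) simp_all
  have U: "\<Union>(co ` T) = T" using selfi T(3) N(1) unfolding co_def by auto
  have cc: "card (co R) = card N" if R: "R \<in> T" for R
    unfolding co_def by (intro card_image inj_onI) (use add_left_imp_eq T(2)[OF R] oN in blast)
  have eq: "co R = co S" if R: "R \<in> T" and S: "S \<in> T" and z: "z \<in> co R" "z \<in> co S" for R S z
  proof -
    have sub: "co A \<subseteq> co B" if A: "A \<in> T" and B: "B \<in> T" and z: "z \<in> co A" "z \<in> co B" for A B
    proof
      fix x assume "x \<in> co A"
      then obtain n where n: "n \<in> N" "x = A \<oplus> n" by (auto simp: co_def)
      obtain a b where ab: "a \<in> N" "z = A \<oplus> a" "b \<in> N" "z = B \<oplus> b" using z by (auto simp: co_def)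
      have "A = (A \<oplus> a) \<oplus> \<ominus> a" using add_cancel T(2)[OF A] oN[OF ab(1)] by simp
      also have "\<dots> = (B \<oplus> b) \<oplus> \<ominus> a" using ab by simp
      finally have "x = B \<oplus> ((b \<oplus> \<ominus> a) \<oplus> n)"
        using n T(2)[OF B] oN[OF ab(1)] oN[OF ab(3)] oN[OF n(1)] by (simp add: add_assoc add_closed)
      moreover have "(b \<oplus> \<ominus> a) \<oplus> n \<in> N" using N(3,4) ab n by blast
      ultimately show "x \<in> co B" unfolding co_def by blast
    qed
    show ?thesis using sub[OF R S z] sub[OF S R z(2,1)] by blast
  qed
  have "card N * card (co ` T) = card (\<Union>(co ` T))"
  proof (rule card_partition)
    show "finite (co ` T)" "finite (\<Union>(co ` T))" using T(1) U by simp_all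
    show "card c = card N" if "c \<in> co ` T" for c using that cc by auto
    show "c1 \<inter> c2 = {}" if "c1 \<in> co ` T" "c2 \<in> co ` T" "c1 \<noteq> c2" for c1 c2 using that eq by blast
  qed
  then show ?thesis unfolding U by (metis dvd_triv_left)
qed

end

lemma irreducible_root_degree:
  fixes p :: "'a::field poly"
  assumes "irreducible p" "poly p x = 0" shows "degree p = 1"
proof -
  obtain g where g: "p = [:-x, 1:] * g" using assms(2) unfolding poly_eq_0_iff_dvd by (elim dvdE)
  have g0: "g \<noteq> 0" using assms(1) g by auto
  have "\<not> [:-x, 1:] dvd 1" by (simp add: is_unit_iff_degree)
  then have "g dvd 1" using assms(1) g unfolding irreducible_def by blast
  then have "degree g = 0" using g0 by (simp add: is_unit_iff_degree)
  then show ?thesis unfolding g using degree_mult_eq[of "[:-x,1:]" g] g0 by simp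
qed

text \<open>\<open>delta E 2 P\<close> is a square when \<open>2 P = O\<close>.\<close>

lemma delta_2_square:
  fixes E :: "'a::field wcurve"
  assumes P: "on_curve E (Pt x y)" "2 * y + wa1 E * x + wa3 E = 0" and two: "(2::'a) \<noteq> 0"
  shows "\<not> irreducible (delta E 2 (Pt x y))"
proof -
  have "(2::'a) * 2 \<noteq> 0" unfolding mult_eq_0_iff using two by simp
  then have four: "(4::'a) \<noteq> 0" by simp
  have d2: "divf E 2 = 1" "divf E 3 = [: wb8 E, 3 * wb6 E, 3 * wb4 E, wb2 E, 3 :]" "divf E 1 = 1"
    by (subst divf.simps, simp)+
  have d: "delta E 2 (Pt x y) = [:0,1:] * divF E - [: wb8 E, 3 * wb6 E, 3 * wb4 E, wb2 E, 3 :] - [:x:] * divF E"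
    unfolding delta_def theta_def psi_nb_def psi_sq_def using d2 by (simp add: numeral_3_eq_3[symmetric])
  \<comment> \<open>Comparing the quadratic coefficient with that of the square of X^2 - 2 x X + c
    determines c.\<close>
  define c where "c = - (wb4 E + x * wb2 E + 4 * x^2) / 2"
  have half: "2 * (s / 2) = s" for s :: 'a using two by simp
  have c: "2 * c = - (wb4 E + x * wb2 E + 4 * x^2)" unfolding c_def half ..
  have "(2 * y + wa1 E * x + wa3 E)^2 = 4 * x^3 + wb2 E * x^2 + 2 * wb4 E * x + wb6 E"
    using P(1) unfolding on_curve.simps wb2_def wb4_def wb6_def by algebra
  then have b6: "wb6 E = - (4 * x^3 + wb2 E * x^2 + 2 * wb4 E * x)" unfolding P(2) by (simp add: eq_neg_iff_add_eq_0 algebra_simps)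
  have b8: "4 * wb8 E = wb2 E * wb6 E - wb4 E ^ 2" unfolding wb2_def wb4_def wb6_def wb8_def by algebra
  have q1: "- wb4 E - x * wb2 E = 4 * x^2 + 2 * c" unfolding c by algebra
  have q2: "- 2 * wb6 E - 2 * wb4 E * x = - 4 * x * c"
  proof -
    have "- 4 * x * c = - 2 * x * (2 * c)" by algebra
    then show ?thesis unfolding c b6 by algebra
  qed
  have q3: "- wb8 E - x * wb6 E = c^2"
  proof -
    have "4 * c^2 = (2 * c)^2" by algebra
    also have "\<dots> = - (4 * wb8 E) - 4 * x * wb6 E" unfolding c b8 b6 by algebra
    also have "\<dots> = 4 * (- wb8 E - x * wb6 E)" by algebra
    finally have "4 * (c^2 - (- wb8 E - x * wb6 E)) = 0" by algebra
    then show ?thesis unfolding mult_eq_0_iff using four by simp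
  qed
  have "delta E 2 (Pt x y) = [: - wb8 E - x * wb6 E, - 2 * wb6 E - 2 * wb4 E * x, - wb4 E - x * wb2 E, - 4 * x, 1 :]"
    unfolding d divF_def by (simp add: algebra_simps)
  also have "\<dots> = [:c, - 2 * x, 1:] * [:c, - 2 * x, 1:]" unfolding q1 q2 q3
    by (simp add: algebra_simps power2_eq_square)
  finally have e: "delta E 2 (Pt x y) = [:c, - 2 * x, 1:] * [:c, - 2 * x, 1:]" .
  have "\<not> [:c, - 2 * x, 1:] dvd 1" by (simp add: is_unit_iff_degree)
  then show ?thesis unfolding e irreducible_def by blast
qed

lemma delta_degree:
  fixes E :: "'a::field wcurve"
  shows "n \<ge> 1 \<Longrightarrow> degree (delta E n (Pt x y)) = n^2"
  using theta_degree[of n E x] by (simp add: delta_def)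

section \<open>The affine Galois group and the proof of the dichotomy\<close>

locale galpt = galcv emb E for emb :: "'k::field \<Rightarrow> 'c::alg_closed_field" and E +
  fixes P :: "'k ecpt" and m :: nat
  assumes onP: "on_curve E P" and m: "m > 1" and m0: "(of_nat m :: 'k) \<noteq> 0"
begin

definition "Pc = map_pt emb P"
abbreviation "tor n \<equiv> torsion Ec n"
abbreviation "pre n \<equiv> preimg Ec n Pc"

lemma Pc_Inf: "P = Inf \<Longrightarrow> Pc = Inf" and Pc_Pt: "P = Pt x y \<Longrightarrow> Pc = Pt (emb x) (emb y)"
  unfolding Pc_def by simp_all

lemma onPc: "on_curve Ec Pc" unfolding Pc_def using onP on_curve_f by blast

lemma tor_iff: "R \<in> tor n \<longleftrightarrow> on_curve Ec R \<and> mul n R = Inf" by (simp add: torsion_def points_def)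
lemma pre_iff: "R \<in> pre n \<longleftrightarrow> on_curve Ec R \<and> mul n R = Pc" by (simp add: preimg_def points_def)

lemma pre_ex: "n \<ge> 1 \<Longrightarrow> \<exists>R. R \<in> pre n" using mul_surj[OF onPc] pre_iff by blast

lemma pre_add: "R \<in> pre n \<Longrightarrow> T \<in> tor n \<Longrightarrow> ec_add Ec R T \<in> pre n"
  unfolding pre_iff tor_iff by (simp add: mul_distrib add_closed)

lemma pre_diff: "R \<in> pre n \<Longrightarrow> S \<in> pre n \<Longrightarrow> ec_add Ec (ec_neg Ec R) S \<in> tor n"
  unfolding pre_iff tor_iff by (simp add: mul_distrib mul_neg add_closed)

lemma tor_act: "\<sigma> \<in> galois emb \<Longrightarrow> T \<in> tor n \<Longrightarrow> map_pt \<sigma> T \<in> tor n"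
  unfolding tor_iff by (simp add: act_on_curve act_mul[symmetric])

lemma pre_act: "\<sigma> \<in> galois emb \<Longrightarrow> R \<in> pre n \<Longrightarrow> map_pt \<sigma> R \<in> pre n"
  unfolding pre_iff by (simp add: act_on_curve act_mul[symmetric] act_emb Pc_def)

text \<open>The chosen base point cancels: sigma(R0 + T) - sigma(R0) = sigma(T). So
  \<open>alpha\<close> merely passes from the action on the fibre to the action on E[m] and respects
  composition; bijectivity is all that an isomorphism requires.\<close>

lemma alpha_restrict:
  assumes s: "\<sigma> \<in> galois emb"
  shows "alpha emb E m P (restrict (map_pt \<sigma>) (pre m)) = restrict (map_pt \<sigma>) (tor m)"
proof -
  define R0 where "R0 = (SOME R. R \<in> pre m)"
  have R0: "R0 \<in> pre m" unfolding R0_def by (rule someI_ex, rule pre_ex) (use m in simp)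
  have o: "on_curve Ec (map_pt \<sigma> R0)" using R0 s by (simp add: pre_iff act_on_curve)
  have "restrict (map_pt \<sigma>) (pre m) (ec_add Ec R0 T) = ec_add Ec (map_pt \<sigma> T) (map_pt \<sigma> R0)" if T: "T \<in> tor m" for T
  proof -
    have oT: "on_curve Ec (map_pt \<sigma> T)" using T s by (simp add: tor_iff act_on_curve)
    show ?thesis using pre_add[OF R0 T] act_add[OF s, of R0 T] add_commute[OF o oT] by simp
  qed
  moreover have "restrict (map_pt \<sigma>) (pre m) R0 = map_pt \<sigma> R0" using R0 by simp
  moreover have "ec_add Ec (ec_add Ec (map_pt \<sigma> T) (map_pt \<sigma> R0)) (ec_neg Ec (map_pt \<sigma> R0)) = map_pt \<sigma> T" if T: "T \<in> tor m" for T
    by (rule add_cancel[OF _ o]) (use T s in \<open>simp add: tor_iff act_on_curve\<close>)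
  ultimately show ?thesis
    unfolding alpha_def Let_def Pc_def[symmetric] R0_def[symmetric] by (intro restrict_ext) simp
qed

text \<open>Two elements with equal linear part come from sigma, tau such that the inverse of sigma
  followed after tau fixes E[m] pointwise; by assumption it then fixes the fibre too. Surjectivity
  is clear from \<open>alpha_restrict\<close>.\<close>

lemma alpha_bij:
  assumes tr: "\<And>\<sigma> R. \<sigma> \<in> galois emb \<Longrightarrow> \<forall>T\<in>tor m. map_pt \<sigma> T = T \<Longrightarrow> R \<in> pre m \<Longrightarrow> map_pt \<sigma> R = R"
  shows "bij_betw (alpha emb E m P) (calGm emb E m P) (Gm emb E m)"
  unfolding bij_betw_def
proof
  show "alpha emb E m P ` calGm emb E m P = Gm emb E m"
    unfolding calGm_def Gm_def Pc_def[symmetric] image_image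
    by (intro image_cong refl) (rule alpha_restrict)
  show "inj_on (alpha emb E m P) (calGm emb E m P)"
  proof (rule inj_onI)
    fix g h assume gh: "g \<in> calGm emb E m P" "h \<in> calGm emb E m P" "alpha emb E m P g = alpha emb E m P h"
    obtain \<sigma> where g: "\<sigma> \<in> galois emb" "g = restrict (map_pt \<sigma>) (pre m)"
      using gh(1) unfolding calGm_def Pc_def[symmetric] by auto
    obtain \<tau> where h: "\<tau> \<in> galois emb" "h = restrict (map_pt \<tau>) (pre m)"
      using gh(2) unfolding calGm_def Pc_def[symmetric] by auto
    define \<rho> where "\<rho> = inv_into UNIV \<sigma> \<circ> \<tau>"
    have r: "\<rho> \<in> galois emb" unfolding \<rho>_def by (intro gal_comp gal_inv g h)
    have e: "restrict (map_pt \<sigma>) (tor m) = restrict (map_pt \<tau>) (tor m)"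
      using gh(3) unfolding g(2) h(2) alpha_restrict[OF g(1)] alpha_restrict[OF h(1)] .
    have "map_pt \<rho> T = T" if "T \<in> tor m" for T
    proof -
      have "map_pt \<tau> T = map_pt \<sigma> T" using fun_cong[OF e, of T] that by simp
      then show ?thesis unfolding \<rho>_def act_comp by (simp add: act_inv(1)[OF g(1)])
    qed
    then have "map_pt \<rho> R = R" if "R \<in> pre m" for R using tr[OF r] that by blast
    then have "map_pt \<sigma> R = map_pt \<tau> R" if "R \<in> pre m" for R
      using that act_inv(2)[OF g(1), of "map_pt \<tau> R"] unfolding \<rho>_def act_comp by simp
    then show "g = h" unfolding g(2) h(2) by (intro restrict_ext) simp
  qed
qed

text \<open>The kernel of \<open>alpha\<close>, recorded as translation vectors instead of maps, so
  that it is a subgroup of E[m] to which isogenies can be attached.\<close>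

definition tr :: "'c ecpt set" where
  "tr = {t \<in> tor m. \<exists>\<rho>\<in>galois emb. (\<forall>T\<in>tor m. map_pt \<rho> T = T) \<and> (\<forall>R\<in>pre m. map_pt \<rho> R = ec_add Ec R t)}"

lemma trE:
  assumes "t \<in> tr"
  obtains \<rho> where "\<rho> \<in> galois emb" "\<And>T. T \<in> tor m \<Longrightarrow> map_pt \<rho> T = T" "\<And>R. R \<in> pre m \<Longrightarrow> map_pt \<rho> R = ec_add Ec R t"
  using assms unfolding tr_def by blast

lemma tor_add: "R \<in> tor n \<Longrightarrow> S \<in> tor n \<Longrightarrow> ec_add Ec R S \<in> tor n"
  and tor_neg: "R \<in> tor n \<Longrightarrow> ec_neg Ec R \<in> tor n"
  unfolding tor_iff by (simp_all add: mul_distrib mul_neg add_closed)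

lemma tr_tor: "t \<in> tr \<Longrightarrow> t \<in> tor m" by (simp add: tr_def)

lemma tr_Inf: "Inf \<in> tr"
proof -
  have "id \<in> galois emb" by (simp add: galois_def)
  moreover have "map_pt id R = R" for R :: "'c ecpt" by (cases R) simp_all
  ultimately show ?thesis unfolding tr_def by (auto simp: tor_iff intro!: bexI[of _ id])
qed

lemma tr_add: assumes t: "t \<in> tr" "u \<in> tr" shows "ec_add Ec t u \<in> tr"
proof -
  obtain \<rho> where r: "\<rho> \<in> galois emb" "\<And>T. T \<in> tor m \<Longrightarrow> map_pt \<rho> T = T" "\<And>R. R \<in> pre m \<Longrightarrow> map_pt \<rho> R = ec_add Ec R t"
    by (rule trE[OF t(1)], rule that, blast+)
  obtain \<tau> where s: "\<tau> \<in> galois emb" "\<And>T. T \<in> tor m \<Longrightarrow> map_pt \<tau> T = T" "\<And>R. R \<in> pre m \<Longrightarrow> map_pt \<tau> R = ec_add Ec R u"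
    by (rule trE[OF t(2)], rule that, blast+)
  note tm = tr_tor[OF t(1)] and um = tr_tor[OF t(2)]
  have "map_pt (\<rho> \<circ> \<tau>) T = T" if "T \<in> tor m" for T unfolding act_comp using r(2) s(2) that by simp
  moreover have "map_pt (\<rho> \<circ> \<tau>) R = ec_add Ec R (ec_add Ec t u)" if R: "R \<in> pre m" for R
    unfolding act_comp s(3)[OF R] act_add[OF r(1)] r(3)[OF R] r(2)[OF um]
    using R tm um by (intro add_assoc) (simp_all add: pre_iff tor_iff)
  ultimately show ?thesis unfolding tr_def using tor_add[OF tm um] gal_comp[OF r(1) s(1)] by blast
qed

lemma tr_neg: assumes t: "t \<in> tr" shows "ec_neg Ec t \<in> tr"
proof -
  obtain \<rho> where r: "\<rho> \<in> galois emb" "\<And>T. T \<in> tor m \<Longrightarrow> map_pt \<rho> T = T" "\<And>R. R \<in> pre m \<Longrightarrow> map_pt \<rho> R = ec_add Ec R t"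
    by (rule trE[OF t], rule that, blast+)
  define \<tau> where "\<tau> = inv_into UNIV \<rho>"
  note tm = tr_tor[OF t]
  have s: "\<tau> \<in> galois emb" unfolding \<tau>_def by (rule gal_inv[OF r(1)])
  have i: "map_pt \<tau> (map_pt \<rho> R) = R" for R unfolding \<tau>_def by (rule act_inv(1)[OF r(1)])
  have "map_pt \<tau> T = T" if "T \<in> tor m" for T using i[of T] r(2)[OF that] by simp
  moreover have "map_pt \<tau> R = ec_add Ec R (ec_neg Ec t)" if R: "R \<in> pre m" for R
  proof -
    have R': "ec_add Ec R (ec_neg Ec t) \<in> pre m" by (rule pre_add[OF R tor_neg[OF tm]])
    have "map_pt \<rho> (ec_add Ec R (ec_neg Ec t)) = ec_add Ec (ec_add Ec R (ec_neg Ec t)) t" by (rule r(3)[OF R'])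
    also have "\<dots> = R" using add_cancel[of R "ec_neg Ec t"] R tm by (simp add: pre_iff tor_iff)
    finally show ?thesis using i[of "ec_add Ec R (ec_neg Ec t)"] by simp
  qed
  ultimately show ?thesis unfolding tr_def using tor_neg[OF tm] s by blast
qed

text \<open>Conjugating an automorphism that translates by t with sigma gives one that translates by
  sigma(t).\<close>

lemma tr_act: assumes t: "t \<in> tr" and s: "\<sigma> \<in> galois emb" shows "map_pt \<sigma> t \<in> tr"
proof -
  obtain \<rho> where r: "\<rho> \<in> galois emb" "\<And>T. T \<in> tor m \<Longrightarrow> map_pt \<rho> T = T" "\<And>R. R \<in> pre m \<Longrightarrow> map_pt \<rho> R = ec_add Ec R t"
    by (rule trE[OF t], rule that, blast+)
  define \<tau> where "\<tau> = inv_into UNIV \<sigma>"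
  have ti: "\<tau> \<in> galois emb" unfolding \<tau>_def by (rule gal_inv[OF s])
  have i: "map_pt \<sigma> (map_pt \<tau> R) = R" for R unfolding \<tau>_def by (rule act_inv(2)[OF s])
  have "map_pt (\<sigma> \<circ> (\<rho> \<circ> \<tau>)) T = T" if "T \<in> tor m" for T
    unfolding act_comp r(2)[OF tor_act[OF ti that]] by (rule i)
  moreover have "map_pt (\<sigma> \<circ> (\<rho> \<circ> \<tau>)) R = ec_add Ec R (map_pt \<sigma> t)" if "R \<in> pre m" for R
    unfolding act_comp r(3)[OF pre_act[OF ti that]] act_add[OF s] i ..
  moreover have "\<sigma> \<circ> (\<rho> \<circ> \<tau>) \<in> galois emb" by (intro gal_comp s r(1) ti)
  ultimately show ?thesis unfolding tr_def using tor_act[OF s tr_tor[OF t]] by blast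
qed

lemma tr_mul: "t \<in> tr \<Longrightarrow> mul k t \<in> tr" by (induction k) (auto intro: tr_Inf tr_add)

lemma tr_nontrivial:
  assumes s: "\<sigma> \<in> galois emb" "\<forall>T\<in>tor m. map_pt \<sigma> T = T" and R0: "R0 \<in> pre m" "map_pt \<sigma> R0 \<noteq> R0"
  shows "\<exists>t\<in>tr. t \<noteq> Inf"
proof -
  define t where "t = ec_add Ec (ec_neg Ec R0) (map_pt \<sigma> R0)"
  have tm: "t \<in> tor m" unfolding t_def by (rule pre_diff[OF R0(1) pre_act[OF s(1) R0(1)]])
  have e: "ec_add Ec R0 t = map_pt \<sigma> R0" unfolding t_def
    using R0(1) pre_act[OF s(1) R0(1)] by (intro add_cancel_left') (simp_all add: pre_iff)
  have "map_pt \<sigma> R = ec_add Ec R t" if R: "R \<in> pre m" for R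
  proof -
    define T where "T = ec_add Ec (ec_neg Ec R0) R"
    have T: "T \<in> tor m" unfolding T_def by (rule pre_diff[OF R0(1) R])
    have RT: "R = ec_add Ec R0 T" unfolding T_def
      using R0(1) R by (intro add_cancel_left'[symmetric]) (simp_all add: pre_iff)
    have "map_pt \<sigma> R = ec_add Ec (ec_add Ec R0 t) T" unfolding RT act_add[OF s(1)] e using s(2) T by simp
    also have "\<dots> = ec_add Ec R t" unfolding RT using R0(1) tm T by (simp add: pre_iff tor_iff add_ac add_closed)
    finally show ?thesis .
  qed
  then have "t \<in> tr" unfolding tr_def using tm s by blast
  moreover have "t \<noteq> Inf" using e R0(2) by auto
  ultimately show ?thesis by blast
qed

text \<open>If \<open>d = m / l\<close> and \<open>\<delta>\<^sub>d\<close> is irreducible, the Galois group permutes the fibre of \<open>[d]\<close> transitively, and the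
  translations by \<open>l\<close>-torsion make it transitive on the fibre of \<open>[m]\<close>.\<close>

lemma full_torsion_irreducible:
  assumes P2: "ec_add Ec Pc Pc \<noteq> Inf" and md: "m = d * l" and d: "d \<ge> 1" and irr: "irreducible (delta E d P)" and full: "tor l \<subseteq> tr"
  shows "irreducible (delta E m P)"
proof -
  have m1: "m \<ge> 1" "m \<ge> 2" using m by simp_all
  have mc: "(of_nat m :: 'c) \<noteq> 0" using m0 by (simp add: emb_of_nat_0)
  obtain x0 y0 where P: "P = Pt x0 y0" using P2 Pc_Inf by (cases P) fastforce+
  have Pce: "Pc = Pt (emb x0) (emb y0)" by (rule Pc_Pt[OF P])
  have mpd: "mp (delta E n P) = theta Ec n - smult (emb x0) (psi_sq Ec n)" for n
    unfolding delta_f P by (simp add: delta_def)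
  have onx: "on_curve Ec (Pt (emb x0) (emb y0))" using onPc unfolding Pce .
  have P2': "ec_add Ec (Pt (emb x0) (emb y0)) (Pt (emb x0) (emb y0)) \<noteq> Inf" using P2 unfolding Pce .
  have bij: "bij_betw px (pre n) {x. poly (mp (delta E n P)) x = 0}" if "n \<ge> 1" for n
    using fibre_px[OF that onx P2'] unfolding mpd preimg_def Pce .
  have neq: "ec_neg Ec Pc \<noteq> Pc" using add_eq_Inf[OF onPc onPc] P2 by auto
  have trans: "\<exists>\<sigma>\<in>galois emb. map_pt \<sigma> R = S" if R: "R \<in> pre m" and S: "S \<in> pre m" for R S
  proof -
    have oR: "on_curve Ec R" "on_curve Ec S" using R S by (simp_all add: pre_iff)
    have dR: "mul l R \<in> pre d" "mul l S \<in> pre d"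
      using R S mul_mult[OF oR(1), of d l] mul_mult[OF oR(2), of d l] unfolding pre_iff md by simp_all
    have "poly (mp (delta E d P)) (px (mul l R)) = 0" "poly (mp (delta E d P)) (px (mul l S)) = 0"
      using bij_betwE[OF bij[OF d]] dR by auto
    then obtain \<sigma> where s: "\<sigma> \<in> galois emb" "\<sigma> (px (mul l R)) = px (mul l S)"
      using irreducible_transitive[OF irr] by blast
    have "px (map_pt \<sigma> (mul l R)) = px (mul l S)" using s by (simp add: act_px)
    \<comment> \<open>Here 2 P different from O is used: conjugate x-coordinates give conjugate
      points and not just points conjugate up to sign.\<close>
    moreover have "inj_on px (pre d)" using bij[OF d] by (simp add: bij_betw_def)
    ultimately have e: "map_pt \<sigma> (mul l R) = mul l S"
      using pre_act[OF s(1) dR(1)] dR(2) by (auto dest: inj_onD)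
    define t where "t = ec_add Ec (ec_neg Ec (map_pt \<sigma> R)) S"
    have osR: "on_curve Ec (map_pt \<sigma> R)" using oR s by (simp add: act_on_curve)
    have "mul l t = Inf" unfolding t_def using oR osR e act_mul[OF s(1), of l R]
      by (simp add: mul_distrib mul_neg)
    then have "t \<in> tor l" unfolding tor_iff t_def using oR osR by (simp add: add_closed)
    then have tt: "t \<in> tr" using full by blast
    obtain \<rho> where r: "\<rho> \<in> galois emb" "\<And>T. T \<in> tor m \<Longrightarrow> map_pt \<rho> T = T" "\<And>R. R \<in> pre m \<Longrightarrow> map_pt \<rho> R = ec_add Ec R t"
      by (rule trE[OF tt], rule that, blast+)
    have "map_pt (\<rho> \<circ> \<sigma>) R = ec_add Ec (map_pt \<sigma> R) t" unfolding act_comp by (rule r(3)[OF pre_act[OF s(1) R]])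
    also have "\<dots> = S" unfolding t_def by (rule add_cancel_left'[OF osR oR(2)])
    finally show ?thesis using gal_comp[OF r(1) s(1)] by blast
  qed
  show ?thesis
  proof (rule transitive_irreducible)
    have dg: "degree (delta E m P) = m^2" unfolding P by (rule delta_degree[OF m1(1)])
    show "degree (delta E m P) \<ge> 1" unfolding dg using m1 by simp
    show "card {x. poly (mp (delta E m P)) x = 0} = degree (delta E m P)"
      unfolding dg mpd by (rule card_delta_roots[OF m1(2) mc onx P2'])
    fix a b assume ab: "poly (mp (delta E m P)) a = 0" "poly (mp (delta E m P)) b = 0"
    then have "a \<in> px ` pre m" "b \<in> px ` pre m" using bij[OF m1(1)] by (auto simp: bij_betw_def)
    then obtain R S where RS: "R \<in> pre m" "a = px R" "S \<in> pre m" "b = px S" by auto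
    then obtain \<sigma> where s: "\<sigma> \<in> galois emb" "map_pt \<sigma> R = S" using trans by blast
    then have "\<sigma> a = b" using act_px[OF s(1), of R] RS by simp
    then show "\<exists>\<sigma>\<in>galois emb. \<sigma> a = b" using s(1) by blast
  qed
qed

text \<open>Any prime divisor q of m is proper, as m is composite. For q = 2 the polynomial is a
  square; for odd q one has q P = P, so x(P) is a rational root of a polynomial of degree q^2 >
  1.\<close>

lemma two_torsion_reducible:
  assumes P2: "ec_add Ec Pc Pc = Inf" and P0: "P \<noteq> Inf" and np: "\<not> prime m"
  shows "\<exists>d. d dvd m \<and> 1 < d \<and> d < m \<and> \<not> irreducible (delta E d P)"
proof -
  obtain x0 y0 where P: "P = Pt x0 y0" using P0 by (cases P) auto
  have onP': "on_curve E (Pt x0 y0)" using onP P by simp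
  obtain q where q: "prime q" "q dvd m" using prime_factor_nat[of m] m by auto
  have qm: "1 < q" "q < m" "q \<ge> 1" using prime_gt_1_nat[OF q(1)] dvd_imp_le[OF q(2)] m np q(1) by (auto simp: le_less)
  have "\<not> irreducible (delta E q P)"
  proof (cases "q = 2")
    case True
    have two: "(2::'k) \<noteq> 0"
    proof
      assume "(2::'k) = 0"
      then have "(of_nat q :: 'k) = 0" using True by simp
      moreover obtain k where "m = q * k" using q(2) by (elim dvdE)
      ultimately show False using m0 by simp
    qed
    have "Pc = ec_neg Ec Pc" using add_eq_Inf[OF onPc onPc] P2 by simp
    then have "emb y0 = - emb y0 - emb (wa1 E) * emb x0 - emb (wa3 E)" unfolding Pc_Pt[OF P] by simp
    moreover have "emb (2 * y0 + wa1 E * x0 + wa3 E) = emb y0 - (- emb y0 - emb (wa1 E) * emb x0 - emb (wa3 E))"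
      by (simp add: f_hom)
    ultimately have "emb (2 * y0 + wa1 E * x0 + wa3 E) = 0" by simp
    then have "2 * y0 + wa1 E * x0 + wa3 E = 0" by (simp add: f_eq_0)
    then show ?thesis unfolding True P using delta_2_square[OF onP' _ two] by blast
  next
    case False
    then have "odd q" using q(1) qm prime_odd_nat by auto
    then obtain i where i: "q = i * 2 + 1" by (metis oddE mult.commute)
    have Pce: "Pc = Pt (emb x0) (emb y0)" by (rule Pc_Pt[OF P])
    have "mul 2 Pc = Inf" using P2 by (simp add: numeral_2_eq_2)
    then have "mul (i * 2) Pc = Inf" unfolding mul_mult[OF onPc] by simp
    then have "mul q Pc = Pc" unfolding i mul_add[OF onPc] by simp
    then have "poly (theta Ec q - smult (emb x0) (psi_sq Ec q)) (emb x0) = 0"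
      using delta_root[of "emb x0" "emb y0" q "emb x0" "emb y0"] onPc qm unfolding Pce by blast
    moreover have "mp (delta E q P) = theta Ec q - smult (emb x0) (psi_sq Ec q)" unfolding delta_f P by (simp add: delta_def)
    ultimately have "emb (poly (delta E q P) x0) = 0" using mp_poly[of "delta E q P" x0] by simp
    then have "poly (delta E q P) x0 = 0" by (simp add: f_eq_0)
    moreover have "degree (delta E q P) = q^2" unfolding P by (rule delta_degree[OF qm(3)])
    moreover have "q^2 \<noteq> 1" using qm by (simp add: power2_eq_square)
    ultimately show ?thesis using irreducible_root_degree by metis
  qed
  then show ?thesis using q qm by blast
qed

lemma composite_alternatives:
  assumes np: "\<not> prime m"
  shows "irreducible (delta E m P)
      \<or> (\<exists>d. d dvd m \<and> 1 < d \<and> d < m \<and> \<not> irreducible (delta E d P))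
      \<or> (\<exists>l. prime l \<and> l dvd m \<and> (\<exists>E' \<phi>. elliptic E' \<and> isogeny_over emb E E' \<phi> l))
      \<or> bij_betw (alpha emb E m P) (calGm emb E m P) (Gm emb E m)"
proof (cases "\<exists>\<sigma> R. \<sigma> \<in> galois emb \<and> (\<forall>T\<in>tor m. map_pt \<sigma> T = T) \<and> R \<in> pre m \<and> map_pt \<sigma> R \<noteq> R")
  case False
  have "bij_betw (alpha emb E m P) (calGm emb E m P) (Gm emb E m)" by (rule alpha_bij) (use False in blast)
  then show ?thesis by blast
next
  case True
  then obtain \<sigma> R where s: "\<sigma> \<in> galois emb" "\<forall>T\<in>tor m. map_pt \<sigma> T = T" "R \<in> pre m" "map_pt \<sigma> R \<noteq> R" by blast
  \<comment> \<open>For P = O the fibre is E[m] itself, so fixing E[m] pointwise means fixing the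
    fibre.\<close>
  have P0: "P \<noteq> Inf"
  proof
    assume "P = Inf"
    then have "R \<in> tor m" using s(3) unfolding pre_iff tor_iff using Pc_Inf by simp
    then show False using s(2,4) by blast
  qed
  show ?thesis
  proof (cases "ec_add Ec Pc Pc = Inf")
    case True
    then show ?thesis using two_torsion_reducible[OF True P0 np] by blast
  next
    case P2: False
    obtain t where t: "t \<in> tr" "t \<noteq> Inf" using tr_nontrivial[OF s] by blast
    have tt: "on_curve Ec t" "mul m t = Inf" using tr_tor[OF t(1)] by (simp_all add: tor_iff)
    obtain l k where l: "prime l" "l dvd m" "mul k t \<noteq> Inf" "mul l (mul k t) = Inf"
      using prime_multiple[OF tt t(2)] m by auto
    have l2: "l \<ge> 2" "l \<ge> 1" using prime_ge_2_nat[OF l(1)] by auto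
    obtain d where d: "m = d * l" using l(2) by (metis dvdE mult.commute)
    have l0: "(of_nat l :: 'k) \<noteq> 0" using m0 d by auto
    define C where "C = tr \<inter> tor l"
    have kt: "mul k t \<in> C" using tr_mul[OF t(1)] l(4) tt(1) by (simp add: C_def tor_iff)
    have ct: "card (tor l) = l^2" using card_torsion[OF l2(1)] l0 unfolding torsion_def by (simp add: emb_of_nat_0)
    have fT: "finite (tor l)" unfolding torsion_def by (rule finite_torsion[OF l2(2)])
    have C_Inf: "Inf \<in> C" using tr_Inf by (simp add: C_def tor_iff)
    have C_add: "ec_add Ec A B \<in> C" if "A \<in> C" "B \<in> C" for A B using that tr_add tor_add by (auto simp: C_def)
    have C_neg: "ec_neg Ec A \<in> C" if "A \<in> C" for A using that tr_neg tor_neg by (auto simp: C_def)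
    have CT: "C \<subseteq> tor l" by (simp add: C_def)
    have fC: "finite C" using CT fT by (rule finite_subset)
    have "card C dvd card (tor l)"
      by (rule card_subgroup_dvd[OF fT]) (use CT C_Inf C_add C_neg tor_add in \<open>auto simp: tor_iff\<close>)
    \<comment> \<open>Lagrange in E[l], of order l^2, leaves the orders 1, l and l^2; the nonzero
      multiple of t excludes the first.\<close>
    then obtain j where j: "j \<le> 2" "card C = l ^ j" unfolding ct using divides_primepow_nat[OF l(1)] by blast
    have "card {Inf, mul k t} \<le> card C" using C_Inf kt by (intro card_mono fC) auto
    then have "card C \<ge> 2" using l(3) by simp
    then have "j \<noteq> 0" using j(2) by (intro notI) simp
    then consider "j = 1" | "j = 2" using j by linarith
    then show ?thesis
    proof cases
      case 1
      have "\<exists>E' \<phi>. elliptic E' \<and> isogeny_over emb E E' \<phi> l"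
      proof (rule isogeny_ex[OF l(1) l0 C_Inf])
        show "on_curve Ec A \<and> mul l A = Inf" if "A \<in> C" for A using that by (simp add: C_def tor_iff)
        show "map_pt \<tau> A \<in> C" if "\<tau> \<in> galois emb" "A \<in> C" for \<tau> A using that tr_act tor_act by (simp add: C_def)
      qed (use C_add C_neg j 1 in auto)
      then show ?thesis using l by blast
    next
      case 2
      then have "C = tor l" using card_subset_eq[OF fT CT] ct j by simp
      then have full: "tor l \<subseteq> tr" unfolding C_def by blast
      \<comment> \<open>Compositeness again: d = 1 would mean that m is the prime l. The value 1
        must be excluded because the second alternative asks for a divisor greater than 1.\<close>
      have d1: "1 < d"
      proof (rule ccontr)
        assume "\<not> 1 < d"
        then have "d = 1" using d m by (cases d) auto
        then show False using d l(1) np by simp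
      qed
      have dm: "d < m" "d dvd m" "d \<ge> 1" using d d1 l2 by auto
      show ?thesis
      proof (cases "irreducible (delta E d P)")
        case True
        then have "irreducible (delta E m P)" by (rule full_torsion_irreducible[OF P2 d dm(3) _ full])
        then show ?thesis by blast
      next
        case False
        then show ?thesis using d1 dm by blast
      qed
    qed
  qed
qed

end

theorem theorem5p1:
  fixes emb :: "'k::field \<Rightarrow> 'c::alg_closed_field"
    and E :: "'k wcurve" and P :: "'k ecpt" and m :: nat
  assumes "is_alg_closure emb"
    and "elliptic E"
    and "1 < m" and "\<not> prime m"
    and "of_nat m \<noteq> (0::'k)"
    and "P \<in> points E"
  shows "irreducible (delta E m P)
      \<or> (\<exists>d. d dvd m \<and> 1 < d \<and> d < m \<and> \<not> irreducible (delta E d P))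
      \<or> (\<exists>l. prime l \<and> l dvd m \<and> (\<exists>E' \<phi>. elliptic E' \<and> isogeny_over emb E E' \<phi> l))
      \<or> bij_betw (alpha emb E m P) (calGm emb E m P) (Gm emb E m)"
proof -
  interpret galpt emb E P m
    by unfold_locales (use assms in \<open>simp_all add: points_def\<close>)
  show ?thesis by (rule composite_alternatives[OF assms(4)])
qed

end
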